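(* Let $d\ge1$, $k\ge 2$ an integer, $s>0$ with $2s>d(k-1)$, and let $\Omega\subset\mathbb{R}^d$ be a bounded connected Lipschitz domain. Let $N\ge\lceil s\rceil^d k$. Then there exists a constant $C>0$ depending only on $s,k,N,\Omega$ (and $d$) such that $$\|u\|_{\dot H^{s,N}(\Omega)}\ge C\|u\|_{L^2(\Omega^N)}$$ for all $u\in C^\infty(\Omega^N)\cap L^2(\Omega^N)$ whose restriction to $\triangle_k\cap\Omega^N$ is zero.
   Context: Local seminorm: for $s=m+\sigma$, $m\in\mathbb{N}_0$, $0\le\sigma<1$: $\|u\|^2_{\dot H^s(\Omega)}=\sum_{|\alpha|=m}\frac{m!}{\alpha!}\int_\Omega|D^\alpha u|^2$ if $\sigma=0$, and $c_{d,\sigma}\sum_{|\alpha|=m}\frac{m!}{\alpha!}\iint_{\Omega\times\Omega}\frac{|D^\alpha u(\mathbf{x})-D^\alpha u(\mathbf{y})|^2}{|\mathbf{x}-\mathbf{y}|^{d+2\sigma}}d\mathbf{x}\,d\mathbf{y}$ if $0<\sigma<1$, with $c_{d,\sigma}>0$ a fixed constant. For a function $u$ on $\Omega^N$, $\|u\|^2_{\dot H^{s,N}(\Omega)}=\sum_{j=1}^N\int_{\Omega^{N-1}}\|u\|^2_{\dot H^s_{\mathbf{x}_j}(\Omega)}\prod_{\ell\ne j}d\mathbf{x}_\ell$, the seminorm taken in the variable $\mathbf{x}_j\in\Omega$. $\triangle_k=\{(\mathbf{x}_1,\dots,\mathbf{x}_N)\in(\mathbb{R}^d)^N:\mathbf{x}_{j_1}=\dots=\mathbf{x}_{j_k}\text{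 for some distinct }j_1,\dots,j_k\}$. *)

theory Defs
  imports "HOL-Analysis.Analysis"
begin

definition dir_deriv :: "'a::euclidean_space \<Rightarrow> ('a \<Rightarrow> real) \<Rightarrow> ('a \<Rightarrow> real)" where
  "dir_deriv v f = (\<lambda>x. frechet_derivative f (at x) v)"

definition smooth_on :: "'a::euclidean_space set \<Rightarrow> ('a \<Rightarrow> real) \<Rightarrow> bool" where
  "smooth_on S f \<longleftrightarrow> (\<forall>vs. foldr dir_deriv vs f differentiable_on S)"

text \<open>A configuration of N points of R^d is an element of (real^'d)^'n, with N = CARD('n).
  The set Omega^N:\<close>
definition power_set :: "(real^'d) set \<Rightarrow> (real^'d^'n) set" where
  "power_set \<Omega> = {X. \<forall>j. X $ j \<in> \<Omega>}"

definition upd_pt :: "real^'d^'n \<Rightarrow> 'n \<Rightarrow> real^'d \<Rightarrow> real^'d^'n" where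
  "upd_pt X j y = (\<chi> l. if l = j then y else X $ l)"

definition partial :: "'n \<Rightarrow> 'd \<Rightarrow> (real^'d^'n \<Rightarrow> real) \<Rightarrow> (real^'d^'n \<Rightarrow> real)" where
  "partial j i u = dir_deriv (axis j (axis i 1 :: real^'d)) u"

text \<open>A fixed enumeration of the coordinate indices (the order is immaterial for
  smooth functions, by Schwarz' theorem).\<close>
definition coord_list :: "'d::finite list" where
  "coord_list = (SOME xs. distinct xs \<and> set xs = UNIV)"

definition Dalpha :: "'n \<Rightarrow> ('d::finite \<Rightarrow> nat) \<Rightarrow> (real^'d^'n \<Rightarrow> real) \<Rightarrow> (real^'d^'n \<Rightarrow> real)" where
  "Dalpha j \<alpha> u = foldr (\<lambda>i f. (partial j i ^^ \<alpha> i) f) coord_list u"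

definition multi_indices :: "nat \<Rightarrow> ('d::finite \<Rightarrow> nat) set" where
  "multi_indices m = {\<alpha>. (\<Sum>i\<in>UNIV. \<alpha> i) = m}"

definition mfact :: "('d::finite \<Rightarrow> nat) \<Rightarrow> real" where
  "mfact \<alpha> = (\<Prod>i\<in>UNIV. fact (\<alpha> i))"

definition ennsqrt :: "ennreal \<Rightarrow> ennreal" where
  "ennsqrt x = (if x = \<infinity> then \<infinity> else ennreal (sqrt (enn2real x)))"

definition L2sq :: "(real^'d) set \<Rightarrow> (real^'d^'n \<Rightarrow> real) \<Rightarrow> ennreal" where
  "L2sq \<Omega> u = (\<integral>\<^sup>+ X. indicator (power_set \<Omega>) X * ennreal ((u X)\<^sup>2) \<partial>lborel)"

text \<open>Squared seminorm of H^{s,N}(Omega), s = m + sigma, with the constant c = c_{d,sigma}.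
  The integral over Omega^{N-1} of the seminorm in x_j is written (Tonelli) as one integral
  over X in Omega^N, where X$j plays the role of x_j (and, in the fractional case,
  an additional integral over y in Omega).\<close>
definition HsNsq :: "real \<Rightarrow> real \<Rightarrow> (real^'d) set \<Rightarrow> (real^'d^'n \<Rightarrow> real) \<Rightarrow> ennreal" where
  "HsNsq c s \<Omega> u =
    (let m = nat \<lfloor>s\<rfloor>; \<sigma> = s - of_int \<lfloor>s\<rfloor>; d = CARD('d) in
     (\<Sum>j\<in>(UNIV::'n set).
       (if \<sigma> = 0 then
          (\<integral>\<^sup>+ X. indicator (power_set \<Omega>) X *
             ennreal (\<Sum>\<alpha>\<in>(multi_indices m :: ('d \<Rightarrow> nat) set).
                (fact m / mfact \<alpha>) * (Dalpha j \<alpha> u X)\<^sup>2) \<partial>lborel)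
        else
          ennreal c *
          (\<integral>\<^sup>+ X. indicator (power_set \<Omega>) X *
             (\<integral>\<^sup>+ y. indicator \<Omega> y *
               ennreal (\<Sum>\<alpha>\<in>(multi_indices m :: ('d \<Rightarrow> nat) set).
                 (fact m / mfact \<alpha>) *
                 (Dalpha j \<alpha> u X - Dalpha j \<alpha> u (upd_pt X j y))\<^sup>2
                 / norm (X $ j - y) powr (real d + 2 * \<sigma>)) \<partial>lborel) \<partial>lborel))))"

text \<open>Omega is open and near every boundary point, after a rigid motion, it is the region
  below the graph of a Lipschitz function of the remaining d-1 coordinates.\<close>
definition lipschitz_domain :: "(real^'d) set \<Rightarrow> bool" where
  "lipschitz_domain \<Omega> \<longleftrightarrow> open \<Omega> \<and>
    (\<forall>p\<in>frontier \<Omega>. \<exists>r>0. \<exists>R i0 (\<gamma>::real^'d \<Rightarrow> real) L.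
       orthogonal_transformation R \<and>
       (\<forall>y z. (\<forall>i. i \<noteq> i0 \<longrightarrow> y $ i = z $ i) \<longrightarrow> \<gamma> y = \<gamma> z) \<and>
       L-lipschitz_on UNIV \<gamma> \<and>
       \<Omega> \<inter> ball p r = {x \<in> ball p r. R (x - p) $ i0 < \<gamma> (R (x - p))})"

definition coinc :: "nat \<Rightarrow> (real^'d^'n) set" where
  "coinc k = {X. \<exists>S::'n set. card S = k \<and> (\<forall>a\<in>S. \<forall>b\<in>S. X $ a = X $ b)}"

end

theory Submission
  imports Defs
begin

text \<open>
  Let $M = \lceil s \rceil$. The seminorm controls the $M$-th differences of u in each slot, averaged
  over steps of length at most $\rho$, by $\rho^{2s+d}$.

  Away from a small ball B the value of u in a slot is extrapolated from M equidistant points further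
  inside $\Omega$; at a boundary point the Lipschitz graph provides an open cone of admissible steps,
  and connectedness propagates the control. So it suffices to bound u on $B^N$.

  In B each slot is replaced by Lagrange interpolation at a grid of $M^d$ nodes, which is exact on the
  Taylor polynomials, followed by extrapolation from a scale-one neighbourhood of the nodes. As $N > M^d (k-1)$,
  in every tuple of nodes some k slots carry the same node. Halving the extrapolation step in these k
  slots n times and translating all nodes by the same z, the change at the n-th halving has squared mean at
  most $C\, 2^{-n(2s - d(k-1))}$ times the squared seminorm; this is summable, and in the limit u is evaluated
  where k points coincide, hence vanishes. All estimates are quantitative, no compactness in function
  spaces is needed.
\<close>

section \<open>Lebesgue measure on configurations\<close>

text \<open>The seminorm differentiates one slot at a time. No mixed regularity is available, so the
  diagonal has to be reached by moving one slot after the other, and the price is a count of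
  volumes. While slot j moves at scale 2^-n, the other k - 1 slots of its group are confined to
  cells of side about 2^-n. This costs 2^(n d (k - 1)), against a gain of 2^(-2 s n) from the
  difference. Only k - 1 of the k slots are paid for, because the common translation takes over slot
  j and leaves its increment a free variable. That is the codimension of the diagonal and the reason
  for 2 s > d (k - 1).

  Point values are never compared directly, since differences are bounded only on average over base
  points and steps. Extrapolation from several points is a substitute for evaluation that such
  averages can control.

  The number M^d of nodes comes from the polynomials in a single slot that the estimates cannot see:
  a tensor grid with M values per coordinate determines them.\<close>

lemma nn_integral_lborel_swap:
  fixes f :: "'a::euclidean_space \<Rightarrow> 'b::euclidean_space \<Rightarrow> ennreal"
  assumes "case_prod f \<in> borel_measurable borel"
  shows "(\<integral>\<^sup>+x. \<integral>\<^sup>+y. f x y \<partial>lborel \<partial>lborel) = (\<integral>\<^sup>+y. \<integral>\<^sup>+x. f x y \<partial>lborel \<partial>lborel)"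
proof -
  have "case_prod f \<in> borel_measurable (lborel \<Otimes>\<^sub>M lborel)"
    using assms by (simp add: lborel_prod)
  from lborel_pair.Fubini'[OF this] show ?thesis by simp
qed

lemma nn_integral_lborel_snd_measurable:
  fixes f :: "'a::euclidean_space \<Rightarrow> 'b::euclidean_space \<Rightarrow> ennreal"
  assumes "case_prod f \<in> borel_measurable borel"
  shows "(\<lambda>x. \<integral>\<^sup>+y. f x y \<partial>lborel) \<in> borel_measurable borel"
proof -
  have "case_prod f \<in> borel_measurable (lborel \<Otimes>\<^sub>M lborel)"
    using assms by (simp add: lborel_prod)
  then have "(\<lambda>x. \<integral>\<^sup>+y. f x y \<partial>lborel) \<in> borel_measurable lborel"
    by (intro lborel.borel_measurable_nn_integral) 
  then show ?thesis by simp
qed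

lemma borel_measurable_compose_continuous:
  assumes "f \<in> borel_measurable borel" "continuous_on UNIV g"
  shows "(\<lambda>x. f (g x)) \<in> borel_measurable borel"
  using measurable_compose[OF borel_measurable_continuous_onI[OF assms(2)] assms(1)] .

lemma nn_integral_lborel_translate:
  fixes f :: "'a::euclidean_space \<Rightarrow> ennreal"
  assumes "f \<in> borel_measurable borel"
  shows "(\<integral>\<^sup>+x. f (c + x) \<partial>lborel) = (\<integral>\<^sup>+x. f x \<partial>lborel)"
proof -
  have "(\<integral>\<^sup>+x. f x \<partial>lborel) = (\<integral>\<^sup>+x. f x \<partial>distr lborel borel ((+) c))"
    by (simp only: lborel_distr_plus)
  also have "\<dots> = (\<integral>\<^sup>+x. f (c + x) \<partial>lborel)"
    using assms by (subst nn_integral_distr) auto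
  finally show ?thesis by simp
qed

lemma nn_integral_lborel_reflect:
  fixes f :: "'a::euclidean_space \<Rightarrow> ennreal"
  assumes "f \<in> borel_measurable borel"
  shows "(\<integral>\<^sup>+x. f (- x) \<partial>lborel) = (\<integral>\<^sup>+x. f x \<partial>lborel)"
proof -
  have "lborel = density (distr lborel borel (\<lambda>x::'a. 0 + (-1) *\<^sub>R x)) (\<lambda>_. ennreal (\<bar>-1\<bar>^DIM('a)))"
    by (rule lborel_affine) auto
  then have *: "lborel = distr lborel borel (\<lambda>x::'a. - x)" by (simp add: density_1)
  have "(\<integral>\<^sup>+x. f x \<partial>lborel) = (\<integral>\<^sup>+x. f x \<partial>distr lborel borel (\<lambda>x::'a. - x))"
    by (subst *) simp
  also have "\<dots> = (\<integral>\<^sup>+x. f (- x) \<partial>lborel)"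
    using assms by (subst nn_integral_distr) auto
  finally show ?thesis by simp
qed

lemma nn_integral_lborel_scale:
  fixes f :: "'a::euclidean_space \<Rightarrow> ennreal"
  assumes "f \<in> borel_measurable borel" "r > 0"
  shows "(\<integral>\<^sup>+x. f x \<partial>lborel) = ennreal (r ^ DIM('a)) * (\<integral>\<^sup>+x. f (c + r *\<^sub>R x) \<partial>lborel)"
proof -
  have *: "lborel = density (distr lborel borel (\<lambda>x::'a. c + r *\<^sub>R x)) (\<lambda>_. \<bar>r\<bar>^DIM('a))"
    using assms(2) by (intro lborel_affine) auto
  have "(\<integral>\<^sup>+x. f x \<partial>lborel) = (\<integral>\<^sup>+x. f x \<partial>density (distr lborel borel (\<lambda>x::'a. c + r *\<^sub>R x)) (\<lambda>_. \<bar>r\<bar>^DIM('a)))"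
    by (subst *) simp
  also have "\<dots> = ennreal (r ^ DIM('a)) * (\<integral>\<^sup>+x. f (c + r *\<^sub>R x) \<partial>lborel)"
    using assms by (simp add: nn_integral_density nn_integral_distr nn_integral_cmult)
  finally show ?thesis .
qed

section \<open>Affine changes of variables slot by slot\<close>

lemma sum_Basis_vec:
  fixes f :: "'a::euclidean_space ^ 'n \<Rightarrow> 'b::comm_monoid_add"
  shows "sum f Basis = (\<Sum>l\<in>UNIV. \<Sum>e\<in>Basis. f (axis l e))"
proof -
  have inj: "inj_on (\<lambda>(l::'n, e::'a). axis l e) (UNIV \<times> Basis)"
    by (auto simp: inj_on_def axis_eq_axis)
  have "(Basis :: ('a ^ 'n) set) = (\<lambda>(l, e). axis l e) ` (UNIV \<times> Basis)"
    by (auto simp: Basis_vec_def)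
  then have "sum f Basis = sum f ((\<lambda>(l, e). axis l e) ` (UNIV \<times> Basis))"
    by (rule arg_cong)
  also have "\<dots> = sum (f \<circ> (\<lambda>(l, e). axis l e)) (UNIV \<times> Basis)"
    by (rule sum.reindex[OF inj])
  finally show ?thesis
    by (simp add: sum.cartesian_product case_prod_unfold)
qed

lemma prod_Basis_vec:
  fixes f :: "'a::euclidean_space ^ 'n \<Rightarrow> 'b::comm_monoid_mult"
  shows "prod f Basis = (\<Prod>l\<in>UNIV. \<Prod>e\<in>Basis. f (axis l e))"
proof -
  have inj: "inj_on (\<lambda>(l::'n, e::'a). axis l e) (UNIV \<times> Basis)"
    by (auto simp: inj_on_def axis_eq_axis)
  have "(Basis :: ('a ^ 'n) set) = (\<lambda>(l, e). axis l e) ` (UNIV \<times> Basis)"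
    by (auto simp: Basis_vec_def)
  then have "prod f Basis = prod f ((\<lambda>(l, e). axis l e) ` (UNIV \<times> Basis))"
    by (rule arg_cong)
  also have "\<dots> = prod (f \<circ> (\<lambda>(l, e). axis l e)) (UNIV \<times> Basis)"
    by (rule prod.reindex[OF inj])
  finally show ?thesis
    by (simp add: prod.cartesian_product case_prod_unfold)
qed

lemma nn_integral_lborel_slotwise_affine:
  fixes f :: "'a::euclidean_space ^ 'n \<Rightarrow> ennreal" and b :: "'n \<Rightarrow> real"
  assumes f: "f \<in> borel_measurable borel" and b: "\<And>l. b l > 0"
  shows "(\<integral>\<^sup>+x. f x \<partial>lborel) =
    ennreal (\<Prod>l\<in>UNIV. b l ^ DIM('a)) * (\<integral>\<^sup>+x. f (\<chi> l. P $ l + b l *\<^sub>R x $ l) \<partial>lborel)"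
proof -
  \<comment> \<open>The change of variables takes one factor per basis vector. Basis vectors have
    the form \<open>axis l e\<close> with \<open>norm e = 1\<close>, so this sum picks out
    \<open>b l\<close>.\<close>
  define c where "c v = (\<Sum>l\<in>UNIV. b l * norm (v $ l))" for v :: "'a ^ 'n"
  have c: "c (axis l e) = b l" if "e \<in> Basis" for l e
  proof -
    have "c (axis l e) = (\<Sum>l'\<in>UNIV. if l' = l then b l else 0)"
      unfolding c_def by (intro sum.cong) (use that in \<open>auto simp: axis_def\<close>)
    then show ?thesis by simp
  qed
  define T where "T x = P + (\<Sum>v\<in>Basis. (c v * (x \<bullet> v)) *\<^sub>R v)" for x
  have T: "T x = (\<chi> l. P $ l + b l *\<^sub>R x $ l)" for x
  proof -
    have "(\<Sum>v\<in>Basis. (c v * (x \<bullet> v)) *\<^sub>R v) $ l = b l *\<^sub>R x $ l" for l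
    proof -
      have "(\<Sum>v\<in>Basis. (c v * (x \<bullet> v)) *\<^sub>R v) $ l
          = (\<Sum>l'\<in>UNIV. if l' = l then (\<Sum>e\<in>Basis. (b l * (x $ l \<bullet> e)) *\<^sub>R e) else 0)"
        unfolding sum_Basis_vec sum_component
      proof (intro sum.cong refl)
        fix l'
        have "(\<Sum>e\<in>Basis. ((c (axis l' e) * (x \<bullet> axis l' e)) *\<^sub>R axis l' e) $ l)
            = (\<Sum>e\<in>Basis. if l' = l then (b l * (x $ l \<bullet> e)) *\<^sub>R e else 0)"
          by (intro sum.cong refl) (simp add: c inner_axis, simp add: axis_def)
        then show "(\<Sum>e\<in>Basis. ((c (axis l' e) * (x \<bullet> axis l' e)) *\<^sub>R axis l' e) $ l)
            = (if l' = l then \<Sum>e\<in>Basis. (b l * (x $ l \<bullet> e)) *\<^sub>R e else 0)"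
          by simp
      qed
      also have "\<dots> = b l *\<^sub>R (\<Sum>e\<in>Basis. (x $ l \<bullet> e) *\<^sub>R e)"
        by (simp add: scaleR_sum_right)
      finally show ?thesis by (simp add: euclidean_representation)
    qed
    then show ?thesis by (simp add: T_def vec_eq_iff)
  qed
  have c0: "c v > 0" if "v \<in> Basis" for v
    using that b by (auto simp: Basis_vec_def c)
  have *: "lborel = density (distr lborel borel T) (\<lambda>_. (\<Prod>v\<in>Basis. \<bar>c v\<bar>))"
    unfolding T_def using c0 by (intro lborel_affine_euclidean) fastforce
  have [measurable]: "T \<in> borel_measurable borel" unfolding T_def by measurable
  have "(\<integral>\<^sup>+x. f x \<partial>lborel) = (\<integral>\<^sup>+x. f x \<partial>density (distr lborel borel T) (\<lambda>_. (\<Prod>v\<in>Basis. \<bar>c v\<bar>)))"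
    by (subst *) simp
  also have "\<dots> = ennreal (\<Prod>v\<in>Basis. \<bar>c v\<bar>) * (\<integral>\<^sup>+x. f (T x) \<partial>lborel)"
    using f by (simp add: nn_integral_density nn_integral_distr nn_integral_cmult)
  also have "(\<Prod>v\<in>Basis. \<bar>c v\<bar>) = (\<Prod>l\<in>UNIV. b l ^ DIM('a))"
    unfolding prod_Basis_vec using b by (simp add: c less_imp_le)
  finally show ?thesis by (simp add: T)
qed

lemma upd_pt_eq: "upd_pt Y j z = Y + axis j (z - Y $ j)"
  by (simp add: upd_pt_def axis_def vec_eq_iff)

lemma upd_pt_nth [simp]: "upd_pt Y j z $ l = (if l = j then z else Y $ l)"
  by (simp add: upd_pt_def)

lemma continuous_on_vec_nth [continuous_intros]:
  "continuous_on S f \<Longrightarrow> continuous_on S (\<lambda>x. f x $ i)"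
  by (auto intro: continuous_on_component)

lemma continuous_on_axis [continuous_intros]:
  fixes f :: "'b::topological_space \<Rightarrow> 'a::real_normed_vector"
  assumes "continuous_on S f"
  shows "continuous_on S (\<lambda>x. axis j (f x) :: 'a ^ 'n)"
proof -
  have "continuous_on S (\<lambda>x. if l = j then f x else 0)" for l
    using assms by (cases "l = j") auto
  then show ?thesis unfolding axis_def by (intro continuous_on_vec_lambda) auto
qed

lemma continuous_on_upd_pt [continuous_intros]:
  assumes "continuous_on S f" "continuous_on S g"
  shows "continuous_on S (\<lambda>x. upd_pt (f x) j (g x))"
  unfolding upd_pt_eq by (intro continuous_intros assms)

text \<open>Exchanging a slot of Y with z preserves Lebesgue measure: up to a reflection the
  exchange is a composition of three shears.\<close>
lemma nn_integral_swap_slot: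
  fixes G :: "real^'d^'n \<Rightarrow> real^'d \<Rightarrow> ennreal"
  assumes G: "case_prod G \<in> borel_measurable borel"
  shows "(\<integral>\<^sup>+Y. \<integral>\<^sup>+z. G (upd_pt Y j z) (Y $ j) \<partial>lborel \<partial>lborel) = (\<integral>\<^sup>+Y. \<integral>\<^sup>+z. G Y z \<partial>lborel \<partial>lborel)"
proof -
  \<comment> \<open>The three shears produce the exchange with one sign reversed. The claim is made
    for every integrand because it is afterwards applied to \<open>G Y (- z)\<close>.\<close>
  have main: "(\<integral>\<^sup>+Y. \<integral>\<^sup>+z. G (upd_pt Y j z) (- (Y $ j)) \<partial>lborel \<partial>lborel) = (\<integral>\<^sup>+Y. \<integral>\<^sup>+z. G Y z \<partial>lborel \<partial>lborel)"
    if G: "case_prod G \<in> borel_measurable borel" for G :: "real^'d^'n \<Rightarrow> real^'d \<Rightarrow> ennreal"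
  proof -
    have m: "(\<lambda>p. G (f p) (g p)) \<in> borel_measurable borel"
      if "continuous_on UNIV f" "continuous_on UNIV g" for f g
      using borel_measurable_compose_continuous[OF G, of "\<lambda>p. (f p, g p)"] that
      by (simp add: continuous_on_Pair)
    have "(\<integral>\<^sup>+Y. \<integral>\<^sup>+z. G Y z \<partial>lborel \<partial>lborel) = (\<integral>\<^sup>+z. \<integral>\<^sup>+Y. G Y z \<partial>lborel \<partial>lborel)"
      by (rule nn_integral_lborel_swap[OF G])
    also have "\<dots> = (\<integral>\<^sup>+z. \<integral>\<^sup>+Y. G (axis j z + Y) z \<partial>lborel \<partial>lborel)"
      by (subst nn_integral_lborel_translate) (auto intro!: m continuous_intros)
    also have "\<dots> = (\<integral>\<^sup>+Y. \<integral>\<^sup>+z. G (axis j z + Y) z \<partial>lborel \<partial>lborel)"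
      by (rule nn_integral_lborel_swap) (auto simp: case_prod_unfold intro!: m continuous_intros)
    also have "\<dots> = (\<integral>\<^sup>+Y. \<integral>\<^sup>+z. G (axis j (- (Y $ j) + z) + Y) (- (Y $ j) + z) \<partial>lborel \<partial>lborel)"
      by (intro nn_integral_cong nn_integral_lborel_translate[symmetric]) (auto intro!: m continuous_intros)
    also have "\<dots> = (\<integral>\<^sup>+z. \<integral>\<^sup>+Y. G (axis j (- (Y $ j) + z) + Y) (- (Y $ j) + z) \<partial>lborel \<partial>lborel)"
      by (rule nn_integral_lborel_swap) (auto simp: case_prod_unfold intro!: m continuous_intros)
    also have "\<dots> = (\<integral>\<^sup>+z. \<integral>\<^sup>+Y. G (axis j (- ((axis j z + Y) $ j) + z) + (axis j z + Y)) (- ((axis j z + Y) $ j) + z) \<partial>lborel \<partial>lborel)"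
      by (intro nn_integral_cong nn_integral_lborel_translate[symmetric, where f = "\<lambda>Y. G (axis j (- (Y $ j) + z) + Y) (- (Y $ j) + z)" for z])
         (auto intro!: m continuous_intros)
    also have "\<dots> = (\<integral>\<^sup>+z. \<integral>\<^sup>+Y. G (upd_pt Y j z) (- (Y $ j)) \<partial>lborel \<partial>lborel)"
    proof -
      have "axis j (- ((axis j z + Y) $ j) + z) + (axis j z + Y) = upd_pt Y j z" for z and Y :: "real^'d^'n"
        by (simp add: vec_eq_iff axis_def)
      moreover have "- ((axis j z + Y) $ j) + z = - (Y $ j)" for z and Y :: "real^'d^'n"
        by (simp add: axis_def)
      ultimately show ?thesis by simp
    qed
    also have "\<dots> = (\<integral>\<^sup>+Y. \<integral>\<^sup>+z. G (upd_pt Y j z) (- (Y $ j)) \<partial>lborel \<partial>lborel)"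
      by (rule nn_integral_lborel_swap) (auto simp: case_prod_unfold intro!: m continuous_intros)
    finally show ?thesis by simp
  qed
  have m: "(\<lambda>p. G (f p) (g p)) \<in> borel_measurable borel"
    if "continuous_on UNIV f" "continuous_on UNIV g" for f g
    using borel_measurable_compose_continuous[OF G, of "\<lambda>p. (f p, g p)"] that
    by (simp add: continuous_on_Pair)
  have "(\<integral>\<^sup>+Y. \<integral>\<^sup>+z. G (upd_pt Y j z) (Y $ j) \<partial>lborel \<partial>lborel) = (\<integral>\<^sup>+Y. \<integral>\<^sup>+z. G Y (- z) \<partial>lborel \<partial>lborel)"
    using main[of "\<lambda>Y z. G Y (- z)"] by (simp add: case_prod_unfold m continuous_intros)
  also have "\<dots> = (\<integral>\<^sup>+Y. \<integral>\<^sup>+z. G Y z \<partial>lborel \<partial>lborel)"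
    by (intro nn_integral_cong nn_integral_lborel_reflect) (auto intro!: m continuous_intros)
  finally show ?thesis .
qed

text \<open>The substitution behind all scale counts below: the slot j of the new point absorbs
  the translation z, so the increment W $ j survives as an independent variable.\<close>
lemma nn_integral_slots_substitution:
  fixes G :: "real^'d^'n \<Rightarrow> real^'d \<Rightarrow> ennreal" and b \<epsilon> :: "'n \<Rightarrow> real" and P :: "real^'d^'n"
  assumes G: "case_prod G \<in> borel_measurable borel"
    and b: "\<And>l. l \<noteq> j \<Longrightarrow> b l > 0" and e: "\<epsilon> j = 1"
  shows "(\<integral>\<^sup>+z. \<integral>\<^sup>+W. G (\<chi> l. P $ l + \<epsilon> l *\<^sub>R z + b l *\<^sub>R W $ l) (W $ j) \<partial>lborel \<partial>lborel)
    = ennreal (1 / (\<Prod>l\<in>UNIV-{j}. b l ^ CARD('d))) * (\<integral>\<^sup>+Y. \<integral>\<^sup>+\<eta>. G Y \<eta> \<partial>lborel \<partial>lborel)"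
proof -
  have m: "(\<lambda>p. G (f p) (g p)) \<in> borel_measurable borel"
    if "continuous_on UNIV f" "continuous_on UNIV g" for f g
    using borel_measurable_compose_continuous[OF G, of "\<lambda>p. (f p, g p)"] that
    by (simp add: continuous_on_Pair)
  \<comment> \<open>Slot j is scaled by 1: its coefficient \<open>b j\<close> may vanish, and its
    place is overwritten in \<open>H\<close> anyway, so the slot can carry the increment
    itself.\<close>
  define b' where "b' l = (if l = j then 1 else b l)" for l
  have b': "b' l > 0" for l using b by (simp add: b'_def)
  define J where "J = (\<Prod>l\<in>UNIV-{j}. b l ^ CARD('d))"
  have J: "J > 0" using b unfolding J_def by (intro prod_pos) simp
  have J': "(\<Prod>l\<in>UNIV. b' l ^ DIM(real^'d)) = J"
    unfolding J_def by (subst prod.remove[of _ j]) (auto simp: b'_def intro!: prod.cong)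
  define H where "H z Y = G (upd_pt Y j ((P $ j + b j *\<^sub>R Y $ j) + z)) (Y $ j)" for z Y
  have mH: "(\<lambda>(z, Y). H z Y) \<in> borel_measurable borel"
    unfolding H_def case_prod_unfold by (intro m continuous_intros)
  have inner: "(\<integral>\<^sup>+W. G (\<chi> l. P $ l + \<epsilon> l *\<^sub>R z + b l *\<^sub>R W $ l) (W $ j) \<partial>lborel)
      = ennreal (1 / J) * (\<integral>\<^sup>+Y. H z Y \<partial>lborel)" for z
  proof -
    define P' :: "real^'d^'n" where "P' = (\<chi> l. if l = j then 0 else P $ l + \<epsilon> l *\<^sub>R z)"
    have "(\<integral>\<^sup>+Y. H z Y \<partial>lborel) = ennreal J * (\<integral>\<^sup>+W. H z (\<chi> l. P' $ l + b' l *\<^sub>R W $ l) \<partial>lborel)"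
      unfolding J'[symmetric]
      by (intro nn_integral_lborel_slotwise_affine b')
         (auto simp: H_def intro!: m continuous_intros)
    also have "(\<lambda>W. H z (\<chi> l. P' $ l + b' l *\<^sub>R W $ l)) = (\<lambda>W. G (\<chi> l. P $ l + \<epsilon> l *\<^sub>R z + b l *\<^sub>R W $ l) (W $ j))"
    proof
      fix W :: "real^'d^'n"
      have "upd_pt (\<chi> l. P' $ l + b' l *\<^sub>R W $ l) j ((P $ j + b j *\<^sub>R (\<chi> l. P' $ l + b' l *\<^sub>R W $ l) $ j) + z)
          = (\<chi> l. P $ l + \<epsilon> l *\<^sub>R z + b l *\<^sub>R W $ l)"
        by (simp add: vec_eq_iff P'_def b'_def e)
      then show "H z (\<chi> l. P' $ l + b' l *\<^sub>R W $ l) = G (\<chi> l. P $ l + \<epsilon> l *\<^sub>R z + b l *\<^sub>R W $ l) (W $ j)"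
        by (simp add: H_def P'_def b'_def)
    qed
    finally have "ennreal (1 / J) * (\<integral>\<^sup>+Y. H z Y \<partial>lborel) = (ennreal (1 / J) * ennreal J) * (\<integral>\<^sup>+W. G (\<chi> l. P $ l + \<epsilon> l *\<^sub>R z + b l *\<^sub>R W $ l) (W $ j) \<partial>lborel)"
      by (simp add: mult.assoc)
    also have "ennreal (1 / J) * ennreal J = 1"
      using J by (simp add: ennreal_mult[symmetric])
    finally show ?thesis by simp
  qed
  have "(\<integral>\<^sup>+z. \<integral>\<^sup>+W. G (\<chi> l. P $ l + \<epsilon> l *\<^sub>R z + b l *\<^sub>R W $ l) (W $ j) \<partial>lborel \<partial>lborel)
      = ennreal (1 / J) * (\<integral>\<^sup>+z. \<integral>\<^sup>+Y. H z Y \<partial>lborel \<partial>lborel)"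
    unfolding inner
    by (intro nn_integral_cmult) (use nn_integral_lborel_snd_measurable[OF mH] in simp)
  also have "(\<integral>\<^sup>+z. \<integral>\<^sup>+Y. H z Y \<partial>lborel \<partial>lborel) = (\<integral>\<^sup>+Y. \<integral>\<^sup>+z. H z Y \<partial>lborel \<partial>lborel)"
    by (rule nn_integral_lborel_swap[OF mH])
  \<comment> \<open>The shift by \<open>P $ j + b j *\<^sub>R Y $ j\<close> is absorbed by
    translation invariance in z; what is left is the exchange of slot j with z.\<close>
  also have "\<dots> = (\<integral>\<^sup>+Y. \<integral>\<^sup>+z. G (upd_pt Y j z) (Y $ j) \<partial>lborel \<partial>lborel)"
    unfolding H_def
    by (intro nn_integral_cong nn_integral_lborel_translate[where f = "\<lambda>z. G (upd_pt Y j z) (Y $ j)" for Y])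
       (auto intro!: m continuous_intros)
  also have "\<dots> = (\<integral>\<^sup>+Y. \<integral>\<^sup>+z. G Y z \<partial>lborel \<partial>lborel)"
    by (rule nn_integral_swap_slot[OF G])
  finally show ?thesis by (simp add: J_def)
qed

section \<open>Iterated differences along a direction\<close>

text \<open>Jensen's inequality on the unit interval, by integrating the nonnegative square of g t -
  a.\<close>

lemma power2_integral_le_nn_integral:
  fixes g :: "real \<Rightarrow> real"
  assumes g: "(g has_integral a) {0..1}" and cont: "continuous_on {0..1} g"
  shows "ennreal (a\<^sup>2) \<le> (\<integral>\<^sup>+t. indicator {0..1} t * ennreal ((g t)\<^sup>2) \<partial>lborel)"
proof -
  have "(\<lambda>t. (g t)\<^sup>2) integrable_on {0..1}"
    by (intro integrable_continuous_real continuous_intros cont)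
  then obtain I where I: "((\<lambda>t. (g t)\<^sup>2) has_integral I) {0..1}" by blast
  have "((\<lambda>t. 2 * a * g t - a\<^sup>2) has_integral (2 * a * a - a\<^sup>2)) {0..1}"
    using has_integral_diff[OF has_integral_mult_right[OF g, of "2 * a"] has_integral_const_real[of "a\<^sup>2" 0 1]]
    by simp
  from has_integral_le[OF this I] have "2 * a * a - a\<^sup>2 \<le> I"
    using zero_le_power2[of "g _ - a"] by (simp add: power2_eq_square algebra_simps)
  then have "a\<^sup>2 \<le> I" by (simp add: power2_eq_square)
  moreover have "(\<integral>\<^sup>+t. indicator {0..1} t * ennreal ((g t)\<^sup>2) \<partial>lborel) = ennreal I"
    using nn_integral_has_integral_lebesgue'[OF _ I] by (simp add: mult.commute)
  ultimately show ?thesis by (simp add: ennreal_leI)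
qed

definition diff_op :: "'a::real_vector \<Rightarrow> ('a \<Rightarrow> real) \<Rightarrow> 'a \<Rightarrow> real" where
  "diff_op h g = (\<lambda>X. g (X + h) - g X)"

text \<open>Smoothness is available only on U, which need not be convex. A difference with step h
  can be written as an integral of derivatives only at points whose whole path up to parameter T
  stays in U.\<close>

definition segment_core :: "'a::real_vector set \<Rightarrow> 'a \<Rightarrow> real \<Rightarrow> 'a set" where
  "segment_core U h T = {X. \<forall>t\<in>{0..T}. X + t *\<^sub>R h \<in> U}"

text \<open>The complement is the sum of a compact segment and the closed complement of U, hence
  closed.\<close>

lemma open_segment_core:
  fixes U :: "'a::euclidean_space set"
  assumes "open U"
  shows "open (segment_core U h T)"
proof -
  have "closed (\<Union>y\<in>(\<lambda>t. - t *\<^sub>R h) ` {0..T}. \<Union>x\<in>- U. {y + x})"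
    by (intro compact_closed_sums compact_continuous_image continuous_intros)
       (use assms in \<open>auto simp: closed_open\<close>)
  also have "(\<Union>y\<in>(\<lambda>t. - t *\<^sub>R h) ` {0..T}. \<Union>x\<in>- U. {y + x}) = - segment_core U h T"
  proof (intro set_eqI iffI)
    fix X assume "X \<in> - segment_core U h T"
    then obtain t where t: "t \<in> {0..T}" "X + t *\<^sub>R h \<in> - U"
      by (auto simp: segment_core_def)
    then show "X \<in> (\<Union>y\<in>(\<lambda>t. - t *\<^sub>R h) ` {0..T}. \<Union>x\<in>- U. {y + x})"
      by (intro UN_I[of "- t *\<^sub>R h"] UN_I[of "X + t *\<^sub>R h"]) auto
  qed (auto simp: segment_core_def intro!: bexI)
  finally show ?thesis by (simp add: closed_open)
qed

lemma segment_core_Suc: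
  "segment_core U h (real (Suc m)) \<subseteq> segment_core (segment_core U h 1) h (real m)"
  by (auto simp: segment_core_def scaleR_add_left[symmetric] add.assoc)

lemma segment_core_0: "segment_core U h 0 = U"
  by (auto simp: segment_core_def)

lemma measurable_sq_indicator:
  fixes g :: "'a::euclidean_space \<Rightarrow> real"
  assumes "open U" "continuous_on U g"
  shows "(\<lambda>X. indicator U X * ennreal ((g X)\<^sup>2)) \<in> borel_measurable borel"
proof -
  have "(\<lambda>X. indicator U X *\<^sub>R (g X)\<^sup>2) \<in> borel_measurable borel"
    using assms by (intro borel_measurable_continuous_on_indicator continuous_intros) auto
  then have "(\<lambda>X. ennreal (indicator U X *\<^sub>R (g X)\<^sup>2)) \<in> borel_measurable borel" by simp
  also have "(\<lambda>X. ennreal (indicator U X *\<^sub>R (g X)\<^sup>2)) = (\<lambda>X. indicator U X * ennreal ((g X)\<^sup>2))"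
    by (auto simp: indicator_def)
  finally show ?thesis .
qed

text \<open>A difference is the integral of the derivative along the segment. Jensen bounds its
  square by the mean along the segment, and by translation invariance every parameter t contributes
  the same integral; hence the constant 1.\<close>

lemma nn_integral_diff_op_le:
  fixes g g' :: "'a::euclidean_space \<Rightarrow> real"
  assumes U: "open U" and cont: "continuous_on U g'"
    and der: "\<And>X. X \<in> U \<Longrightarrow> ((\<lambda>t. g (X + t *\<^sub>R h)) has_vector_derivative g' X) (at 0)"
  shows "(\<integral>\<^sup>+X. indicator (segment_core U h 1) X * ennreal ((diff_op h g X)\<^sup>2) \<partial>lborel)
    \<le> (\<integral>\<^sup>+X. indicator U X * ennreal ((g' X)\<^sup>2) \<partial>lborel)"
proof -
  define \<Phi> where "\<Phi> X = indicator U X * ennreal ((g' X)\<^sup>2)" for X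
  have m: "\<Phi> \<in> borel_measurable borel"
    using measurable_sq_indicator[OF U cont] by (simp add: \<Phi>_def[abs_def])
  have m2: "(\<lambda>(X, t::real). indicator {0..1} t * \<Phi> (t *\<^sub>R h + X)) \<in> borel_measurable borel"
  proof -
    have "(\<lambda>p::'a\<times>real. indicator (UNIV \<times> {0..1}) p * \<Phi> (snd p *\<^sub>R h + fst p)) \<in> borel_measurable borel"
      by (intro borel_measurable_times_ennreal borel_measurable_indicator
            borel_measurable_compose_continuous[OF m] continuous_intros)
         (auto intro!: borel_closed closed_Times)
    then show ?thesis by (simp add: case_prod_unfold indicator_def mem_Times_iff)
  qed
  have pt: "indicator (segment_core U h 1) X * ennreal ((diff_op h g X)\<^sup>2)
      \<le> (\<integral>\<^sup>+t. indicator {0..1} t * \<Phi> (t *\<^sub>R h + X) \<partial>lborel)" for X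
  proof (cases "X \<in> segment_core U h 1")
    case True
    then have XU: "X + t *\<^sub>R h \<in> U" if "t \<in> {0..1}" for t
      using that by (auto simp: segment_core_def)
    have vd: "((\<lambda>t. g (X + t *\<^sub>R h)) has_vector_derivative g' (X + t *\<^sub>R h)) (at t within {0..1})"
      if "t \<in> {0..1}" for t
    proof -
      have "((\<lambda>s. g ((X + t *\<^sub>R h) + s *\<^sub>R h)) has_vector_derivative g' (X + t *\<^sub>R h)) (at (t + - t))"
        using der[OF XU[OF that]] by simp
      then have "((\<lambda>s. g ((X + t *\<^sub>R h) + s *\<^sub>R h)) \<circ> (\<lambda>s. s + - t) has_vector_derivative 1 *\<^sub>R g' (X + t *\<^sub>R h)) (at t)"
        by (intro vector_diff_chain_at) (auto intro!: derivative_eq_intros)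
      moreover have "(\<lambda>s. g ((X + t *\<^sub>R h) + s *\<^sub>R h)) \<circ> (\<lambda>s. s + - t) = (\<lambda>t. g (X + t *\<^sub>R h))"
        by (auto simp: algebra_simps fun_eq_iff)
      ultimately show ?thesis
        by (simp add: has_vector_derivative_at_within)
    qed
    have cont': "continuous_on {0..1} (\<lambda>t. g' (X + t *\<^sub>R h))"
      by (intro continuous_on_compose2[OF cont] continuous_intros) (use XU in auto)
    have "((\<lambda>t. g' (X + t *\<^sub>R h)) has_integral (g (X + 1 *\<^sub>R h) - g (X + 0 *\<^sub>R h))) {0..1}"
      by (intro fundamental_theorem_of_calculus vd) auto
    then have "((\<lambda>t. g' (X + t *\<^sub>R h)) has_integral (diff_op h g X)) {0..1}"
      by (simp add: diff_op_def)
    from power2_integral_le_nn_integral[OF this cont']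
    have "ennreal ((diff_op h g X)\<^sup>2) \<le> (\<integral>\<^sup>+t. indicator {0..1} t * ennreal ((g' (X + t *\<^sub>R h))\<^sup>2) \<partial>lborel)" .
    also have "\<dots> = (\<integral>\<^sup>+t. indicator {0..1} t * \<Phi> (t *\<^sub>R h + X) \<partial>lborel)"
      using XU by (intro nn_integral_cong) (auto simp: \<Phi>_def indicator_def add.commute)
    finally show ?thesis using True by simp
  qed simp
  have "(\<integral>\<^sup>+X. indicator (segment_core U h 1) X * ennreal ((diff_op h g X)\<^sup>2) \<partial>lborel)
      \<le> (\<integral>\<^sup>+X. \<integral>\<^sup>+t. indicator {0..1} t * \<Phi> (t *\<^sub>R h + X) \<partial>lborel \<partial>lborel)"
    by (intro nn_integral_mono pt)
  also have "\<dots> = (\<integral>\<^sup>+t. \<integral>\<^sup>+X. indicator {0..1} t * \<Phi> (t *\<^sub>R h + X) \<partial>lborel \<partial>lborel)"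
    by (rule nn_integral_lborel_swap[OF m2])
  also have "\<dots> = (\<integral>\<^sup>+(t::real). indicator {0..1} t * (\<integral>\<^sup>+X. \<Phi> X \<partial>lborel) \<partial>lborel)"
  proof (intro nn_integral_cong)
    fix t :: real
    have "(\<lambda>X. \<Phi> (t *\<^sub>R h + X)) \<in> borel_measurable borel"
      by (intro borel_measurable_compose_continuous[OF m] continuous_intros)
    then have "(\<integral>\<^sup>+X. indicator {0..1} t * \<Phi> (t *\<^sub>R h + X) \<partial>lborel) = indicator {0..1} t * (\<integral>\<^sup>+X. \<Phi> (t *\<^sub>R h + X) \<partial>lborel)"
      by (intro nn_integral_cmult) simp
    then show "(\<integral>\<^sup>+X. indicator {0..1} t * \<Phi> (t *\<^sub>R h + X) \<partial>lborel) = indicator {0..1} t * (\<integral>\<^sup>+X. \<Phi> X \<partial>lborel)"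
      by (simp add: nn_integral_lborel_translate[OF m])
  qed
  also have "\<dots> = (\<integral>\<^sup>+X. \<Phi> X \<partial>lborel)"
    by (subst nn_integral_multc) auto
  finally show ?thesis by (simp add: \<Phi>_def)
qed

text \<open>\<open>F\<close> is a chain of successive derivatives along h. Differencing the chain
  gives another such chain on the smaller set \<open>segment_core U h 1\<close>, so differences can
  be traded for derivatives one at a time. The second bound keeps one difference back: the
  fractional seminorm contains differences of the derivatives of order m.\<close>

lemma diff_op_pow_bounds:
  fixes F :: "nat \<Rightarrow> 'a::euclidean_space \<Rightarrow> real"
  assumes "open U" "\<And>i. i \<le> m \<Longrightarrow> continuous_on U (F i)"
    and "\<And>i X. i < m \<Longrightarrow> X \<in> U \<Longrightarrow> ((\<lambda>t. F i (X + t *\<^sub>R h)) has_vector_derivative F (Suc i) X) (at 0)"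
  shows diff_op_pow_le: "(\<integral>\<^sup>+X. indicator (segment_core U h (real m)) X * ennreal (((diff_op h ^^ m) (F 0) X)\<^sup>2) \<partial>lborel)
      \<le> (\<integral>\<^sup>+X. indicator U X * ennreal ((F m X)\<^sup>2) \<partial>lborel)" (is ?A)
    and diff_op_pow_Suc_le: "(\<integral>\<^sup>+X. indicator (segment_core U h (real (Suc m))) X * ennreal (((diff_op h ^^ Suc m) (F 0) X)\<^sup>2) \<partial>lborel)
      \<le> (\<integral>\<^sup>+X. indicator (segment_core U h 1) X * ennreal ((diff_op h (F m) X)\<^sup>2) \<partial>lborel)" (is ?B)
proof -
  \<comment> \<open>The first bound for m is a premise here, so this serves both as the inductive
    step and, after the induction, for the second bound.\<close>
  have step: "(\<integral>\<^sup>+X. indicator (segment_core U h (real (Suc m))) X * ennreal (((diff_op h ^^ Suc m) (F 0) X)\<^sup>2) \<partial>lborel)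
      \<le> (\<integral>\<^sup>+X. indicator (segment_core U h 1) X * ennreal ((diff_op h (F m) X)\<^sup>2) \<partial>lborel)"
    if IH: "\<And>(U::'a set) F. open U \<Longrightarrow> (\<And>i. i \<le> m \<Longrightarrow> continuous_on U (F i)) \<Longrightarrow>
      (\<And>i X. i < m \<Longrightarrow> X \<in> U \<Longrightarrow> ((\<lambda>t. F i (X + t *\<^sub>R h)) has_vector_derivative F (Suc i) X) (at 0)) \<Longrightarrow>
      (\<integral>\<^sup>+X. indicator (segment_core U h (real m)) X * ennreal (((diff_op h ^^ m) (F 0) X)\<^sup>2) \<partial>lborel)
      \<le> (\<integral>\<^sup>+X. indicator U X * ennreal ((F m X)\<^sup>2) \<partial>lborel)"
    and *: "open U" "\<And>i. i \<le> m \<Longrightarrow> continuous_on U (F i)"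
    and **: "\<And>i X. i < m \<Longrightarrow> X \<in> U \<Longrightarrow> ((\<lambda>t. F i (X + t *\<^sub>R h)) has_vector_derivative F (Suc i) X) (at 0)"
    for m F and U :: "'a set"
  proof -
    have sub: "X + h \<in> U" "X \<in> U" if "X \<in> segment_core U h 1" for X
    proof -
      have "\<forall>t\<in>{0..1}. X + t *\<^sub>R h \<in> U" using that by (simp add: segment_core_def)
      from bspec[OF this, of 1] bspec[OF this, of 0] show "X + h \<in> U" "X \<in> U" by auto
    qed
    have "(\<integral>\<^sup>+X. indicator (segment_core (segment_core U h 1) h (real m)) X * ennreal (((diff_op h ^^ m) (diff_op h (F 0)) X)\<^sup>2) \<partial>lborel)
        \<le> (\<integral>\<^sup>+X. indicator (segment_core U h 1) X * ennreal ((diff_op h (F m) X)\<^sup>2) \<partial>lborel)"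
    proof (rule IH)
      show "open (segment_core U h 1)" using *(1) by (rule open_segment_core)
      show "continuous_on (segment_core U h 1) (diff_op h (F i))" if "i \<le> m" for i
        unfolding diff_op_def
        by (intro continuous_intros continuous_on_compose2[OF *(2)[OF that]]) (use sub in auto)
      show "((\<lambda>t. diff_op h (F i) (X + t *\<^sub>R h)) has_vector_derivative diff_op h (F (Suc i)) X) (at 0)"
        if "i < m" "X \<in> segment_core U h 1" for i X
        using has_vector_derivative_diff[OF **[OF that(1) sub(1)[OF that(2)]] **[OF that(1) sub(2)[OF that(2)]]]
        by (simp add: diff_op_def algebra_simps)
    qed
    moreover have "(\<integral>\<^sup>+X. indicator (segment_core U h (real (Suc m))) X * ennreal (((diff_op h ^^ Suc m) (F 0) X)\<^sup>2) \<partial>lborel)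
      \<le> (\<integral>\<^sup>+X. indicator (segment_core (segment_core U h 1) h (real m)) X * ennreal (((diff_op h ^^ m) (diff_op h (F 0)) X)\<^sup>2) \<partial>lborel)"
      using segment_core_Suc[of U h m]
      by (intro nn_integral_mono mult_right_mono) (auto simp: indicator_def funpow_Suc_right simp del: funpow.simps)
    ultimately show ?thesis by (rule order_trans[rotated])
  qed
  have A: "(\<integral>\<^sup>+X. indicator (segment_core U h (real m)) X * ennreal (((diff_op h ^^ m) (F 0) X)\<^sup>2) \<partial>lborel)
      \<le> (\<integral>\<^sup>+X. indicator U X * ennreal ((F m X)\<^sup>2) \<partial>lborel)"
    if "open U" "\<And>i. i \<le> m \<Longrightarrow> continuous_on U (F i)"
    and "\<And>i X. i < m \<Longrightarrow> X \<in> U \<Longrightarrow> ((\<lambda>t. F i (X + t *\<^sub>R h)) has_vector_derivative F (Suc i) X) (at 0)"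
    for m F and U :: "'a set"
    using that
  proof (induction m arbitrary: U F)
    case 0
    then show ?case by (simp add: segment_core_0)
  next
    case (Suc m)
    have "(\<integral>\<^sup>+X. indicator (segment_core U h (real (Suc m))) X * ennreal (((diff_op h ^^ Suc m) (F 0) X)\<^sup>2) \<partial>lborel)
      \<le> (\<integral>\<^sup>+X. indicator (segment_core U h 1) X * ennreal ((diff_op h (F m) X)\<^sup>2) \<partial>lborel)"
      using Suc.prems by (intro step Suc.IH) auto
    also have "\<dots> \<le> (\<integral>\<^sup>+X. indicator U X * ennreal ((F (Suc m) X)\<^sup>2) \<partial>lborel)"
      using Suc.prems by (intro nn_integral_diff_op_le) auto
    finally show ?case .
  qed
  show ?A using assms by (rule A)
  show ?B using assms by (intro step A)
qed

section \<open>Iterated differences as alternating binomial sums\<close>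

lemma alternating_choose_sum_Suc:
  fixes a :: "nat \<Rightarrow> real"
  shows "(\<Sum>i\<le>Suc M. (-1) ^ i * real (Suc M choose i) * a i)
    = (\<Sum>i\<le>M. (-1) ^ i * real (M choose i) * (a i - a (Suc i)))"
proof -
  have "(\<Sum>i\<le>Suc M. (-1) ^ i * real (Suc M choose i) * a i)
      = a 0 + (\<Sum>i\<le>M. (-1) ^ Suc i * real (Suc M choose Suc i) * a (Suc i))"
    by (subst sum.atMost_Suc_shift) simp
  also have "\<dots> = (a 0 + (\<Sum>i\<le>M. (-1) ^ Suc i * real (M choose Suc i) * a (Suc i)))
      - (\<Sum>i\<le>M. (-1) ^ i * real (M choose i) * a (Suc i))"
    by (simp add: sum.distrib[symmetric] sum_subtractf[symmetric] algebra_simps sum_negf[symmetric])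
  also have "a 0 + (\<Sum>i\<le>M. (-1) ^ Suc i * real (M choose Suc i) * a (Suc i))
      = (\<Sum>i\<le>Suc M. (-1) ^ i * real (M choose i) * a i)"
    by (subst sum.atMost_Suc_shift) simp
  also have "\<dots> = (\<Sum>i\<le>M. (-1) ^ i * real (M choose i) * a i)" by simp
  finally show ?thesis by (simp add: algebra_simps sum_subtractf)
qed

lemma alternating_choose_sum_diff_op:
  "(\<Sum>i\<le>M. (-1) ^ i * real (M choose i) * g (X + real i *\<^sub>R h)) = (-1) ^ M * (diff_op h ^^ M) g X"
proof (induction M arbitrary: g)
  case (Suc M)
  have "(\<Sum>i\<le>Suc M. (-1) ^ i * real (Suc M choose i) * g (X + real i *\<^sub>R h))
      = - (\<Sum>i\<le>M. (-1) ^ i * real (M choose i) * diff_op h g (X + real i *\<^sub>R h))"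
    unfolding alternating_choose_sum_Suc sum_negf[symmetric]
    by (intro sum.cong refl) (simp add: diff_op_def algebra_simps)
  also have "\<dots> = - ((-1) ^ M * (diff_op h ^^ M) (diff_op h g) X)"
    by (simp add: Suc.IH)
  also have "\<dots> = (-1) ^ Suc M * (diff_op h ^^ Suc M) g X"
    by (simp add: funpow_Suc_right del: funpow.simps)
  finally show ?case .
qed simp

section \<open>Multi-index derivatives\<close>

lemma smooth_on_foldr_differentiable:
  assumes "smooth_on S u" "open S" "X \<in> S"
  shows "foldr dir_deriv vs u differentiable (at X)"
  using assms by (auto simp: smooth_on_def differentiable_on_eq_differentiable_at)

lemma smooth_on_foldr_continuous:
  assumes "smooth_on S u"
  shows "continuous_on S (foldr dir_deriv vs u)"
  using assms by (auto simp: smooth_on_def intro: differentiable_imp_continuous_on)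

lemma has_vector_derivative_dir_deriv:
  assumes "f differentiable (at (X + t *\<^sub>R v))"
  shows "((\<lambda>t. f (X + t *\<^sub>R v)) has_vector_derivative dir_deriv v f (X + t *\<^sub>R v)) (at t within T)"
proof -
  have "(f has_derivative frechet_derivative f (at (X + t *\<^sub>R v))) (at (X + t *\<^sub>R v))"
    using assms frechet_derivative_works by blast
  moreover have "((\<lambda>t. X + t *\<^sub>R v) has_derivative (\<lambda>t. t *\<^sub>R v)) (at t within T)"
    by (auto intro!: derivative_eq_intros)
  ultimately have "((\<lambda>t. f (X + t *\<^sub>R v)) has_derivative
      (\<lambda>s. frechet_derivative f (at (X + t *\<^sub>R v)) (s *\<^sub>R v))) (at t within T)"
    using has_derivative_compose[of "\<lambda>t. X + t *\<^sub>R v" "\<lambda>t. t *\<^sub>R v" t T f] by blast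
  moreover have "linear (frechet_derivative f (at (X + t *\<^sub>R v)))"
    using assms by (rule linear_frechet_derivative)
  ultimately show ?thesis
    by (simp add: has_vector_derivative_def dir_deriv_def linear_scale)
qed

section \<open>Interchange of directional derivatives\<close>

lemma dir_deriv_cong_on:
  assumes "open S" "\<And>X. X \<in> S \<Longrightarrow> f X = g X" "X \<in> S"
  shows "dir_deriv v f X = dir_deriv v g X"
proof -
  have "(f has_derivative f') (at X) \<longleftrightarrow> (g has_derivative f') (at X)" for f'
  proof
    assume "(f has_derivative f') (at X)"
    from has_derivative_transform_within_open[OF this assms(1,3)] show "(g has_derivative f') (at X)"
      using assms(2) by simp
  next
    assume "(g has_derivative f') (at X)"
    from has_derivative_transform_within_open[OF this assms(1,3)] show "(f has_derivative f') (at X)"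
      using assms(2) by simp
  qed
  then show ?thesis by (simp add: dir_deriv_def frechet_derivative_def)
qed

text \<open>The mean value theorem is used twice: in direction v for the difference of two
  translates, then in direction w for its derivative. The second difference is symmetric in v and w,
  so both mixed derivatives can be read off from it.\<close>

lemma second_difference_mean_value:
  fixes f :: "'a::euclidean_space \<Rightarrow> real"
  assumes t: "t > 0"
    and in_S: "\<And>a b. a \<in> {0..t} \<Longrightarrow> b \<in> {0..t} \<Longrightarrow> X + a *\<^sub>R v + b *\<^sub>R w \<in> S"
    and d: "\<And>Y. Y \<in> S \<Longrightarrow> f differentiable (at Y)" "\<And>Y. Y \<in> S \<Longrightarrow> dir_deriv v f differentiable (at Y)"
  obtains a b where "a \<in> {0..t}" "b \<in> {0..t}"
    "f (X + t *\<^sub>R v + t *\<^sub>R w) - f (X + t *\<^sub>R v) - f (X + t *\<^sub>R w) + f X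
      = t * t * dir_deriv w (dir_deriv v f) (X + a *\<^sub>R v + b *\<^sub>R w)"
proof -
  have mv: "\<exists>a\<in>{0..t}. p t - p 0 = t * p' a"
    if p: "\<And>a. a \<in> {0..t} \<Longrightarrow> (p has_vector_derivative p' a) (at a within {0..t})" for p p' :: "real \<Rightarrow> real"
  proof -
    have "(p has_derivative (\<lambda>x. x * p' a)) (at a within {0..t})" if "0 \<le> a" "a \<le> t" for a
      using p[of a] that by (simp add: has_vector_derivative_def)
    then obtain a where "a \<in> {0<..<t}" "p t - p 0 = (t - 0) * p' a"
      using mvt_simple[OF t, of p "\<lambda>a x. x * p' a"] by blast
    then show ?thesis by (intro bexI[of _ a]) auto
  qed
  define p where "p a = f ((X + t *\<^sub>R w) + a *\<^sub>R v) - f (X + a *\<^sub>R v)" for a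
  have "\<exists>a\<in>{0..t}. p t - p 0 = t * (dir_deriv v f ((X + t *\<^sub>R w) + a *\<^sub>R v) - dir_deriv v f (X + a *\<^sub>R v))"
    unfolding p_def
  proof (rule mv)
    fix a assume a: "a \<in> {0..t}"
    have "f differentiable at (X + t *\<^sub>R w + a *\<^sub>R v)" "f differentiable at (X + a *\<^sub>R v)"
      using in_S[OF a, of t] in_S[OF a, of 0] t d(1) by (auto simp: add_ac)
    then show "((\<lambda>a. f (X + t *\<^sub>R w + a *\<^sub>R v) - f (X + a *\<^sub>R v)) has_vector_derivative
         dir_deriv v f (X + t *\<^sub>R w + a *\<^sub>R v) - dir_deriv v f (X + a *\<^sub>R v)) (at a within {0..t})"
      by (intro has_vector_derivative_diff has_vector_derivative_dir_deriv)
  qed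
  then obtain a where a: "a \<in> {0..t}" and pa:
    "p t - p 0 = t * (dir_deriv v f ((X + t *\<^sub>R w) + a *\<^sub>R v) - dir_deriv v f (X + a *\<^sub>R v))" by blast
  have "\<exists>b\<in>{0..t}. dir_deriv v f ((X + a *\<^sub>R v) + t *\<^sub>R w) - dir_deriv v f ((X + a *\<^sub>R v) + 0 *\<^sub>R w)
      = t * dir_deriv w (dir_deriv v f) ((X + a *\<^sub>R v) + b *\<^sub>R w)"
    by (rule mv, rule has_vector_derivative_dir_deriv, rule d(2), rule in_S[OF a])
  then obtain b where b: "b \<in> {0..t}" and "dir_deriv v f ((X + a *\<^sub>R v) + t *\<^sub>R w) - dir_deriv v f (X + a *\<^sub>R v)
      = t * dir_deriv w (dir_deriv v f) ((X + a *\<^sub>R v) + b *\<^sub>R w)" by auto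
  with pa have "p t - p 0 = t * t * dir_deriv w (dir_deriv v f) (X + a *\<^sub>R v + b *\<^sub>R w)"
    by (simp add: add_ac)
  moreover have "p t - p 0 = f (X + t *\<^sub>R v + t *\<^sub>R w) - f (X + t *\<^sub>R v) - f (X + t *\<^sub>R w) + f X"
    by (simp add: p_def add_ac)
  ultimately show ?thesis using that[OF a b] by simp
qed

text \<open>Schwarz's theorem. One second difference, expanded in both orders, gives equal values of
  the two mixed derivatives at points near X, and continuity transfers the equality to X. It is
  required because \<open>Dalpha\<close> fixes an order of the coordinates, while iterated
  directional derivatives produce every order.\<close>

lemma dir_deriv_commute:
  fixes f :: "'a::euclidean_space \<Rightarrow> real"
  assumes S: "open S" "X \<in> S"
    and d: "\<And>Y. Y \<in> S \<Longrightarrow> f differentiable (at Y)" "\<And>v Y. Y \<in> S \<Longrightarrow> dir_deriv v f differentiable (at Y)"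
    and c: "\<And>v w. continuous_on S (dir_deriv v (dir_deriv w f))"
  shows "dir_deriv v (dir_deriv w f) X = dir_deriv w (dir_deriv v f) X"
proof (rule ccontr)
  let ?A = "dir_deriv v (dir_deriv w f)" and ?B = "dir_deriv w (dir_deriv v f)"
  assume ne: "?A X \<noteq> ?B X"
  \<comment> \<open>Half of the gap at X: two errors below e cannot bridge it.\<close>
  define e where "e = \<bar>?A X - ?B X\<bar> / 2"
  have e: "e > 0" using ne by (simp add: e_def)
  obtain \<delta>1 where \<delta>1: "\<delta>1 > 0" "\<And>Y. Y \<in> S \<Longrightarrow> dist Y X < \<delta>1 \<Longrightarrow> dist (?A Y) (?A X) < e"
    using c[of v w, unfolded continuous_on_iff, rule_format, OF S(2) e] by blast
  obtain \<delta>2 where \<delta>2: "\<delta>2 > 0" "\<And>Y. Y \<in> S \<Longrightarrow> dist Y X < \<delta>2 \<Longrightarrow> dist (?B Y) (?B X) < e"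
    using c[of w v, unfolded continuous_on_iff, rule_format, OF S(2) e] by blast
  obtain \<delta>3 where \<delta>3: "\<delta>3 > 0" "ball X \<delta>3 \<subseteq> S" using S openE by blast
  define \<delta> where "\<delta> = min \<delta>1 (min \<delta>2 \<delta>3)"
  \<comment> \<open>Keeps \<open>a *\<^sub>R v + b *\<^sub>R w\<close> within half of
    \<open>\<delta>\<close> for all a and b up to t; the summand 1 avoids a zero
    denominator.\<close>
  define t where "t = \<delta> / (2 * (norm v + norm w + 1))"
  have \<delta>: "\<delta> > 0" using \<delta>1 \<delta>2 \<delta>3 by (simp add: \<delta>_def)
  have nvw: "norm v + norm w + 1 > 0" by (smt (verit) norm_ge_zero)
  then have t: "t > 0" using \<delta> by (simp add: t_def)
  have near: "dist (X + a *\<^sub>R v + b *\<^sub>R w) X < \<delta>" if "a \<in> {0..t}" "b \<in> {0..t}" for a b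
  proof -
    have "dist (X + a *\<^sub>R v + b *\<^sub>R w) X = norm (a *\<^sub>R v + b *\<^sub>R w)" by (simp add: dist_norm)
    also have "\<dots> \<le> a * norm v + b * norm w"
      using norm_triangle_ineq[of "a *\<^sub>R v" "b *\<^sub>R w"] that by simp
    also have "\<dots> \<le> t * norm v + t * norm w"
      using that by (intro add_mono mult_right_mono) auto
    also have "\<dots> \<le> t * (norm v + norm w + 1)" using t by (simp add: algebra_simps)
    also have "\<dots> = \<delta> / 2" unfolding t_def using nvw by (metis mult.commute nonzero_mult_div_cancel_left divide_divide_eq_left less_irrefl times_divide_eq_left)
    finally show ?thesis using \<delta> by simp
  qed
  have in_S: "X + a *\<^sub>R v + b *\<^sub>R w \<in> S" if "a \<in> {0..t}" "b \<in> {0..t}" for a b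
    using near[OF that] \<delta>3 by (force simp: \<delta>_def dist_commute)
  obtain a b where ab: "a \<in> {0..t}" "b \<in> {0..t}" and eq1:
    "f (X + t *\<^sub>R v + t *\<^sub>R w) - f (X + t *\<^sub>R v) - f (X + t *\<^sub>R w) + f X = t * t * ?B (X + a *\<^sub>R v + b *\<^sub>R w)"
    by (rule second_difference_mean_value[OF t in_S d(1) d(2)])
  have in_S': "X + b *\<^sub>R w + a *\<^sub>R v \<in> S" if "b \<in> {0..t}" "a \<in> {0..t}" for a b
    using in_S[OF that(2,1)] by (simp add: add_ac)
  obtain a' b' where ab': "b' \<in> {0..t}" "a' \<in> {0..t}" and eq2:
    "f (X + t *\<^sub>R w + t *\<^sub>R v) - f (X + t *\<^sub>R w) - f (X + t *\<^sub>R v) + f X = t * t * ?A (X + b' *\<^sub>R w + a' *\<^sub>R v)"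
    by (rule second_difference_mean_value[OF t in_S' d(1) d(2)])
  have "t * t * ?B (X + a *\<^sub>R v + b *\<^sub>R w) = t * t * ?A (X + a' *\<^sub>R v + b' *\<^sub>R w)"
  proof -
    have "X + t *\<^sub>R w + t *\<^sub>R v = X + t *\<^sub>R v + t *\<^sub>R w"
      "X + b' *\<^sub>R w + a' *\<^sub>R v = X + a' *\<^sub>R v + b' *\<^sub>R w" by (simp_all add: add_ac)
    then show ?thesis using eq1 eq2 by (metis add.commute diff_add_eq diff_diff_add)
  qed
  then have "?B (X + a *\<^sub>R v + b *\<^sub>R w) = ?A (X + a' *\<^sub>R v + b' *\<^sub>R w)" using t by simp
  moreover have "dist (?B (X + a *\<^sub>R v + b *\<^sub>R w)) (?B X) < e"
    using near[OF ab] in_S[OF ab] \<delta>2 by (simp add: \<delta>_def)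
  moreover have "dist (?A (X + a' *\<^sub>R v + b' *\<^sub>R w)) (?A X) < e"
    using near[OF ab'(2,1)] in_S[OF ab'(2,1)] \<delta>1 by (simp add: \<delta>_def)
  ultimately have "dist (?A X) (?B X) < e + e"
    using dist_triangle3[of "?A X" "?B X" "?A (X + a' *\<^sub>R v + b' *\<^sub>R w)"] by simp
  then show False by (simp add: e_def dist_real_def)
qed

text \<open>The derivative is carried past one neighbour at a time. Each exchange is valid on all of
  the open set S, so the derivatives applied outside it are unaffected.\<close>

lemma foldr_dir_deriv_move_front:
  assumes "smooth_on S u" "open S" "X \<in> S"
  shows "foldr dir_deriv (vs @ v # ws) u X = foldr dir_deriv (v # vs @ ws) u X"
  using assms(3)
proof (induction vs arbitrary: X)
  case (Cons v' vs)
  have "foldr dir_deriv ((v' # vs) @ v # ws) u X = dir_deriv v' (foldr dir_deriv (v # vs @ ws) u) X"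
    using dir_deriv_cong_on[OF assms(2) Cons.IH Cons.prems] by simp
  also have "\<dots> = dir_deriv v (dir_deriv v' (foldr dir_deriv (vs @ ws) u)) X"
  proof -
    have "foldr dir_deriv (vs @ ws) u differentiable (at Y)"
      "dir_deriv a (foldr dir_deriv (vs @ ws) u) differentiable (at Y)"
      "continuous_on S (dir_deriv a (dir_deriv b (foldr dir_deriv (vs @ ws) u)))" if "Y \<in> S" for Y a b
      using smooth_on_foldr_differentiable[OF assms(1,2) that, of "vs @ ws"]
        smooth_on_foldr_differentiable[OF assms(1,2) that, of "a # vs @ ws"]
        smooth_on_foldr_continuous[OF assms(1), of "a # b # vs @ ws"] by simp_all
    then show ?thesis
      using dir_deriv_commute[OF assms(2) Cons.prems, of "foldr dir_deriv (vs @ ws) u" v' v]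
        Cons.prems by simp
  qed
  finally show ?case by simp
qed simp

lemma foldr_dir_deriv_mset_cong:
  assumes "smooth_on S u" "open S" "X \<in> S" "mset vs = mset ws"
  shows "foldr dir_deriv vs u X = foldr dir_deriv ws u X"
  using assms(3,4)
proof (induction vs arbitrary: ws X)
  case (Cons v vs)
  then have "v \<in> set ws" by (metis list.set_intros(1) mset_eq_setD)
  then obtain a b where ws: "ws = a @ v # b" by (meson split_list)
  then have "mset vs = mset (a @ b)" using Cons.prems by simp
  then have "foldr dir_deriv (v # vs) u X = foldr dir_deriv (v # a @ b) u X"
    using dir_deriv_cong_on[OF assms(2) Cons.IH[where ws="a @ b"] Cons.prems(1)] by simp
  also have "\<dots> = foldr dir_deriv ws u X"
    unfolding ws using foldr_dir_deriv_move_front[OF assms(1,2) Cons.prems(1)] by metis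
  finally show ?case .
qed simp

section \<open>Multi-indices as words of coordinate directions\<close>

lemma coord_list: "distinct (coord_list :: 'd::finite list)" "set (coord_list :: 'd list) = UNIV"
proof -
  have "\<exists>xs::'d list. distinct xs \<and> set xs = UNIV"
    using finite_distinct_list[of "UNIV :: 'd set"] by auto
  from someI_ex[OF this] show "distinct (coord_list :: 'd list)" "set (coord_list :: 'd list) = UNIV"
    unfolding coord_list_def by auto
qed

text \<open>A word is a multi-index that remembers an order. Powers of a directional derivative
  multiply out into a sum over words with products of coordinates as coefficients, so no multinomial
  coefficients have to be tracked.\<close>

definition word_deriv :: "'n::finite \<Rightarrow> 'd::finite list \<Rightarrow> (real^'d^'n \<Rightarrow> real) \<Rightarrow> real^'d^'n \<Rightarrow> real" where
  "word_deriv j w u = foldr dir_deriv (map (\<lambda>i. axis j (axis i 1)) w) u"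

lemma word_deriv_Cons: "word_deriv j (i # w) u = dir_deriv (axis j (axis i 1)) (word_deriv j w u)"
  by (simp add: word_deriv_def)

text \<open>Turns the nested powers in \<open>Dalpha\<close> into one fold over a word; comparing
  two orders of differentiation then becomes comparing multisets.\<close>

lemma foldr_funpow_conv_concat:
  "foldr (\<lambda>i f. (F i ^^ \<alpha> i) f) xs u = foldr F (concat (map (\<lambda>i. replicate (\<alpha> i) i) xs)) u"
proof (induction xs)
  case (Cons x xs)
  have "(F x ^^ k) f = foldr F (replicate k x) f" for k f
    by (induction k) auto
  with Cons show ?case by simp
qed simp

lemma Dalpha_conv_word_deriv:
  fixes j :: "'n::finite" and \<alpha> :: "'d::finite \<Rightarrow> nat" and u :: "real^'d^'n \<Rightarrow> real"
  shows "Dalpha j \<alpha> u = word_deriv j (concat (map (\<lambda>i. replicate (\<alpha> i) i) coord_list)) u"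
proof -
  have "partial j = (\<lambda>i. dir_deriv (axis j (axis i 1 :: real^'d) :: real^'d^'n))" for j :: 'n
    by (simp add: partial_def fun_eq_iff)
  then show ?thesis
    by (simp add: Dalpha_def foldr_funpow_conv_concat word_deriv_def foldr_map o_def)
qed

lemma mset_concat_replicate:
  "distinct xs \<Longrightarrow> count (mset (concat (map (\<lambda>i. replicate (\<alpha> i) i) xs))) x = (if x \<in> set xs then \<alpha> x else 0)"
  by (induction xs) (auto simp: count_mset)

lemma word_deriv_conv_Dalpha:
  fixes w :: "'d::finite list"
  assumes "smooth_on S u" "open S" "X \<in> S"
  shows "word_deriv j w u X = Dalpha j (count (mset w)) u X"
proof -
  have "mset (concat (map (\<lambda>i. replicate (count (mset w) i) i) coord_list)) = mset w"
    by (rule multiset_eqI) (simp add: mset_concat_replicate coord_list)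
  then show ?thesis
    unfolding Dalpha_conv_word_deriv word_deriv_def
    by (intro foldr_dir_deriv_mset_cong[OF assms]) (metis mset_map)
qed

lemma count_mset_in_multi_indices: "count (mset w) \<in> multi_indices (length w)"
  for w :: "'d::finite list"
  unfolding multi_indices_def
proof (induction w)
  case (Cons a w)
  have "(\<Sum>i\<in>UNIV. count (mset (a # w)) i) = (\<Sum>i\<in>UNIV. count (mset w) i + (if i = a then 1 else 0))"
    by (intro sum.cong) auto
  also have "\<dots> = length w + 1" using Cons by (simp add: sum.distrib)
  finally show ?case by simp
qed simp

definition words :: "nat \<Rightarrow> 'd::finite list set" where
  "words l = {w. length w = l}"

lemma finite_words [simp]: "finite (words l :: 'd::finite list set)"
  using finite_lists_length_eq[of "UNIV :: 'd set" l] by (simp add: words_def)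

lemma sum_words_Suc:
  fixes f :: "'d::finite list \<Rightarrow> 'b::comm_monoid_add"
  shows "sum f (words (Suc l)) = (\<Sum>i\<in>UNIV. \<Sum>w\<in>words l. f (i # w))"
proof -
  have "words (Suc l) = (\<lambda>(i, w). i # w) ` (UNIV \<times> words l :: ('d \<times> 'd list) set)"
    by (auto simp: words_def length_Suc_conv)
  then have "sum f (words (Suc l)) = sum f ((\<lambda>(i, w). i # w) ` (UNIV \<times> words l))" by simp
  also have "\<dots> = (\<Sum>p\<in>UNIV \<times> words l. f (fst p # snd p))"
    by (subst sum.reindex) (auto simp: inj_on_def case_prod_unfold)
  finally show ?thesis by (simp add: sum.cartesian_product case_prod_unfold)
qed

lemma dir_deriv_axis_sum:
  fixes f :: "'w \<Rightarrow> real^'d^'n \<Rightarrow> real"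
  assumes "finite A" "\<And>w. w \<in> A \<Longrightarrow> f w differentiable (at X)"
  shows "dir_deriv (axis j \<eta>) (\<lambda>Y. \<Sum>w\<in>A. c w * f w Y) X
    = (\<Sum>i\<in>UNIV. \<Sum>w\<in>A. \<eta> $ i * c w * dir_deriv (axis j (axis i 1)) (f w) X)"
proof -
  have "((\<lambda>Y. \<Sum>w\<in>A. c w * f w Y) has_derivative (\<lambda>h. \<Sum>w\<in>A. c w * frechet_derivative (f w) (at X) h)) (at X)"
    using assms by (intro has_derivative_sum has_derivative_mult_right) (simp add: frechet_derivative_works[symmetric])
  then have "frechet_derivative (\<lambda>Y. \<Sum>w\<in>A. c w * f w Y) (at X) = (\<lambda>h. \<Sum>w\<in>A. c w * frechet_derivative (f w) (at X) h)"
    by (rule frechet_derivative_at[symmetric])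
  then have "dir_deriv (axis j \<eta>) (\<lambda>Y. \<Sum>w\<in>A. c w * f w Y) X = (\<Sum>w\<in>A. c w * frechet_derivative (f w) (at X) (axis j \<eta>))"
    by (simp add: dir_deriv_def)
  also have "\<dots> = (\<Sum>w\<in>A. c w * (\<Sum>i\<in>UNIV. \<eta> $ i * dir_deriv (axis j (axis i 1)) (f w) X))"
  proof (intro sum.cong refl arg_cong2[where f = "(*)"])
    fix w assume "w \<in> A"
    then have lin: "linear (frechet_derivative (f w) (at X))"
      using assms by (intro linear_frechet_derivative)
    have "axis j \<eta> = (\<Sum>i\<in>UNIV. \<eta> $ i *\<^sub>R (axis j (axis i 1 :: real^'d) :: real^'d^'n))"
    proof -
      have "(\<Sum>i\<in>UNIV. \<eta> $ i *\<^sub>R (axis j (axis i 1 :: real^'d) :: real^'d^'n)) $ a $ b = axis j \<eta> $ a $ b" for a b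
        by (cases "a = j") (simp_all add: axis_def if_distrib cong: if_cong)
      then show ?thesis by (simp add: vec_eq_iff)
    qed
    then show "frechet_derivative (f w) (at X) (axis j \<eta>) = (\<Sum>i\<in>UNIV. \<eta> $ i * dir_deriv (axis j (axis i 1)) (f w) X)"
      using lin by (simp add: linear_sum linear_scale dir_deriv_def)
  qed
  also have "\<dots> = (\<Sum>i\<in>UNIV. \<Sum>w\<in>A. \<eta> $ i * c w * dir_deriv (axis j (axis i 1)) (f w) X)"
    by (subst sum.swap) (simp add: sum_distrib_left mult_ac)
  finally show ?thesis .
qed

text \<open>Leads from the derivatives along one step, which iterated differences produce, to the
  coordinate derivatives of which the seminorm is made.\<close>

lemma foldr_dir_deriv_replicate_words:
  fixes u :: "real^'d^'n \<Rightarrow> real"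
  assumes "smooth_on S u" "open S" "X \<in> S"
  shows "foldr dir_deriv (replicate l (axis j \<eta>)) u X
    = (\<Sum>w\<in>words l. prod_list (map (($) \<eta>) w) * word_deriv j w u X)"
  using assms(3)
proof (induction l arbitrary: X)
  case 0
  then show ?case by (simp add: words_def word_deriv_def)
next
  case (Suc l)
  have "foldr dir_deriv (replicate (Suc l) (axis j \<eta>)) u X
      = dir_deriv (axis j \<eta>) (\<lambda>X. \<Sum>w\<in>words l. prod_list (map (($) \<eta>) w) * word_deriv j w u X) X"
    using dir_deriv_cong_on[OF assms(2) Suc.IH Suc.prems] by simp
  also have "\<dots> = (\<Sum>i\<in>UNIV. \<Sum>w\<in>words l. \<eta> $ i * prod_list (map (($) \<eta>) w) * dir_deriv (axis j (axis i 1)) (word_deriv j w u) X)"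
    using smooth_on_foldr_differentiable[OF assms(1,2) Suc.prems]
    by (intro dir_deriv_axis_sum) (auto simp: word_deriv_def)
  also have "\<dots> = (\<Sum>w\<in>words (Suc l). prod_list (map (($) \<eta>) w) * word_deriv j w u X)"
    by (simp add: sum_words_Suc word_deriv_Cons)
  finally show ?case .
qed

lemma prod_list_coords_le: "\<bar>prod_list (map (($) \<eta>) w)\<bar> \<le> norm \<eta> ^ length w"
  for \<eta> :: "real^'d"
proof (induction w)
  case (Cons i w)
  then show ?case
    using component_le_norm_cart[of \<eta> i] by (auto simp: abs_mult intro!: mult_mono)
qed simp

text \<open>A difference of two directional derivatives is controlled by the multi-index
  derivatives; with coefficient b = 0 the same bound covers a single derivative.\<close>
lemma word_sum_sq_le:
  fixes u :: "real^'d^'n \<Rightarrow> real"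
  assumes u: "smooth_on S u" "open S" and XY: "X \<in> S" "b \<noteq> 0 \<Longrightarrow> Y \<in> S"
  shows "(\<Sum>w\<in>words m. prod_list (map (($) \<eta>) w) * (word_deriv j w u X - b * word_deriv j w u Y))\<^sup>2
    \<le> (real (card (words m :: 'd list set)))\<^sup>2 * norm \<eta> ^ (2 * m) * (\<Sum>\<alpha>\<in>multi_indices m. mfact (\<alpha> :: 'd \<Rightarrow> nat))
      * (\<Sum>\<alpha>\<in>multi_indices m. (fact m / mfact \<alpha>) * (Dalpha j \<alpha> u X - b * Dalpha j \<alpha> u Y)\<^sup>2)"
proof -
  let ?W = "words m :: 'd list set" and ?I = "multi_indices m :: ('d \<Rightarrow> nat) set"
  define D where "D \<alpha> = Dalpha j \<alpha> u X - b * Dalpha j \<alpha> u Y" for \<alpha>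
  define T where "T = (\<Sum>\<alpha>\<in>?I. (fact m / mfact \<alpha>) * (D \<alpha>)\<^sup>2)"
  have fin: "finite ?I"
  proof (rule finite_subset)
    show "?I \<subseteq> Pi\<^sub>E UNIV (\<lambda>_. {..m})"
      unfolding multi_indices_def by (auto simp: member_le_sum)
  qed (auto intro: finite_PiE)
  have mf: "mfact \<alpha> > 0" for \<alpha> :: "'d \<Rightarrow> nat" by (simp add: mfact_def prod_pos)
  \<comment> \<open>Since \<open>fact m\<close> is at least 1, one term of the weighted sum controls
    a single derivative up to the factor \<open>mfact \<alpha>\<close>; adding up these factorials
    gives one constant for all \<alpha>.\<close>
  have each: "(D \<alpha>)\<^sup>2 \<le> sum mfact ?I * T" if "\<alpha> \<in> ?I" for \<alpha>
  proof -
    have "(fact m / mfact \<alpha>) * (D \<alpha>)\<^sup>2 \<le> T"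
      unfolding T_def using fin that mf by (intro member_le_sum) (auto intro!: mult_nonneg_nonneg divide_nonneg_pos)
    moreover have "(1 / mfact \<alpha>) * (D \<alpha>)\<^sup>2 \<le> (fact m / mfact \<alpha>) * (D \<alpha>)\<^sup>2"
      using mf[of \<alpha>] by (intro mult_right_mono divide_right_mono) (auto simp: fact_ge_1)
    ultimately have "(1 / mfact \<alpha>) * (D \<alpha>)\<^sup>2 \<le> T" by linarith
    then have "(D \<alpha>)\<^sup>2 \<le> mfact \<alpha> * T" using mf[of \<alpha>] by (simp add: field_simps)
    also have "\<dots> \<le> sum mfact ?I * T"
    proof (rule mult_right_mono)
      show "mfact \<alpha> \<le> sum mfact ?I"
        using that fin mf by (intro member_le_sum) (auto simp: less_imp_le)
      show "0 \<le> T" unfolding T_def using mf by (intro sum_nonneg mult_nonneg_nonneg divide_nonneg_pos) auto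
    qed
    finally show ?thesis .
  qed
  have wD: "word_deriv j w u X - b * word_deriv j w u Y = D (count (mset w))" for w :: "'d list"
    using word_deriv_conv_Dalpha[OF u XY(1), of j w] word_deriv_conv_Dalpha[OF u XY(2), of j w]
    by (cases "b = 0") (auto simp: D_def)
  have "(\<Sum>w\<in>?W. prod_list (map (($) \<eta>) w) * D (count (mset w)))\<^sup>2
      \<le> (\<Sum>w\<in>?W. (prod_list (map (($) \<eta>) w) * D (count (mset w)))\<^sup>2) * card ?W"
    by (rule sum_squared_le_sum_of_squares)
  also have "\<dots> \<le> (\<Sum>w\<in>?W. norm \<eta> ^ (2 * m) * (sum mfact ?I * T)) * card ?W"
  proof (intro mult_right_mono sum_mono)
    fix w :: "'d list" assume w: "w \<in> ?W"
    then have len: "length w = m" by (simp add: words_def)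
    have "(prod_list (map (($) \<eta>) w))\<^sup>2 \<le> (norm \<eta> ^ m)\<^sup>2"
      using prod_list_coords_le[of \<eta> w] len by (metis power_mono power2_abs abs_ge_zero)
    moreover have "(D (count (mset w)))\<^sup>2 \<le> sum mfact ?I * T"
      using each[of "count (mset w)"] count_mset_in_multi_indices[of w] len by simp
    ultimately show "(prod_list (map (($) \<eta>) w) * D (count (mset w)))\<^sup>2 \<le> norm \<eta> ^ (2 * m) * (sum mfact ?I * T)"
      by (simp add: power_mult_distrib power_mult[symmetric] mult.commute[of m] mult_mono)
  qed simp
  also have "\<dots> = (real (card ?W))\<^sup>2 * norm \<eta> ^ (2 * m) * sum mfact ?I * T"
    by (simp add: power2_eq_square)
  finally show ?thesis unfolding wD T_def D_def .
qed

section \<open>The seminorm bounds finite differences\<close>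

text \<open>The sign is chosen so that \<open>fd_coeff M 0 = -1\<close>. The terms from 1 to M then
  extrapolate the value at step 0, and \<open>fdiff\<close> is the extrapolated value minus the true
  one.\<close>

definition fd_coeff :: "nat \<Rightarrow> nat \<Rightarrow> real" where
  "fd_coeff M i = (-1) ^ Suc i * real (M choose i)"

definition fdiff :: "nat \<Rightarrow> 'n \<Rightarrow> real^'d \<Rightarrow> (real^'d^'n \<Rightarrow> real) \<Rightarrow> real^'d^'n \<Rightarrow> real" where
  "fdiff M j \<eta> u X = (\<Sum>i\<le>M. fd_coeff M i * u (X + real i *\<^sub>R axis j \<eta>))"

lemma fdiff_sq: "(fdiff M j \<eta> u X)\<^sup>2 = ((diff_op (axis j \<eta>) ^^ M) u X)\<^sup>2"
proof -
  have "fdiff M j \<eta> u X = - (\<Sum>i\<le>M. (-1) ^ i * real (M choose i) * u (X + real i *\<^sub>R axis j \<eta>))"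
    by (simp add: fdiff_def fd_coeff_def sum_negf)
  also have "\<dots> = - ((-1) ^ M * (diff_op (axis j \<eta>) ^^ M) u X)"
    by (simp only: alternating_choose_sum_diff_op)
  finally show ?thesis by (simp add: power_mult_distrib power_mult[symmetric] mult.commute[of M])
qed

text \<open>The form in which the seminorm enters wherever only differences matter; it is the same
  for integer and fractional order. The exponent r will be 2 s + d: 2 s is the order of smallness of
  the squared difference, and d corresponds to the volume of the ball of steps. No bound is claimed
  for an individual step.\<close>

definition difference_bound :: "(real^'d) set \<Rightarrow> nat \<Rightarrow> real \<Rightarrow> (real^'d^'n \<Rightarrow> real) \<Rightarrow> ennreal \<Rightarrow> bool" where
  "difference_bound \<Omega> M r u E \<longleftrightarrow> (\<forall>j \<rho>. \<rho> > 0 \<longrightarrow>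
    (\<integral>\<^sup>+\<eta>. indicator (ball 0 \<rho>) \<eta> *
      (\<integral>\<^sup>+X. indicator (segment_core (power_set \<Omega>) (axis j \<eta>) (real M)) X *
        ennreal ((fdiff M j \<eta> u X)\<^sup>2) \<partial>lborel) \<partial>lborel) \<le> ennreal (\<rho> powr r) * E)"

lemma open_power_set:
  fixes \<Omega> :: "(real^'d) set"
  assumes "open \<Omega>"
  shows "open (power_set \<Omega> :: (real^'d^'n) set)"
proof -
  have "power_set \<Omega> = (\<Inter>j. (\<lambda>X :: real^'d^'n. X $ j) -` \<Omega>)"
    by (auto simp: power_set_def)
  moreover have "open ((\<lambda>X :: real^'d^'n. X $ j) -` \<Omega>)" for j
    by (intro open_vimage assms continuous_intros)
  ultimately show ?thesis by (simp add: open_INT)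
qed

definition top_seminorm :: "nat \<Rightarrow> (real^'d) set \<Rightarrow> 'n \<Rightarrow> (real^'d^'n \<Rightarrow> real) \<Rightarrow> ennreal" where
  "top_seminorm m \<Omega> j u = (\<integral>\<^sup>+ X. indicator (power_set \<Omega>) X *
     ennreal (\<Sum>\<alpha>\<in>(multi_indices m :: ('d \<Rightarrow> nat) set).
        (fact m / mfact \<alpha>) * (Dalpha j \<alpha> u X)\<^sup>2) \<partial>lborel)"

text \<open>The exponent p will be d + 2 \<sigma>. The constant c of the seminorm is left out and
  divided off in the comparison with \<open>HsNsq\<close>.\<close>

definition frac_seminorm :: "nat \<Rightarrow> real \<Rightarrow> (real^'d) set \<Rightarrow> 'n \<Rightarrow> (real^'d^'n \<Rightarrow> real) \<Rightarrow> ennreal" where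
  "frac_seminorm m p \<Omega> j u = (\<integral>\<^sup>+ X. indicator (power_set \<Omega>) X *
     (\<integral>\<^sup>+ y. indicator \<Omega> y *
       ennreal (\<Sum>\<alpha>\<in>(multi_indices m :: ('d \<Rightarrow> nat) set).
         (fact m / mfact \<alpha>) * (Dalpha j \<alpha> u X - Dalpha j \<alpha> u (upd_pt X j y))\<^sup>2
         / norm (X $ j - y) powr p) \<partial>lborel) \<partial>lborel)"

lemma top_seminorm_le_HsNsq:
  fixes u :: "real^'d^'n \<Rightarrow> real"
  assumes "s = of_int \<lfloor>s\<rfloor>"
  shows "top_seminorm (nat \<lfloor>s\<rfloor>) \<Omega> j u \<le> HsNsq c s \<Omega> u"
proof -
  have "top_seminorm (nat \<lfloor>s\<rfloor>) \<Omega> j u \<le> (\<Sum>j\<in>UNIV. top_seminorm (nat \<lfloor>s\<rfloor>) \<Omega> j u)"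
    by (rule member_le_sum) auto
  also have "\<dots> = HsNsq c s \<Omega> u"
    using assms by (simp add: HsNsq_def Let_def top_seminorm_def)
  finally show ?thesis .
qed

lemma frac_seminorm_le_HsNsq:
  fixes u :: "real^'d^'n \<Rightarrow> real"
  assumes "s \<noteq> of_int \<lfloor>s\<rfloor>" "c > 0"
  shows "frac_seminorm (nat \<lfloor>s\<rfloor>) (real CARD('d) + 2 * (s - of_int \<lfloor>s\<rfloor>)) \<Omega> j u \<le> ennreal (1 / c) * HsNsq c s \<Omega> u"
proof -
  let ?F = "\<lambda>j. frac_seminorm (nat \<lfloor>s\<rfloor>) (real CARD('d) + 2 * (s - of_int \<lfloor>s\<rfloor>)) \<Omega> j u"
  have "ennreal c * ?F j \<le> (\<Sum>j\<in>UNIV. ennreal c * ?F j)"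
    by (rule member_le_sum) auto
  also have "\<dots> = HsNsq c s \<Omega> u"
    using assms by (simp add: HsNsq_def Let_def frac_seminorm_def)
  finally have "ennreal c * ?F j \<le> HsNsq c s \<Omega> u" .
  then have "ennreal (1 / c) * (ennreal c * ?F j) \<le> ennreal (1 / c) * HsNsq c s \<Omega> u"
    by (intro mult_left_mono) auto
  moreover have "ennreal (1 / c) * (ennreal c * ?F j) = ?F j"
    using assms(2) by (simp add: mult.assoc[symmetric] ennreal_mult[symmetric])
  ultimately show ?thesis by simp
qed

section \<open>Difference bound for integer order\<close>

lemma nn_integral_indicator_ball:
  assumes "\<rho> > 0"
  shows "(\<integral>\<^sup>+\<eta>. indicator (ball (0::'a::euclidean_space) \<rho>) \<eta> \<partial>lborel) = ennreal (\<rho> ^ DIM('a) * measure lborel (ball (0::'a) 1))"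
proof -
  have "(\<integral>\<^sup>+\<eta>. indicator (ball (0::'a) \<rho>) \<eta> \<partial>lborel) = ennreal (\<rho> ^ DIM('a)) * (\<integral>\<^sup>+\<eta>. indicator (ball (0::'a) \<rho>) (0 + \<rho> *\<^sub>R \<eta>) \<partial>lborel)"
    using assms by (intro nn_integral_lborel_scale borel_measurable_indicator borel_open open_ball)
  also have "(\<lambda>\<eta>::'a. indicator (ball (0::'a) \<rho>) (0 + \<rho> *\<^sub>R \<eta>)) = (\<lambda>\<eta>. indicator (ball (0::'a) 1) \<eta>)"
    using assms by (auto simp: indicator_def)
  also have "(\<integral>\<^sup>+\<eta>. indicator (ball (0::'a) 1) \<eta> \<partial>lborel) = ennreal (measure lborel (ball (0::'a) 1))"
  proof -
    have "emeasure lborel (ball (0::'a) 1) \<noteq> top"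
      using emeasure_lborel_ball_finite[of "0::'a" 1] by (simp add: less_top)
    then show ?thesis by (simp add: emeasure_eq_ennreal_measure)
  qed
  finally show ?thesis using assms by (simp add: ennreal_mult)
qed

lemma segment_core_end: "X \<in> segment_core U h 1 \<Longrightarrow> X \<in> U \<and> X + h \<in> U"
  unfolding segment_core_def by (auto dest: bspec[of _ _ 0] bspec[of _ _ 1])

lemma iterated_dir_deriv_chain:
  fixes u :: "'a::euclidean_space \<Rightarrow> real"
  assumes "smooth_on U u" "open U"
  shows "continuous_on U (foldr dir_deriv (replicate i h) u)"
    and "X \<in> U \<Longrightarrow> ((\<lambda>t. foldr dir_deriv (replicate i h) u (X + t *\<^sub>R h)) has_vector_derivative
      foldr dir_deriv (replicate (Suc i) h) u X) (at 0)"
proof -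
  show "continuous_on U (foldr dir_deriv (replicate i h) u)"
    by (rule smooth_on_foldr_continuous[OF assms(1)])
  assume "X \<in> U"
  then show "((\<lambda>t. foldr dir_deriv (replicate i h) u (X + t *\<^sub>R h)) has_vector_derivative
      foldr dir_deriv (replicate (Suc i) h) u X) (at 0)"
    using has_vector_derivative_dir_deriv[of "foldr dir_deriv (replicate i h) u" X 0 h UNIV]
      smooth_on_foldr_differentiable[OF assms, of X "replicate i h"] by simp
qed

text \<open>For a single step \<eta> the m-th difference is bounded through the m-th directional
  derivative, at the cost of norm \<eta> to the power 2 m. Integration over all steps shorter than
  \<rho> adds the volume, of exponent d.\<close>

lemma difference_bound_integer:
  fixes \<Omega> :: "(real^'d) set"
  assumes \<Omega>: "open \<Omega>"
  shows "\<exists>K\<ge>0. \<forall>(u :: real^'d^'n \<Rightarrow> real) E. smooth_on (power_set \<Omega>) u \<longrightarrow> (\<forall>j. top_seminorm m \<Omega> j u \<le> E) \<longrightarrow>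
    difference_bound \<Omega> m (2 * real m + real CARD('d)) u (ennreal K * E)"
proof -
  define C where "C = (real (card (words m :: 'd list set)))\<^sup>2 * (\<Sum>\<alpha>\<in>multi_indices m. mfact (\<alpha> :: 'd \<Rightarrow> nat))"
  have C0: "C \<ge> 0" unfolding C_def by (auto intro!: mult_nonneg_nonneg sum_nonneg prod_nonneg simp: mfact_def)
  define K where "K = C * measure lborel (ball (0::real^'d) 1)"
  have "difference_bound \<Omega> m (2 * real m + real CARD('d)) u (ennreal K * E)"
    if u: "smooth_on (power_set \<Omega>) u" and E: "\<forall>j. top_seminorm m \<Omega> j u \<le> E" for u :: "real^'d^'n \<Rightarrow> real" and E
    unfolding difference_bound_def
  proof (intro allI impI)
    fix j :: 'n and \<rho> :: real assume \<rho>: "\<rho> > 0"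
    let ?U = "power_set \<Omega> :: (real^'d^'n) set"
    have U: "open ?U" by (rule open_power_set[OF \<Omega>])
    have inner: "(\<integral>\<^sup>+X. indicator (segment_core ?U (axis j \<eta>) (real m)) X * ennreal ((fdiff m j \<eta> u X)\<^sup>2) \<partial>lborel)
        \<le> ennreal (C * \<rho> ^ (2 * m)) * E" if \<eta>: "\<eta> \<in> ball 0 \<rho>" for \<eta>
    proof -
      let ?F = "\<lambda>i. foldr dir_deriv (replicate i (axis j \<eta>)) u"
      let ?T = "\<lambda>X. \<Sum>\<alpha>\<in>(multi_indices m :: ('d \<Rightarrow> nat) set). (fact m / mfact \<alpha>) * (Dalpha j \<alpha> u X)\<^sup>2"
      have T0: "?T X \<ge> 0" for X by (intro sum_nonneg mult_nonneg_nonneg divide_nonneg_nonneg) (auto simp: mfact_def prod_nonneg)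
      have "(\<integral>\<^sup>+X. indicator (segment_core ?U (axis j \<eta>) (real m)) X * ennreal ((fdiff m j \<eta> u X)\<^sup>2) \<partial>lborel)
          \<le> (\<integral>\<^sup>+X. indicator ?U X * ennreal ((?F m X)\<^sup>2) \<partial>lborel)"
        unfolding fdiff_sq
        using diff_op_pow_le[where F = ?F and U = ?U and m = m and h = "axis j \<eta>"] iterated_dir_deriv_chain[OF u U, where h = "axis j \<eta>"] U
        by simp
      also have "\<dots> \<le> (\<integral>\<^sup>+X. ennreal (C * \<rho> ^ (2 * m)) * (indicator ?U X * ennreal (?T X)) \<partial>lborel)"
      proof (intro nn_integral_mono)
        fix X :: "real^'d^'n"
        show "indicator ?U X * ennreal ((?F m X)\<^sup>2) \<le> ennreal (C * \<rho> ^ (2 * m)) * (indicator ?U X * ennreal (?T X))"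
        proof (cases "X \<in> ?U")
          case True
          have "(?F m X)\<^sup>2 \<le> C * norm \<eta> ^ (2 * m) * ?T X"
            using word_sum_sq_le[OF u U True, where b = 0 and m = m and \<eta> = \<eta> and j = j]
            unfolding foldr_dir_deriv_replicate_words[OF u U True] by (simp add: C_def mult_ac)
          also have "\<dots> \<le> C * \<rho> ^ (2 * m) * ?T X"
            using \<eta> C0 T0 by (intro mult_right_mono mult_left_mono power_mono) auto
          finally show ?thesis using True C0 \<rho> T0 by (simp add: ennreal_mult[symmetric] ennreal_leI)
        qed simp
      qed
      also have "\<dots> = ennreal (C * \<rho> ^ (2 * m)) * top_seminorm m \<Omega> j u"
        unfolding top_seminorm_def
      proof (rule nn_integral_cmult)
        have "continuous_on ?U (Dalpha j \<alpha> u)" for \<alpha> :: "'d \<Rightarrow> nat"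
          unfolding Dalpha_conv_word_deriv word_deriv_def by (rule smooth_on_foldr_continuous[OF u])
        then have "(\<lambda>X. indicator ?U X *\<^sub>R ?T X) \<in> borel_measurable borel"
          using U by (intro borel_measurable_continuous_on_indicator continuous_intros) auto
        then have "(\<lambda>X. ennreal (indicator ?U X *\<^sub>R ?T X)) \<in> borel_measurable lborel" by simp
        also have "(\<lambda>X. ennreal (indicator ?U X *\<^sub>R ?T X)) = (\<lambda>X. indicator ?U X * ennreal (?T X))"
          by (auto simp: indicator_def)
        finally show "(\<lambda>X. indicator ?U X * ennreal (?T X)) \<in> borel_measurable lborel" .
      qed
      also have "\<dots> \<le> ennreal (C * \<rho> ^ (2 * m)) * E" using E by (intro mult_left_mono) auto
      finally show ?thesis .
    qed
    have "(\<integral>\<^sup>+\<eta>. indicator (ball 0 \<rho>) \<eta> *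
        (\<integral>\<^sup>+X. indicator (segment_core ?U (axis j \<eta>) (real m)) X * ennreal ((fdiff m j \<eta> u X)\<^sup>2) \<partial>lborel) \<partial>lborel)
      \<le> (\<integral>\<^sup>+\<eta>. (ennreal (C * \<rho> ^ (2 * m)) * E) * indicator (ball (0::real^'d) \<rho>) \<eta> \<partial>lborel)"
      using inner by (intro nn_integral_mono) (auto simp: indicator_def)
    also have "\<dots> = (ennreal (C * \<rho> ^ (2 * m)) * E) * ennreal (\<rho> ^ CARD('d) * measure lborel (ball (0::real^'d) 1))"
      using nn_integral_indicator_ball[OF \<rho>, where 'a = "real^'d"]
      by (subst nn_integral_cmult) (auto intro!: borel_measurable_indicator)
    also have "\<dots> = ennreal (C * \<rho> ^ (2 * m) * (\<rho> ^ CARD('d) * measure lborel (ball (0::real^'d) 1))) * E"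
      using C0 \<rho> by (subst ennreal_mult) (simp_all add: mult_ac)
    also have "C * \<rho> ^ (2 * m) * (\<rho> ^ CARD('d) * measure lborel (ball (0::real^'d) 1)) = \<rho> powr (2 * real m + real CARD('d)) * K"
      using \<rho> by (simp add: K_def powr_add powr_realpow[symmetric] mult_ac)
    also have "ennreal (\<rho> powr (2 * real m + real CARD('d)) * K) * E = ennreal (\<rho> powr (2 * real m + real CARD('d))) * (ennreal K * E)"
      using C0 by (subst ennreal_mult) (simp_all add: K_def mult_ac)
    finally show "(\<integral>\<^sup>+\<eta>. indicator (ball 0 \<rho>) \<eta> *
        (\<integral>\<^sup>+X. indicator (segment_core ?U (axis j \<eta>) (real m)) X * ennreal ((fdiff m j \<eta> u X)\<^sup>2) \<partial>lborel) \<partial>lborel)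
      \<le> ennreal (\<rho> powr (2 * real m + real CARD('d))) * (ennreal K * E)" .
  qed
  then show ?thesis using C0 by (intro exI[of _ K]) (auto simp: K_def)
qed

section \<open>Difference bound for fractional order\<close>

lemma borel_measurable_Dalpha_indicator:
  fixes u :: "real^'d^'n \<Rightarrow> real"
  assumes "smooth_on U u" "open U"
  shows "(\<lambda>X. indicator U X *\<^sub>R Dalpha j \<alpha> u X) \<in> borel_measurable borel"
proof (intro borel_measurable_continuous_on_indicator)
  show "continuous_on U (Dalpha j \<alpha> u)"
    unfolding Dalpha_conv_word_deriv word_deriv_def by (rule smooth_on_foldr_continuous[OF assms(1)])
qed (use assms in auto)

lemma upd_pt_in_power_set: "X \<in> power_set \<Omega> \<Longrightarrow> y \<in> \<Omega> \<Longrightarrow> upd_pt X j y \<in> power_set \<Omega>"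
  by (auto simp: power_set_def)

lemma frac_seminorm_integrand_measurable:
  fixes u :: "real^'d^'n \<Rightarrow> real"
  assumes u: "smooth_on (power_set \<Omega>) u" and \<Omega>: "open \<Omega>"
  shows "(\<lambda>(X, y). indicator (power_set \<Omega>) X * (indicator \<Omega> y *
       ennreal (\<Sum>\<alpha>\<in>(multi_indices m :: ('d \<Rightarrow> nat) set).
         (fact m / mfact \<alpha>) * (Dalpha j \<alpha> u X - Dalpha j \<alpha> u (upd_pt X j y))\<^sup>2
         / norm (X $ j - y) powr p))) \<in> borel_measurable borel"
proof -
  let ?U = "power_set \<Omega> :: (real^'d^'n) set"
  \<comment> \<open>Outside of \<open>power_set \<Omega>\<close> nothing is known about the
    derivatives, so they are extended by 0 to become Borel functions. The indicators hide the
    change, because replacing a slot by a point of \<Omega> does not lead out of the set.\<close>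
  define V where "V \<alpha> X = indicator ?U X *\<^sub>R Dalpha j \<alpha> u X" for \<alpha> :: "'d \<Rightarrow> nat" and X
  have V: "V \<alpha> \<in> borel_measurable borel" for \<alpha>
    unfolding V_def[abs_def] by (rule borel_measurable_Dalpha_indicator[OF u open_power_set[OF \<Omega>]])
  have V1[measurable]: "(\<lambda>p::(real^'d^'n)\<times>(real^'d). V \<alpha> (fst p)) \<in> borel_measurable borel" for \<alpha>
    by (intro borel_measurable_compose_continuous[OF V] continuous_intros)
  have V2[measurable]: "(\<lambda>p::(real^'d^'n)\<times>(real^'d). V \<alpha> (upd_pt (fst p) j (snd p))) \<in> borel_measurable borel" for \<alpha>
    by (intro borel_measurable_compose_continuous[OF V] continuous_intros)
  have N[measurable]: "(\<lambda>p::(real^'d^'n)\<times>(real^'d). norm (fst p $ j - snd p)) \<in> borel_measurable borel"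
    by (intro borel_measurable_continuous_onI continuous_intros)
  have I[measurable]: "(\<lambda>p::(real^'d^'n)\<times>(real^'d). indicator (?U \<times> \<Omega>) p :: ennreal) \<in> borel_measurable borel"
    by (intro borel_measurable_indicator borel_open open_Times open_power_set \<Omega>)
  have "(\<lambda>p. indicator (?U \<times> \<Omega>) p * ennreal (\<Sum>\<alpha>\<in>(multi_indices m :: ('d \<Rightarrow> nat) set).
         (fact m / mfact \<alpha>) * (V \<alpha> (fst p) - V \<alpha> (upd_pt (fst p) j (snd p)))\<^sup>2
         / norm (fst p $ j - snd p) powr p')) \<in> borel_measurable borel" for p'
    by measurable
  also have "(\<lambda>p. indicator (?U \<times> \<Omega>) p * ennreal (\<Sum>\<alpha>\<in>(multi_indices m :: ('d \<Rightarrow> nat) set).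
         (fact m / mfact \<alpha>) * (V \<alpha> (fst p) - V \<alpha> (upd_pt (fst p) j (snd p)))\<^sup>2
         / norm (fst p $ j - snd p) powr p')) = (\<lambda>(X, y). indicator (power_set \<Omega>) X * (indicator \<Omega> y *
       ennreal (\<Sum>\<alpha>\<in>(multi_indices m :: ('d \<Rightarrow> nat) set).
         (fact m / mfact \<alpha>) * (Dalpha j \<alpha> u X - Dalpha j \<alpha> u (upd_pt X j y))\<^sup>2
         / norm (X $ j - y) powr p')))" for p'
    by (auto simp: fun_eq_iff indicator_def V_def upd_pt_in_power_set)
  finally show ?thesis .
qed

text \<open>The second point is written as \<open>X $ j + \<eta>\<close>, so that the outer integral
  runs over steps, as it does in \<open>difference_bound\<close>.\<close>

lemma frac_seminorm_translated:
  fixes u :: "real^'d^'n \<Rightarrow> real"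
  assumes u: "smooth_on (power_set \<Omega>) u" and \<Omega>: "open \<Omega>"
  shows "frac_seminorm m p \<Omega> j u = (\<integral>\<^sup>+\<eta>. \<integral>\<^sup>+X. indicator (power_set \<Omega>) X * (indicator \<Omega> (X $ j + \<eta>) *
       ennreal (\<Sum>\<alpha>\<in>(multi_indices m :: ('d \<Rightarrow> nat) set).
         (fact m / mfact \<alpha>) * (Dalpha j \<alpha> u X - Dalpha j \<alpha> u (X + axis j \<eta>))\<^sup>2
         / norm \<eta> powr p)) \<partial>lborel \<partial>lborel)"
proof -
  define g where "g X y = indicator (power_set \<Omega>) X * (indicator \<Omega> y *
       ennreal (\<Sum>\<alpha>\<in>(multi_indices m :: ('d \<Rightarrow> nat) set).
         (fact m / mfact \<alpha>) * (Dalpha j \<alpha> u X - Dalpha j \<alpha> u (upd_pt X j y))\<^sup>2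
         / norm (X $ j - y) powr p))" for X y
  have g: "case_prod g \<in> borel_measurable borel"
    unfolding g_def[abs_def] by (rule frac_seminorm_integrand_measurable[OF assms])
  have m: "(\<lambda>p. g (f p) (h p)) \<in> borel_measurable borel"
    if "continuous_on UNIV f" "continuous_on UNIV h" for f h
    using borel_measurable_compose_continuous[OF g, of "\<lambda>p. (f p, h p)"] that
    by (simp add: continuous_on_Pair)
  have "frac_seminorm m p \<Omega> j u = (\<integral>\<^sup>+X. \<integral>\<^sup>+y. g X y \<partial>lborel \<partial>lborel)"
    unfolding frac_seminorm_def g_def
    by (intro nn_integral_cong) (auto simp: indicator_def)
  also have "\<dots> = (\<integral>\<^sup>+X. \<integral>\<^sup>+\<eta>. g X (X $ j + \<eta>) \<partial>lborel \<partial>lborel)"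
    by (intro nn_integral_cong nn_integral_lborel_translate[symmetric]) (auto intro!: m continuous_intros)
  also have "\<dots> = (\<integral>\<^sup>+\<eta>. \<integral>\<^sup>+X. g X (X $ j + \<eta>) \<partial>lborel \<partial>lborel)"
    by (rule nn_integral_lborel_swap) (auto simp: case_prod_unfold intro!: m continuous_intros)
  also have "\<dots> = (\<integral>\<^sup>+\<eta>. \<integral>\<^sup>+X. indicator (power_set \<Omega>) X * (indicator \<Omega> (X $ j + \<eta>) *
       ennreal (\<Sum>\<alpha>\<in>(multi_indices m :: ('d \<Rightarrow> nat) set).
         (fact m / mfact \<alpha>) * (Dalpha j \<alpha> u X - Dalpha j \<alpha> u (X + axis j \<eta>))\<^sup>2
         / norm \<eta> powr p)) \<partial>lborel \<partial>lborel)"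
    by (simp add: g_def upd_pt_eq)
  finally show ?thesis .
qed

text \<open>Of the m + 1 differences, m are spent on derivatives and give norm \<eta> to the power 2
  m; the last one is the increment inside the seminorm. The part d + 2 \<sigma> of the exponent
  comes from removing the kernel, not from the volume of the steps.\<close>

lemma difference_bound_fractional:
  fixes \<Omega> :: "(real^'d) set"
  assumes \<Omega>: "open \<Omega>" and \<sigma>: "\<sigma> > 0"
  shows "\<exists>K\<ge>0. \<forall>(u :: real^'d^'n \<Rightarrow> real) E. smooth_on (power_set \<Omega>) u \<longrightarrow>
    (\<forall>j. frac_seminorm m (real CARD('d) + 2 * \<sigma>) \<Omega> j u \<le> E) \<longrightarrow>
    difference_bound \<Omega> (Suc m) (2 * (real m + \<sigma>) + real CARD('d)) u (ennreal K * E)"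
proof -
  define C where "C = (real (card (words m :: 'd list set)))\<^sup>2 * (\<Sum>\<alpha>\<in>multi_indices m. mfact (\<alpha> :: 'd \<Rightarrow> nat))"
  have C0: "C \<ge> 0" unfolding C_def by (auto intro!: mult_nonneg_nonneg sum_nonneg prod_nonneg simp: mfact_def)
  let ?p = "real CARD('d) + 2 * \<sigma>"
  have "difference_bound \<Omega> (Suc m) (2 * (real m + \<sigma>) + real CARD('d)) u (ennreal C * E)"
    if u: "smooth_on (power_set \<Omega>) u" and E: "\<forall>j. frac_seminorm m ?p \<Omega> j u \<le> E" for u :: "real^'d^'n \<Rightarrow> real" and E
    unfolding difference_bound_def
  proof (intro allI impI)
    fix j :: 'n and \<rho> :: real assume \<rho>: "\<rho> > 0"
    let ?U = "power_set \<Omega> :: (real^'d^'n) set"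
    have U: "open ?U" by (rule open_power_set[OF \<Omega>])
    let ?T = "\<lambda>X Y. \<Sum>\<alpha>\<in>(multi_indices m :: ('d \<Rightarrow> nat) set). (fact m / mfact \<alpha>) * (Dalpha j \<alpha> u X - Dalpha j \<alpha> u Y)\<^sup>2"
    have T0: "?T X Y \<ge> 0" for X Y by (intro sum_nonneg mult_nonneg_nonneg divide_nonneg_nonneg) (auto simp: mfact_def prod_nonneg)
    let ?g = "\<lambda>\<eta> X. indicator ?U X * (indicator \<Omega> (X $ j + \<eta>) *
       ennreal (\<Sum>\<alpha>\<in>(multi_indices m :: ('d \<Rightarrow> nat) set).
         (fact m / mfact \<alpha>) * (Dalpha j \<alpha> u X - Dalpha j \<alpha> u (X + axis j \<eta>))\<^sup>2
         / norm \<eta> powr ?p))"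
    let ?A = "C * \<rho> powr (2 * (real m + \<sigma>) + real CARD('d))"
    have inner: "(\<integral>\<^sup>+X. indicator (segment_core ?U (axis j \<eta>) (real (Suc m))) X * ennreal ((fdiff (Suc m) j \<eta> u X)\<^sup>2) \<partial>lborel)
        \<le> (\<integral>\<^sup>+X. ennreal ?A * ?g \<eta> X \<partial>lborel)" if \<eta>: "\<eta> \<in> ball 0 \<rho>" for \<eta>
    proof -
      let ?F = "\<lambda>i. foldr dir_deriv (replicate i (axis j \<eta>)) u"
      have "(\<integral>\<^sup>+X. indicator (segment_core ?U (axis j \<eta>) (real (Suc m))) X * ennreal ((fdiff (Suc m) j \<eta> u X)\<^sup>2) \<partial>lborel)
          \<le> (\<integral>\<^sup>+X. indicator (segment_core ?U (axis j \<eta>) 1) X * ennreal ((diff_op (axis j \<eta>) (?F m) X)\<^sup>2) \<partial>lborel)"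
        unfolding fdiff_sq
        using diff_op_pow_Suc_le[where F = ?F and U = ?U and m = m and h = "axis j \<eta>"] iterated_dir_deriv_chain[OF u U, where h = "axis j \<eta>"] U
        by simp
      also have "\<dots> \<le> (\<integral>\<^sup>+X. ennreal ?A * ?g \<eta> X \<partial>lborel)"
      proof (intro nn_integral_mono)
        fix X :: "real^'d^'n"
        show "indicator (segment_core ?U (axis j \<eta>) 1) X * ennreal ((diff_op (axis j \<eta>) (?F m) X)\<^sup>2) \<le> ennreal ?A * ?g \<eta> X"
        proof (cases "X \<in> segment_core ?U (axis j \<eta>) 1")
          case True
          then have XU: "X \<in> ?U" "X + axis j \<eta> \<in> ?U" using segment_core_end by blast+
          then have "X $ j + \<eta> \<in> \<Omega>" by (auto simp: power_set_def axis_def dest: spec[of _ j])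
          have d: "(diff_op (axis j \<eta>) (?F m) X)\<^sup>2
              = (\<Sum>w\<in>words m. prod_list (map (($) \<eta>) w) * (word_deriv j w u X - 1 * word_deriv j w u (X + axis j \<eta>)))\<^sup>2"
            unfolding diff_op_def foldr_dir_deriv_replicate_words[OF u U XU(1)] foldr_dir_deriv_replicate_words[OF u U XU(2)]
            by (subst power2_commute) (simp add: sum_subtractf right_diff_distrib)
          have "(diff_op (axis j \<eta>) (?F m) X)\<^sup>2 \<le> C * norm \<eta> ^ (2 * m) * ?T X (X + axis j \<eta>)"
            unfolding d
            using word_sum_sq_le[OF u U XU, where b = 1 and m = m and \<eta> = \<eta> and j = j]
            by (simp add: C_def mult_ac)
          also have "\<dots> \<le> ?A * (?T X (X + axis j \<eta>) / norm \<eta> powr ?p)"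
          proof (cases "\<eta> = 0")
            case False
            have "norm \<eta> powr ?p \<le> \<rho> powr ?p" using \<eta> \<sigma> by (intro powr_mono2) auto
            moreover have "norm \<eta> ^ (2 * m) \<le> \<rho> ^ (2 * m)" using \<eta> by (intro power_mono) auto
            ultimately have "norm \<eta> ^ (2 * m) * norm \<eta> powr ?p \<le> \<rho> ^ (2 * m) * \<rho> powr ?p"
              using \<rho> by (intro mult_mono) auto
            also have "\<dots> = \<rho> powr (2 * (real m + \<sigma>) + real CARD('d))"
              using \<rho> by (simp add: powr_add[symmetric] powr_realpow[symmetric] algebra_simps)
            finally have "norm \<eta> ^ (2 * m) \<le> \<rho> powr (2 * (real m + \<sigma>) + real CARD('d)) / norm \<eta> powr ?p"
              using False by (simp add: field_simps)
            then have "C * norm \<eta> ^ (2 * m) * ?T X (X + axis j \<eta>)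
                \<le> C * (\<rho> powr (2 * (real m + \<sigma>) + real CARD('d)) / norm \<eta> powr ?p) * ?T X (X + axis j \<eta>)"
              using C0 T0 by (intro mult_right_mono mult_left_mono) auto
            then show ?thesis by (simp add: mult_ac)
          next
            case True
            \<comment> \<open>At \<eta> = 0 the quotient is 0 by convention; the other side vanishes
              as well, since both derivatives are taken at the same point.\<close>
            have axis0: "axis j 0 = (0 :: real^'d^'n)" by (simp add: axis_def vec_eq_iff)
            show ?thesis unfolding True axis0 by simp
          qed
          finally have "(diff_op (axis j \<eta>) (?F m) X)\<^sup>2 \<le> ?A * (?T X (X + axis j \<eta>) / norm \<eta> powr ?p)" .
          then have "ennreal ((diff_op (axis j \<eta>) (?F m) X)\<^sup>2) \<le> ennreal ?A * ennreal (?T X (X + axis j \<eta>) / norm \<eta> powr ?p)"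
            using C0 T0 by (subst ennreal_mult[symmetric]) (auto intro!: ennreal_leI)
          then show ?thesis using True XU \<open>X $ j + \<eta> \<in> \<Omega>\<close> by (simp add: sum_divide_distrib)
        qed simp
      qed
      finally show ?thesis .
    qed
    have mg: "(\<lambda>X. ?g \<eta> X) \<in> borel_measurable borel" for \<eta>
      using borel_measurable_compose_continuous[OF frac_seminorm_integrand_measurable[OF u \<Omega>, of m j ?p], of "\<lambda>X. (X, X $ j + \<eta>)"]
      by (simp add: upd_pt_eq continuous_intros)
    have mg2: "(\<lambda>\<eta>. \<integral>\<^sup>+X. ?g \<eta> X \<partial>lborel) \<in> borel_measurable borel"
    proof (rule nn_integral_lborel_snd_measurable)
      show "(\<lambda>(\<eta>, X). ?g \<eta> X) \<in> borel_measurable borel"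
        using borel_measurable_compose_continuous[OF frac_seminorm_integrand_measurable[OF u \<Omega>, of m j ?p], of "\<lambda>p. (snd p, snd p $ j + fst p)"]
        by (simp add: upd_pt_eq continuous_intros case_prod_unfold)
    qed
    have "(\<integral>\<^sup>+\<eta>. indicator (ball 0 \<rho>) \<eta> *
        (\<integral>\<^sup>+X. indicator (segment_core ?U (axis j \<eta>) (real (Suc m))) X * ennreal ((fdiff (Suc m) j \<eta> u X)\<^sup>2) \<partial>lborel) \<partial>lborel)
      \<le> (\<integral>\<^sup>+\<eta>. \<integral>\<^sup>+X. ennreal ?A * ?g \<eta> X \<partial>lborel \<partial>lborel)"
      using inner by (intro nn_integral_mono) (auto simp: indicator_def)
    also have "\<dots> = (\<integral>\<^sup>+\<eta>. ennreal ?A * (\<integral>\<^sup>+X. ?g \<eta> X \<partial>lborel) \<partial>lborel)"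
      using mg by (intro nn_integral_cong nn_integral_cmult) simp
    also have "\<dots> = ennreal ?A * (\<integral>\<^sup>+\<eta>. \<integral>\<^sup>+X. ?g \<eta> X \<partial>lborel \<partial>lborel)"
      using mg2 by (intro nn_integral_cmult) simp
    also have "(\<integral>\<^sup>+\<eta>. \<integral>\<^sup>+X. ?g \<eta> X \<partial>lborel \<partial>lborel) = frac_seminorm m ?p \<Omega> j u"
      by (rule frac_seminorm_translated[OF u \<Omega>, symmetric])
    also have "ennreal ?A * frac_seminorm m ?p \<Omega> j u \<le> ennreal ?A * E"
      using E by (intro mult_left_mono) auto
    also have "\<dots> = ennreal (\<rho> powr (2 * (real m + \<sigma>) + real CARD('d))) * (ennreal C * E)"
      using C0 by (subst ennreal_mult) (simp_all add: mult_ac)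
    finally show "(\<integral>\<^sup>+\<eta>. indicator (ball 0 \<rho>) \<eta> *
        (\<integral>\<^sup>+X. indicator (segment_core ?U (axis j \<eta>) (real (Suc m))) X * ennreal ((fdiff (Suc m) j \<eta> u X)\<^sup>2) \<partial>lborel) \<partial>lborel)
      \<le> ennreal (\<rho> powr (2 * (real m + \<sigma>) + real CARD('d))) * (ennreal C * E)" .
  qed
  then show ?thesis using C0 by (intro exI[of _ C]) auto
qed

section \<open>Propagating local control by finite differences\<close>

text \<open>A condition on all slots except j. The other slots may already have been restricted
  further, which is how one-slot control is applied after earlier slots have been treated.\<close>

definition slot_cylinder :: "'n \<Rightarrow> (real^'d) set \<Rightarrow> (real^'d^'n) set \<Rightarrow> bool" where
  "slot_cylinder j \<Omega> T \<longleftrightarrow> T \<in> sets borel \<and> (\<forall>X\<in>T. (\<forall>y. upd_pt X j y \<in> T) \<and> (\<forall>l. l \<noteq> j \<longrightarrow> X $ l \<in> \<Omega>))"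

definition slot_norm :: "'n \<Rightarrow> (real^'d^'n) set \<Rightarrow> (real^'d) set \<Rightarrow> (real^'d^'n \<Rightarrow> real) \<Rightarrow> ennreal" where
  "slot_norm j T K u = (\<integral>\<^sup>+X. indicator T X * (indicator K (X $ j) * ennreal ((u X)\<^sup>2)) \<partial>lborel)"

text \<open>\<open>B\<close> is the set on which u counts as known. The constant precedes u, E and
  T: uniformity in T is what allows the slots to be treated one after another.\<close>

definition controlled :: "(real^'d) set \<Rightarrow> nat \<Rightarrow> real \<Rightarrow> 'n::finite \<Rightarrow> (real^'d) set \<Rightarrow> (real^'d) set \<Rightarrow> bool" where
  "controlled \<Omega> M r j B K \<longleftrightarrow> K \<in> sets borel \<and> (\<exists>C\<ge>0. \<forall>(u :: real^'d^'n \<Rightarrow> real) E T.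
    u \<in> borel_measurable borel \<longrightarrow> difference_bound \<Omega> M r u E \<longrightarrow> slot_cylinder j \<Omega> T \<longrightarrow>
    slot_norm j T K u \<le> ennreal C * (slot_norm j T B u + E))"

lemma measurable_slot_indicator:
  fixes K :: "(real^'d) set"
  assumes "K \<in> sets borel"
  shows "(\<lambda>X :: real^'d^'n. indicator K (X $ j) :: ennreal) \<in> borel_measurable borel"
  using borel_measurable_compose_continuous[of "indicator K :: _ \<Rightarrow> ennreal" "\<lambda>X :: real^'d^'n. X $ j"] assms
  by (simp add: continuous_intros)

lemma measurable_slot_norm_integrand:
  fixes u :: "real^'d^'n \<Rightarrow> real"
  assumes "u \<in> borel_measurable borel" "T \<in> sets borel" "K \<in> sets borel"
  shows "(\<lambda>X. indicator T X * (indicator K (X $ j) * ennreal ((u X)\<^sup>2))) \<in> borel_measurable borel"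
  using assms measurable_slot_indicator[OF assms(3)] by measurable

lemma controlled_mono:
  assumes "controlled \<Omega> M r j B K" "K' \<subseteq> K" "K' \<in> sets borel"
  shows "controlled \<Omega> M r j B K'"
proof -
  have "slot_norm j T K' u \<le> slot_norm j T K u" for T u
    unfolding slot_norm_def using assms(2) by (intro nn_integral_mono) (auto simp: indicator_def)
  then show ?thesis using assms unfolding controlled_def by (meson order_trans)
qed

lemma controlled_empty: "controlled \<Omega> M r j B {}"
  unfolding controlled_def slot_norm_def by (auto intro!: exI[of _ 0])

lemma controlled_self: "B \<in> sets borel \<Longrightarrow> controlled \<Omega> M r j B B"
  unfolding controlled_def by (auto intro!: exI[of _ 1])

lemma controlled_Un:
  assumes "controlled \<Omega> M r j B K1" "controlled \<Omega> M r j B K2"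
  shows "controlled \<Omega> M r j B (K1 \<union> K2)"
proof -
  obtain C1 C2 where C: "C1 \<ge> 0" "C2 \<ge> 0"
    and c1: "\<And>(u :: real^'a^'b \<Rightarrow> real) E T. u \<in> borel_measurable borel \<Longrightarrow> difference_bound \<Omega> M r u E \<Longrightarrow> slot_cylinder j \<Omega> T \<Longrightarrow>
      slot_norm j T K1 u \<le> ennreal C1 * (slot_norm j T B u + E)"
    and c2: "\<And>(u :: real^'a^'b \<Rightarrow> real) E T. u \<in> borel_measurable borel \<Longrightarrow> difference_bound \<Omega> M r u E \<Longrightarrow> slot_cylinder j \<Omega> T \<Longrightarrow>
      slot_norm j T K2 u \<le> ennreal C2 * (slot_norm j T B u + E)"
    and K: "K1 \<in> sets borel" "K2 \<in> sets borel"
    using assms unfolding controlled_def by blast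
  have "slot_norm j T (K1 \<union> K2) u \<le> ennreal (C1 + C2) * (slot_norm j T B u + E)"
    if u: "u \<in> borel_measurable borel" "difference_bound \<Omega> M r u E" "slot_cylinder j \<Omega> T"
    for u :: "real^'a^'b \<Rightarrow> real" and E T
  proof -
    have T: "T \<in> sets borel" using u by (simp add: slot_cylinder_def)
    have "slot_norm j T (K1 \<union> K2) u \<le> (\<integral>\<^sup>+X. indicator T X * (indicator K1 (X $ j) * ennreal ((u X)\<^sup>2))
        + indicator T X * (indicator K2 (X $ j) * ennreal ((u X)\<^sup>2)) \<partial>lborel)"
      unfolding slot_norm_def by (intro nn_integral_mono) (auto simp: indicator_def)
    also have "\<dots> = slot_norm j T K1 u + slot_norm j T K2 u"
      unfolding slot_norm_def
      using measurable_slot_norm_integrand[OF u(1) T] K by (intro nn_integral_add) auto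
    also have "\<dots> \<le> ennreal C1 * (slot_norm j T B u + E) + ennreal C2 * (slot_norm j T B u + E)"
      using c1[OF u] c2[OF u] by (intro add_mono)
    also have "\<dots> = ennreal (C1 + C2) * (slot_norm j T B u + E)"
      using C by (simp add: distrib_right)
    finally show ?thesis .
  qed
  then show ?thesis using K C unfolding controlled_def
    by (intro conjI sets.Un exI[of _ "C1 + C2"]) auto
qed

lemma controlled_UN:
  assumes "finite I" "\<And>i. i \<in> I \<Longrightarrow> controlled \<Omega> M r j B (K i)"
  shows "controlled \<Omega> M r j B (\<Union>i\<in>I. K i)"
  using assms by (induction I) (auto intro: controlled_empty controlled_Un)

text \<open>The coefficient of \<open>u X\<close> in \<open>fdiff\<close> is -1, so
  \<open>u X\<close> is the extrapolated value minus the difference, and Cauchy-Schwarz does the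
  rest. The constant depends on neither the function nor the step.\<close>

lemma power2_le_fdiff:
  obtains D where "D \<ge> 0" "\<And>u :: real^'d^'n \<Rightarrow> real. \<And>X j \<eta>. (u X)\<^sup>2 \<le> D * ((\<Sum>i\<in>{1..M}. (u (X + real i *\<^sub>R axis j \<eta>))\<^sup>2) + (fdiff M j \<eta> u X)\<^sup>2)"
proof
  \<comment> \<open>The summand 1 gives \<open>A \<ge> 1\<close>, so that the same factor also
    covers the term with \<open>fdiff\<close>.\<close>
  define A where "A = (\<Sum>i\<in>{1..M}. (fd_coeff M i)\<^sup>2) + 1"
  define D where "D = 2 * (real M + 1) * A"
  have A: "A \<ge> 1" by (simp add: A_def sum_nonneg)
  show D0: "2 * (real M + 1) * A \<ge> 0" using A by simp
  fix u :: "real^'d^'n \<Rightarrow> real" and X j \<eta>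
  let ?v = "\<lambda>i. u (X + real i *\<^sub>R axis j \<eta>)"
  have "fdiff M j \<eta> u X = fd_coeff M 0 * ?v 0 + (\<Sum>i\<in>{1..M}. fd_coeff M i * ?v i)"
    unfolding fdiff_def by (simp add: atMost_atLeast0 sum.atLeast_Suc_atMost)
  then have "u X = (\<Sum>i\<in>{1..M}. fd_coeff M i * ?v i) - fdiff M j \<eta> u X"
    by (simp add: fd_coeff_def)
  then have "(u X)\<^sup>2 \<le> 2 * (\<Sum>i\<in>{1..M}. fd_coeff M i * ?v i)\<^sup>2 + 2 * (fdiff M j \<eta> u X)\<^sup>2"
    using zero_le_power2[of "(\<Sum>i\<in>{1..M}. fd_coeff M i * ?v i) + fdiff M j \<eta> u X"]
    by (simp add: power2_sum power2_diff)
  also have "(\<Sum>i\<in>{1..M}. fd_coeff M i * ?v i)\<^sup>2 \<le> (\<Sum>i\<in>{1..M}. (fd_coeff M i * ?v i)\<^sup>2) * card {1..M}"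
    by (rule sum_squared_le_sum_of_squares)
  also have "\<dots> \<le> (\<Sum>i\<in>{1..M}. A * (?v i)\<^sup>2) * card {1..M}"
  proof (intro mult_right_mono sum_mono)
    fix i assume i: "i \<in> {1..M}"
    have "(fd_coeff M i)\<^sup>2 \<le> (\<Sum>i\<in>{1..M}. (fd_coeff M i)\<^sup>2)"
      using i by (intro member_le_sum) auto
    then show "(fd_coeff M i * ?v i)\<^sup>2 \<le> A * (?v i)\<^sup>2"
      unfolding power_mult_distrib A_def by (intro mult_right_mono) auto
  qed simp
  also have "\<dots> \<le> ((real M + 1) * A) * (\<Sum>i\<in>{1..M}. (?v i)\<^sup>2)"
    using A by (simp add: sum_distrib_left[symmetric] sum_nonneg algebra_simps)
  finally have "(u X)\<^sup>2 \<le> 2 * (((real M + 1) * A) * (\<Sum>i\<in>{1..M}. (?v i)\<^sup>2)) + 2 * (fdiff M j \<eta> u X)\<^sup>2" by simp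
  moreover have "1 * (fdiff M j \<eta> u X)\<^sup>2 \<le> ((real M + 1) * A) * (fdiff M j \<eta> u X)\<^sup>2"
    using A mult_mono[of 1 "real M + 1" 1 A] by (intro mult_right_mono) auto
  ultimately show "(u X)\<^sup>2 \<le> 2 * (real M + 1) * A * ((\<Sum>i\<in>{1..M}. (?v i)\<^sup>2) + (fdiff M j \<eta> u X)\<^sup>2)"
    by (simp add: algebra_simps)
qed

lemma slot_cylinder_axis:
  assumes "slot_cylinder j \<Omega> T"
  shows "X + axis j h \<in> T \<longleftrightarrow> X \<in> T"
proof -
  have *: "Y + axis j h \<in> T" if "Y \<in> T" for Y h
  proof -
    have "upd_pt Y j (Y $ j + h) \<in> T" using assms that by (simp add: slot_cylinder_def)
    then show ?thesis by (simp add: upd_pt_eq)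
  qed
  have "X + axis j h + axis j (- h) = X" by (simp add: vec_eq_iff axis_def)
  then show ?thesis using *[of "X + axis j h" "- h"] *[of X h] by metis
qed


text \<open>One extrapolation step: the value at x is recovered from the points x + i h, which lie
  in sets already controlled. Since differences are bounded only on average over h, a whole ball of
  admissible steps is required, and the estimate is averaged over it.\<close>

lemma controlled_step:
  fixes j :: "'n::finite" and K :: "(real^'d) set"
  assumes K: "K \<in> sets borel" and K1: "\<And>i. i \<in> {1..M} \<Longrightarrow> controlled \<Omega> M r j B (K1 i)"
    and \<epsilon>: "\<epsilon> > 0"
    and step: "\<And>x h i. x \<in> K \<Longrightarrow> h \<in> ball h0 \<epsilon> \<Longrightarrow> i \<in> {1..M} \<Longrightarrow> x + real i *\<^sub>R h \<in> K1 i"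
    and seg: "\<And>x h t. x \<in> K \<Longrightarrow> h \<in> ball h0 \<epsilon> \<Longrightarrow> t \<in> {0..real M} \<Longrightarrow> x + t *\<^sub>R h \<in> \<Omega>"
  shows "controlled \<Omega> M r j B K"
proof -
  obtain C where C: "\<And>i. i \<in> {1..M} \<Longrightarrow> C i \<ge> 0"
    and c: "\<And>i (u :: real^'d^'n \<Rightarrow> real) E T. i \<in> {1..M} \<Longrightarrow> u \<in> borel_measurable borel \<Longrightarrow> difference_bound \<Omega> M r u E \<Longrightarrow> slot_cylinder j \<Omega> T \<Longrightarrow>
      slot_norm j T (K1 i) u \<le> ennreal (C i) * (slot_norm j T B u + E)"
    using K1 unfolding controlled_def by metis
  have K1m: "K1 i \<in> sets borel" if "i \<in> {1..M}" for i using K1[OF that] by (simp add: controlled_def)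
  obtain D where D0: "D \<ge> 0" and D: "\<And>u :: real^'d^'n \<Rightarrow> real. \<And>X j \<eta>. (u X)\<^sup>2 \<le> D * ((\<Sum>i\<in>{1..M}. (u (X + real i *\<^sub>R axis j \<eta>))\<^sup>2) + (fdiff M j \<eta> u X)\<^sup>2)"
    using power2_le_fdiff[where M = M and 'd = 'd and 'n = 'n] by metis
  let ?H = "ball h0 \<epsilon>"
  \<comment> \<open>\<open>difference_bound\<close> speaks of balls of steps centred at 0; this
    radius is large enough to contain all steps near h0.\<close>
  define \<rho> where "\<rho> = norm h0 + \<epsilon>"
  have \<rho>: "\<rho> > 0" using \<epsilon> by (smt (verit) \<rho>_def norm_ge_zero)
  have H\<rho>: "?H \<subseteq> ball 0 \<rho>"
  proof
    fix h assume "h \<in> ?H"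
    then have "norm (h - h0) < \<epsilon>" by (simp add: dist_norm norm_minus_commute)
    then show "h \<in> ball 0 \<rho>" using norm_triangle_ineq[of "h - h0" h0] by (simp add: \<rho>_def)
  qed
  define V where "V = measure lborel ?H"
  have V: "emeasure lborel ?H = ennreal V"
  proof -
    have "emeasure lborel ?H \<noteq> top" using emeasure_lborel_ball_finite[of h0 \<epsilon>] by (simp add: less_top)
    then show ?thesis by (simp add: V_def emeasure_eq_ennreal_measure)
  qed
  have V0: "V > 0" unfolding V_def using \<epsilon> by (rule content_ball_pos)
  define C' where "C' = D * ((\<Sum>i\<in>{1..M}. C i) + \<rho> powr r / V)"
  have C'0: "C' \<ge> 0" unfolding C'_def using C D0 V0 by (intro mult_nonneg_nonneg add_nonneg_nonneg sum_nonneg) auto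
  have "slot_norm j T K u \<le> ennreal C' * (slot_norm j T B u + E)"
    if u: "u \<in> borel_measurable borel" "difference_bound \<Omega> M r u E" "slot_cylinder j \<Omega> T"
    for u :: "real^'d^'n \<Rightarrow> real" and E T
  proof -
    have T: "T \<in> sets borel" using u(3) by (simp add: slot_cylinder_def)
    let ?S = "slot_norm j T B u + E"
    define q where "q i X = indicator T X * (indicator (K1 i) (X $ j) * ennreal ((u X)\<^sup>2))" for i X
    define g where "g h X = indicator T X * (indicator K (X $ j) * ennreal ((fdiff M j h u X)\<^sup>2))" for h X
    have mq: "q i \<in> borel_measurable borel" if "i \<in> {1..M}" for i
      unfolding q_def[abs_def] by (rule measurable_slot_norm_integrand[OF u(1) T K1m[OF that]])
    have mu: "(\<lambda>p. u (snd p + real i *\<^sub>R axis j (fst p))) \<in> borel_measurable (borel :: ((real^'d) \<times> (real^'d^'n)) measure)" for i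
      by (intro borel_measurable_compose_continuous[OF u(1)] continuous_intros)
    have mg: "case_prod g \<in> borel_measurable borel"
    proof -
      have 1: "(\<lambda>p :: (real^'d) \<times> (real^'d^'n). indicator T (snd p) :: ennreal) \<in> borel_measurable borel"
        using borel_measurable_compose_continuous[of "indicator T :: _ \<Rightarrow> ennreal" "snd :: (real^'d) \<times> (real^'d^'n) \<Rightarrow> _"] T
        by (simp add: continuous_intros)
      have 2: "(\<lambda>p :: (real^'d) \<times> (real^'d^'n). indicator K (snd p $ j) :: ennreal) \<in> borel_measurable borel"
        using borel_measurable_compose_continuous[of "indicator K :: _ \<Rightarrow> ennreal" "\<lambda>p :: (real^'d) \<times> (real^'d^'n). snd p $ j"] K
        by (simp add: continuous_intros)
      show ?thesis using 1 2 mu unfolding g_def[abs_def] fdiff_def case_prod_unfold by measurable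
    qed
    have mg1: "g h \<in> borel_measurable borel" for h
      using borel_measurable_compose_continuous[OF mg, of "\<lambda>X. (h, X)"] by (simp add: continuous_intros)
    have mg2: "(\<lambda>h. \<integral>\<^sup>+X. g h X \<partial>lborel) \<in> borel_measurable borel"
      by (rule nn_integral_lborel_snd_measurable[OF mg])
    have fixed_h: "slot_norm j T K u \<le> ennreal D * ((\<Sum>i\<in>{1..M}. ennreal (C i) * ?S) + (\<integral>\<^sup>+X. g h X \<partial>lborel))"
      if h: "h \<in> ?H" for h
    proof -
      have mqt: "(\<lambda>X. q i (real i *\<^sub>R axis j h + X)) \<in> borel_measurable borel" if "i \<in> {1..M}" for i
        by (intro borel_measurable_compose_continuous[OF mq[OF that]] continuous_intros)
      have "slot_norm j T K u \<le> (\<integral>\<^sup>+X. ennreal D * ((\<Sum>i\<in>{1..M}. q i (real i *\<^sub>R axis j h + X)) + g h X) \<partial>lborel)"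
        unfolding slot_norm_def
      proof (intro nn_integral_mono)
        fix X
        show "indicator T X * (indicator K (X $ j) * ennreal ((u X)\<^sup>2)) \<le> ennreal D * ((\<Sum>i\<in>{1..M}. q i (real i *\<^sub>R axis j h + X)) + g h X)"
        proof (cases "X \<in> T \<and> X $ j \<in> K")
          case True
          have "q i (real i *\<^sub>R axis j h + X) = ennreal ((u (X + real i *\<^sub>R axis j h))\<^sup>2)" if i: "i \<in> {1..M}" for i
          proof -
            have e: "real i *\<^sub>R axis j h + X = X + axis j (real i *\<^sub>R h)"
              by (simp add: vec_eq_iff axis_def)
            have "X + axis j (real i *\<^sub>R h) \<in> T" using slot_cylinder_axis[OF u(3)] True by blast
            moreover have "(X + axis j (real i *\<^sub>R h)) $ j \<in> K1 i"
              using step[of "X $ j" h i] True h i by (simp add: axis_def)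
            ultimately have "q i (X + axis j (real i *\<^sub>R h)) = ennreal ((u (X + axis j (real i *\<^sub>R h)))\<^sup>2)"
              by (simp add: q_def)
            then show ?thesis using e by (metis add.commute)
          qed
          then have "(\<Sum>i\<in>{1..M}. q i (real i *\<^sub>R axis j h + X)) + g h X
              = ennreal ((\<Sum>i\<in>{1..M}. (u (X + real i *\<^sub>R axis j h))\<^sup>2) + (fdiff M j h u X)\<^sup>2)"
            using True by (simp add: g_def sum_ennreal sum_nonneg)
          moreover have "ennreal ((u X)\<^sup>2) \<le> ennreal D * ennreal ((\<Sum>i\<in>{1..M}. (u (X + real i *\<^sub>R axis j h))\<^sup>2) + (fdiff M j h u X)\<^sup>2)"
            using D[of u X j h] D0 by (subst ennreal_mult[symmetric]) (auto intro!: ennreal_leI add_nonneg_nonneg sum_nonneg)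
          ultimately show ?thesis using True by simp
        qed (auto simp: indicator_def)
      qed
      also have "\<dots> = ennreal D * (\<integral>\<^sup>+X. (\<Sum>i\<in>{1..M}. q i (real i *\<^sub>R axis j h + X)) + g h X \<partial>lborel)"
        using mqt mg1 by (intro nn_integral_cmult) (auto intro!: borel_measurable_sum)
      also have "(\<integral>\<^sup>+X. (\<Sum>i\<in>{1..M}. q i (real i *\<^sub>R axis j h + X)) + g h X \<partial>lborel)
          = (\<integral>\<^sup>+X. (\<Sum>i\<in>{1..M}. q i (real i *\<^sub>R axis j h + X)) \<partial>lborel) + (\<integral>\<^sup>+X. g h X \<partial>lborel)"
        using mqt mg1 by (intro nn_integral_add) (auto intro!: borel_measurable_sum)
      also have "(\<integral>\<^sup>+X. (\<Sum>i\<in>{1..M}. q i (real i *\<^sub>R axis j h + X)) \<partial>lborel) = (\<Sum>i\<in>{1..M}. \<integral>\<^sup>+X. q i (real i *\<^sub>R axis j h + X) \<partial>lborel)"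
        using mqt by (intro nn_integral_sum) auto
      also have "\<dots> = (\<Sum>i\<in>{1..M}. slot_norm j T (K1 i) u)"
        unfolding slot_norm_def q_def[symmetric]
        by (intro sum.cong refl nn_integral_lborel_translate mq)
      also have "\<dots> \<le> (\<Sum>i\<in>{1..M}. ennreal (C i) * ?S)"
        using c[OF _ u] by (intro sum_mono) auto
      finally show ?thesis by (simp add: add_mono mult_left_mono)
    qed
    \<comment> \<open>The norm to be bounded does not depend on h, so integration over the ball of
      steps multiplies it by V.\<close>
    have "slot_norm j T K u * ennreal V = (\<integral>\<^sup>+h. slot_norm j T K u * indicator ?H h \<partial>lborel)"
      by (simp add: V nn_integral_cmult_indicator)
    also have "\<dots> \<le> (\<integral>\<^sup>+h. ennreal D * ((\<Sum>i\<in>{1..M}. ennreal (C i) * ?S) * indicator ?H h + indicator ?H h * (\<integral>\<^sup>+X. g h X \<partial>lborel)) \<partial>lborel)"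
      using fixed_h by (intro nn_integral_mono) (auto simp: indicator_def)
    also have "\<dots> = ennreal D * ((\<integral>\<^sup>+h. (\<Sum>i\<in>{1..M}. ennreal (C i) * ?S) * indicator ?H h \<partial>lborel) + (\<integral>\<^sup>+h. indicator ?H h * (\<integral>\<^sup>+X. g h X \<partial>lborel) \<partial>lborel))"
    proof -
      have m3: "(\<lambda>h. indicator ?H h * (\<integral>\<^sup>+X. g h X \<partial>lborel)) \<in> borel_measurable lborel"
        using mg2 by (intro borel_measurable_times_ennreal borel_measurable_indicator) auto
      have m4: "(\<lambda>h. (\<Sum>i\<in>{1..M}. ennreal (C i) * ?S) * indicator ?H h) \<in> borel_measurable lborel"
        by (intro borel_measurable_times_ennreal borel_measurable_indicator borel_measurable_const) auto
      show ?thesis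
        by (subst nn_integral_cmult[OF borel_measurable_add[OF m4 m3]], subst nn_integral_add[OF m4 m3]) simp
    qed
    also have "(\<integral>\<^sup>+h. (\<Sum>i\<in>{1..M}. ennreal (C i) * ?S) * indicator ?H h \<partial>lborel) = (\<Sum>i\<in>{1..M}. ennreal (C i) * ?S) * ennreal V"
      by (simp add: V nn_integral_cmult_indicator)
    also have "(\<Sum>i\<in>{1..M}. ennreal (C i) * ?S) = ennreal (\<Sum>i\<in>{1..M}. C i) * ?S"
      using C by (subst sum_distrib_right[symmetric], subst sum_ennreal) auto
    also have "(\<integral>\<^sup>+h. indicator ?H h * (\<integral>\<^sup>+X. g h X \<partial>lborel) \<partial>lborel) \<le> ennreal (\<rho> powr r) * E"
    proof -
      have "(\<integral>\<^sup>+h. indicator ?H h * (\<integral>\<^sup>+X. g h X \<partial>lborel) \<partial>lborel) \<le> (\<integral>\<^sup>+h. indicator (ball 0 \<rho>) h *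
          (\<integral>\<^sup>+X. indicator (segment_core (power_set \<Omega>) (axis j h) (real M)) X * ennreal ((fdiff M j h u X)\<^sup>2) \<partial>lborel) \<partial>lborel)"
      proof (intro nn_integral_mono)
        fix h
        show "indicator ?H h * (\<integral>\<^sup>+X. g h X \<partial>lborel) \<le> indicator (ball 0 \<rho>) h *
          (\<integral>\<^sup>+X. indicator (segment_core (power_set \<Omega>) (axis j h) (real M)) X * ennreal ((fdiff M j h u X)\<^sup>2) \<partial>lborel)"
        proof (cases "h \<in> ?H")
          case True
          have "g h X \<le> indicator (segment_core (power_set \<Omega>) (axis j h) (real M)) X * ennreal ((fdiff M j h u X)\<^sup>2)" for X
          proof (cases "X \<in> T \<and> X $ j \<in> K")
            case XT: True
            have "X \<in> segment_core (power_set \<Omega>) (axis j h) (real M)"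
              unfolding segment_core_def power_set_def
            proof (clarify)
              fix t l assume t: "t \<in> {0..real M}"
              show "(X + t *\<^sub>R axis j h) $ l \<in> \<Omega>"
                using seg[of "X $ j" h t] XT True t u(3) by (cases "l = j") (auto simp: axis_def slot_cylinder_def)
            qed
            then show ?thesis by (simp add: g_def indicator_def)
          qed (auto simp: g_def indicator_def)
          then show ?thesis using True H\<rho> by (auto simp: indicator_def intro!: nn_integral_mono)
        qed simp
      qed
      also have "\<dots> \<le> ennreal (\<rho> powr r) * E"
        using u(2) \<rho> by (simp add: difference_bound_def)
      finally show ?thesis .
    qed
    finally have "slot_norm j T K u * ennreal V \<le> ennreal D * (ennreal (\<Sum>i\<in>{1..M}. C i) * ?S * ennreal V + ennreal (\<rho> powr r) * E)"
      by (simp add: add_left_mono mult_left_mono)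
    also have "\<dots> \<le> ennreal D * (ennreal (\<Sum>i\<in>{1..M}. C i) * ?S * ennreal V + ennreal (\<rho> powr r) * ?S)"
      by (intro mult_left_mono add_left_mono) (auto simp: add_increasing)
    also have "\<dots> = (ennreal C' * ?S) * ennreal V"
    proof -
      have "C' * V = D * ((\<Sum>i\<in>{1..M}. C i) * V + \<rho> powr r)"
        using V0 by (simp add: C'_def field_simps)
      moreover have "(\<Sum>i\<in>{1..M}. C i) \<ge> 0" using C by (intro sum_nonneg) auto
      ultimately have ce: "ennreal C' * ennreal V = ennreal D * (ennreal (\<Sum>i\<in>{1..M}. C i) * ennreal V + ennreal (\<rho> powr r))"
        using C'0 V0 D0 by (simp add: ennreal_mult[symmetric] ennreal_plus[symmetric] del: ennreal_plus)
      have "ennreal C' * ?S * ennreal V = (ennreal C' * ennreal V) * ?S"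
        by (simp only: mult_ac)
      also have "\<dots> = ennreal D * (ennreal (\<Sum>i\<in>{1..M}. C i) * ennreal V + ennreal (\<rho> powr r)) * ?S"
        by (simp only: ce)
      also have "\<dots> = ennreal D * ((ennreal (\<Sum>i\<in>{1..M}. C i) * ennreal V + ennreal (\<rho> powr r)) * ?S)"
        by (simp only: mult.assoc)
      also have "(ennreal (\<Sum>i\<in>{1..M}. C i) * ennreal V + ennreal (\<rho> powr r)) * ?S
          = ennreal (\<Sum>i\<in>{1..M}. C i) * ?S * ennreal V + ennreal (\<rho> powr r) * ?S"
        by (subst distrib_right) (simp only: mult_ac)
      finally show ?thesis by (rule sym)
    qed
    finally have le: "slot_norm j T K u * ennreal V \<le> (ennreal C' * ?S) * ennreal V" .
    have "slot_norm j T K u = slot_norm j T K u * ennreal V * ennreal (1 / V)"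
      using V0 by (simp add: mult.assoc ennreal_mult[symmetric])
    also have "\<dots> \<le> (ennreal C' * ?S) * ennreal V * ennreal (1 / V)"
      using le by (rule mult_right_mono) simp
    also have "\<dots> = ennreal C' * ?S"
      using V0 by (simp add: mult.assoc ennreal_mult[symmetric])
    finally show ?thesis .
  qed
  then show ?thesis using K C'0 unfolding controlled_def by blast
qed

section \<open>Propagation of control through the domain and to its boundary\<close>

definition good_point :: "(real^'d) set \<Rightarrow> nat \<Rightarrow> real \<Rightarrow> 'n::finite \<Rightarrow> (real^'d) set \<Rightarrow> real^'d \<Rightarrow> bool" where
  "good_point \<Omega> M r j B p \<longleftrightarrow> (\<exists>\<delta>>0. controlled \<Omega> M r j B (ball p \<delta> \<inter> \<Omega>))"

text \<open>The points \<open>p + real i *\<^sub>R h0\<close> are good with certain radii; shrinking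
  the neighbourhoods of p and of h0 brings all extrapolation points into those balls. The point p
  may lie on the boundary, since only points of \<Omega> near p are moved.\<close>

lemma good_point_step:
  assumes \<Omega>: "open \<Omega>" and M: "M \<ge> 1" and \<delta>: "\<delta> > 0"
    and cone: "\<And>x h t. x \<in> ball p \<delta> \<inter> \<Omega> \<Longrightarrow> h \<in> ball h0 \<delta> \<Longrightarrow> t \<in> {0..real M} \<Longrightarrow> x + t *\<^sub>R h \<in> \<Omega>"
    and good: "\<And>i. i \<in> {1..M} \<Longrightarrow> good_point \<Omega> M r j B (p + real i *\<^sub>R h0)"
  shows "good_point \<Omega> M r j B p"
proof -
  obtain d where d: "\<And>i. i \<in> {1..M} \<Longrightarrow> d i > 0"
    and dc: "\<And>i. i \<in> {1..M} \<Longrightarrow> controlled \<Omega> M r j B (ball (p + real i *\<^sub>R h0) (d i) \<inter> \<Omega>)"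
    using good unfolding good_point_def by metis
  define \<delta>1 where "\<delta>1 = Min (d ` {1..M})"
  have \<delta>1: "\<delta>1 > 0" "\<And>i. i \<in> {1..M} \<Longrightarrow> \<delta>1 \<le> d i"
    using d M by (auto simp: \<delta>1_def Min_gr_iff)
  \<comment> \<open>A point and a step that are each off by less than \<open>\<delta>2\<close>
    displace the i-th extrapolation point by less than
    \<open>\<delta>2 * (1 + real M)\<close>.\<close>
  define \<delta>2 where "\<delta>2 = min \<delta> (\<delta>1 / (1 + real M))"
  have \<delta>2: "\<delta>2 > 0" "\<delta>2 \<le> \<delta>" "\<delta>2 * (1 + real M) \<le> \<delta>1"
    using \<delta> \<delta>1 pos_le_divide_eq[of "1 + real M" \<delta>2 \<delta>1] by (auto simp: \<delta>2_def)
  have "controlled \<Omega> M r j B (ball p \<delta>2 \<inter> \<Omega>)"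
  proof (rule controlled_step[where \<epsilon> = \<delta>2 and ?h0.0 = h0 and ?K1.0 = "\<lambda>i. ball (p + real i *\<^sub>R h0) (d i) \<inter> \<Omega>"])
    show "ball p \<delta>2 \<inter> \<Omega> \<in> sets borel" using \<Omega> by simp
    show "x + t *\<^sub>R h \<in> \<Omega>" if "x \<in> ball p \<delta>2 \<inter> \<Omega>" "h \<in> ball h0 \<delta>2" "t \<in> {0..real M}" for x h t
      using that \<delta>2(2) by (intro cone) auto
    show "x + real i *\<^sub>R h \<in> ball (p + real i *\<^sub>R h0) (d i) \<inter> \<Omega>"
      if "x \<in> ball p \<delta>2 \<inter> \<Omega>" "h \<in> ball h0 \<delta>2" "i \<in> {1..M}" for x h i
    proof -
      have "x + real i *\<^sub>R h \<in> \<Omega>" using that \<delta>2(2) by (intro cone) auto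
      moreover have "dist (p + real i *\<^sub>R h0) (x + real i *\<^sub>R h) < d i"
      proof -
        have "(p + real i *\<^sub>R h0) - (x + real i *\<^sub>R h) = (p - x) + real i *\<^sub>R (h0 - h)" by (simp add: algebra_simps)
        then have "dist (p + real i *\<^sub>R h0) (x + real i *\<^sub>R h) \<le> dist p x + real i * dist h0 h"
          unfolding dist_norm by (metis norm_triangle_ineq norm_scaleR abs_of_nat)
        also have "\<dots> < \<delta>2 + real M * \<delta>2"
          using that by (intro add_less_le_mono mult_mono) auto
        also have "\<dots> \<le> d i" using \<delta>2(3) \<delta>1(2)[OF that(3)] by (simp add: algebra_simps)
        finally show ?thesis .
      qed
      ultimately show ?thesis by simp
    qed
  qed (use dc \<delta>2 in auto)
  then show ?thesis using \<delta>2 by (auto simp: good_point_def)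
qed

text \<open>A compact segment in an open set has a tube around it inside the set, so nearby starting
  points and steps are admissible as well.\<close>

lemma good_point_step_interior:
  assumes \<Omega>: "open \<Omega>" and M: "M \<ge> 1"
    and seg: "\<And>t. t \<in> {0..real M} \<Longrightarrow> p + t *\<^sub>R h0 \<in> \<Omega>"
    and good: "\<And>i. i \<in> {1..M} \<Longrightarrow> good_point \<Omega> M r j B (p + real i *\<^sub>R h0)"
  shows "good_point \<Omega> M r j B p"
proof -
  have "compact ((\<lambda>t. p + t *\<^sub>R h0) ` {0..real M})"
    by (intro compact_continuous_image continuous_intros) auto
  moreover have "(\<lambda>t. p + t *\<^sub>R h0) ` {0..real M} \<subseteq> \<Omega>" using seg by auto
  ultimately obtain e where e: "e > 0" and sub: "(\<Union>x\<in>(\<lambda>t. p + t *\<^sub>R h0) ` {0..real M}. ball x e) \<subseteq> \<Omega>"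
    using compact_subset_open_imp_ball_epsilon_subset[OF _ \<Omega>] by blast
  define \<delta> where "\<delta> = e / (1 + real M)"
  have \<delta>: "\<delta> > 0" using e by (simp add: \<delta>_def add_pos_nonneg)
  show ?thesis
  proof (rule good_point_step[OF \<Omega> M \<delta> _ good])
    fix x h t assume x: "x \<in> ball p \<delta> \<inter> \<Omega>" "h \<in> ball h0 \<delta>" "t \<in> {0..real M}"
    have "(p + t *\<^sub>R h0) - (x + t *\<^sub>R h) = (p - x) + t *\<^sub>R (h0 - h)" by (simp add: algebra_simps)
    then have "dist (p + t *\<^sub>R h0) (x + t *\<^sub>R h) \<le> dist p x + \<bar>t\<bar> * dist h0 h"
      unfolding dist_norm by (metis norm_triangle_ineq norm_scaleR)
    also have "\<dots> < \<delta> + real M * \<delta>"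
      using x by (intro add_less_le_mono mult_mono) auto
    also have "\<dots> = \<delta> * (1 + real M)" by (simp add: algebra_simps)
    also have "\<dots> = e"
    proof -
      have "1 + real M \<noteq> 0" by linarith
      then show ?thesis by (metis \<delta>_def nonzero_divide_eq_eq)
    qed
    finally have "x + t *\<^sub>R h \<in> ball (p + t *\<^sub>R h0) e" by simp
    then show "x + t *\<^sub>R h \<in> \<Omega>" using sub x(3) by blast
  qed
qed

lemma good_point_nearby:
  assumes "open \<Omega>" "good_point \<Omega> M r j B p"
  shows "\<exists>\<delta>>0. \<forall>x\<in>ball p \<delta>. good_point \<Omega> M r j B x"
proof -
  obtain \<delta> where \<delta>: "\<delta> > 0" "controlled \<Omega> M r j B (ball p \<delta> \<inter> \<Omega>)"
    using assms(2) by (auto simp: good_point_def)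
  have "good_point \<Omega> M r j B x" if x: "x \<in> ball p \<delta>" for x
  proof -
    obtain e where "e > 0" "ball x e \<subseteq> ball p \<delta>" using x openE[OF open_ball] by blast
    moreover have "controlled \<Omega> M r j B (ball x e \<inter> \<Omega>)"
      by (rule controlled_mono[OF \<delta>(2)]) (use \<open>ball x e \<subseteq> ball p \<delta>\<close> assms(1) in auto)
    ultimately show ?thesis by (auto simp: good_point_def)
  qed
  with \<delta>(1) show ?thesis by blast
qed

text \<open>Goodness propagates along segments: the first bad point of the segment would have
  M equidistant good predecessors, and then it is good as well.\<close>
lemma good_point_segment:
  assumes \<Omega>: "open \<Omega>" and M: "M \<ge> 1" and q: "good_point \<Omega> M r j B q"
    and seg: "\<And>t. t \<in> {0..1} \<Longrightarrow> q + t *\<^sub>R v \<in> \<Omega>"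
  shows "good_point \<Omega> M r j B (q + v)"
proof (rule ccontr)
  assume bad: "\<not> ?thesis"
  let ?P = "\<lambda>t. good_point \<Omega> M r j B (q + t *\<^sub>R v)"
  define A where "A = {t \<in> {0..1}. \<not> ?P t}"
  have "open {x. good_point \<Omega> M r j B x}"
    unfolding open_contains_ball using good_point_nearby[OF \<Omega>] by blast
  then have A_closed: "closed ({0..1} \<inter> (\<lambda>t. q + t *\<^sub>R v) -` (- {x. good_point \<Omega> M r j B x}))"
    by (intro continuous_closed_preimage continuous_intros) auto
  have "{0..1} \<inter> (\<lambda>t. q + t *\<^sub>R v) -` (- {x. good_point \<Omega> M r j B x}) = A"
    by (auto simp: A_def)
  then have "closed A" using A_closed by simp
  moreover have "bounded A" by (rule bounded_subset[of "{0..1}"]) (auto simp: A_def)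
  ultimately have "compact A" by (simp add: compact_eq_bounded_closed)
  moreover have "1 \<in> A" using bad by (simp add: A_def)
  ultimately obtain t where t: "t \<in> A" and tmin: "\<And>s. s \<in> A \<Longrightarrow> t \<le> s"
    using compact_attains_inf[of A] by blast
  have t0: "t > 0" using t q by (cases "t = 0") (auto simp: A_def)
  have before: "?P s" if "0 \<le> s" "s < t" for s
    using tmin[of s] that t by (force simp: A_def)
  \<comment> \<open>Steps back by the fraction 1 / (M + 1) of the way to q, so that all M
    predecessors lie on the segment strictly before t.\<close>
  have "?P t"
  proof (rule good_point_step_interior[OF \<Omega> M, where ?h0.0 = "- (t / (real M + 1)) *\<^sub>R v"])
    fix a :: real assume a: "a \<in> {0..real M}"
    have e: "(q + t *\<^sub>R v) + a *\<^sub>R (- (t / (real M + 1)) *\<^sub>R v) = q + (t * (1 - a / (real M + 1))) *\<^sub>R v"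
      by (simp add: algebra_simps)
    have "0 \<le> a / (real M + 1)" "a / (real M + 1) \<le> 1" using a by auto
    then have "t * (1 - a / (real M + 1)) \<in> {0..1}"
      using t by (auto simp: A_def intro!: mult_nonneg_nonneg mult_le_one)
    then show "(q + t *\<^sub>R v) + a *\<^sub>R (- (t / (real M + 1)) *\<^sub>R v) \<in> \<Omega>"
      unfolding e by (rule seg)
  next
    fix i assume i: "i \<in> {1..M}"
    have e: "(q + t *\<^sub>R v) + real i *\<^sub>R (- (t / (real M + 1)) *\<^sub>R v) = q + (t * (1 - real i / (real M + 1))) *\<^sub>R v"
      by (simp add: algebra_simps)
    have "0 < real i / (real M + 1)" "real i / (real M + 1) \<le> 1" using i by auto
    then have "0 \<le> t * (1 - real i / (real M + 1))" "t * (1 - real i / (real M + 1)) < t * 1"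
      using t0 by (intro mult_nonneg_nonneg mult_strict_left_mono; simp)+
    then show "good_point \<Omega> M r j B ((q + t *\<^sub>R v) + real i *\<^sub>R (- (t / (real M + 1)) *\<^sub>R v))"
      unfolding e by (intro before) simp_all
  qed
  with t show False by (simp add: A_def)
qed

text \<open>Good points form an open subset of \<Omega>, and so do bad ones: inside a ball contained
  in \<Omega> a good point would pass its goodness along a segment to the bad centre. The points of
  B are good, so connectedness excludes bad points.\<close>

lemma good_point_connected:
  assumes \<Omega>: "open \<Omega>" "connected \<Omega>" and M: "M \<ge> 1"
    and B: "open B" "B \<subseteq> \<Omega>" "B \<noteq> {}" and p: "p \<in> \<Omega>"
  shows "good_point \<Omega> M r j B p"
proof -
  define G where "G = {x \<in> \<Omega>. good_point \<Omega> M r j B x}"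
  have "\<exists>e>0. ball x e \<subseteq> G" if "x \<in> G" for x
  proof -
    have "x \<in> \<Omega>" using that by (simp add: G_def)
    then obtain e1 where "e1 > 0" "ball x e1 \<subseteq> \<Omega>" using openE[OF \<Omega>(1)] by blast
    moreover have "good_point \<Omega> M r j B x" using that by (simp add: G_def)
    from good_point_nearby[OF \<Omega>(1) this]
    obtain e2 where "e2 > 0" "\<forall>y\<in>ball x e2. good_point \<Omega> M r j B y" by auto
    ultimately show ?thesis by (intro exI[of _ "min e1 e2"]) (auto simp: G_def)
  qed
  then have G1: "open G" by (simp add: open_contains_ball)
  have "\<exists>e>0. ball x e \<subseteq> \<Omega> - G" if x: "x \<in> \<Omega> - G" for x
  proof -
    obtain e where e: "e > 0" "ball x e \<subseteq> \<Omega>" using x \<Omega>(1) openE by blast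
    have "y \<notin> G" if y: "y \<in> ball x e" for y
    proof
      assume "y \<in> G"
      then have gy: "good_point \<Omega> M r j B y" by (simp add: G_def)
      have "y + t *\<^sub>R (x - y) \<in> \<Omega>" if "t \<in> {0..1}" for t
      proof -
        have "(1 - t) *\<^sub>R y + t *\<^sub>R x \<in> ball x e"
          using convexD_alt[OF convex_ball y, of x t] e(1) that by simp
        then show ?thesis using e(2) by (auto simp: algebra_simps)
      qed
      from good_point_segment[OF \<Omega>(1) M gy this] have "good_point \<Omega> M r j B x" by simp
      then show False using x by (simp add: G_def)
    qed
    then show ?thesis using e by blast
  qed
  then have G2: "open (\<Omega> - G)" by (simp add: open_contains_ball)
  obtain b where b: "b \<in> B" using B by blast
  obtain e where e: "e > 0" "ball b e \<subseteq> B" using B(1) b openE by blast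
  have "controlled \<Omega> M r j B (ball b e \<inter> \<Omega>)"
    by (rule controlled_mono[OF controlled_self]) (use e B \<Omega> in auto)
  then have "b \<in> G" using e b B by (auto simp: G_def good_point_def)
  have "G \<inter> \<Omega> = {} \<or> (\<Omega> - G) \<inter> \<Omega> = {}"
    by (rule connectedD[OF \<Omega>(2) G1 G2]) auto
  then show ?thesis using \<open>b \<in> G\<close> p by (auto simp: G_def)
qed

text \<open>In a boundary chart the central step leads straight down from the graph. A deviation of
  size \<delta> raises the point and lowers the graph by at most (1 + L) \<delta> together per unit
  of t, which the descent \<tau> compensates.\<close>

lemma lipschitz_domain_cone:
  fixes \<Omega> :: "(real^'d) set" and T :: real
  assumes \<Omega>: "lipschitz_domain \<Omega>" and p: "p \<in> frontier \<Omega>" and T: "T \<ge> 1"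
  obtains \<delta> h0 where "\<delta> > 0"
    "\<And>x h t. x \<in> ball p \<delta> \<inter> \<Omega> \<Longrightarrow> h \<in> ball h0 \<delta> \<Longrightarrow> t \<in> {0..T} \<Longrightarrow> x + t *\<^sub>R h \<in> \<Omega>"
proof -
  obtain \<rho> R i0 \<gamma> L where \<rho>: "\<rho> > 0" and R: "orthogonal_transformation R"
    and indep: "\<And>y z :: real^'d. (\<And>i. i \<noteq> i0 \<Longrightarrow> y $ i = z $ i) \<Longrightarrow> \<gamma> y = \<gamma> z"
    and lip: "L-lipschitz_on UNIV \<gamma>"
    and chart: "\<Omega> \<inter> ball p \<rho> = {x \<in> ball p \<rho>. R (x - p) $ i0 < \<gamma> (R (x - p))}"
    using \<Omega> p unfolding lipschitz_domain_def by (elim conjE ballE[of _ _ p]) blast+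
  have L: "L \<ge> 0" using lip by (rule lipschitz_on_nonneg)
  have linR: "linear R" using R by (simp add: orthogonal_transformation_def)
  obtain e where e: "R e = axis i0 1" using orthogonal_transformation_surj[OF R] by (metis surjD)
  have norm_e: "norm e = 1" using orthogonal_transformation_norm[OF R, of e] e by simp
  \<comment> \<open>Small enough that a path of duration T with steps of length at most
    \<open>2 * \<tau>\<close> does not leave the chart.\<close>
  define \<tau> where "\<tau> = \<rho> / (4 * T)"
  have \<tau>: "\<tau> > 0" using \<rho> T by (simp add: \<tau>_def)
  define \<delta> where "\<delta> = \<tau> / (1 + L)"
  have \<delta>: "\<delta> > 0" "\<delta> \<le> \<tau>" "\<delta> * (1 + L) = \<tau>" using \<tau> L by (auto simp: \<delta>_def field_simps)
  show ?thesis
  proof (rule that[of \<delta> "- \<tau> *\<^sub>R e", OF \<delta>(1)])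
    fix x h t assume x: "x \<in> ball p \<delta> \<inter> \<Omega>" and h: "h \<in> ball (- \<tau> *\<^sub>R e) \<delta>" and t: "t \<in> {0..T}"
    have \<tau>T: "\<tau> * T = \<rho> / 4" using T by (simp add: \<tau>_def)
    have \<tau>\<rho>: "\<tau> \<le> \<rho> / 4" 
    proof -
      have "\<tau> * 1 \<le> \<tau> * T" using T \<tau> by (intro mult_left_mono) auto
      then show ?thesis using \<tau>T by simp
    qed
    define k where "k = h + \<tau> *\<^sub>R e"
    have k: "norm k < \<delta>" using h by (simp add: k_def dist_norm norm_minus_commute algebra_simps)
    have nh: "norm h \<le> 2 * \<tau>"
      using norm_triangle_ineq4[of k "\<tau> *\<^sub>R e"] k \<delta>(2) \<tau> norm_e by (simp add: k_def)
    have "dist p (x + t *\<^sub>R h) \<le> dist p x + \<bar>t\<bar> * norm h"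
      using norm_triangle_ineq4[of "p - x" "t *\<^sub>R h"] by (simp add: dist_norm algebra_simps)
    also have "\<dots> < \<tau> + T * (2 * \<tau>)"
      using x \<delta>(2) t nh T by (intro add_less_le_mono mult_mono) auto
    also have "\<dots> < \<rho>" using \<tau>T \<tau>\<rho> \<rho> by (simp add: algebra_simps)
    finally have inb: "x + t *\<^sub>R h \<in> ball p \<rho>" by simp
    have xb: "x \<in> ball p \<rho>" using x \<delta>(2) \<tau>\<rho> \<rho> by auto
    define \<xi> where "\<xi> = R (x - p)"
    have "x \<in> \<Omega> \<inter> ball p \<rho>" using x xb by blast
    then have \<xi>: "\<xi> $ i0 < \<gamma> \<xi>" unfolding chart \<xi>_def by simp
    have Rh: "R (x + t *\<^sub>R h - p) = \<xi> + t *\<^sub>R R k - (t * \<tau>) *\<^sub>R axis i0 1"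
    proof -
      have "x + t *\<^sub>R h - p = (x - p) + t *\<^sub>R k - (t * \<tau>) *\<^sub>R e" by (simp add: k_def algebra_simps)
      then show ?thesis
        unfolding \<xi>_def e[symmetric] by (simp add: linear_add[OF linR] linear_diff[OF linR] linear_cmul[OF linR])
    qed
    have Rk: "norm (R k) < \<delta>" using k orthogonal_transformation_norm[OF R, of k] by simp
    \<comment> \<open>The vertical part of the step does not affect \<gamma>, which depends on the
      other coordinates only; the deviation k alone moves the graph.\<close>
    have "\<gamma> (R (x + t *\<^sub>R h - p)) = \<gamma> (\<xi> + t *\<^sub>R R k)"
      unfolding Rh by (rule indep) (simp add: axis_def)
    moreover have "\<bar>\<gamma> (\<xi> + t *\<^sub>R R k) - \<gamma> \<xi>\<bar> \<le> L * (t * \<delta>)"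
    proof -
      have "\<bar>\<gamma> (\<xi> + t *\<^sub>R R k) - \<gamma> \<xi>\<bar> \<le> L * dist (\<xi> + t *\<^sub>R R k) \<xi>"
        using lipschitz_onD[OF lip, of "\<xi> + t *\<^sub>R R k" \<xi>] by (simp add: dist_real_def)
      also have "\<dots> \<le> L * (t * \<delta>)"
        using L t Rk by (intro mult_left_mono) (auto simp: dist_norm intro: mult_left_mono)
      finally show ?thesis .
    qed
    moreover have "R (x + t *\<^sub>R h - p) $ i0 \<le> \<xi> $ i0 + t * \<delta> - t * \<tau>"
    proof -
      have "R k $ i0 \<le> \<delta>" using component_le_norm_cart[of "R k" i0] Rk by simp
      then have "t * (R k $ i0) \<le> t * \<delta>" using t by (intro mult_left_mono) auto
      then show ?thesis unfolding Rh by (simp add: axis_def)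
    qed
    moreover have "t * \<tau> = t * \<delta> + L * (t * \<delta>)" unfolding \<delta>(3)[symmetric] by (simp add: algebra_simps)
    ultimately have "R (x + t *\<^sub>R h - p) $ i0 < \<gamma> (R (x + t *\<^sub>R h - p))" using \<xi> by linarith
    with inb have "x + t *\<^sub>R h \<in> \<Omega> \<inter> ball p \<rho>" unfolding chart by simp
    then show "x + t *\<^sub>R h \<in> \<Omega>" by blast
  qed
qed

text \<open>Points of \<Omega> are reached through connectedness, boundary points from these through
  the cone. Compactness of the closure turns the local constants into a single one.\<close>

lemma controlled_lipschitz_domain:
  fixes \<Omega> :: "(real^'d) set"
  assumes \<Omega>: "lipschitz_domain \<Omega>" "connected \<Omega>" "bounded \<Omega>" and M: "M \<ge> 1"
    and B: "open B" "B \<subseteq> \<Omega>" "B \<noteq> {}"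
  shows "controlled \<Omega> M r j B \<Omega>"
proof -
  have op: "open \<Omega>" using \<Omega>(1) by (simp add: lipschitz_domain_def)
  have good: "good_point \<Omega> M r j B p" if p: "p \<in> closure \<Omega>" for p
  proof (cases "p \<in> \<Omega>")
    case True
    then show ?thesis by (rule good_point_connected[OF op \<Omega>(2) M B])
  next
    case False
    then have pf: "p \<in> frontier \<Omega>" using p op by (simp add: frontier_def interior_open)
    have T: "real M \<ge> 1" using M by simp
    obtain h0 \<delta> where \<delta>: "\<delta> > 0"
      and cone: "\<And>x h t. x \<in> ball p \<delta> \<inter> \<Omega> \<Longrightarrow> h \<in> ball h0 \<delta> \<Longrightarrow> t \<in> {0..real M} \<Longrightarrow> x + t *\<^sub>R h \<in> \<Omega>"
      by (rule lipschitz_domain_cone[OF \<Omega>(1) pf T]) blast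
    show ?thesis
    proof (rule good_point_step[OF op M \<delta> cone])
      fix i assume i: "i \<in> {1..M}"
      obtain x where x: "x \<in> \<Omega>" "dist x p < \<delta>" using p \<delta> by (auto simp: closure_approachable)
      \<comment> \<open>The cone condition starts from points of \<Omega>, not from p. From x near p
        the corrected step \<open>h0 + (1 / real i) *\<^sub>R (p - x)\<close> is still admissible
        and arrives exactly at \<open>p + real i *\<^sub>R h0\<close>, which therefore lies in
        \<Omega>.\<close>
      have "norm ((1 / real i) *\<^sub>R (p - x)) \<le> norm (p - x)"
        using i mult_right_mono[of "1 / real i" 1 "norm (p - x)"] by (simp only: norm_scaleR) simp
      then have h: "h0 + (1 / real i) *\<^sub>R (p - x) \<in> ball h0 \<delta>"
        using x by (simp add: dist_norm norm_minus_commute)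
      have "x + real i *\<^sub>R (h0 + (1 / real i) *\<^sub>R (p - x)) \<in> \<Omega>"
        by (rule cone) (use x h i in \<open>auto simp: dist_commute\<close>)
      also have "x + real i *\<^sub>R (h0 + (1 / real i) *\<^sub>R (p - x)) = p + real i *\<^sub>R h0"
        using i by (simp add: algebra_simps)
      finally show "good_point \<Omega> M r j B (p + real i *\<^sub>R h0)"
        by (rule good_point_connected[OF op \<Omega>(2) M B])
    qed auto
  qed
  obtain d where d: "\<And>p. p \<in> closure \<Omega> \<Longrightarrow> d p > 0"
    "\<And>p. p \<in> closure \<Omega> \<Longrightarrow> controlled \<Omega> M r j B (ball p (d p) \<inter> \<Omega>)"
    using good unfolding good_point_def by metis
  have "compact (closure \<Omega>)" using \<Omega>(3) by (simp add: compact_closure)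
  moreover have "\<And>p. p \<in> closure \<Omega> \<Longrightarrow> open (ball p (d p))" by simp
  moreover have "closure \<Omega> \<subseteq> (\<Union>p\<in>closure \<Omega>. ball p (d p))" using d(1) by force
  ultimately obtain I where I: "I \<subseteq> closure \<Omega>" "finite I" "closure \<Omega> \<subseteq> (\<Union>p\<in>I. ball p (d p))"
    by (rule compactE_image)
  have "controlled \<Omega> M r j B (\<Union>p\<in>I. ball p (d p) \<inter> \<Omega>)"
    by (rule controlled_UN) (use I d in auto)
  moreover have "\<Omega> \<subseteq> (\<Union>p\<in>I. ball p (d p) \<inter> \<Omega>)" using I(3) closure_subset[of \<Omega>] by blast
  ultimately show ?thesis by (rule controlled_mono) (use op in simp)
qed

section \<open>From the domain to a small set in every slot\<close>

definition partial_box :: "'n set \<Rightarrow> (real^'d) set \<Rightarrow> (real^'d) set \<Rightarrow> (real^'d^'n) set" where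
  "partial_box R B \<Omega> = {X. \<forall>l. X $ l \<in> (if l \<in> R then B else \<Omega>)}"

lemma sets_slotwise:
  fixes A :: "'n::finite \<Rightarrow> (real^'d) set"
  assumes "\<And>l. A l \<in> sets borel"
  shows "{X :: real^'d^'n. \<forall>l. X $ l \<in> A l} \<in> sets borel"
proof -
  have "{X :: real^'d^'n. \<forall>l. X $ l \<in> A l} = (\<Inter>l. (\<lambda>X. X $ l) -` A l \<inter> space borel)" by auto
  moreover have "(\<lambda>X :: real^'d^'n. X $ l) -` A l \<inter> space borel \<in> sets borel" for l
    by (rule measurable_sets[OF borel_measurable_continuous_onI assms]) (intro continuous_intros)
  ultimately show ?thesis by (simp add: sets.finite_INT)
qed

text \<open>The slots are moved from \<Omega> to B one at a time. For the slot in question, the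
  conditions on all others form a cylinder, so the one-slot control applies with a constant
  independent of them.\<close>

lemma L2_norm_le_box:
  fixes \<Omega> :: "(real^'d) set"
  assumes \<Omega>: "lipschitz_domain \<Omega>" "connected \<Omega>" "bounded \<Omega>" and M: "M \<ge> 1"
    and B: "open B" "B \<subseteq> \<Omega>" "B \<noteq> {}"
  shows "\<exists>C\<ge>0. \<forall>(u :: real^'d^'n \<Rightarrow> real) E. u \<in> borel_measurable borel \<longrightarrow> difference_bound \<Omega> M r u E \<longrightarrow>
    (\<integral>\<^sup>+X. indicator (power_set \<Omega>) X * ennreal ((u X)\<^sup>2) \<partial>lborel)
     \<le> ennreal C * ((\<integral>\<^sup>+X. indicator (power_set B) X * ennreal ((u X)\<^sup>2) \<partial>lborel) + E)"
proof -
  have op: "open \<Omega>" using \<Omega>(1) by (simp add: lipschitz_domain_def)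
  let ?N = "\<lambda>R (u :: real^'d^'n \<Rightarrow> real). \<integral>\<^sup>+X. indicator (partial_box R B \<Omega>) X * ennreal ((u X)\<^sup>2) \<partial>lborel"
  have "\<exists>C\<ge>0. \<forall>(u :: real^'d^'n \<Rightarrow> real) E. u \<in> borel_measurable borel \<longrightarrow> difference_bound \<Omega> M r u E \<longrightarrow>
    ?N {} u \<le> ennreal C * (?N R u + E)" for R :: "'n set"
    using finite[of R]
  proof (induction R)
    case empty
    show ?case by (intro exI[of _ 1]) auto
  next
    case (insert j R)
    obtain C where C: "C \<ge> 0" and c: "\<And>(u :: real^'d^'n \<Rightarrow> real) E. u \<in> borel_measurable borel \<Longrightarrow> difference_bound \<Omega> M r u E \<Longrightarrow>
      ?N {} u \<le> ennreal C * (?N R u + E)" using insert.IH by blast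
    obtain C' where C': "C' \<ge> 0" and c': "\<And>(u :: real^'d^'n \<Rightarrow> real) E T. u \<in> borel_measurable borel \<Longrightarrow>
       difference_bound \<Omega> M r u E \<Longrightarrow> slot_cylinder j \<Omega> T \<Longrightarrow> slot_norm j T \<Omega> u \<le> ennreal C' * (slot_norm j T B u + E)"
      using controlled_lipschitz_domain[OF \<Omega> M B, of r j] unfolding controlled_def by blast
    \<comment> \<open>Slot j is unrestricted here, because \<open>slot_norm\<close> imposes its own
      condition on it: first \<Omega>, then B.\<close>
    define T where "T = {X :: real^'d^'n. \<forall>l. X $ l \<in> (if l = j then UNIV else if l \<in> R then B else \<Omega>)}"
    have T: "slot_cylinder j \<Omega> T"
    proof -
      have "T \<in> sets borel" unfolding T_def by (rule sets_slotwise) (use B op in auto)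
      then show ?thesis unfolding slot_cylinder_def using B(2) by (auto simp: T_def split: if_splits)
    qed
    have n1: "slot_norm j T \<Omega> u = ?N R u" for u
      unfolding slot_norm_def
    proof (intro nn_integral_cong)
      fix X :: "real^'d^'n"
      have "X \<in> T \<and> X $ j \<in> \<Omega> \<longleftrightarrow> X \<in> partial_box R B \<Omega>"
        using insert.hyps unfolding T_def partial_box_def by (auto split: if_splits)
      then show "indicator T X * (indicator \<Omega> (X $ j) * ennreal ((u X)\<^sup>2)) = indicator (partial_box R B \<Omega>) X * ennreal ((u X)\<^sup>2)"
        by (auto simp: indicator_def)
    qed
    have n2: "slot_norm j T B u = ?N (insert j R) u" for u
      unfolding slot_norm_def
    proof (intro nn_integral_cong)
      fix X :: "real^'d^'n"
      have "X \<in> T \<and> X $ j \<in> B \<longleftrightarrow> X \<in> partial_box (insert j R) B \<Omega>"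
        unfolding T_def partial_box_def by (auto split: if_splits)
      then show "indicator T X * (indicator B (X $ j) * ennreal ((u X)\<^sup>2)) = indicator (partial_box (insert j R) B \<Omega>) X * ennreal ((u X)\<^sup>2)"
        by (auto simp: indicator_def)
    qed
    have "?N {} u \<le> ennreal (C * (C' + 1)) * (?N (insert j R) u + E)"
      if u: "u \<in> borel_measurable borel" "difference_bound \<Omega> M r u E" for u :: "real^'d^'n \<Rightarrow> real" and E
    proof -
      have "?N {} u \<le> ennreal C * (?N R u + E)" by (rule c[OF u])
      also have "\<dots> \<le> ennreal C * (ennreal C' * (?N (insert j R) u + E) + (?N (insert j R) u + E))"
        using c'[OF u T] unfolding n1 n2 by (intro mult_left_mono add_mono) (auto simp: add_increasing)
      also have "\<dots> = ennreal (C * (C' + 1)) * (?N (insert j R) u + E)"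
        using C C' by (simp add: ennreal_mult distrib_right mult.assoc)
      finally show ?thesis .
    qed
    then show ?case using C C' by (intro exI[of _ "C * (C' + 1)"]) auto
  qed
  from this[of UNIV] show ?thesis by (simp add: partial_box_def power_set_def)
qed

section \<open>Tensor products of extrapolation operators\<close>

text \<open>The tensor product of one-slot extrapolations: in each slot l of R, u is evaluated at
  the points \<open>e l 1\<close> to \<open>e l M\<close> with the weights
  \<open>fd_coeff M\<close>. The points are arbitrary, so that every slot may have its own base
  point and its own step.\<close>

definition tens :: "nat \<Rightarrow> 'n set \<Rightarrow> ('n \<Rightarrow> nat \<Rightarrow> real^'d) \<Rightarrow> (real^'d^'n \<Rightarrow> real) \<Rightarrow> real^'d^'n \<Rightarrow> real" where
  "tens M R e u Y = (\<Sum>a\<in>Pi\<^sub>E R (\<lambda>_. {1..M}). (\<Prod>l\<in>R. fd_coeff M (a l)) * u (\<chi> l. if l \<in> R then e l (a l) else Y $ l))"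

lemma sum_PiE_insert:
  assumes "j \<notin> R"
  shows "(\<Sum>a\<in>Pi\<^sub>E (insert j R) B. f a) = (\<Sum>i\<in>B j. \<Sum>a\<in>Pi\<^sub>E R B. f (a(j := i)))"
proof -
  have "(\<Sum>a\<in>Pi\<^sub>E (insert j R) B. f a) = (\<Sum>p\<in>B j \<times> Pi\<^sub>E R B. f ((snd p)(j := fst p)))"
    unfolding PiE_insert_eq
    by (subst sum.reindex[OF inj_combinator[OF assms]]) (simp add: case_prod_unfold)
  then show ?thesis by (simp add: sum.cartesian_product case_prod_unfold)
qed

lemma tens_insert:
  assumes "j \<notin> R"
  shows "tens M (insert j R) e u Y = (\<Sum>i\<in>{1..M}. fd_coeff M i * tens M R e u (upd_pt Y j (e j i)))"
  unfolding tens_def sum_PiE_insert[OF assms] sum_distrib_left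
proof (intro sum.cong refl)
  fix i a
  have fin: "finite R" by simp
  have "(\<Prod>l\<in>insert j R. fd_coeff M ((a(j := i)) l)) = fd_coeff M i * (\<Prod>l\<in>R. fd_coeff M (a l))"
  proof -
    have "(\<Prod>l\<in>R. fd_coeff M ((a(j := i)) l)) = (\<Prod>l\<in>R. fd_coeff M (a l))"
      using assms by (intro prod.cong) auto
    then show ?thesis using assms by (simp add: prod.insert[OF fin] del: fun_upd_apply) simp
  qed
  moreover have "(\<chi> l. if l \<in> insert j R then e l ((a(j := i)) l) else Y $ l)
      = (\<chi> l. if l \<in> R then e l (a l) else upd_pt Y j (e j i) $ l)"
    using assms by (auto simp: vec_eq_iff)
  ultimately show "(\<Prod>l\<in>insert j R. fd_coeff M ((a(j := i)) l)) * u (\<chi> l. if l \<in> insert j R then e l ((a(j := i)) l) else Y $ l)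
      = fd_coeff M i * ((\<Prod>l\<in>R. fd_coeff M (a l)) * u (\<chi> l. if l \<in> R then e l (a l) else upd_pt Y j (e j i) $ l))"
    by (simp add: mult.assoc)
qed

lemma tens_cong:
  "(\<And>l. l \<in> R \<Longrightarrow> e l = e' l) \<Longrightarrow> (\<And>l. l \<notin> R \<Longrightarrow> Y $ l = Y' $ l) \<Longrightarrow> tens M R e u Y = tens M R e' u Y'"
  unfolding tens_def by (intro sum.cong refl arg_cong2[where f = "(*)"] arg_cong[where f = u]) (auto simp: vec_eq_iff)

lemma tens_sum:
  "(\<Sum>k\<in>A. c k * tens M R e (f k) Y) = tens M R e (\<lambda>X. \<Sum>k\<in>A. c k * f k X) Y"
  unfolding tens_def sum_distrib_left by (subst sum.swap) (intro sum.cong refl, simp add: mult_ac)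

text \<open>Operations in different slots commute. This moves a difference from outside the tensor
  product onto u itself, where \<open>difference_bound\<close> applies.\<close>

lemma fdiff_tens:
  assumes "j \<notin> R"
  shows "(\<Sum>k\<le>M. fd_coeff M k * tens M' R e u (upd_pt Y j (x + real k *\<^sub>R \<eta>))) = tens M' R e (fdiff M j \<eta> u) (upd_pt Y j x)"
proof -
  have "(\<Sum>k\<le>M. fd_coeff M k * tens M' R e u (upd_pt Y j (x + real k *\<^sub>R \<eta>)))
      = (\<Sum>k\<le>M. fd_coeff M k * tens M' R e (\<lambda>X. u (X + real k *\<^sub>R axis j \<eta>)) (upd_pt Y j x))"
  proof (intro sum.cong refl arg_cong2[where f = "(*)"])
    fix k
    have "(\<chi> l. if l \<in> R then e l (a l) else upd_pt Y j (x + real k *\<^sub>R \<eta>) $ l)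
       = (\<chi> l. if l \<in> R then e l (a l) else upd_pt Y j x $ l) + real k *\<^sub>R axis j \<eta>" for a
      using assms by (auto simp: vec_eq_iff axis_def)
    then show "tens M' R e u (upd_pt Y j (x + real k *\<^sub>R \<eta>)) = tens M' R e (\<lambda>X. u (X + real k *\<^sub>R axis j \<eta>)) (upd_pt Y j x)"
      unfolding tens_def by simp
  qed
  also have "\<dots> = tens M' R e (fdiff M j \<eta> u) (upd_pt Y j x)"
    unfolding tens_sum fdiff_def ..
  finally show ?thesis .
qed

text \<open>The constant does not depend on the points \<open>e\<close>, so it can be fixed before
  the scales of the extrapolations tend to 0.\<close>

lemma tens_sq_le:
  fixes R :: "'n::finite set"
  shows "\<exists>D\<ge>0. \<forall>(e :: 'n \<Rightarrow> nat \<Rightarrow> real^'d) (u :: real^'d^'n \<Rightarrow> real) Y. (tens M R e u Y)\<^sup>2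
    \<le> D * (\<Sum>a\<in>Pi\<^sub>E R (\<lambda>_. {1..M}). (u (\<chi> l. if l \<in> R then e l (a l) else Y $ l))\<^sup>2)"
proof (intro exI conjI allI)
  let ?A = "Pi\<^sub>E R (\<lambda>_. {1..M})"
  let ?c = "\<lambda>a. \<Prod>l\<in>R. fd_coeff M (a l)"
  have fin: "finite ?A" by (intro finite_PiE) auto
  define C where "C = (\<Sum>a\<in>?A. (?c a)\<^sup>2)"
  have C: "(?c a)\<^sup>2 \<le> C" if "a \<in> ?A" for a
    unfolding C_def using that fin by (intro member_le_sum) auto
  show "real (card ?A) * C \<ge> 0" by (simp add: C_def sum_nonneg)
  fix e :: "'n \<Rightarrow> nat \<Rightarrow> real^'d" and u :: "real^'d^'n \<Rightarrow> real" and Y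
  let ?v = "\<lambda>a. u (\<chi> l. if l \<in> R then e l (a l) else Y $ l)"
  have "(tens M R e u Y)\<^sup>2 \<le> (\<Sum>a\<in>?A. (?c a * ?v a)\<^sup>2) * card ?A"
    unfolding tens_def by (rule sum_squared_le_sum_of_squares)
  also have "\<dots> \<le> (\<Sum>a\<in>?A. C * (?v a)\<^sup>2) * card ?A"
    using C by (intro mult_right_mono sum_mono) (auto simp: power_mult_distrib intro!: mult_right_mono)
  also have "\<dots> = real (card ?A) * C * (\<Sum>a\<in>?A. (?v a)\<^sup>2)"
    by (simp add: sum_distrib_left[symmetric])
  finally show "(tens M R e u Y)\<^sup>2 \<le> real (card ?A) * C * (\<Sum>a\<in>?A. (?v a)\<^sup>2)" .
qed

text \<open>Writing A for the extrapolation operator, A(h) - A(h/2) = A(h/2) D(h) - A(h) D(h/2) because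
  A(h) = id + D(h) and all these operators commute. Both differences on the right are
  taken at a base point that is itself averaged.\<close>
lemma extrapolation_halving:
  fixes v :: "'a::real_vector \<Rightarrow> real"
  shows "(\<Sum>i\<in>{1..M}. fd_coeff M i * v (p + real i *\<^sub>R h)) - (\<Sum>i\<in>{1..M}. fd_coeff M i * v (p + real i *\<^sub>R (h /\<^sub>R 2)))
    = (\<Sum>i\<in>{1..M}. fd_coeff M i * (\<Sum>k\<le>M. fd_coeff M k * v (p + real i *\<^sub>R (h /\<^sub>R 2) + real k *\<^sub>R h)))
    - (\<Sum>i\<in>{1..M}. fd_coeff M i * (\<Sum>k\<le>M. fd_coeff M k * v (p + real i *\<^sub>R h + real k *\<^sub>R (h /\<^sub>R 2))))"
proof -
  have split: "(\<Sum>k\<le>M. fd_coeff M k * f k) = - f 0 + (\<Sum>k\<in>{1..M}. fd_coeff M k * f k)" for f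
    by (simp add: atMost_atLeast0 sum.atLeast_Suc_atMost fd_coeff_def)
  \<comment> \<open>The products of two extrapolations occur in both terms and agree after
    exchanging i and k, so they cancel; the terms with k = 0 give the left side.\<close>
  have swap: "(\<Sum>i\<in>{1..M}. fd_coeff M i * (\<Sum>k\<in>{1..M}. fd_coeff M k * v (p + real i *\<^sub>R (h /\<^sub>R 2) + real k *\<^sub>R h)))
      = (\<Sum>i\<in>{1..M}. fd_coeff M i * (\<Sum>k\<in>{1..M}. fd_coeff M k * v (p + real i *\<^sub>R h + real k *\<^sub>R (h /\<^sub>R 2))))"
    unfolding sum_distrib_left
    by (subst sum.swap) (intro sum.cong refl, simp add: algebra_simps)
  have expand: "(\<Sum>i\<in>{1..M}. fd_coeff M i * (- g i + f i)) = - (\<Sum>i\<in>{1..M}. fd_coeff M i * g i) + (\<Sum>i\<in>{1..M}. fd_coeff M i * f i)" for f g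
    by (simp add: right_diff_distrib sum_subtractf)
  show ?thesis unfolding split expand swap by simp
qed

text \<open>The halving identity in slot j, tensored with the extrapolations in the other slots. The
  constant is independent of p, h and \<open>e\<close>, since it has to serve at every
  scale.\<close>

lemma tens_halving_sq_le:
  fixes j :: "'n::finite"
  shows "\<exists>D\<ge>0. \<forall>(e :: 'n \<Rightarrow> nat \<Rightarrow> real^'d) (u :: real^'d^'n \<Rightarrow> real) p h. (tens M UNIV (e(j := \<lambda>i. p + real i *\<^sub>R h)) u 0 - tens M UNIV (e(j := \<lambda>i. p + real i *\<^sub>R (h /\<^sub>R 2))) u 0)\<^sup>2
    \<le> D * (\<Sum>i\<in>{1..M}. \<Sum>a\<in>Pi\<^sub>E (UNIV - {j}) (\<lambda>_. {1..M}).
        (fdiff M j h u (\<chi> l. if l = j then p + real i *\<^sub>R (h /\<^sub>R 2) else e l (a l)))\<^sup>2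
      + (fdiff M j (h /\<^sub>R 2) u (\<chi> l. if l = j then p + real i *\<^sub>R h else e l (a l)))\<^sup>2)"
proof -
  let ?R = "UNIV - {j}" and ?A = "Pi\<^sub>E (UNIV - {j}) (\<lambda>_. {1..M})"
  obtain D where D: "D \<ge> 0" and Dle: "\<And>(e :: 'n \<Rightarrow> nat \<Rightarrow> real^'d) (u :: real^'d^'n \<Rightarrow> real) Y. (tens M ?R e u Y)\<^sup>2
    \<le> D * (\<Sum>a\<in>?A. (u (\<chi> l. if l \<in> ?R then e l (a l) else Y $ l))\<^sup>2)"
    using tens_sq_le[where M = M and R = ?R and 'd = 'd] by blast
  define c where "c = (\<Sum>i\<in>{1..M}. (fd_coeff M i)\<^sup>2)"
  have c: "c \<ge> 0" "\<And>i. i \<in> {1..M} \<Longrightarrow> (fd_coeff M i)\<^sup>2 \<le> c"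
    unfolding c_def by (auto intro!: sum_nonneg member_le_sum)
  show ?thesis
  proof (intro exI conjI allI)
    show "2 * real M * c * D \<ge> 0" using c D by simp
    fix e :: "'n \<Rightarrow> nat \<Rightarrow> real^'d" and u :: "real^'d^'n \<Rightarrow> real" and p h
    define T where "T = tens M ?R e"
    have UN: "UNIV = insert j ?R" by auto
    have exp: "tens M UNIV (e(j := \<lambda>i. p + real i *\<^sub>R h')) u 0 = (\<Sum>i\<in>{1..M}. fd_coeff M i * T u (upd_pt 0 j (p + real i *\<^sub>R h')))" for h'
    proof -
      have "tens M UNIV (e(j := \<lambda>i. p + real i *\<^sub>R h')) u 0 = tens M (insert j ?R) (e(j := \<lambda>i. p + real i *\<^sub>R h')) u 0"
        using UN by metis
      also have "\<dots> = (\<Sum>i\<in>{1..M}. fd_coeff M i * tens M ?R (e(j := \<lambda>i. p + real i *\<^sub>R h')) u (upd_pt 0 j (p + real i *\<^sub>R h')))"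
        by (subst tens_insert) auto
      also have "\<dots> = (\<Sum>i\<in>{1..M}. fd_coeff M i * T u (upd_pt 0 j (p + real i *\<^sub>R h')))"
        unfolding T_def by (intro sum.cong refl arg_cong2[where f = "(*)"] tens_cong) auto
      finally show ?thesis .
    qed
    let ?X = "\<lambda>i. T (fdiff M j h u) (upd_pt 0 j (p + real i *\<^sub>R (h /\<^sub>R 2)))"
    let ?Y = "\<lambda>i. T (fdiff M j (h /\<^sub>R 2) u) (upd_pt 0 j (p + real i *\<^sub>R h))"
    have "tens M UNIV (e(j := \<lambda>i. p + real i *\<^sub>R h)) u 0 - tens M UNIV (e(j := \<lambda>i. p + real i *\<^sub>R (h /\<^sub>R 2))) u 0
        = (\<Sum>i\<in>{1..M}. fd_coeff M i * ?X i) - (\<Sum>i\<in>{1..M}. fd_coeff M i * ?Y i)"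
      unfolding exp extrapolation_halving[of M "\<lambda>x. T u (upd_pt 0 j x)"]
      unfolding T_def by (subst fdiff_tens, simp)+ simp
    also have "\<dots> = (\<Sum>i\<in>{1..M}. fd_coeff M i * (?X i - ?Y i))"
      by (simp add: right_diff_distrib sum_subtractf)
    finally have "(tens M UNIV (e(j := \<lambda>i. p + real i *\<^sub>R h)) u 0 - tens M UNIV (e(j := \<lambda>i. p + real i *\<^sub>R (h /\<^sub>R 2))) u 0)\<^sup>2
        = (\<Sum>i\<in>{1..M}. fd_coeff M i * (?X i - ?Y i))\<^sup>2" by simp
    also have "\<dots> \<le> (\<Sum>i\<in>{1..M}. (fd_coeff M i * (?X i - ?Y i))\<^sup>2) * card {1..M}"
      by (rule sum_squared_le_sum_of_squares)
    also have "\<dots> \<le> (\<Sum>i\<in>{1..M}. c * (2 * (D * (\<Sum>a\<in>?A. (fdiff M j h u (\<chi> l. if l = j then p + real i *\<^sub>R (h /\<^sub>R 2) else e l (a l)))\<^sup>2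
      + (fdiff M j (h /\<^sub>R 2) u (\<chi> l. if l = j then p + real i *\<^sub>R h else e l (a l)))\<^sup>2)))) * card {1..M}"
    proof (intro mult_right_mono sum_mono)
      fix i assume i: "i \<in> {1..M}"
      have 1: "(?X i)\<^sup>2 \<le> D * (\<Sum>a\<in>?A. (fdiff M j h u (\<chi> l. if l = j then p + real i *\<^sub>R (h /\<^sub>R 2) else e l (a l)))\<^sup>2)"
      proof -
        have "(\<chi> l. if l \<in> ?R then e l (a l) else upd_pt 0 j x $ l) = (\<chi> l. if l = j then x else e l (a l))" for a x
          by (auto simp: vec_eq_iff)
        then show ?thesis using Dle[of e "fdiff M j h u" "upd_pt 0 j (p + real i *\<^sub>R (h /\<^sub>R 2))"] by (simp add: T_def)
      qed
      have 2: "(?Y i)\<^sup>2 \<le> D * (\<Sum>a\<in>?A. (fdiff M j (h /\<^sub>R 2) u (\<chi> l. if l = j then p + real i *\<^sub>R h else e l (a l)))\<^sup>2)"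
      proof -
        have "(\<chi> l. if l \<in> ?R then e l (a l) else upd_pt 0 j x $ l) = (\<chi> l. if l = j then x else e l (a l))" for a x
          by (auto simp: vec_eq_iff)
        then show ?thesis using Dle[of e "fdiff M j (h /\<^sub>R 2) u" "upd_pt 0 j (p + real i *\<^sub>R h)"] by (simp add: T_def)
      qed
      have "(?X i - ?Y i)\<^sup>2 \<le> 2 * ((?X i)\<^sup>2 + (?Y i)\<^sup>2)"
        using zero_le_power2[of "?X i + ?Y i"] by (simp add: power2_sum power2_diff)
      also have "\<dots> \<le> 2 * (D * (\<Sum>a\<in>?A. (fdiff M j h u (\<chi> l. if l = j then p + real i *\<^sub>R (h /\<^sub>R 2) else e l (a l)))\<^sup>2)
         + D * (\<Sum>a\<in>?A. (fdiff M j (h /\<^sub>R 2) u (\<chi> l. if l = j then p + real i *\<^sub>R h else e l (a l)))\<^sup>2))"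
        using 1 2 by (intro mult_left_mono add_mono) auto
      also have "\<dots> = 2 * (D * (\<Sum>a\<in>?A. (fdiff M j h u (\<chi> l. if l = j then p + real i *\<^sub>R (h /\<^sub>R 2) else e l (a l)))\<^sup>2
      + (fdiff M j (h /\<^sub>R 2) u (\<chi> l. if l = j then p + real i *\<^sub>R h else e l (a l)))\<^sup>2))"
        by (simp add: sum.distrib distrib_left)
      finally show "(fd_coeff M i * (?X i - ?Y i))\<^sup>2 \<le> c * (2 * (D * (\<Sum>a\<in>?A. (fdiff M j h u (\<chi> l. if l = j then p + real i *\<^sub>R (h /\<^sub>R 2) else e l (a l)))\<^sup>2
      + (fdiff M j (h /\<^sub>R 2) u (\<chi> l. if l = j then p + real i *\<^sub>R h else e l (a l)))\<^sup>2)))"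
        unfolding power_mult_distrib using c i by (intro mult_mono) auto
    qed simp
    also have "\<dots> = 2 * real M * c * D * (\<Sum>i\<in>{1..M}. \<Sum>a\<in>?A. (fdiff M j h u (\<chi> l. if l = j then p + real i *\<^sub>R (h /\<^sub>R 2) else e l (a l)))\<^sup>2
      + (fdiff M j (h /\<^sub>R 2) u (\<chi> l. if l = j then p + real i *\<^sub>R h else e l (a l)))\<^sup>2)"
      by (simp add: sum_distrib_left[symmetric])
    finally show "(tens M UNIV (e(j := \<lambda>i. p + real i *\<^sub>R h)) u 0 - tens M UNIV (e(j := \<lambda>i. p + real i *\<^sub>R (h /\<^sub>R 2))) u 0)\<^sup>2
        \<le> 2 * real M * c * D * (\<Sum>i\<in>{1..M}. \<Sum>a\<in>?A. (fdiff M j h u (\<chi> l. if l = j then p + real i *\<^sub>R (h /\<^sub>R 2) else e l (a l)))\<^sup>2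
      + (fdiff M j (h /\<^sub>R 2) u (\<chi> l. if l = j then p + real i *\<^sub>R h else e l (a l)))\<^sup>2)" .
  qed
qed

section \<open>Differences integrated over moving base points\<close>

lemma continuous_on_slotwise [continuous_intros]:
  assumes "\<And>l. continuous_on S (\<lambda>x. f x l)"
  shows "continuous_on S (\<lambda>x. (\<chi> l. f x l) :: 'a::real_normed_vector ^ 'n)"
  using assms by (intro continuous_on_vec_lambda)

lemma borel_measurable_fdiff:
  fixes u :: "real^'d^'n \<Rightarrow> real" and f :: "'a::topological_space \<Rightarrow> _"
  assumes u: "u \<in> borel_measurable borel" and f: "continuous_on UNIV f" "continuous_on UNIV g"
  shows "(\<lambda>x. fdiff M j (g x) u (f x)) \<in> borel_measurable borel"
  unfolding fdiff_def
  by (intro borel_measurable_sum borel_measurable_times borel_measurable_const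
        borel_measurable_compose_continuous[OF u] continuous_intros f)

lemma borel_measurable_indicator_compose:
  assumes "open A" "continuous_on UNIV f"
  shows "(\<lambda>x. indicator A (f x) :: ennreal) \<in> borel_measurable borel"
  using borel_measurable_compose_continuous[OF _ assms(2), of "indicator A"] assms(1) by simp

text \<open>The factor theta^(-d) comes from rescaling the increment, the product from the slots that are
  integrated at scale b l.\<close>
lemma fdiff_slots_bound:
  fixes \<Omega> :: "(real^'d) set" and u :: "real^'d^'n \<Rightarrow> real" and P :: "real^'d^'n"
  assumes u: "u \<in> borel_measurable borel" and db: "difference_bound \<Omega> M r u E"
    and Q: "open Q" "convex Q" "Q \<subseteq> \<Omega>"
    and pos: "\<theta> > 0" "\<omega> > 0" "\<And>l. l \<noteq> j \<Longrightarrow> b l > 0" and \<epsilon>: "\<epsilon> j = 1"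
    and inQ: "\<And>z W l. z \<in> ball 0 \<omega> \<Longrightarrow> W \<in> power_set (ball 0 \<omega>) \<Longrightarrow> P $ l + \<epsilon> l *\<^sub>R z + b l *\<^sub>R W $ l \<in> Q"
    and inQ': "\<And>z W l. z \<in> ball 0 \<omega> \<Longrightarrow> W \<in> power_set (ball 0 \<omega>) \<Longrightarrow> P $ j + z + b j *\<^sub>R W $ j + (real M * \<theta>) *\<^sub>R W $ j \<in> Q"
  shows "(\<integral>\<^sup>+z. \<integral>\<^sup>+W. indicator (ball 0 \<omega>) z * (indicator (power_set (ball 0 \<omega>)) W *
      ennreal ((fdiff M j (\<theta> *\<^sub>R W $ j) u (\<chi> l. P $ l + \<epsilon> l *\<^sub>R z + b l *\<^sub>R W $ l))\<^sup>2)) \<partial>lborel \<partial>lborel)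
    \<le> ennreal ((1 / (\<Prod>l\<in>UNIV-{j}. b l ^ CARD('d))) * (1 / \<theta> ^ CARD('d)) * (\<theta> * \<omega>) powr r) * E"
proof -
  \<comment> \<open>Only the start and the end of the difference are recorded. Q is convex, so the
    whole segment between them stays in \<Omega>, and the point belongs to
    \<open>segment_core\<close>.\<close>
  define F where "F Y \<eta> = indicator (power_set Q) Y * (indicator Q (Y $ j + real M *\<^sub>R \<eta>) * (indicator (ball 0 (\<theta> * \<omega>)) \<eta> * ennreal ((fdiff M j \<eta> u Y)\<^sup>2)))" for Y \<eta>
  have mF: "(\<lambda>x. F (f x) (g x)) \<in> borel_measurable borel" if "continuous_on UNIV f" "continuous_on UNIV g" for f g
    unfolding F_def using that borel_measurable_fdiff[OF u that, of M j] open_power_set[OF Q(1), where 'n='n] Q(1)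
    by (intro borel_measurable_times_ennreal borel_measurable_indicator_compose) (auto intro!: continuous_intros)
  have mF2: "case_prod (\<lambda>Y \<eta>. F Y (\<theta> *\<^sub>R \<eta>)) \<in> borel_measurable borel"
    unfolding case_prod_unfold by (intro mF continuous_intros)
  let ?J = "1 / (\<Prod>l\<in>UNIV-{j}. b l ^ CARD('d))"
  have "(\<integral>\<^sup>+z. \<integral>\<^sup>+W. indicator (ball 0 \<omega>) z * (indicator (power_set (ball 0 \<omega>)) W *
      ennreal ((fdiff M j (\<theta> *\<^sub>R W $ j) u (\<chi> l. P $ l + \<epsilon> l *\<^sub>R z + b l *\<^sub>R W $ l))\<^sup>2)) \<partial>lborel \<partial>lborel)
    \<le> (\<integral>\<^sup>+z. \<integral>\<^sup>+W. F (\<chi> l. P $ l + \<epsilon> l *\<^sub>R z + b l *\<^sub>R W $ l) (\<theta> *\<^sub>R W $ j) \<partial>lborel \<partial>lborel)"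
  proof (intro nn_integral_mono)
    fix z :: "real^'d" and W :: "real^'d^'n"
    show "indicator (ball 0 \<omega>) z * (indicator (power_set (ball 0 \<omega>)) W *
      ennreal ((fdiff M j (\<theta> *\<^sub>R W $ j) u (\<chi> l. P $ l + \<epsilon> l *\<^sub>R z + b l *\<^sub>R W $ l))\<^sup>2))
      \<le> F (\<chi> l. P $ l + \<epsilon> l *\<^sub>R z + b l *\<^sub>R W $ l) (\<theta> *\<^sub>R W $ j)"
    proof (cases "z \<in> ball 0 \<omega> \<and> W \<in> power_set (ball 0 \<omega>)")
      case True
      then have "norm (W $ j) < \<omega>" by (auto simp: power_set_def dest: spec[of _ j])
      then have "\<theta> *\<^sub>R W $ j \<in> ball 0 (\<theta> * \<omega>)" using pos by simp
      moreover have "(\<chi> l. P $ l + \<epsilon> l *\<^sub>R z + b l *\<^sub>R W $ l) \<in> power_set Q"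
        using inQ True by (auto simp: power_set_def)
      moreover have "(\<chi> l. P $ l + \<epsilon> l *\<^sub>R z + b l *\<^sub>R W $ l) $ j + real M *\<^sub>R \<theta> *\<^sub>R W $ j \<in> Q"
        using inQ'[of z W] True \<epsilon> by simp
      ultimately show ?thesis by (simp add: F_def indicator_def)
    qed (auto simp: indicator_def)
  qed
  also have "\<dots> = ennreal ?J * (\<integral>\<^sup>+Y. \<integral>\<^sup>+\<eta>. F Y (\<theta> *\<^sub>R \<eta>) \<partial>lborel \<partial>lborel)"
    using pos(3) by (intro nn_integral_slots_substitution[OF mF2] \<epsilon>)
  also have "(\<integral>\<^sup>+Y. \<integral>\<^sup>+\<eta>. F Y (\<theta> *\<^sub>R \<eta>) \<partial>lborel \<partial>lborel) = (\<integral>\<^sup>+\<eta>. \<integral>\<^sup>+Y. F Y (\<theta> *\<^sub>R \<eta>) \<partial>lborel \<partial>lborel)"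
    by (rule nn_integral_lborel_swap[OF mF2])
  also have "\<dots> = ennreal (1 / \<theta> ^ CARD('d)) * (\<integral>\<^sup>+\<eta>. \<integral>\<^sup>+Y. F Y \<eta> \<partial>lborel \<partial>lborel)"
  proof -
    have "(\<integral>\<^sup>+\<eta>. \<integral>\<^sup>+Y. F Y \<eta> \<partial>lborel \<partial>lborel) = ennreal (\<theta> ^ DIM(real^'d)) * (\<integral>\<^sup>+\<eta>. \<integral>\<^sup>+Y. F Y (0 + \<theta> *\<^sub>R \<eta>) \<partial>lborel \<partial>lborel)"
      by (intro nn_integral_lborel_scale pos nn_integral_lborel_snd_measurable)
         (auto simp: case_prod_unfold intro!: mF continuous_intros)
    then have "ennreal (1 / \<theta> ^ CARD('d)) * (\<integral>\<^sup>+\<eta>. \<integral>\<^sup>+Y. F Y \<eta> \<partial>lborel \<partial>lborel)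
        = (ennreal (1 / \<theta> ^ CARD('d)) * ennreal (\<theta> ^ CARD('d))) * (\<integral>\<^sup>+\<eta>. \<integral>\<^sup>+Y. F Y (\<theta> *\<^sub>R \<eta>) \<partial>lborel \<partial>lborel)"
      by (simp add: mult.assoc)
    also have "ennreal (1 / \<theta> ^ CARD('d)) * ennreal (\<theta> ^ CARD('d)) = 1"
      using pos by (simp add: ennreal_mult[symmetric])
    finally show ?thesis by simp
  qed
  also have "(\<integral>\<^sup>+\<eta>. \<integral>\<^sup>+Y. F Y \<eta> \<partial>lborel \<partial>lborel) \<le> ennreal ((\<theta> * \<omega>) powr r) * E"
  proof -
    have "(\<integral>\<^sup>+\<eta>. \<integral>\<^sup>+Y. F Y \<eta> \<partial>lborel \<partial>lborel) \<le> (\<integral>\<^sup>+\<eta>. indicator (ball 0 (\<theta> * \<omega>)) \<eta> *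
        (\<integral>\<^sup>+X. indicator (segment_core (power_set \<Omega>) (axis j \<eta>) (real M)) X * ennreal ((fdiff M j \<eta> u X)\<^sup>2) \<partial>lborel) \<partial>lborel)"
    proof (intro nn_integral_mono)
      fix \<eta> :: "real^'d"
      show "(\<integral>\<^sup>+Y. F Y \<eta> \<partial>lborel) \<le> indicator (ball 0 (\<theta> * \<omega>)) \<eta> *
        (\<integral>\<^sup>+X. indicator (segment_core (power_set \<Omega>) (axis j \<eta>) (real M)) X * ennreal ((fdiff M j \<eta> u X)\<^sup>2) \<partial>lborel)"
      proof (cases "\<eta> \<in> ball 0 (\<theta> * \<omega>)")
        case True
        have "F Y \<eta> \<le> indicator (segment_core (power_set \<Omega>) (axis j \<eta>) (real M)) Y * ennreal ((fdiff M j \<eta> u Y)\<^sup>2)" for Y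
        proof (cases "Y \<in> power_set Q \<and> Y $ j + real M *\<^sub>R \<eta> \<in> Q")
          case Y: True
          have "Y \<in> segment_core (power_set \<Omega>) (axis j \<eta>) (real M)"
            unfolding segment_core_def power_set_def
          proof (clarify)
            fix t l assume t: "t \<in> {0..real M}"
            have YQ: "Y $ l \<in> Q" for l using Y by (auto simp: power_set_def)
            show "(Y + t *\<^sub>R axis j \<eta>) $ l \<in> \<Omega>"
            proof (cases "l = j")
              case True
              have "Y $ j + t *\<^sub>R \<eta> \<in> Q"
              proof (cases "M = 0")
                case False
                have "(1 - t / real M) *\<^sub>R Y $ j + (t / real M) *\<^sub>R (Y $ j + real M *\<^sub>R \<eta>) \<in> Q"
                  using t False Y YQ by (intro convexD_alt[OF Q(2)]) auto
                then show ?thesis using False by (simp add: algebra_simps)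
              qed (use t YQ in auto)
              then show ?thesis using Q(3) True by (auto simp: axis_def)
            next
              case False
              then show ?thesis using YQ[of l] Q(3) by (auto simp: axis_def)
            qed
          qed
          then show ?thesis by (simp add: F_def indicator_def)
        qed (auto simp: F_def indicator_def)
        then show ?thesis using True by (auto intro!: nn_integral_mono)
      qed (simp add: F_def)
    qed
    also have "\<dots> \<le> ennreal ((\<theta> * \<omega>) powr r) * E" using db pos by (simp add: difference_bound_def)
    finally show ?thesis .
  qed
  finally have "(\<integral>\<^sup>+z. \<integral>\<^sup>+W. indicator (ball 0 \<omega>) z * (indicator (power_set (ball 0 \<omega>)) W *
      ennreal ((fdiff M j (\<theta> *\<^sub>R W $ j) u (\<chi> l. P $ l + \<epsilon> l *\<^sub>R z + b l *\<^sub>R W $ l))\<^sup>2)) \<partial>lborel \<partial>lborel)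
    \<le> ennreal ?J * (ennreal (1 / \<theta> ^ CARD('d)) * (ennreal ((\<theta> * \<omega>) powr r) * E))"
    by (simp add: mult_left_mono)
  also have "\<dots> = ennreal (?J * (1 / \<theta> ^ CARD('d)) * (\<theta> * \<omega>) powr r) * E"
  proof -
    have "(\<Prod>l\<in>UNIV-{j}. b l ^ CARD('d)) > 0" using pos(3) by (intro prod_pos) simp
    then have "?J \<ge> 0" by simp
    moreover have "ennreal (a * b * c) = ennreal a * ennreal b * ennreal c" if "a \<ge> 0" "b \<ge> 0" "c \<ge> 0" for a b c
      using that by (simp add: ennreal_mult)
    ultimately have "ennreal (?J * (1 / \<theta> ^ CARD('d)) * (\<theta> * \<omega>) powr r)
        = ennreal ?J * ennreal (1 / \<theta> ^ CARD('d)) * ennreal ((\<theta> * \<omega>) powr r)"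
      using pos by (metis (no_types, lifting) powr_ge_zero zero_le_divide_1_iff zero_le_power less_imp_le)
    then show ?thesis by (simp only: mult.assoc)
  qed
  finally show ?thesis .
qed

section \<open>The trace on coinciding slots\<close>

text \<open>All trace estimates are integrated over one common translation and one increment per
  slot. The domain of integration stays fixed; smaller scales enter only as factors of the
  increments.\<close>

definition dint :: "real \<Rightarrow> ((real^'d) \<times> (real^'d^'n) \<Rightarrow> ennreal) \<Rightarrow> ennreal" where
  "dint \<omega> f = (\<integral>\<^sup>+p. indicator (ball 0 \<omega> \<times> power_set (ball 0 \<omega>)) p * f p \<partial>lborel)"

lemma open_dint_domain: "open (ball 0 \<omega> \<times> power_set (ball 0 \<omega>) :: ((real^'d) \<times> (real^'d^'n)) set)"
  by (intro open_Times open_ball open_power_set)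

lemma dint_measurable:
  fixes f :: "(real^'d) \<times> (real^'d^'n) \<Rightarrow> ennreal"
  assumes "f \<in> borel_measurable borel"
  shows "(\<lambda>p. indicator (ball 0 \<omega> \<times> power_set (ball 0 \<omega>)) p * f p) \<in> borel_measurable borel"
  by (intro borel_measurable_times_ennreal borel_measurable_indicator borel_open open_dint_domain assms)

lemma dint_iterated:
  fixes f :: "(real^'d) \<times> (real^'d^'n) \<Rightarrow> ennreal"
  assumes "f \<in> borel_measurable borel"
  shows "dint \<omega> f = (\<integral>\<^sup>+z. \<integral>\<^sup>+W. indicator (ball 0 \<omega>) z * (indicator (power_set (ball 0 \<omega>)) W * f (z, W)) \<partial>lborel \<partial>lborel)"
proof -
  let ?g = "\<lambda>p. indicator (ball 0 \<omega> \<times> power_set (ball 0 \<omega>)) p * f p"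
  have "?g \<in> borel_measurable (lborel \<Otimes>\<^sub>M lborel)"
    using dint_measurable[OF assms, of \<omega>] by (simp add: lborel_prod)
  from lborel.nn_integral_fst[OF this]
  have "dint \<omega> f = (\<integral>\<^sup>+z. \<integral>\<^sup>+W. ?g (z, W) \<partial>lborel \<partial>lborel)"
    by (simp add: dint_def lborel_prod)
  then show ?thesis by (simp add: indicator_times mult.assoc)
qed

lemma dint_mono:
  assumes "\<And>z W. z \<in> ball 0 \<omega> \<Longrightarrow> W \<in> power_set (ball 0 \<omega>) \<Longrightarrow> f (z, W) \<le> g (z, W)"
  shows "dint \<omega> f \<le> dint \<omega> g"
  unfolding dint_def using assms by (intro nn_integral_mono) (auto simp: indicator_def)

lemma dint_add:
  fixes f :: "(real^'d) \<times> (real^'d^'n) \<Rightarrow> ennreal"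
  assumes "f \<in> borel_measurable borel" "g \<in> borel_measurable borel"
  shows "dint \<omega> (\<lambda>p. f p + g p) = dint \<omega> f + dint \<omega> g"
  unfolding dint_def distrib_left
  using dint_measurable[OF assms(1), of \<omega>] dint_measurable[OF assms(2), of \<omega>]
  by (intro nn_integral_add) auto

lemma dint_cmult:
  fixes f :: "(real^'d) \<times> (real^'d^'n) \<Rightarrow> ennreal"
  assumes "f \<in> borel_measurable borel"
  shows "dint \<omega> (\<lambda>p. c * f p) = c * dint \<omega> f"
  unfolding dint_def using dint_measurable[OF assms, of \<omega>]
  by (subst nn_integral_cmult[symmetric]) (auto simp: mult_ac)

lemma dint_sum:
  fixes f :: "'i \<Rightarrow> (real^'d) \<times> (real^'d^'n) \<Rightarrow> ennreal"
  assumes "\<And>i. i \<in> A \<Longrightarrow> f i \<in> borel_measurable borel"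
  shows "dint \<omega> (\<lambda>p. \<Sum>i\<in>A. f i p) = (\<Sum>i\<in>A. dint \<omega> (f i))"
  unfolding dint_def sum_distrib_left using dint_measurable[OF assms, where \<omega> = \<omega>]
  by (intro nn_integral_sum) auto

lemma dint_suminf:
  fixes f :: "nat \<Rightarrow> (real^'d) \<times> (real^'d^'n) \<Rightarrow> ennreal"
  assumes "\<And>i. f i \<in> borel_measurable borel"
  shows "dint \<omega> (\<lambda>p. \<Sum>i. f i p) = (\<Sum>i. dint \<omega> (f i))"
  unfolding dint_def using dint_measurable[OF assms, where \<omega> = \<omega>]
  by (subst nn_integral_suminf[symmetric]) auto

text \<open>As x tends to 0, \<open>x 0\<close> is the sum of the increments, and Cauchy-Schwarz
  with geometric weights applies. The growing weights on the right are affordable when the squared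
  increments decay faster than the n-th power of \<mu>.\<close>

lemma telescoping_sq_le:
  fixes x :: "nat \<Rightarrow> real"
  assumes x: "x \<longlonglongrightarrow> 0" and \<mu>: "0 < \<mu>" "\<mu> < 1"
  shows "ennreal ((x 0)\<^sup>2) \<le> ennreal (1 / (1 - \<mu>)) * (\<Sum>n. ennreal ((1 / \<mu>) ^ n * (x n - x (Suc n))\<^sup>2))"
    (is "_ \<le> ?R")
proof -
  have "ennreal ((x 0 - x m)\<^sup>2) \<le> ?R" for m
  proof -
    have "x 0 - x m = (\<Sum>n<m. sqrt \<mu> ^ n * ((1 / sqrt \<mu>) ^ n * (x n - x (Suc n))))"
    proof -
      have "sqrt \<mu> ^ n * ((1 / sqrt \<mu>) ^ n * d) = d" for n d
        using \<mu> by (simp add: power_one_over)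
      then show ?thesis by (simp only: sum_lessThan_telescope'[symmetric])
    qed
    then have "(x 0 - x m)\<^sup>2 \<le> (\<Sum>n<m. (sqrt \<mu> ^ n)\<^sup>2) * (\<Sum>n<m. ((1 / sqrt \<mu>) ^ n * (x n - x (Suc n)))\<^sup>2)"
      using Cauchy_Schwarz_ineq_sum by simp
    also have "(\<Sum>n<m. (sqrt \<mu> ^ n)\<^sup>2) = (\<Sum>n<m. \<mu> ^ n)"
      using \<mu> by (simp add: power_mult[symmetric] mult.commute[of _ 2]) (simp add: power_mult)
    also have "(\<Sum>n<m. ((1 / sqrt \<mu>) ^ n * (x n - x (Suc n)))\<^sup>2) = (\<Sum>n<m. (1 / \<mu>) ^ n * (x n - x (Suc n))\<^sup>2)"
    proof (intro sum.cong refl)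
      fix n
      have "((1 / sqrt \<mu>) ^ n)\<^sup>2 = ((1 / sqrt \<mu>)\<^sup>2) ^ n" by (simp add: power_mult[symmetric] mult.commute)
      then show "((1 / sqrt \<mu>) ^ n * (x n - x (Suc n)))\<^sup>2 = (1 / \<mu>) ^ n * (x n - x (Suc n))\<^sup>2"
        using \<mu> by (simp add: power_mult_distrib power_divide)
    qed
    also have "(\<Sum>n<m. \<mu> ^ n) * (\<Sum>n<m. (1 / \<mu>) ^ n * (x n - x (Suc n))\<^sup>2)
        \<le> (1 / (1 - \<mu>)) * (\<Sum>n<m. (1 / \<mu>) ^ n * (x n - x (Suc n))\<^sup>2)"
    proof (rule mult_right_mono)
      have "(\<Sum>n<m. \<mu> ^ n) = (1 - \<mu> ^ m) / (1 - \<mu>)" using \<mu> by (simp add: sum_gp_strict)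
      also have "\<dots> \<le> 1 / (1 - \<mu>)" using \<mu> by (intro divide_right_mono) auto
      finally show "(\<Sum>n<m. \<mu> ^ n) \<le> 1 / (1 - \<mu>)" .
    qed (use \<mu> in \<open>auto intro!: sum_nonneg\<close>)
    finally have "ennreal ((x 0 - x m)\<^sup>2) \<le> ennreal (1 / (1 - \<mu>)) * (\<Sum>n<m. ennreal ((1 / \<mu>) ^ n * (x n - x (Suc n))\<^sup>2))"
      using \<mu> by (subst sum_ennreal) (auto simp: ennreal_mult[symmetric] sum_nonneg intro!: ennreal_leI)
    also have "\<dots> \<le> ?R" by (intro mult_left_mono sum_le_suminf) auto
    finally show ?thesis .
  qed
  moreover have "(\<lambda>m. ennreal ((x 0 - x m)\<^sup>2)) \<longlonglongrightarrow> ennreal ((x 0 - 0)\<^sup>2)"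
    by (intro tendsto_ennrealI tendsto_intros x)
  ultimately show ?thesis using LIMSEQ_le_const2 by fastforce
qed

text \<open>Slot l is extrapolated to a translated base point with step \<open>\<beta> l\<close>
  times its own increment. The translation is shared, so slots with equal base points meet exactly
  when their factors tend to 0.\<close>

definition scaled_tens :: "nat \<Rightarrow> real^'d^'n \<Rightarrow> ('n \<Rightarrow> real) \<Rightarrow> (real^'d^'n \<Rightarrow> real) \<Rightarrow> (real^'d) \<times> (real^'d^'n) \<Rightarrow> real" where
  "scaled_tens M P \<beta> u p = tens M UNIV (\<lambda>l i. P $ l + fst p + real i *\<^sub>R (\<beta> l *\<^sub>R snd p $ l)) u 0"

lemma scaled_tens_eq:
  "scaled_tens M P \<beta> u p = (\<Sum>a\<in>Pi\<^sub>E UNIV (\<lambda>_. {1..M}). (\<Prod>l\<in>UNIV. fd_coeff M (a l)) *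
     u (\<chi> l. P $ l + fst p + real (a l) *\<^sub>R (\<beta> l *\<^sub>R snd p $ l)))"
  by (simp add: scaled_tens_def tens_def)

lemma borel_measurable_scaled_tens:
  fixes u :: "real^'d^'n \<Rightarrow> real"
  assumes "u \<in> borel_measurable borel"
  shows "scaled_tens M P \<beta> u \<in> borel_measurable borel"
proof -
  have "scaled_tens M P \<beta> u = (\<lambda>p. \<Sum>a\<in>Pi\<^sub>E UNIV (\<lambda>_. {1..M}). (\<Prod>l\<in>UNIV. fd_coeff M (a l)) *
     u (\<chi> l. P $ l + fst p + real (a l) *\<^sub>R (\<beta> l *\<^sub>R snd p $ l)))"
    by (simp add: scaled_tens_eq fun_eq_iff)
  also have "\<dots> \<in> borel_measurable borel"
    by (intro borel_measurable_sum borel_measurable_times borel_measurable_const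
        borel_measurable_compose_continuous[OF assms] continuous_intros)
  finally show ?thesis .
qed

text \<open>The radius of the balls: the translation contributes \<omega>, an extrapolation point at
  most M \<omega>, and the M-th difference taken from there at most another M \<omega>.\<close>

definition trace_data :: "(real^'d) set \<Rightarrow> nat \<Rightarrow> real \<Rightarrow> (real^'d) set \<Rightarrow> real \<Rightarrow> real^'d^'n \<Rightarrow> (real^'d^'n \<Rightarrow> real) \<Rightarrow> ennreal \<Rightarrow> bool" where
  "trace_data \<Omega> M r Q \<omega> P u E \<longleftrightarrow> u \<in> borel_measurable borel \<and> difference_bound \<Omega> M r u E \<and>
    (\<forall>l. ball (P $ l) ((2 * real M + 1) * \<omega>) \<subseteq> Q)"

lemma in_fat_ball:
  fixes P :: "real^'d"
  assumes "ball P ((2 * real M + 1) * \<omega>) \<subseteq> Q" "z \<in> ball 0 \<omega>" "w \<in> ball 0 \<omega>" "\<bar>t\<bar> \<le> 2 * real M"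
  shows "P + z + t *\<^sub>R w \<in> Q"
proof -
  have "norm (z + t *\<^sub>R w) \<le> norm z + \<bar>t\<bar> * norm w" using norm_triangle_ineq[of z "t *\<^sub>R w"] by simp
  also have "\<dots> < \<omega> + 2 * real M * \<omega>" using assms by (intro add_less_le_mono mult_mono) auto
  finally have "P + z + t *\<^sub>R w \<in> ball P ((2 * real M + 1) * \<omega>)"
    by (simp add: dist_norm algebra_simps) (metis (no_types, lifting) minus_diff_eq norm_minus_cancel diff_minus_eq_add add.inverse_inverse minus_add_distrib)
  with assms(1) show ?thesis by blast
qed

text \<open>A step \<theta> of size at most 2^-n in slot j contributes \<theta>^(2 s), which is what
  remains of the bound for the differences after rescaling the increment. The other slots of S may
  already be halved, so their scale is only known to be at least 2^-(n + 1), and each of them costs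
  the inverse d-th power of its scale. Slots outside S have scale at least 1 and cost
  nothing.\<close>

lemma scaled_tens_step:
  fixes \<Omega> Q :: "(real^'d) set" and S :: "'n::finite set"
  assumes Q: "open Q" "convex Q" "Q \<subseteq> \<Omega>" and \<omega>: "\<omega> > 0" and s: "s > 0" and jS: "j \<in> S"
  shows "\<exists>K\<ge>0. \<forall>n \<beta> (P :: real^'d^'n) u E. trace_data \<Omega> M (2 * s + real CARD('d)) Q \<omega> P u E \<longrightarrow>
    (\<forall>l. 0 < \<beta> l \<and> \<beta> l \<le> 1) \<longrightarrow> (\<forall>l\<in>S. \<beta> l \<ge> (1/2) ^ Suc n) \<longrightarrow> (\<forall>l. l \<notin> S \<longrightarrow> \<beta> l = 1) \<longrightarrow> \<beta> j = (1/2) ^ n \<longrightarrow>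
    dint \<omega> (\<lambda>p. ennreal ((scaled_tens M P \<beta> u p - scaled_tens M P (\<beta>(j := \<beta> j / 2)) u p)\<^sup>2))
      \<le> ennreal (K * (2 powr (- (2 * s - (real (card S) - 1) * real CARD('d)))) ^ n) * E"
proof -
  let ?r = "2 * s + real CARD('d)"
  let ?lam = "2 powr (- (2 * s - (real (card S) - 1) * real CARD('d)))"
  let ?A = "Pi\<^sub>E (UNIV - {j}) (\<lambda>_. {1..M})"
  obtain D where D0: "D \<ge> 0" and D: "\<And>(e :: 'n \<Rightarrow> nat \<Rightarrow> real^'d) (u :: real^'d^'n \<Rightarrow> real) p h.
      (tens M UNIV (e(j := \<lambda>i. p + real i *\<^sub>R h)) u 0 - tens M UNIV (e(j := \<lambda>i. p + real i *\<^sub>R (h /\<^sub>R 2))) u 0)\<^sup>2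
    \<le> D * (\<Sum>i\<in>{1..M}. \<Sum>a\<in>?A.
        (fdiff M j h u (\<chi> l. if l = j then p + real i *\<^sub>R (h /\<^sub>R 2) else e l (a l)))\<^sup>2
      + (fdiff M j (h /\<^sub>R 2) u (\<chi> l. if l = j then p + real i *\<^sub>R h else e l (a l)))\<^sup>2)"
    using tens_halving_sq_le[where M = M and j = j and 'd = 'd] by blast
  define d where "d = CARD('d)"
  \<comment> \<open>The power of 2 is the surplus caused by using the scale 2^-(n + 1) instead of
    2^-n in the \<open>card S - 1\<close> other slots.\<close>
  define C where "C = 2 ^ (d * (card S - 1)) * \<omega> powr ?r"
  have C: "C \<ge> 0" by (simp add: C_def)
  have cS: "card S \<ge> 1" using jS by (simp add: Suc_le_eq card_gt_0_iff) auto
  have const: "(1 / (\<Prod>l\<in>UNIV-{j}. b l ^ CARD('d))) * (1 / \<theta> ^ CARD('d)) * (\<theta> * \<omega>) powr ?r \<le> C * ?lam ^ n"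
    if \<theta>: "0 < \<theta>" "\<theta> \<le> (1/2) ^ n" and b: "\<And>l. l \<noteq> j \<Longrightarrow> b l \<ge> (if l \<in> S then (1/2) ^ Suc n else 1)" for \<theta> n b
  proof -
    \<comment> \<open>Lower bound for the volume factor of one slot of S.\<close>
    define x :: real where "x = ((1/2) ^ Suc n) ^ d"
    have x: "x > 0" by (simp add: x_def)
    have "x ^ (card S - 1) = (\<Prod>l\<in>UNIV-{j}. if l \<in> S then x else 1)"
    proof -
      have "(\<Prod>l\<in>UNIV-{j}. if l \<in> S then x else 1) = (\<Prod>l\<in>(UNIV-{j}) \<inter> S. x)"
        by (subst prod.inter_restrict) auto
      also have "(UNIV-{j}) \<inter> S = S - {j}" by auto
      finally show ?thesis using jS by simp
    qed
    also have "\<dots> \<le> (\<Prod>l\<in>UNIV-{j}. b l ^ CARD('d))"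
    proof (rule prod_mono)
      fix l assume "l \<in> UNIV - {j}"
      then have bl: "b l \<ge> (if l \<in> S then (1/2) ^ Suc n else 1)" using b by simp
      show "0 \<le> (if l \<in> S then x else 1) \<and> (if l \<in> S then x else 1) \<le> b l ^ CARD('d)"
        using bl x power_mono[of "(1/2) ^ Suc n" "b l" d] one_le_power[of "b l" d]
        by (auto simp: x_def d_def simp del: power_Suc)
    qed
    finally have 1: "1 / (\<Prod>l\<in>UNIV-{j}. b l ^ CARD('d)) \<le> 1 / x ^ (card S - 1)"
      using x by (intro divide_left_mono) (auto intro!: mult_pos_pos intro: less_le_trans[OF zero_less_power])
    have "(1 / \<theta> ^ CARD('d)) * (\<theta> * \<omega>) powr ?r = \<theta> powr (2 * s) * \<omega> powr ?r"
      using \<theta> \<omega> by (simp add: powr_mult powr_add powr_realpow)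
    also have "\<dots> \<le> ((1/2) ^ n) powr (2 * s) * \<omega> powr ?r"
      using \<theta> s by (intro mult_right_mono powr_mono2) auto
    finally have 2: "(1 / \<theta> ^ CARD('d)) * (\<theta> * \<omega>) powr ?r \<le> ((1/2) ^ n) powr (2 * s) * \<omega> powr ?r" .
    have "(1 / (\<Prod>l\<in>UNIV-{j}. b l ^ CARD('d))) * ((1 / \<theta> ^ CARD('d)) * (\<theta> * \<omega>) powr ?r)
        \<le> (1 / x ^ (card S - 1)) * (((1/2) ^ n) powr (2 * s) * \<omega> powr ?r)"
      by (rule mult_mono[OF 1 2]) (use x \<theta> in auto)
    also have "\<dots> = C * ?lam ^ n"
    proof -
      have h: "(1/2 :: real) ^ m = 2 powr (- real m)" for m
        by (simp add: powr_minus powr_realpow power_one_over inverse_eq_divide)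
      have "1 / x ^ (card S - 1) = 2 powr (real (Suc n) * real d * (real (card S) - 1))"
      proof -
        have "x ^ (card S - 1) = (1/2) ^ (Suc n * d * (card S - 1))"
          by (simp add: x_def power_mult[symmetric] del: power_Suc)
        also have "\<dots> = 2 powr (- (real (Suc n) * real d * (real (card S) - 1)))"
        proof -
          have rc: "real (card S) - 1 = real (card S - 1)" using cS by (simp add: of_nat_diff)
          show ?thesis unfolding h rc of_nat_mult ..
        qed
        finally show ?thesis by (simp add: powr_minus inverse_eq_divide)
      qed
      moreover have "((1/2 :: real) ^ n) powr (2 * s) = 2 powr (- real n * (2 * s))"
        unfolding h by (simp add: powr_powr)
      moreover have "(2::real) ^ (d * (card S - 1)) = 2 powr (real d * (real (card S) - 1))"
        using cS by (simp add: powr_realpow[symmetric] of_nat_diff)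
      moreover have "?lam ^ n = 2 powr (- (2 * s - (real (card S) - 1) * real d) * real n)"
        by (simp add: powr_realpow[symmetric] powr_powr d_def)
      ultimately show ?thesis
        unfolding C_def by (simp add: powr_add[symmetric] mult_ac) (simp add: algebra_simps)
    qed
    finally show ?thesis by (simp add: mult.assoc)
  qed
  define m where "m = (\<Sum>i\<in>{1..M}. \<Sum>a\<in>?A. (2::real))"
  have m0: "m \<ge> 0" by (simp add: m_def sum_nonneg)
  have "dint \<omega> (\<lambda>p. ennreal ((scaled_tens M P \<beta> u p - scaled_tens M P (\<beta>(j := \<beta> j / 2)) u p)\<^sup>2))
      \<le> ennreal (D * (m * C) * ?lam ^ n) * E"
    if td: "trace_data \<Omega> M ?r Q \<omega> P u E" and \<beta>: "\<forall>l. 0 < \<beta> l \<and> \<beta> l \<le> 1" "\<forall>l\<in>S. \<beta> l \<ge> (1/2) ^ Suc n" "\<forall>l. l \<notin> S \<longrightarrow> \<beta> l = 1" "\<beta> j = (1/2) ^ n"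
    for n \<beta> and P :: "real^'d^'n" and u E
  proof -
    have u: "u \<in> borel_measurable borel" and db: "difference_bound \<Omega> M ?r u E"
      and PQ: "\<And>l. ball (P $ l) ((2 * real M + 1) * \<omega>) \<subseteq> Q" using td by (auto simp: trace_data_def)
    \<comment> \<open>\<open>b1\<close> and \<open>b2\<close> are the coefficients of the increments
      at the base points of the two differences in the halving identity: the full step is based at
      multiples of the halved one, and the halved step at multiples of the full one.\<close>
    define b1 where "b1 i a l = (if l = j then real i * \<beta> j / 2 else real (a l) * \<beta> l)" for i and a :: "'n \<Rightarrow> nat" and l
    define b2 where "b2 i a l = (if l = j then real i * \<beta> j else real (a l) * \<beta> l)" for i and a :: "'n \<Rightarrow> nat" and l
    define f where "f \<theta> b p = ennreal ((fdiff M j (\<theta> *\<^sub>R snd p $ j) u (\<chi> l. P $ l + 1 *\<^sub>R fst p + b l *\<^sub>R snd p $ l))\<^sup>2)"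
      for \<theta> and b :: "'n \<Rightarrow> real" and p
    have mf: "f \<theta> b \<in> borel_measurable borel" for \<theta> b
    proof -
      have "(\<lambda>p. fdiff M j (\<theta> *\<^sub>R snd p $ j) u (\<chi> l. P $ l + 1 *\<^sub>R fst p + b l *\<^sub>R snd p $ l)) \<in> borel_measurable borel"
        by (intro borel_measurable_fdiff[OF u] continuous_intros)
      then show ?thesis unfolding f_def[abs_def] by simp
    qed
    have each: "dint \<omega> (f \<theta> b) \<le> ennreal (C * ?lam ^ n) * E"
      if \<theta>: "0 < \<theta>" "\<theta> \<le> (1/2) ^ n" and b: "\<And>l. l \<noteq> j \<Longrightarrow> b l \<ge> (if l \<in> S then (1/2) ^ Suc n else 1)"
        "\<And>l. 0 < b l \<and> b l \<le> real M" for \<theta> b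
    proof -
      have \<theta>1: "\<theta> \<le> 1" using \<theta>(2) power_le_one[of "1/2 :: real" n] by simp
      have "dint \<omega> (f \<theta> b) = (\<integral>\<^sup>+z. \<integral>\<^sup>+W. indicator (ball 0 \<omega>) z * (indicator (power_set (ball 0 \<omega>)) W *
        ennreal ((fdiff M j (\<theta> *\<^sub>R W $ j) u (\<chi> l. P $ l + 1 *\<^sub>R z + b l *\<^sub>R W $ l))\<^sup>2)) \<partial>lborel \<partial>lborel)"
        unfolding dint_iterated[OF mf] f_def by simp
      also have "\<dots> \<le> ennreal ((1 / (\<Prod>l\<in>UNIV-{j}. b l ^ CARD('d))) * (1 / \<theta> ^ CARD('d)) * (\<theta> * \<omega>) powr ?r) * E"
      proof (rule fdiff_slots_bound[OF u db Q \<theta>(1) \<omega>])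
        fix z :: "real^'d" and W :: "real^'d^'n" assume z: "z \<in> ball 0 \<omega>" and W: "W \<in> power_set (ball 0 \<omega>)"
        then have Wl: "W $ l \<in> ball 0 \<omega>" for l by (simp add: power_set_def)
        show "P $ l + 1 *\<^sub>R z + b l *\<^sub>R W $ l \<in> Q" for l
          using in_fat_ball[OF PQ z Wl, of "b l"] b(2)[of l] by simp
        have "\<bar>b j + real M * \<theta>\<bar> \<le> 2 * real M"
        proof -
          have "real M * \<theta> \<le> real M * 1" "0 \<le> real M * \<theta>" using mult_left_mono[OF \<theta>1, of "real M"] \<theta>(1) by auto
          then show ?thesis using b(2)[of j] by linarith
        qed
        from in_fat_ball[OF PQ z Wl this, of j]
        show "P $ j + z + b j *\<^sub>R W $ j + (real M * \<theta>) *\<^sub>R W $ j \<in> Q" by (simp add: algebra_simps)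
      qed (use b in auto)
      also have "\<dots> \<le> ennreal (C * ?lam ^ n) * E"
        by (intro mult_right_mono ennreal_leI const \<theta> b(1)) auto
      finally show ?thesis .
    qed
    have pt: "ennreal ((scaled_tens M P \<beta> u p - scaled_tens M P (\<beta>(j := \<beta> j / 2)) u p)\<^sup>2)
        \<le> ennreal D * (\<Sum>i\<in>{1..M}. \<Sum>a\<in>?A. f (\<beta> j) (b1 i a) p + f (\<beta> j / 2) (b2 i a) p)" for p
    proof -
      obtain z W where p: "p = (z, W)" by (cases p)
      define e where "e = (\<lambda>l i. P $ l + z + real i *\<^sub>R (\<beta> l *\<^sub>R W $ l))"
      let ?h = "\<beta> j *\<^sub>R W $ j"
      have 5: "(\<beta> j *\<^sub>R W $ j) /\<^sub>R 2 = (\<beta> j / 2) *\<^sub>R W $ j" by simp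
      have 1: "scaled_tens M P \<beta> u p = tens M UNIV (e(j := \<lambda>i. (P $ j + z) + real i *\<^sub>R ?h)) u 0"
        unfolding scaled_tens_def p by (intro tens_cong) (auto simp: e_def)
      have 2: "scaled_tens M P (\<beta>(j := \<beta> j / 2)) u p = tens M UNIV (e(j := \<lambda>i. (P $ j + z) + real i *\<^sub>R (?h /\<^sub>R 2))) u 0"
        unfolding scaled_tens_def p 5 by (intro tens_cong) (auto simp: e_def)
      have 3: "(\<chi> l. if l = j then (P $ j + z) + real i *\<^sub>R ((\<beta> j / 2) *\<^sub>R W $ j) else e l (a l)) = (\<chi> l. P $ l + 1 *\<^sub>R z + b1 i a l *\<^sub>R W $ l)" for i a
        by (auto simp: vec_eq_iff b1_def e_def)
      have 4: "(\<chi> l. if l = j then (P $ j + z) + real i *\<^sub>R ?h else e l (a l)) = (\<chi> l. P $ l + 1 *\<^sub>R z + b2 i a l *\<^sub>R W $ l)" for i a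
        by (auto simp: vec_eq_iff b2_def e_def)
      have "(scaled_tens M P \<beta> u p - scaled_tens M P (\<beta>(j := \<beta> j / 2)) u p)\<^sup>2
        \<le> D * (\<Sum>i\<in>{1..M}. \<Sum>a\<in>?A.
          (fdiff M j (\<beta> j *\<^sub>R W $ j) u (\<chi> l. P $ l + 1 *\<^sub>R z + b1 i a l *\<^sub>R W $ l))\<^sup>2
         + (fdiff M j ((\<beta> j / 2) *\<^sub>R W $ j) u (\<chi> l. P $ l + 1 *\<^sub>R z + b2 i a l *\<^sub>R W $ l))\<^sup>2)" (is "_ \<le> D * ?S")
        using D[of e "P $ j + z" ?h u] unfolding 1 2 5 3 4 .
      then have "ennreal ((scaled_tens M P \<beta> u p - scaled_tens M P (\<beta>(j := \<beta> j / 2)) u p)\<^sup>2) \<le> ennreal (D * ?S)"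
        by (rule ennreal_leI)
      also have "ennreal (D * ?S) = ennreal D * ennreal ?S"
        by (intro ennreal_mult D0 sum_nonneg add_nonneg_nonneg zero_le_power2)
      also have "ennreal ?S = (\<Sum>i\<in>{1..M}. \<Sum>a\<in>?A. f (\<beta> j) (b1 i a) p + f (\<beta> j / 2) (b2 i a) p)"
        unfolding f_def p fst_conv snd_conv
        by (subst sum_ennreal[symmetric], simp add: sum_nonneg, intro sum.cong refl,
            subst sum_ennreal[symmetric], simp, intro sum.cong refl, rule ennreal_plus) simp_all
      finally show ?thesis .
    qed
    have "dint \<omega> (\<lambda>p. ennreal ((scaled_tens M P \<beta> u p - scaled_tens M P (\<beta>(j := \<beta> j / 2)) u p)\<^sup>2))
        \<le> dint \<omega> (\<lambda>p. ennreal D * (\<Sum>i\<in>{1..M}. \<Sum>a\<in>?A. f (\<beta> j) (b1 i a) p + f (\<beta> j / 2) (b2 i a) p))"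
      by (intro dint_mono pt)
    also have "\<dots> = ennreal D * (\<Sum>i\<in>{1..M}. \<Sum>a\<in>?A. dint \<omega> (f (\<beta> j) (b1 i a)) + dint \<omega> (f (\<beta> j / 2) (b2 i a)))"
      using mf by (simp add: dint_cmult dint_sum dint_add)
    also have "\<dots> \<le> ennreal D * (\<Sum>i\<in>{1..M}. \<Sum>a\<in>?A. ennreal (C * ?lam ^ n) * E + ennreal (C * ?lam ^ n) * E)"
    proof (intro mult_left_mono sum_mono add_mono)
      fix i a assume i: "i \<in> {1..M}" and a: "a \<in> ?A"
      have al: "1 \<le> a l" "a l \<le> M" if "l \<noteq> j" for l using a that by (auto simp: PiE_iff)
      have bl: "real (a l) * \<beta> l \<ge> (if l \<in> S then (1/2) ^ Suc n else 1)" if "l \<noteq> j" for l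
      proof -
        have "1 * \<beta> l \<le> real (a l) * \<beta> l" using al[OF that] \<beta>(1) by (intro mult_right_mono) (auto simp: less_imp_le)
        then show ?thesis using \<beta> by (auto intro: order_trans)
      qed
      have bM: "real c * \<beta> l \<le> real M" if "c \<le> M" for c l
        using mult_mono[of "real c" "real M" "\<beta> l" 1] that \<beta>(1) by (auto simp: less_imp_le)
      have bj: "0 < \<beta> j" using \<beta> by simp
      show "dint \<omega> (f (\<beta> j) (b1 i a)) \<le> ennreal (C * ?lam ^ n) * E"
      proof (rule each)
        show "(if l \<in> S then (1/2) ^ Suc n else 1) \<le> b1 i a l" if "l \<noteq> j" for l
          using bl[OF that] that by (simp add: b1_def)
        show "0 < b1 i a l \<and> b1 i a l \<le> real M" for l
        proof (cases "l = j")
          case True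
          then show ?thesis using bM[of i j] i bj by (simp add: b1_def)
        next
          case False
          then show ?thesis using bM[of "a l" l] al[of l] \<beta>(1) by (auto simp: b1_def)
        qed
      qed (use \<beta> in auto)
      show "dint \<omega> (f (\<beta> j / 2) (b2 i a)) \<le> ennreal (C * ?lam ^ n) * E"
      proof (rule each)
        show "(if l \<in> S then (1/2) ^ Suc n else 1) \<le> b2 i a l" if "l \<noteq> j" for l
          using bl[OF that] that by (simp add: b2_def)
        show "0 < b2 i a l \<and> b2 i a l \<le> real M" for l
        proof (cases "l = j")
          case True
          then show ?thesis using bM[of i j] i bj by (simp add: b2_def)
        next
          case False
          then show ?thesis using bM[of "a l" l] al[of l] \<beta>(1) by (auto simp: b2_def)
        qed
      qed (use \<beta> in auto)
    qed auto
    also have "\<dots> = ennreal D * (ennreal m * (ennreal (C * ?lam ^ n) * E))"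
    proof -
      have "ennreal m = (\<Sum>i\<in>{1..M}. \<Sum>a\<in>?A. ennreal 2)" unfolding m_def
        by (subst sum_ennreal[symmetric], rule sum_nonneg, simp, intro sum.cong refl, subst sum_ennreal[symmetric], simp, rule refl)
      then have "ennreal m * (ennreal (C * ?lam ^ n) * E) = (\<Sum>i\<in>{1..M}. \<Sum>a\<in>?A. ennreal 2 * (ennreal (C * ?lam ^ n) * E))"
        by (simp only: sum_distrib_right)
      moreover have "x + x = ennreal 2 * x" for x :: ennreal by (simp add: mult_2)
      ultimately show ?thesis by (simp only:)
    qed
    also have "\<dots> = ennreal (D * (m * C) * ?lam ^ n) * E"
      using D0 m0 C by (simp add: ennreal_mult mult.assoc)
    finally show ?thesis .
  qed
  then show ?thesis using D0 m0 C by (intro exI[of _ "D * (m * C)"]) auto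
qed


text \<open>Halvings are available for one slot at a time, so passing to the next scale is a sweep
  through S. The induction over T is carried out for all n at once; the constant of a sweep is
  therefore independent of n, and only \<open>lam ^ n\<close> remains to be summed.\<close>

lemma trace_bound:
  fixes \<Omega> Q :: "(real^'d) set" and S :: "'n::finite set"
  assumes Q: "open Q" "convex Q" "Q \<subseteq> \<Omega>" and \<omega>: "\<omega> > 0"
    and s: "s > 0" "2 * s > real CARD('d) * (real k - 1)" and S: "card S = k" "k \<ge> 1" and op: "open \<Omega>"
  shows "\<exists>K\<ge>0. \<forall>(P :: real^'d^'n) u E. trace_data \<Omega> M (2 * s + real CARD('d)) Q \<omega> P u E \<longrightarrow>
    continuous_on (power_set \<Omega>) u \<longrightarrow> (\<forall>X\<in>coinc k \<inter> power_set \<Omega>. u X = 0) \<longrightarrow> (\<forall>a\<in>S. \<forall>b\<in>S. P $ a = P $ b) \<longrightarrow>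
    dint \<omega> (\<lambda>p. ennreal ((scaled_tens M P (\<lambda>_. 1) u p)\<^sup>2)) \<le> ennreal K * E"
proof -
  let ?r = "2 * s + real CARD('d)"
  define lam where "lam = 2 powr (- (2 * s - (real (card S) - 1) * real CARD('d)))"
  have lam: "0 < lam" "lam < 1"
    using s S by (auto simp: lam_def powr_less_one mult.commute)
  \<comment> \<open>The scales during sweep n, with the slots of T already halved. When T is all of
    S, this is the start of sweep n + 1.\<close>
  define bet where "bet n T l = (if l \<in> T then (1/2) ^ Suc n else if l \<in> S then (1/2) ^ n else 1 :: real)"
    for n :: nat and T :: "'n set" and l
  let ?F = "\<lambda>P u n T p. scaled_tens M P (bet n T) u p"
  have step: "\<exists>K\<ge>0. \<forall>n (P :: real^'d^'n) u E. trace_data \<Omega> M ?r Q \<omega> P u E \<longrightarrow>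
    dint \<omega> (\<lambda>p. ennreal ((?F P u n {} p - ?F P u n T p)\<^sup>2)) \<le> ennreal (K * lam ^ n) * E" if "T \<subseteq> S" for T
    using finite[of T] that
  proof (induction T)
    case empty
    show ?case by (intro exI[of _ 0]) (simp add: dint_def)
  next
    case (insert j T)
    then have jS: "j \<in> S" and jT: "j \<notin> T" and TS: "T \<subseteq> S" by auto
    obtain K1 where K1: "K1 \<ge> 0" and k1: "\<And>n (P :: real^'d^'n) u E. trace_data \<Omega> M ?r Q \<omega> P u E \<Longrightarrow>
      dint \<omega> (\<lambda>p. ennreal ((?F P u n {} p - ?F P u n T p)\<^sup>2)) \<le> ennreal (K1 * lam ^ n) * E"
      using insert.IH[OF TS] by blast
    obtain K2 where K2: "K2 \<ge> 0" and k2: "\<And>n \<beta> (P :: real^'d^'n) u E. trace_data \<Omega> M ?r Q \<omega> P u E \<Longrightarrow>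
       (\<forall>l. 0 < \<beta> l \<and> \<beta> l \<le> 1) \<Longrightarrow> (\<forall>l\<in>S. \<beta> l \<ge> (1/2) ^ Suc n) \<Longrightarrow> (\<forall>l. l \<notin> S \<longrightarrow> \<beta> l = 1) \<Longrightarrow> \<beta> j = (1/2) ^ n \<Longrightarrow>
       dint \<omega> (\<lambda>p. ennreal ((scaled_tens M P \<beta> u p - scaled_tens M P (\<beta>(j := \<beta> j / 2)) u p)\<^sup>2)) \<le> ennreal (K2 * lam ^ n) * E"
      using scaled_tens_step[OF Q \<omega> s(1) jS, of M, folded lam_def] by blast
    have "dint \<omega> (\<lambda>p. ennreal ((?F P u n {} p - ?F P u n (insert j T) p)\<^sup>2)) \<le> ennreal (2 * (K1 + K2) * lam ^ n) * E"
      if td: "trace_data \<Omega> M ?r Q \<omega> P u E" for n and P :: "real^'d^'n" and u E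
    proof -
      have u: "u \<in> borel_measurable borel" using td by (simp add: trace_data_def)
      have upd: "bet n (insert j T) = (bet n T)(j := bet n T j / 2)"
        using jS jT by (auto simp: bet_def fun_eq_iff)
      have b2: "dint \<omega> (\<lambda>p. ennreal ((?F P u n T p - ?F P u n (insert j T) p)\<^sup>2)) \<le> ennreal (K2 * lam ^ n) * E"
        unfolding upd
      proof (rule k2[OF td])
        have le1: "(1/2 :: real) ^ i \<le> 1" for i by (rule power_le_one) auto
        have dec: "(1/2 :: real) ^ Suc n \<le> (1/2) ^ n" by simp
        show "\<forall>l. 0 < bet n T l \<and> bet n T l \<le> 1"
          using le1[of n] le1[of "Suc n"] by (auto simp: bet_def simp del: power_Suc)
        show "\<forall>l\<in>S. (1/2) ^ Suc n \<le> bet n T l"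
          using dec by (auto simp: bet_def simp del: power_Suc)
        show "\<forall>l. l \<notin> S \<longrightarrow> bet n T l = 1" using TS by (auto simp: bet_def)
        show "bet n T j = (1/2) ^ n" using jS jT by (simp add: bet_def)
      qed
      note mF = borel_measurable_scaled_tens[OF u]
      have m1: "(\<lambda>p. ennreal ((?F P u n A p - ?F P u n B p)\<^sup>2)) \<in> borel_measurable borel" for A B
        using mF[of M P "bet n A"] mF[of M P "bet n B"] by measurable
      have pt: "ennreal ((a - c)\<^sup>2) \<le> ennreal 2 * (ennreal ((a - b)\<^sup>2) + ennreal ((b - c)\<^sup>2))" for a b c :: real
      proof -
        have "(a - c)\<^sup>2 \<le> 2 * ((a - b)\<^sup>2 + (b - c)\<^sup>2)"
          using zero_le_power2[of "(a - b) - (b - c)"] by (simp add: power2_eq_square algebra_simps)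
        then have "ennreal ((a - c)\<^sup>2) \<le> ennreal (2 * ((a - b)\<^sup>2 + (b - c)\<^sup>2))" by (rule ennreal_leI)
        also have "\<dots> = ennreal 2 * (ennreal ((a - b)\<^sup>2) + ennreal ((b - c)\<^sup>2))"
          by (subst ennreal_mult) auto
        finally show ?thesis .
      qed
      have "dint \<omega> (\<lambda>p. ennreal ((?F P u n {} p - ?F P u n (insert j T) p)\<^sup>2))
          \<le> dint \<omega> (\<lambda>p. ennreal 2 * (ennreal ((?F P u n {} p - ?F P u n T p)\<^sup>2) + ennreal ((?F P u n T p - ?F P u n (insert j T) p)\<^sup>2)))"
        by (intro dint_mono pt)
      also have "\<dots> = ennreal 2 * (dint \<omega> (\<lambda>p. ennreal ((?F P u n {} p - ?F P u n T p)\<^sup>2)) + dint \<omega> (\<lambda>p. ennreal ((?F P u n T p - ?F P u n (insert j T) p)\<^sup>2)))"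
        by (subst dint_cmult[OF borel_measurable_add[OF m1 m1]], subst dint_add[OF m1 m1]) simp
      also have "\<dots> \<le> ennreal 2 * (ennreal (K1 * lam ^ n) * E + ennreal (K2 * lam ^ n) * E)"
        by (intro mult_left_mono add_mono k1[OF td] b2) simp
      also have "\<dots> = ennreal (2 * (K1 + K2) * lam ^ n) * E"
      proof -
        have "ennreal (2 * (K1 + K2) * lam ^ n) = ennreal 2 * (ennreal (K1 * lam ^ n) + ennreal (K2 * lam ^ n))"
          using K1 K2 lam by (subst ennreal_plus[symmetric], simp, simp, subst ennreal_mult[symmetric]) (auto simp: algebra_simps)
        then show ?thesis by (simp only: distrib_right mult.assoc)
      qed
      finally show ?thesis .
    qed
    then show ?case using K1 K2 by (intro exI[of _ "2 * (K1 + K2)"]) auto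
  qed
  have bet_Suc: "bet n S = bet (Suc n) {}" for n by (auto simp: bet_def)
  have bet_0: "bet 0 {} = (\<lambda>_. 1)" by (auto simp: bet_def)
  obtain K where K: "K \<ge> 0" and kk: "\<And>n (P :: real^'d^'n) u E. trace_data \<Omega> M ?r Q \<omega> P u E \<Longrightarrow>
      dint \<omega> (\<lambda>p. ennreal ((?F P u n {} p - ?F P u (Suc n) {} p)\<^sup>2)) \<le> ennreal (K * lam ^ n) * E"
    using step[OF order_refl] unfolding bet_Suc by blast
  \<comment> \<open>Half of the decay is spent on the weights of the telescoping sum. The other half
    still converges, because lam / \<mu> = \<mu>.\<close>
  define \<mu> where "\<mu> = sqrt lam"
  have \<mu>: "0 < \<mu>" "\<mu> < 1" "\<mu> * \<mu> = lam" using lam by (auto simp: \<mu>_def)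
  define C where "C = (1 / (1 - \<mu>)) * (K * (1 / (1 - \<mu>)))"
  have "dint \<omega> (\<lambda>p. ennreal ((scaled_tens M P (\<lambda>_. 1) u p)\<^sup>2)) \<le> ennreal C * E"
    if td: "trace_data \<Omega> M ?r Q \<omega> P u E" and cont: "continuous_on (power_set \<Omega>) u"
      and zero: "\<forall>X\<in>coinc k \<inter> power_set \<Omega>. u X = 0" and PS: "\<forall>a\<in>S. \<forall>b\<in>S. P $ a = P $ b"
    for P :: "real^'d^'n" and u E
  proof -
    have u: "u \<in> borel_measurable borel" using td by (simp add: trace_data_def)
    have PQ: "\<And>l. ball (P $ l) ((2 * real M + 1) * \<omega>) \<subseteq> Q" using td by (auto simp: trace_data_def)
    note mF = borel_measurable_scaled_tens[OF u]
    let ?d = "\<lambda>n p. ennreal ((1 / \<mu>) ^ n * (?F P u n {} p - ?F P u (Suc n) {} p)\<^sup>2)"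
    have md: "(\<lambda>p. ennreal ((?F P u n {} p - ?F P u (Suc n) {} p)\<^sup>2)) \<in> borel_measurable borel" for n
      using mF[of M P "bet n {}"] mF[of M P "bet (Suc n) {}"] by measurable
    have md': "?d n \<in> borel_measurable borel" for n
      using mF[of M P "bet n {}"] mF[of M P "bet (Suc n) {}"] by measurable
    have lim: "(\<lambda>n. ?F P u n {} (z, W)) \<longlonglongrightarrow> 0" if z: "z \<in> ball 0 \<omega>" and W: "W \<in> power_set (ball 0 \<omega>)" for z W
    proof -
      have Wl: "W $ l \<in> ball 0 \<omega>" for l using W by (simp add: power_set_def)
      have each: "(\<lambda>n. u (\<chi> l. P $ l + z + real (a l) *\<^sub>R (bet n {} l *\<^sub>R W $ l))) \<longlonglongrightarrow> 0"
        if a: "a \<in> Pi\<^sub>E UNIV (\<lambda>_. {1..M})" for a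
      proof -
        \<comment> \<open>The limit configuration: in the slots of S the increments disappear and
          all of them sit at the common base point plus z; in the other slots the increments
          persist.\<close>
        define Y where "Y = (\<chi> l. P $ l + z + (if l \<in> S then 0 else real (a l)) *\<^sub>R W $ l)"
        have Ylim: "(\<lambda>n. \<chi> l. P $ l + z + real (a l) *\<^sub>R (bet n {} l *\<^sub>R W $ l)) \<longlonglongrightarrow> Y"
        proof (rule vec_tendstoI)
          fix l
          have "(\<lambda>n. bet n {} l) \<longlonglongrightarrow> (if l \<in> S then 0 else 1)"
            by (cases "l \<in> S") (auto simp: bet_def intro!: LIMSEQ_power_zero)
          then have "(\<lambda>n. P $ l + z + real (a l) *\<^sub>R (bet n {} l *\<^sub>R W $ l)) \<longlonglongrightarrow> P $ l + z + real (a l) *\<^sub>R ((if l \<in> S then 0 else 1) *\<^sub>R W $ l)"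
            by (intro tendsto_intros)
          then show "(\<lambda>n. (\<chi> l. P $ l + z + real (a l) *\<^sub>R (bet n {} l *\<^sub>R W $ l)) $ l) \<longlonglongrightarrow> Y $ l"
            by (auto simp: Y_def split: if_splits)
        qed
        have Y\<Omega>: "Y \<in> power_set \<Omega>"
        proof -
          have "Y $ l \<in> Q" for l
          proof -
            have "\<bar>if l \<in> S then 0 else real (a l)\<bar> \<le> 2 * real M" using a by (auto simp: PiE_iff intro: order_trans[of _ "real M"])
            from in_fat_ball[OF PQ z Wl this, of l l] show ?thesis by (simp add: Y_def)
          qed
          then show ?thesis using Q(3) by (auto simp: power_set_def)
        qed
        have "isCont u Y"
          using cont Y\<Omega> continuous_on_eq_continuous_at[OF open_power_set[OF op]] by blast
        from isCont_tendsto_compose[OF this Ylim]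
        have "(\<lambda>n. u (\<chi> l. P $ l + z + real (a l) *\<^sub>R (bet n {} l *\<^sub>R W $ l))) \<longlonglongrightarrow> u Y" .
        moreover have "Y \<in> coinc k"
        proof -
          have "Y $ a = Y $ b" if "a \<in> S" "b \<in> S" for a b
            using PS[rule_format, OF that] that by (simp add: Y_def)
          then show ?thesis unfolding coinc_def using S(1) by blast
        qed
        then have "u Y = 0" using zero Y\<Omega> by blast
        ultimately show ?thesis by metis
      qed
      have "(\<lambda>n. \<Sum>a\<in>Pi\<^sub>E UNIV (\<lambda>_. {1..M}). (\<Prod>l\<in>UNIV. fd_coeff M (a l)) * u (\<chi> l. P $ l + z + real (a l) *\<^sub>R (bet n {} l *\<^sub>R W $ l)))
        \<longlonglongrightarrow> (\<Sum>a\<in>Pi\<^sub>E (UNIV :: 'n set) (\<lambda>_. {1..M}). (\<Prod>l\<in>UNIV. fd_coeff M (a l)) * 0)"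
      proof (rule tendsto_sum)
        fix a :: "'n \<Rightarrow> nat" assume "a \<in> Pi\<^sub>E UNIV (\<lambda>_. {1..M})"
        from tendsto_mult[OF tendsto_const each[OF this]]
        show "(\<lambda>n. (\<Prod>l\<in>UNIV. fd_coeff M (a l)) * u (\<chi> l. P $ l + z + real (a l) *\<^sub>R (bet n {} l *\<^sub>R W $ l)))
          \<longlonglongrightarrow> (\<Prod>l\<in>UNIV. fd_coeff M (a l)) * 0" .
      qed
      then show ?thesis by (simp add: scaled_tens_eq)
    qed
    have "dint \<omega> (\<lambda>p. ennreal ((scaled_tens M P (\<lambda>_. 1) u p)\<^sup>2)) \<le> dint \<omega> (\<lambda>p. ennreal (1 / (1 - \<mu>)) * (\<Sum>n. ?d n p))"
      using telescoping_sq_le[OF lim \<mu>(1,2)] by (intro dint_mono) (simp add: bet_0)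
    also have "\<dots> = ennreal (1 / (1 - \<mu>)) * (\<Sum>n. dint \<omega> (?d n))"
      using md' by (subst dint_cmult) (auto simp: dint_suminf)
    also have "(\<Sum>n. dint \<omega> (?d n)) \<le> (\<Sum>n. ennreal (K * \<mu> ^ n) * E)"
    proof (intro suminf_le allI summableI)
      fix n
      have "dint \<omega> (?d n) = ennreal ((1 / \<mu>) ^ n) * dint \<omega> (\<lambda>p. ennreal ((?F P u n {} p - ?F P u (Suc n) {} p)\<^sup>2))"
        using \<mu> by (subst dint_cmult[OF md, symmetric]) (simp add: ennreal_mult)
      also have "\<dots> \<le> ennreal ((1 / \<mu>) ^ n) * (ennreal (K * lam ^ n) * E)"
        by (intro mult_left_mono kk[OF td]) simp
      also have "\<dots> = ennreal ((1 / \<mu>) ^ n * (K * lam ^ n)) * E"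
        using \<mu> K lam by (subst ennreal_mult) (auto simp: mult.assoc)
      also have "(1 / \<mu>) ^ n * (K * lam ^ n) = K * \<mu> ^ n"
        using \<mu>(1) unfolding \<mu>(3)[symmetric] by (simp add: power_mult_distrib power_one_over)
      finally show "dint \<omega> (?d n) \<le> ennreal (K * \<mu> ^ n) * E" .
    qed
    also have "(\<Sum>n. ennreal (K * \<mu> ^ n) * E) = ennreal (K * (1 / (1 - \<mu>))) * E"
    proof -
      have "(\<lambda>n. K * \<mu> ^ n) sums (K * (1 / (1 - \<mu>)))"
        using \<mu> by (intro sums_mult geometric_sums) auto
      then have "(\<Sum>n. ennreal (K * \<mu> ^ n)) = ennreal (K * (1 / (1 - \<mu>)))"
        using K \<mu> by (subst suminf_ennreal2) (auto simp: sums_iff)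
      then show ?thesis by (simp add: ennreal_suminf_multc)
    qed
    finally have "dint \<omega> (\<lambda>p. ennreal ((scaled_tens M P (\<lambda>_. 1) u p)\<^sup>2)) \<le> ennreal (1 / (1 - \<mu>)) * (ennreal (K * (1 / (1 - \<mu>))) * E)"
      by (simp add: mult_left_mono)
    also have "\<dots> = ennreal C * E"
      unfolding C_def using K \<mu> by (subst ennreal_mult) (auto simp: mult.assoc)
    finally show ?thesis .
  qed
  moreover have "C \<ge> 0" using K \<mu> by (simp add: C_def)
  ultimately show ?thesis by blast
qed

section \<open>Taylor remainders\<close>

text \<open>With b = 0 this is the integrand of the seminorm of integer order m, with b = 1 the
  numerator in the fractional one, so one argument covers both.\<close>

definition top_difference :: "'n \<Rightarrow> nat \<Rightarrow> real \<Rightarrow> (real^'d^'n \<Rightarrow> real) \<Rightarrow> real^'d \<Rightarrow> real^'d^'n \<Rightarrow> real" where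
  "top_difference j m b u w Z = (\<Sum>\<alpha>\<in>(multi_indices m :: ('d \<Rightarrow> nat) set).
     (fact m / mfact \<alpha>) * (Dalpha j \<alpha> u Z - b * Dalpha j \<alpha> u (upd_pt Z j w))\<^sup>2)"

lemma top_difference_nonneg: "top_difference j m b u w Z \<ge> 0"
  unfolding top_difference_def
  by (intro sum_nonneg mult_nonneg_nonneg divide_nonneg_nonneg) (auto simp: mfact_def prod_nonneg)

text \<open>The top-order coefficients are taken at w instead of y, which only needs fractional
  differences of the derivatives of order m. With b = 0 this is the Taylor polynomial of
  degree below m at y.\<close>
definition taylor_part :: "'n \<Rightarrow> nat \<Rightarrow> real \<Rightarrow> (real^'d^'n \<Rightarrow> real) \<Rightarrow> real^'d \<Rightarrow> real^'d \<Rightarrow> real^'d^'n \<Rightarrow> real" where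
  "taylor_part j m b u y w X =
    (\<Sum>l<m. (1 / fact l) * (\<Sum>v\<in>words l. prod_list (map (($) (X $ j - y)) v) * word_deriv j v u (upd_pt X j y)))
    + (b / fact m) * (\<Sum>v\<in>words m. prod_list (map (($) (X $ j - y)) v) * word_deriv j v u (upd_pt X j w))"

lemma upd_pt_upd_pt [simp]: "upd_pt (upd_pt X j a) j b = upd_pt X j b"
  by (simp add: vec_eq_iff)

lemma upd_pt_same [simp]: "upd_pt X j (X $ j) = X"
  by (simp add: vec_eq_iff)

lemma upd_pt_axis: "upd_pt X j (a + t *\<^sub>R v) = upd_pt X j a + t *\<^sub>R axis j v"
  by (simp add: vec_eq_iff axis_def)

lemma power_set_nth: "X \<in> power_set Q \<Longrightarrow> X $ l \<in> Q"
  by (simp add: power_set_def)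

lemma power_set_mono: "Q \<subseteq> \<Omega> \<Longrightarrow> power_set Q \<subseteq> power_set \<Omega>"
  by (auto simp: power_set_def)

definition word_const :: "nat \<Rightarrow> 'd::finite itself \<Rightarrow> real" where
  "word_const m _ = (real (card (words m :: 'd list set)))\<^sup>2 * (\<Sum>\<alpha>\<in>multi_indices m. mfact (\<alpha> :: 'd \<Rightarrow> nat))"

lemma word_const_nonneg: "word_const m TYPE('d::finite) \<ge> 0"
  unfolding word_const_def by (auto intro!: mult_nonneg_nonneg sum_nonneg prod_nonneg simp: mfact_def)

text \<open>Taylor's formula with integral remainder along the segment from y to
  \<open>X $ j\<close>. The kernel has total mass 1 / m!, so a constant may be subtracted from the
  top-order derivative under the integral; this produces the top-order part of
  \<open>taylor_part\<close> with its derivatives taken at w.\<close>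

lemma taylor_remainder_le:
  fixes \<Omega> Q :: "(real^'d) set" and u :: "real^'d^'n \<Rightarrow> real"
  assumes u: "smooth_on (power_set \<Omega>) u" and \<Omega>: "open \<Omega>" and Q: "convex Q" "Q \<subseteq> \<Omega>" and m: "m \<ge> 1"
    and X: "X \<in> power_set Q" and y: "y \<in> Q" and w: "w \<in> Q" and L: "norm (X $ j - y) \<le> L"
  shows "ennreal ((u X - taylor_part j m b u y w X)\<^sup>2) \<le> ennreal (word_const m TYPE('d) * L ^ (2 * m)) *
    (\<integral>\<^sup>+t. indicator {0..1} t * ennreal (top_difference j m b u w (upd_pt X j (y + t *\<^sub>R (X $ j - y)))) \<partial>lborel)"
proof -
  let ?U = "power_set \<Omega> :: (real^'d^'n) set"
  have U: "open ?U" by (rule open_power_set[OF \<Omega>])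
  define \<xi> where "\<xi> = X $ j - y"
  define Y where "Y = upd_pt X j y"
  define Z where "Z t = Y + t *\<^sub>R axis j \<xi>" for t
  have Z: "Z t = upd_pt X j (y + t *\<^sub>R (X $ j - y))" for t
    by (simp add: Z_def Y_def \<xi>_def upd_pt_axis)
  have Z01: "Z 0 = Y" "Z 1 = X" by (simp add: Z_def, simp add: Z)
  have ZU: "Z t \<in> ?U" if "t \<in> {0..1}" for t
  proof -
    have "(1 - t) *\<^sub>R y + t *\<^sub>R X $ j \<in> Q" using that power_set_nth[OF X, of j] y by (intro convexD_alt[OF Q(1)]) auto
    then have "y + t *\<^sub>R (X $ j - y) \<in> Q" by (simp add: algebra_simps)
    then have "Z t \<in> power_set Q" unfolding Z by (rule upd_pt_in_power_set[OF X])
    then show ?thesis using power_set_mono[OF Q(2)] by blast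
  qed
  have Zw: "upd_pt (Z t) j w = upd_pt X j w" for t by (simp add: Z)
  have wU: "upd_pt X j w \<in> ?U" using upd_pt_in_power_set[OF X w] power_set_mono[OF Q(2)] by blast
  define D where "D i t = foldr dir_deriv (replicate i (axis j \<xi>)) u (Z t)" for i t
  \<comment> \<open>The constant subtracted from the top-order derivative: it is the same all along
    the segment, because w replaces the only slot that varies there.\<close>
  define g where "g = b * (\<Sum>v\<in>words m. prod_list (map (($) \<xi>) v) * word_deriv j v u (upd_pt X j w))"
  define k where "k t = (1 - t) ^ (m - 1) / fact (m - 1) * (D m t - g)" for t :: real
  have vd: "(D i has_vector_derivative D (Suc i) t) (at t within {0..1})" if "t \<in> {0..1}" for i t
  proof -
    have "foldr dir_deriv (replicate i (axis j \<xi>)) u differentiable (at (Y + t *\<^sub>R axis j \<xi>))"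
      using smooth_on_foldr_differentiable[OF u U ZU[OF that], of "replicate i (axis j \<xi>)"] by (simp add: Z_def)
    from has_vector_derivative_dir_deriv[OF this, of "{0..1}"] show ?thesis
      by (simp add: D_def[abs_def] Z_def[abs_def])
  qed
  have "((\<lambda>t. ((1 - t) ^ (m - 1) / fact (m - 1)) *\<^sub>R D m t) has_integral
      D 0 1 - (\<Sum>i<m. ((1 - 0) ^ i / fact i) *\<^sub>R D i 0)) {0..1}"
    by (rule Taylor_has_integral[where Df = D]) (use m vd in auto)
  moreover have "((\<lambda>t. (1 - t) ^ (m - 1) / fact (m - 1) * g) has_integral (1 / fact m * g)) {0..1}"
  proof -
    have "((\<lambda>t. (1 - t) ^ (m - 1)) has_integral (- ((1 - 1) ^ m / real m) - (- ((1 - 0) ^ m / real m)))) {0..1::real}"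
    proof (rule fundamental_theorem_of_calculus)
      show "((\<lambda>t. - ((1 - t) ^ m / real m)) has_vector_derivative (1 - t) ^ (m - 1)) (at t within {0..1})" for t :: real
        unfolding has_real_derivative_iff_has_vector_derivative[symmetric]
        using m by (auto intro!: derivative_eq_intros simp: field_simps)
    qed simp
    then have "((\<lambda>t. (1 - t) ^ (m - 1)) has_integral (1 / real m)) {0..1::real}"
      using m by (simp add: zero_power)
    from has_integral_mult_left[OF this, of "g / fact (m - 1)"]
    have "((\<lambda>t. (1 - t) ^ (m - 1) * (g / fact (m - 1))) has_integral (1 / real m * (g / fact (m - 1)))) {0..1}" .
    moreover have "fact m = real m * fact (m - 1)" using m by (simp add: fact_reduce)
    ultimately show ?thesis by simp
  qed
  ultimately have "(k has_integral (D 0 1 - (\<Sum>i<m. ((1 - 0) ^ i / fact i) *\<^sub>R D i 0) - 1 / fact m * g)) {0..1}"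
    unfolding k_def[abs_def] by (auto dest: has_integral_diff simp: right_diff_distrib)
  also have "D 0 1 - (\<Sum>i<m. ((1 - 0) ^ i / fact i) *\<^sub>R D i 0) - 1 / fact m * g = u X - taylor_part j m b u y w X"
  proof -
    have "D i 0 = (\<Sum>v\<in>words i. prod_list (map (($) \<xi>) v) * word_deriv j v u Y)" for i
      unfolding D_def foldr_dir_deriv_replicate_words[OF u U ZU[of 0, simplified]] by (simp add: Z01)
    then show ?thesis
      by (simp add: taylor_part_def g_def \<xi>_def[symmetric] Y_def[symmetric]) (simp add: D_def Z01)
  qed
  finally have int: "(k has_integral (u X - taylor_part j m b u y w X)) {0..1}" .
  have contD: "continuous_on {0..1} (D m)"
    unfolding D_def[abs_def]
    by (rule continuous_on_compose2[OF smooth_on_foldr_continuous[OF u]])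
       (auto simp: Z_def[abs_def] intro!: continuous_intros ZU[unfolded Z_def])
  have contk: "continuous_on {0..1} k"
    unfolding k_def[abs_def] by (intro continuous_intros contD) auto
  have "ennreal ((u X - taylor_part j m b u y w X)\<^sup>2) \<le> (\<integral>\<^sup>+t. indicator {0..1} t * ennreal ((k t)\<^sup>2) \<partial>lborel)"
    by (rule power2_integral_le_nn_integral[OF int contk])
  also have "\<dots> \<le> (\<integral>\<^sup>+t. ennreal (word_const m TYPE('d) * L ^ (2 * m)) * (indicator {0..1} t * ennreal (top_difference j m b u w (Z t))) \<partial>lborel)"
  proof (intro nn_integral_mono)
    fix t :: real
    show "indicator {0..1} t * ennreal ((k t)\<^sup>2) \<le> ennreal (word_const m TYPE('d) * L ^ (2 * m)) * (indicator {0..1} t * ennreal (top_difference j m b u w (Z t)))"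
    proof (cases "t \<in> {0..1}")
      case True
      have "0 \<le> (1 - t) ^ (m - 1)" "(1 - t) ^ (m - 1) \<le> 1" using True by (auto intro!: power_le_one)
      then have "0 \<le> (1 - t) ^ (m - 1) / fact (m - 1)" "(1 - t) ^ (m - 1) / fact (m - 1) \<le> 1"
        using fact_ge_1[of "m - 1", where 'a = real] by (auto simp: divide_le_eq intro: order_trans)
      then have "((1 - t) ^ (m - 1) / fact (m - 1))\<^sup>2 \<le> 1" by (simp add: power_le_one)
      then have "(k t)\<^sup>2 \<le> 1 * (D m t - g)\<^sup>2" unfolding k_def power_mult_distrib by (rule mult_right_mono) simp
      also have "D m t - g = (\<Sum>v\<in>words m. prod_list (map (($) \<xi>) v) * (word_deriv j v u (Z t) - b * word_deriv j v u (upd_pt X j w)))"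
        unfolding D_def foldr_dir_deriv_replicate_words[OF u U ZU[OF True]] g_def sum_distrib_left
        by (simp add: sum_subtractf[symmetric] algebra_simps)
      also have "1 * (\<dots>)\<^sup>2 \<le> word_const m TYPE('d) * norm \<xi> ^ (2 * m) * top_difference j m b u w (Z t)"
        using word_sum_sq_le[OF u U ZU[OF True] wU, where b = b and m = m and \<eta> = \<xi> and j = j]
        by (simp add: word_const_def top_difference_def Zw mult_ac)
      also have "\<dots> \<le> word_const m TYPE('d) * L ^ (2 * m) * top_difference j m b u w (Z t)"
        using L word_const_nonneg[of m, where 'd = 'd] top_difference_nonneg[of j m b u w "Z t"]
        by (intro mult_right_mono mult_left_mono power_mono) (auto simp: \<xi>_def)
      finally show ?thesis
        using True word_const_nonneg[of m, where 'd = 'd] top_difference_nonneg[of j m b u w "Z t"]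
        by (simp add: ennreal_mult''[symmetric] ennreal_leI)
    qed simp
  qed
  also have "\<dots> = ennreal (word_const m TYPE('d) * L ^ (2 * m)) * (\<integral>\<^sup>+t. indicator {0..1} t * ennreal (top_difference j m b u w (Z t)) \<partial>lborel)"
  proof (rule nn_integral_cmult)
    have "continuous_on {0..1} (\<lambda>t. top_difference j m b u w (Z t))"
      unfolding top_difference_def Zw Dalpha_conv_word_deriv word_deriv_def
      by (intro continuous_intros continuous_on_compose2[OF smooth_on_foldr_continuous[OF u]])
         (auto simp: Z_def[abs_def] intro!: continuous_intros ZU[unfolded Z_def])
    then have "(\<lambda>t. indicator {0..1} t *\<^sub>R top_difference j m b u w (Z t)) \<in> borel_measurable borel"
      by (intro borel_measurable_continuous_on_indicator) auto
    then have "(\<lambda>t. ennreal (indicator {0..1} t *\<^sub>R top_difference j m b u w (Z t))) \<in> borel_measurable lborel" by simp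
    also have "(\<lambda>t. ennreal (indicator {0..1} t *\<^sub>R top_difference j m b u w (Z t))) = (\<lambda>t. indicator {0..1} t * ennreal (top_difference j m b u w (Z t)))"
      by (auto simp: indicator_def)
    finally show "(\<lambda>t. indicator {0..1} t * ennreal (top_difference j m b u w (Z t))) \<in> borel_measurable lborel" .
  qed
  finally show ?thesis unfolding Z .
qed

text \<open>For t at least 1/2 substitute in the slot j of X, otherwise in y.\<close>
lemma nn_integral_segment_le:
  fixes Q :: "(real^'d) set" and \<Psi> :: "real^'d^'n \<Rightarrow> ennreal"
  assumes Q: "open Q" "convex Q" and \<Psi>: "\<Psi> \<in> borel_measurable borel"
  shows "(\<integral>\<^sup>+y. indicator Q y * (\<integral>\<^sup>+X. indicator (power_set Q) X *
      (\<integral>\<^sup>+t. indicator {0..1::real} t * \<Psi> (upd_pt X j (y + t *\<^sub>R (X $ j - y))) \<partial>lborel) \<partial>lborel) \<partial>lborel)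
    \<le> ennreal (2 ^ CARD('d)) * emeasure lborel Q * (\<integral>\<^sup>+X. indicator (power_set Q) X * \<Psi> X \<partial>lborel)"
proof -
  let ?N = "power_set Q :: (real^'d^'n) set"
  have oN: "open ?N" by (rule open_power_set[OF Q(1)])
  let ?I = "\<integral>\<^sup>+X. indicator ?N X * \<Psi> X \<partial>lborel"
  define k where "k y X t = indicator Q y * (indicator ?N X * (indicator {0..1::real} t * \<Psi> (upd_pt X j (y + t *\<^sub>R (X $ j - y)))))" for y X t
  have mk: "(\<lambda>p. k (f p) (g p) (h p)) \<in> borel_measurable borel"
    if "continuous_on UNIV f" "continuous_on UNIV g" "continuous_on UNIV h" for f g h
  proof -
    have ind: "(\<lambda>p. indicator {0..1::real} (h p) :: ennreal) \<in> borel_measurable borel"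
      by (rule borel_measurable_compose_continuous[OF _ that(3)]) auto
    have "(\<lambda>p. \<Psi> (upd_pt (g p) j (f p + h p *\<^sub>R (g p $ j - f p)))) \<in> borel_measurable borel"
      by (intro borel_measurable_compose_continuous[OF \<Psi>] continuous_intros that)
    then show ?thesis
      unfolding k_def
      by (intro borel_measurable_times_ennreal ind borel_measurable_indicator_compose[OF Q(1) that(1)]
            borel_measurable_indicator_compose[OF oN that(2)])
  qed
  have "(\<integral>\<^sup>+y. indicator Q y * (\<integral>\<^sup>+X. indicator ?N X *
      (\<integral>\<^sup>+t. indicator {0..1::real} t * \<Psi> (upd_pt X j (y + t *\<^sub>R (X $ j - y))) \<partial>lborel) \<partial>lborel) \<partial>lborel)
    = (\<integral>\<^sup>+y. \<integral>\<^sup>+X. \<integral>\<^sup>+t. k y X t \<partial>lborel \<partial>lborel \<partial>lborel)"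
  proof (intro nn_integral_cong)
    fix y
    have "indicator Q y * (\<integral>\<^sup>+X. indicator ?N X * F X \<partial>lborel) = (\<integral>\<^sup>+X. indicator Q y * (indicator ?N X * F X) \<partial>lborel)"
      for F :: "real^'d^'n \<Rightarrow> ennreal" by (cases "y \<in> Q") auto
    moreover have "indicator Q y * (indicator ?N X * (\<integral>\<^sup>+t. F t \<partial>lborel)) = (\<integral>\<^sup>+t. indicator Q y * (indicator ?N X * F t) \<partial>lborel)"
      for F :: "real \<Rightarrow> ennreal" and X by (cases "y \<in> Q"; cases "X \<in> ?N") auto
    ultimately show "indicator Q y * (\<integral>\<^sup>+X. indicator ?N X *
      (\<integral>\<^sup>+t. indicator {0..1::real} t * \<Psi> (upd_pt X j (y + t *\<^sub>R (X $ j - y))) \<partial>lborel) \<partial>lborel) = (\<integral>\<^sup>+X. \<integral>\<^sup>+t. k y X t \<partial>lborel \<partial>lborel)"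
      by (simp only: k_def)
  qed
  also have "\<dots> = (\<integral>\<^sup>+y. \<integral>\<^sup>+t. \<integral>\<^sup>+X. k y X t \<partial>lborel \<partial>lborel \<partial>lborel)"
    by (intro nn_integral_cong nn_integral_lborel_swap) (auto simp: case_prod_unfold intro!: mk continuous_intros)
  also have "\<dots> = (\<integral>\<^sup>+t. \<integral>\<^sup>+y. \<integral>\<^sup>+X. k y X t \<partial>lborel \<partial>lborel \<partial>lborel)"
  proof (rule nn_integral_lborel_swap)
    show "(\<lambda>(y, t). \<integral>\<^sup>+X. k y X t \<partial>lborel) \<in> borel_measurable borel"
      unfolding case_prod_unfold
      by (rule nn_integral_lborel_snd_measurable[of "\<lambda>p X. k (fst p) X (snd p)"])
         (auto simp: case_prod_unfold intro!: mk continuous_intros)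
  qed
  also have "\<dots> \<le> (\<integral>\<^sup>+t. (ennreal (2 ^ CARD('d)) * emeasure lborel Q * ?I) * indicator {0..1::real} t \<partial>lborel)"
  proof (intro nn_integral_mono)
    fix t :: real
    show "(\<integral>\<^sup>+y. \<integral>\<^sup>+X. k y X t \<partial>lborel \<partial>lborel) \<le> (ennreal (2 ^ CARD('d)) * emeasure lborel Q * ?I) * indicator {0..1} t"
    proof (cases "t \<in> {0..1}")
      case False
      then show ?thesis by (simp add: k_def)
    next
      case t: True
      have inQ: "y + t *\<^sub>R (x - y) \<in> Q" if "x \<in> Q" "y \<in> Q" for x y
        using convexD_alt[OF Q(2) that(2,1), of t] t by (simp add: algebra_simps)
      \<comment> \<open>The substitutions have Jacobian r^d with r = t or r = 1 - t. The one that is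
        used satisfies r \<ge> 1/2, hence the factor 2^d uniformly in t.\<close>
      have scale: "x \<le> ennreal (2 ^ CARD('d)) * z" if z: "z = ennreal (r ^ CARD('d)) * x" and r: "r \<ge> 1/2" for x z r
      proof -
        have "x = ennreal (1 / r ^ CARD('d)) * z"
          unfolding z using r by (simp add: mult.assoc[symmetric] ennreal_mult[symmetric])
        also have "\<dots> \<le> ennreal (2 ^ CARD('d)) * z"
        proof (intro mult_right_mono ennreal_leI)
          have "(1 / r) ^ CARD('d) \<le> 2 ^ CARD('d)" using r by (intro power_mono) (auto simp: field_simps)
          then show "1 / r ^ CARD('d) \<le> 2 ^ CARD('d)" by (simp add: power_one_over)
        qed simp
        finally show ?thesis .
      qed
      show ?thesis
      proof (cases "t \<ge> 1/2")
        case True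
        define b where "b l = (if l = j then t else 1)" for l
        have in_y: "(\<integral>\<^sup>+X. k y X t \<partial>lborel) \<le> (ennreal (2 ^ CARD('d)) * ?I) * indicator Q y" for y
        proof (cases "y \<in> Q")
          case yQ: True
          define P :: "real^'d^'n" where "P = axis j ((1 - t) *\<^sub>R y)"
          have eq: "upd_pt X j (y + t *\<^sub>R (X $ j - y)) = (\<chi> l. P $ l + b l *\<^sub>R X $ l)" for X
            by (simp add: vec_eq_iff P_def b_def axis_def algebra_simps)
          have "(\<integral>\<^sup>+X. k y X t \<partial>lborel) \<le> (\<integral>\<^sup>+X. indicator ?N (\<chi> l. P $ l + b l *\<^sub>R X $ l) * \<Psi> (\<chi> l. P $ l + b l *\<^sub>R X $ l) \<partial>lborel)"
          proof (intro nn_integral_mono)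
            fix X :: "real^'d^'n"
            have "(\<chi> l. P $ l + b l *\<^sub>R X $ l) \<in> ?N" if "X \<in> ?N"
              unfolding eq[symmetric] using upd_pt_in_power_set[OF that inQ[OF power_set_nth[OF that] yQ]] .
            then show "k y X t \<le> indicator ?N (\<chi> l. P $ l + b l *\<^sub>R X $ l) * \<Psi> (\<chi> l. P $ l + b l *\<^sub>R X $ l)"
              unfolding k_def eq by (auto simp: indicator_def)
          qed
          also have "\<dots> \<le> ennreal (2 ^ CARD('d)) * ?I"
          proof (rule scale[OF _ True])
            have "?I = ennreal (\<Prod>l\<in>UNIV. b l ^ DIM(real^'d)) * (\<integral>\<^sup>+X. indicator ?N (\<chi> l. P $ l + b l *\<^sub>R X $ l) * \<Psi> (\<chi> l. P $ l + b l *\<^sub>R X $ l) \<partial>lborel)"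
              by (intro nn_integral_lborel_slotwise_affine[where f = "\<lambda>X. indicator ?N X * \<Psi> X"] borel_measurable_times_ennreal \<Psi> borel_measurable_indicator borel_open oN)
                 (use True in \<open>auto simp: b_def\<close>)
            also have "(\<Prod>l\<in>UNIV. b l ^ DIM(real^'d)) = t ^ CARD('d)"
              by (subst prod.remove[of _ j]) (auto simp: b_def)
            finally show "?I = ennreal (t ^ CARD('d)) * (\<integral>\<^sup>+X. indicator ?N (\<chi> l. P $ l + b l *\<^sub>R X $ l) * \<Psi> (\<chi> l. P $ l + b l *\<^sub>R X $ l) \<partial>lborel)" .
          qed
          finally show ?thesis using yQ by simp
        qed (simp add: k_def)
        have "(\<integral>\<^sup>+y. \<integral>\<^sup>+X. k y X t \<partial>lborel \<partial>lborel) \<le> (\<integral>\<^sup>+y. (ennreal (2 ^ CARD('d)) * ?I) * indicator Q y \<partial>lborel)"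
          by (intro nn_integral_mono in_y)
        also have "\<dots> = (ennreal (2 ^ CARD('d)) * ?I) * emeasure lborel Q"
          using Q(1) by (intro nn_integral_cmult_indicator) auto
        finally show ?thesis using t by (simp add: mult_ac)
      next
        case False
        \<comment> \<open>For small t the moving point takes over slot j as y varies, and the old
          slot j remains as a free variable in Q. Exchanging the two brings out the volume of
          Q.\<close>
        define F where "F Y v = indicator ?N Y * (indicator Q v * \<Psi> Y)" for Y v
        have mF: "case_prod F \<in> borel_measurable borel"
          unfolding F_def[abs_def] case_prod_unfold
          by (intro borel_measurable_times_ennreal borel_measurable_indicator_compose oN Q(1)
               borel_measurable_compose_continuous[OF \<Psi>] continuous_intros)
        have mF': "(\<lambda>v. F (upd_pt X j v) c) \<in> borel_measurable borel" for X c
          using borel_measurable_compose_continuous[OF mF, of "\<lambda>v. (upd_pt X j v, c)"] by (simp add: continuous_intros)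
        have "(\<integral>\<^sup>+y. \<integral>\<^sup>+X. k y X t \<partial>lborel \<partial>lborel) = (\<integral>\<^sup>+X. \<integral>\<^sup>+y. k y X t \<partial>lborel \<partial>lborel)"
          by (rule nn_integral_lborel_swap) (auto simp: case_prod_unfold intro!: mk continuous_intros)
        also have "\<dots> \<le> (\<integral>\<^sup>+X. \<integral>\<^sup>+y. F (upd_pt X j (t *\<^sub>R X $ j + (1 - t) *\<^sub>R y)) (X $ j) \<partial>lborel \<partial>lborel)"
        proof (intro nn_integral_mono)
          fix X :: "real^'d^'n" and y
          have e: "t *\<^sub>R X $ j + (1 - t) *\<^sub>R y = y + t *\<^sub>R (X $ j - y)" by (simp add: algebra_simps)
          show "k y X t \<le> F (upd_pt X j (t *\<^sub>R X $ j + (1 - t) *\<^sub>R y)) (X $ j)"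
          proof (cases "X \<in> ?N \<and> y \<in> Q")
            case True
            then have "upd_pt X j (y + t *\<^sub>R (X $ j - y)) \<in> ?N" "X $ j \<in> Q"
              using upd_pt_in_power_set inQ power_set_nth by blast+
            then show ?thesis unfolding k_def F_def e by (simp add: indicator_def)
          qed (auto simp: k_def indicator_def)
        qed
        also have "\<dots> \<le> (\<integral>\<^sup>+X. ennreal (2 ^ CARD('d)) * (\<integral>\<^sup>+v. F (upd_pt X j v) (X $ j) \<partial>lborel) \<partial>lborel)"
        proof (intro nn_integral_mono scale)
          show "1 / 2 \<le> 1 - t" using False by simp
          show "(\<integral>\<^sup>+v. F (upd_pt X j v) (X $ j) \<partial>lborel) = ennreal ((1 - t) ^ CARD('d)) * (\<integral>\<^sup>+y. F (upd_pt X j (t *\<^sub>R X $ j + (1 - t) *\<^sub>R y)) (X $ j) \<partial>lborel)" for X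
            using nn_integral_lborel_scale[OF mF', of "1 - t" X "X $ j" "t *\<^sub>R X $ j"] False by simp
        qed
        also have "\<dots> = ennreal (2 ^ CARD('d)) * (\<integral>\<^sup>+X. \<integral>\<^sup>+v. F (upd_pt X j v) (X $ j) \<partial>lborel \<partial>lborel)"
        proof (rule nn_integral_cmult)
          have "case_prod (\<lambda>X v. F (upd_pt X j v) (X $ j)) \<in> borel_measurable borel"
            using borel_measurable_compose_continuous[OF mF, of "\<lambda>p. (upd_pt (fst p) j (snd p), fst p $ j)"]
            by (simp add: case_prod_unfold continuous_intros)
          from nn_integral_lborel_snd_measurable[OF this]
          show "(\<lambda>X. \<integral>\<^sup>+v. F (upd_pt X j v) (X $ j) \<partial>lborel) \<in> borel_measurable lborel" by simp
        qed
        also have "(\<integral>\<^sup>+X. \<integral>\<^sup>+v. F (upd_pt X j v) (X $ j) \<partial>lborel \<partial>lborel) = (\<integral>\<^sup>+X. \<integral>\<^sup>+v. F X v \<partial>lborel \<partial>lborel)"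
          by (rule nn_integral_swap_slot[OF mF])
        also have "\<dots> = (\<integral>\<^sup>+X. (indicator ?N X * \<Psi> X) * emeasure lborel Q \<partial>lborel)"
        proof (intro nn_integral_cong)
          fix X
          have "(\<integral>\<^sup>+v. F X v \<partial>lborel) = (\<integral>\<^sup>+v. (indicator ?N X * \<Psi> X) * indicator Q v \<partial>lborel)"
            by (simp add: F_def mult_ac)
          also have "\<dots> = (indicator ?N X * \<Psi> X) * emeasure lborel Q"
            using Q(1) by (intro nn_integral_cmult_indicator) auto
          finally show "(\<integral>\<^sup>+v. F X v \<partial>lborel) = (indicator ?N X * \<Psi> X) * emeasure lborel Q" .
        qed
        also have "\<dots> = ?I * emeasure lborel Q"
          by (rule nn_integral_multc) (use \<Psi> oN in \<open>auto intro!: borel_measurable_times_ennreal borel_measurable_indicator\<close>)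
        finally show ?thesis using t by (simp add: mult_ac)
      qed
    qed
  qed
  also have "\<dots> = ennreal (2 ^ CARD('d)) * emeasure lborel Q * ?I"
    by (subst nn_integral_cmult_indicator) auto
  finally show ?thesis .
qed

section \<open>Lagrange interpolation\<close>

text \<open>The Lagrange basis polynomial of the node a for the nodes 0, ..., M - 1.\<close>

definition lag :: "nat \<Rightarrow> nat \<Rightarrow> real \<Rightarrow> real" where
  "lag M a t = (\<Prod>b\<in>{..<M}-{a}. (t - real b) / (real a - real b))"

text \<open>Both sides are polynomials in t of degree below M that agree at the M nodes. The affine
  form covers monomials centred at an arbitrary point and rescaled.\<close>

lemma lag_exact:
  assumes k: "k < M"
  shows "(\<Sum>a<M. lag M a t * (A + \<delta> * real a) ^ k) = (A + \<delta> * t) ^ k"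
proof -
  define p where "p = [:A, \<delta>:] ^ k"
  have pp: "poly p x = (A + \<delta> * x) ^ k" for x by (simp add: p_def mult.commute)
  define l where "l a = (\<Prod>b\<in>{..<M}-{a}. [:- real b / (real a - real b), 1 / (real a - real b):])" for a
  have pl: "poly (l a) x = lag M a x" for a x
    unfolding l_def lag_def poly_prod
    by (intro prod.cong refl) (simp add: diff_divide_distrib)
  define L where "L = (\<Sum>a<M. smult (poly p (real a)) (l a))"
  have dl: "degree (l a) \<le> M - 1" if "a < M" for a
  proof -
    have "degree (l a) \<le> (\<Sum>b\<in>{..<M}-{a}. degree [:- real b / (real a - real b), 1 / (real a - real b):])"
      unfolding l_def using degree_prod_sum_le[of "{..<M}-{a}" "\<lambda>b. [:- real b / (real a - real b), 1 / (real a - real b):]"] by (simp add: o_def)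
    also have "\<dots> \<le> (\<Sum>b\<in>{..<M}-{a}. 1)" by (intro sum_mono) simp
    also have "\<dots> = M - 1" using that by simp
    finally show ?thesis .
  qed
  have "degree L \<le> M - 1"
    unfolding L_def
  proof (intro degree_sum_le)
    fix a assume "a \<in> {..<M}"
    then show "degree (smult (poly p (real a)) (l a)) \<le> M - 1"
      using order_trans[OF degree_smult_le dl] by simp
  qed simp
  then have dL: "degree L < M" using k by simp
  have dp: "degree p < M"
    using degree_power_le[of "[:A, \<delta>:]" k] degree_pCons_le[of A "[:\<delta>:]"] k
    by (auto simp: p_def intro: le_less_trans split: if_splits)
  have lagval: "lag M a (real a') = (if a = a' then 1 else 0)" if "a < M" "a' < M" for a a'
  proof (cases "a = a'")
    case True
    then show ?thesis by (auto simp: lag_def intro!: prod.neutral)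
  next
    case False
    then show ?thesis using that by (auto simp: lag_def)
  qed
  have "L = p"
  proof (rule poly_eqI_degree[where A = "real ` {..<M}"])
    fix x assume "x \<in> real ` {..<M}"
    then obtain a' where a': "a' < M" "x = real a'" by auto
    have "poly L x = (\<Sum>a<M. poly p (real a) * lag M a (real a'))"
      by (simp add: L_def poly_sum pl a')
    also have "\<dots> = (\<Sum>a<M. if a = a' then poly p (real a) else 0)"
      using lagval[OF _ a'(1)] by (intro sum.cong) auto
    also have "\<dots> = poly p x" using a' by simp
    finally show "poly L x = poly p x" .
  qed (use dL dp in \<open>simp_all add: card_image\<close>)
  then have "poly L t = poly p t" by simp
  then show ?thesis by (simp add: L_def poly_sum pl pp mult.commute)
qed

section \<open>Interpolation on a tensor grid\<close>

definition grid :: "nat \<Rightarrow> ('d::finite \<Rightarrow> nat) set" where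
  "grid M = Pi\<^sub>E UNIV (\<lambda>_. {..<M})"

lemma finite_grid [simp]: "finite (grid M :: ('d::finite \<Rightarrow> nat) set)"
  unfolding grid_def by (intro finite_PiE) auto

lemma card_grid: "card (grid M :: ('d::finite \<Rightarrow> nat) set) = M ^ CARD('d)"
  unfolding grid_def by (simp add: card_PiE)

definition node :: "real^'d \<Rightarrow> real \<Rightarrow> ('d \<Rightarrow> nat) \<Rightarrow> real^'d" where
  "node q \<delta> i = (\<chi> c. q $ c + \<delta> * real (i c))"

text \<open>The tensor product of one-dimensional Lagrange polynomials, in coordinates that turn the
  nodes into integer points.\<close>

definition glag :: "nat \<Rightarrow> real^'d \<Rightarrow> real \<Rightarrow> ('d \<Rightarrow> nat) \<Rightarrow> real^'d \<Rightarrow> real" where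
  "glag M q \<delta> i x = (\<Prod>c\<in>UNIV. lag M (i c) ((x $ c - q $ c) / \<delta>))"

lemma prod_list_coords: "prod_list (map (($) v) w) = (\<Prod>c\<in>UNIV. (v $ c) ^ count (mset w) c)"
  for v :: "real^'d"
proof (induction w)
  case (Cons e w)
  have "(\<Prod>c\<in>UNIV. (v $ c) ^ count (mset (e # w)) c) = (\<Prod>c\<in>UNIV. (v $ c) ^ count (mset w) c * (if c = e then v $ e else 1))"
    by (intro prod.cong) auto
  also have "\<dots> = (\<Prod>c\<in>UNIV. (v $ c) ^ count (mset w) c) * v $ e"
    by (simp add: prod.distrib)
  finally show ?case using Cons by simp
qed simp

text \<open>The sum over the grid factors into one-dimensional interpolations. In a word shorter
  than M every coordinate occurs fewer than M times, which is what the grid handles. Nodes and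
  argument are shifted by the same z, so exactness survives the translation.\<close>

lemma glag_exact:
  fixes x y z q :: "real^'d"
  assumes w: "length w < M" and \<delta>: "\<delta> \<noteq> 0"
  shows "(\<Sum>i\<in>grid M. glag M q \<delta> i (x - z) * prod_list (map (($) (node q \<delta> i + z - y)) w)) = prod_list (map (($) (x - y)) w)"
proof -
  let ?t = "\<lambda>c. ((x - z) $ c - q $ c) / \<delta>" and ?A = "\<lambda>c. q $ c + z $ c - y $ c"
  let ?k = "\<lambda>c. count (mset w) c"
  have "(\<Sum>i\<in>grid M. glag M q \<delta> i (x - z) * prod_list (map (($) (node q \<delta> i + z - y)) w))
      = (\<Sum>i\<in>Pi\<^sub>E UNIV (\<lambda>_. {..<M}). \<Prod>c\<in>UNIV. lag M (i c) (?t c) * (?A c + \<delta> * real (i c)) ^ ?k c)"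
    unfolding grid_def glag_def prod_list_coords prod.distrib[symmetric]
    by (intro sum.cong refl prod.cong) (simp add: node_def algebra_simps)
  also have "\<dots> = (\<Prod>c\<in>UNIV. \<Sum>a<M. lag M a (?t c) * (?A c + \<delta> * real a) ^ ?k c)"
    by (intro prod_sum_PiE[symmetric]) auto
  also have "\<dots> = (\<Prod>c\<in>UNIV. (?A c + \<delta> * ?t c) ^ ?k c)"
  proof (intro prod.cong refl lag_exact)
    fix c show "?k c < M" using count_le_length[of w c] w by (simp add: count_mset)
  qed
  also have "\<dots> = (\<Prod>c\<in>UNIV. ((x - y) $ c) ^ ?k c)"
    using \<delta> by (intro prod.cong refl) simp
  finally show ?thesis by (simp add: prod_list_coords)
qed

lemma continuous_on_glag: "continuous_on S (glag M q \<delta> i)"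
  unfolding glag_def[abs_def] lag_def
  by (cases "\<delta> = 0") (auto intro!: continuous_intros)

text \<open>In slot j \<open>taylor_part\<close> is a polynomial, since its coefficients are
  evaluated with y or w in that slot. Its degree is below m if b = 0 and at most m otherwise, hence
  the stricter condition on M in the second case.\<close>

lemma taylor_part_exact:
  fixes X :: "real^'d^'n"
  assumes \<delta>: "\<delta> \<noteq> 0" and m: "m \<le> M" "b \<noteq> 0 \<Longrightarrow> m < M"
  shows "(\<Sum>i\<in>grid M. glag M q \<delta> i (X $ j - z) * taylor_part j m b u y w (upd_pt X j (node q \<delta> i + z))) = taylor_part j m b u y w X"
proof -
  let ?g = "\<lambda>i. glag M q \<delta> i (X $ j - z)" and ?P = "\<lambda>v x. prod_list (map (($) (x - y)) v)"
  have swap: "(\<Sum>i\<in>grid M. ?g i * (\<Sum>v\<in>words l. ?P v (node q \<delta> i + z) * c v)) = (\<Sum>v\<in>words l. ?P v (X $ j) * c v)"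
    if "l < M" for l c
  proof -
    have "(\<Sum>i\<in>grid M. ?g i * (\<Sum>v\<in>words l. ?P v (node q \<delta> i + z) * c v))
        = (\<Sum>v\<in>words l. (\<Sum>i\<in>grid M. ?g i * ?P v (node q \<delta> i + z)) * c v)"
      unfolding sum_distrib_left sum_distrib_right by (subst sum.swap) (simp add: mult_ac)
    also have "\<dots> = (\<Sum>v\<in>words l. ?P v (X $ j) * c v)"
      using that \<delta> by (intro sum.cong refl arg_cong2[where f = "(*)"] glag_exact) (auto simp: words_def)
    finally show ?thesis .
  qed
  let ?c = "\<lambda>v. word_deriv j v u (upd_pt X j y)" and ?c' = "\<lambda>v. word_deriv j v u (upd_pt X j w)"
  have "(\<Sum>i\<in>grid M. ?g i * taylor_part j m b u y w (upd_pt X j (node q \<delta> i + z)))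
      = (\<Sum>i\<in>grid M. \<Sum>l<m. 1 / fact l * (?g i * (\<Sum>v\<in>words l. ?P v (node q \<delta> i + z) * ?c v)))
      + (\<Sum>i\<in>grid M. b / fact m * (?g i * (\<Sum>v\<in>words m. ?P v (node q \<delta> i + z) * ?c' v)))"
    unfolding taylor_part_def by (simp add: distrib_left sum.distrib sum_distrib_left mult_ac)
  also have "(\<Sum>i\<in>grid M. \<Sum>l<m. 1 / fact l * (?g i * (\<Sum>v\<in>words l. ?P v (node q \<delta> i + z) * ?c v)))
      = (\<Sum>l<m. 1 / fact l * (\<Sum>i\<in>grid M. ?g i * (\<Sum>v\<in>words l. ?P v (node q \<delta> i + z) * ?c v)))"
    by (subst sum.swap) (simp only: sum_distrib_left)
  also have "\<dots> = (\<Sum>l<m. 1 / fact l * (\<Sum>v\<in>words l. ?P v (X $ j) * ?c v))"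
    using m(1) by (intro sum.cong refl arg_cong2[where f = "(*)"] swap) auto
  also have "(\<Sum>i\<in>grid M. b / fact m * (?g i * (\<Sum>v\<in>words m. ?P v (node q \<delta> i + z) * ?c' v)))
      = b / fact m * (\<Sum>v\<in>words m. ?P v (X $ j) * ?c' v)"
  proof (cases "b = 0")
    case False
    then show ?thesis unfolding sum_distrib_left[symmetric] using swap[OF m(2)] by simp
  qed simp
  finally show ?thesis by (simp only: taylor_part_def)
qed

section \<open>Interpolation error in one slot\<close>

lemma ennreal_divide_left:
  assumes "v > 0" "ennreal v * x \<le> y"
  shows "x \<le> ennreal (1 / v) * y"
proof -
  have "x = ennreal (1 / v) * (ennreal v * x)"
    using assms(1) by (simp add: mult.assoc[symmetric] ennreal_mult[symmetric])
  also have "\<dots> \<le> ennreal (1 / v) * y" using assms(2) by (rule mult_left_mono) simp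
  finally show ?thesis .
qed

lemma ennreal_divide_right:
  assumes "v > 0" "x \<le> ennreal v * y"
  shows "ennreal (1 / v) * x \<le> y"
proof -
  have "ennreal (1 / v) * x \<le> ennreal (1 / v) * (ennreal v * y)" using assms(2) by (rule mult_left_mono) simp
  also have "\<dots> = y"
    using assms(1) by (simp add: mult.assoc[symmetric] ennreal_mult[symmetric])
  finally show ?thesis .
qed

text \<open>The Taylor remainder involves a point moving between y and \<open>X $ j\<close>.
  Averaging over the centre y turns this point into an integration variable; w is still held
  fixed.\<close>

lemma remainder_average_le:
  fixes \<Omega> Q :: "(real^'d) set"
  assumes \<Omega>: "open \<Omega>" and Q: "open Q" "convex Q" "bounded Q" "Q \<subseteq> \<Omega>" and mb: "m = 0 \<Longrightarrow> b = 1"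
  shows "\<exists>K>0. \<forall>j (u :: real^'d^'n \<Rightarrow> real) w. smooth_on (power_set \<Omega>) u \<longrightarrow> w \<in> Q \<longrightarrow>
    (\<integral>\<^sup>+y. indicator Q y * (\<integral>\<^sup>+X. indicator (power_set Q) X * ennreal ((u X - taylor_part j m b u y w X)\<^sup>2) \<partial>lborel) \<partial>lborel)
    \<le> ennreal K * (\<integral>\<^sup>+X. indicator (power_set Q) X * ennreal (top_difference j m b u w X) \<partial>lborel)"
proof -
  let ?N = "power_set Q :: (real^'d^'n) set"
  have oN: "open ?N" by (rule open_power_set[OF Q(1)])
  define vQ where "vQ = measure lborel Q"
  have vQ: "emeasure lborel Q = ennreal vQ"
    using emeasure_bounded_finite[OF Q(3)] by (simp add: vQ_def emeasure_eq_ennreal_measure less_top)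
  obtain L where L: "\<And>x y. x \<in> Q \<Longrightarrow> y \<in> Q \<Longrightarrow> norm (x - y) \<le> L"
    using diameter_bounded_bound[OF Q(3)] by (metis dist_norm)
  define c where "c = word_const m TYPE('d) * L ^ (2 * m)"
  have c0: "c \<ge> 0" unfolding c_def by (intro mult_nonneg_nonneg word_const_nonneg) (simp add: power_mult)
  \<comment> \<open>Serves both for m = 0 and for m > 0; the summand 1 keeps K positive for a later
    division.\<close>
  define K where "K = 2 ^ CARD('d) * vQ * c + vQ + 1"
  have vQ0: "vQ \<ge> 0" by (simp add: vQ_def)
  have K0: "K > 0" using c0 vQ0 by (auto simp: K_def intro!: add_nonneg_pos)
  have "(\<integral>\<^sup>+y. indicator Q y * (\<integral>\<^sup>+X. indicator ?N X * ennreal ((u X - taylor_part j m b u y w X)\<^sup>2) \<partial>lborel) \<partial>lborel)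
    \<le> ennreal K * (\<integral>\<^sup>+X. indicator ?N X * ennreal (top_difference j m b u w X) \<partial>lborel)"
    if u: "smooth_on (power_set \<Omega>) u" and w: "w \<in> Q" for j and u :: "real^'d^'n \<Rightarrow> real" and w
  proof -
    let ?J = "\<integral>\<^sup>+X. indicator ?N X * ennreal (top_difference j m b u w X) \<partial>lborel"
    define \<Psi> where "\<Psi> X = indicator ?N X * ennreal (top_difference j m b u w X)" for X
    have m\<Psi>: "\<Psi> \<in> borel_measurable borel"
    proof -
      have upd: "upd_pt X j w \<in> power_set \<Omega>" if "X \<in> ?N" for X
        using upd_pt_in_power_set[OF that w] power_set_mono[OF Q(4)] by blast
      have cw: "continuous_on ?N (\<lambda>X. word_deriv j v u (upd_pt X j w))" for v
        unfolding word_deriv_def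
        by (rule continuous_on_compose2[OF smooth_on_foldr_continuous[OF u]])
           (use upd in \<open>auto intro!: continuous_intros\<close>)
      have cw': "continuous_on ?N (word_deriv j v u)" for v
        unfolding word_deriv_def
        by (rule continuous_on_subset[OF smooth_on_foldr_continuous[OF u] power_set_mono[OF Q(4)]])
      have "continuous_on ?N (top_difference j m b u w)"
        unfolding top_difference_def[abs_def] Dalpha_conv_word_deriv by (intro continuous_intros cw cw')
      then have "(\<lambda>X. indicator ?N X *\<^sub>R top_difference j m b u w X) \<in> borel_measurable borel"
        using oN by (intro borel_measurable_continuous_on_indicator) auto
      then have "(\<lambda>X. ennreal (indicator ?N X *\<^sub>R top_difference j m b u w X)) \<in> borel_measurable borel" by simp
      also have "(\<lambda>X. ennreal (indicator ?N X *\<^sub>R top_difference j m b u w X)) = \<Psi>"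
        by (auto simp: \<Psi>_def indicator_def)
      finally show ?thesis .
    qed
    show ?thesis
    proof (cases "m = 0")
      \<comment> \<open>At order 0 \<open>taylor_part\<close> is the value of u at w, so both
        integrands coincide and the average over y contributes the volume of Q.\<close>
      case True
      then have b: "b = 1" by (rule mb)
      have "taylor_part j m b u y w X = u (upd_pt X j w)" for y X
        using True b by (simp add: taylor_part_def words_def word_deriv_def)
      moreover have "top_difference j m b u w X = (u X - u (upd_pt X j w))\<^sup>2" for X
      proof -
        have "(multi_indices 0 :: ('d \<Rightarrow> nat) set) = {\<lambda>_. 0}" by (auto simp: multi_indices_def)
        moreover have "Dalpha j (\<lambda>_. 0) u = u"
        proof -
          have "concat (map (\<lambda>i. []) (coord_list :: 'd list)) = ([] :: 'd list)" by simp
          then show ?thesis unfolding Dalpha_conv_word_deriv word_deriv_def replicate_0 by (simp only: list.map foldr_Nil id_apply)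
        qed
        ultimately show ?thesis using True b by (simp add: top_difference_def mfact_def)
      qed
      ultimately have "(\<integral>\<^sup>+y. indicator Q y * (\<integral>\<^sup>+X. indicator ?N X * ennreal ((u X - taylor_part j m b u y w X)\<^sup>2) \<partial>lborel) \<partial>lborel)
          = (\<integral>\<^sup>+y. ?J * indicator Q y \<partial>lborel)"
        by (simp add: mult.commute)
      also have "\<dots> = ?J * ennreal vQ"
        using Q(1) by (simp add: nn_integral_cmult_indicator vQ)
      also have "\<dots> \<le> ennreal K * ?J"
        using c0 vQ0 unfolding mult.commute[of ?J] by (intro mult_right_mono ennreal_leI) (auto simp: K_def)
      finally show ?thesis .
    next
      case False
      have "(\<integral>\<^sup>+y. indicator Q y * (\<integral>\<^sup>+X. indicator ?N X * ennreal ((u X - taylor_part j m b u y w X)\<^sup>2) \<partial>lborel) \<partial>lborel)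
        \<le> (\<integral>\<^sup>+y. indicator Q y * (\<integral>\<^sup>+X. indicator ?N X *
         (\<integral>\<^sup>+t. indicator {0..1::real} t * (ennreal c * \<Psi> (upd_pt X j (y + t *\<^sub>R (X $ j - y)))) \<partial>lborel) \<partial>lborel) \<partial>lborel)"
      proof (intro nn_integral_mono)
        fix y
        have "indicator ?N X * ennreal ((u X - taylor_part j m b u y w X)\<^sup>2) \<le> indicator ?N X *
           (\<integral>\<^sup>+t. indicator {0..1::real} t * (ennreal c * \<Psi> (upd_pt X j (y + t *\<^sub>R (X $ j - y)))) \<partial>lborel)" if y: "y \<in> Q" for X
        proof (cases "X \<in> ?N")
          case X: True
          have "ennreal ((u X - taylor_part j m b u y w X)\<^sup>2) \<le> ennreal c *
            (\<integral>\<^sup>+t. indicator {0..1} t * ennreal (top_difference j m b u w (upd_pt X j (y + t *\<^sub>R (X $ j - y)))) \<partial>lborel)"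
            unfolding c_def using False power_set_nth[OF X] y
            by (intro taylor_remainder_le[OF u \<Omega> Q(2,4) _ X y w] L) auto
          also have "(\<integral>\<^sup>+t. indicator {0..1} t * ennreal (top_difference j m b u w (upd_pt X j (y + t *\<^sub>R (X $ j - y)))) \<partial>lborel)
              = (\<integral>\<^sup>+t. indicator {0..1} t * \<Psi> (upd_pt X j (y + t *\<^sub>R (X $ j - y))) \<partial>lborel)"
          proof (intro nn_integral_cong)
            fix t :: real
            show "indicator {0..1} t * ennreal (top_difference j m b u w (upd_pt X j (y + t *\<^sub>R (X $ j - y))))
              = indicator {0..1} t * \<Psi> (upd_pt X j (y + t *\<^sub>R (X $ j - y)))"
            proof (cases "t \<in> {0..1}")
              case True
              have "(1 - t) *\<^sub>R y + t *\<^sub>R X $ j \<in> Q" using True power_set_nth[OF X, of j] y by (intro convexD_alt[OF Q(2)]) auto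
              then have "y + t *\<^sub>R (X $ j - y) \<in> Q" by (simp add: algebra_simps)
              then show ?thesis using upd_pt_in_power_set[OF X] by (simp add: \<Psi>_def)
            qed simp
          qed
          also have "ennreal c * (\<integral>\<^sup>+t. indicator {0..1} t * \<Psi> (upd_pt X j (y + t *\<^sub>R (X $ j - y))) \<partial>lborel)
              = (\<integral>\<^sup>+t. ennreal c * (indicator {0..1} t * \<Psi> (upd_pt X j (y + t *\<^sub>R (X $ j - y)))) \<partial>lborel)"
          proof (rule nn_integral_cmult[symmetric])
            have "(\<lambda>t. \<Psi> (upd_pt X j (y + t *\<^sub>R (X $ j - y)))) \<in> borel_measurable borel"
              by (intro borel_measurable_compose_continuous[OF m\<Psi>] continuous_intros)
            then show "(\<lambda>t. indicator {0..1} t * \<Psi> (upd_pt X j (y + t *\<^sub>R (X $ j - y)))) \<in> borel_measurable lborel" by simp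
          qed
          finally show ?thesis using X by (simp add: mult_ac)
        qed simp
        then show "indicator Q y * (\<integral>\<^sup>+X. indicator ?N X * ennreal ((u X - taylor_part j m b u y w X)\<^sup>2) \<partial>lborel)
          \<le> indicator Q y * (\<integral>\<^sup>+X. indicator ?N X *
         (\<integral>\<^sup>+t. indicator {0..1::real} t * (ennreal c * \<Psi> (upd_pt X j (y + t *\<^sub>R (X $ j - y)))) \<partial>lborel) \<partial>lborel)"
          by (cases "y \<in> Q") (auto intro!: nn_integral_mono)
      qed
      also have "\<dots> \<le> ennreal (2 ^ CARD('d)) * emeasure lborel Q * (\<integral>\<^sup>+X. indicator ?N X * (ennreal c * \<Psi> X) \<partial>lborel)"
        by (rule nn_integral_segment_le[OF Q(1,2)]) (use m\<Psi> in simp)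
      also have "(\<integral>\<^sup>+X. indicator ?N X * (ennreal c * \<Psi> X) \<partial>lborel) = (\<integral>\<^sup>+X. ennreal c * \<Psi> X \<partial>lborel)"
        by (intro nn_integral_cong) (auto simp: \<Psi>_def indicator_def)
      also have "\<dots> = ennreal c * ?J" using m\<Psi> by (simp add: nn_integral_cmult \<Psi>_def[symmetric])
      also have "ennreal (2 ^ CARD('d)) * emeasure lborel Q * (ennreal c * ?J) = ennreal (2 ^ CARD('d) * vQ * c) * ?J"
        using c0 vQ0 by (simp add: vQ ennreal_mult mult.assoc)
      also have "\<dots> \<le> ennreal K * ?J"
        using vQ0 by (intro mult_right_mono ennreal_leI) (auto simp: K_def)
      finally show ?thesis .
    qed
  qed
  with K0 show ?thesis by blast
qed


text \<open>Interpolation reproduces \<open>taylor_part\<close>, so the error for u equals the error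
  for the Taylor remainder, whatever y and w are, and may be averaged over both. The shift z of the
  nodes turns values on slices of measure zero into integrals.\<close>

lemma interpolation_error_le:
  fixes \<Omega> Q :: "(real^'d) set" and q :: "real^'d"
  assumes \<Omega>: "open \<Omega>" and Q: "open Q" "convex Q" "bounded Q" "Q \<subseteq> \<Omega>" "Q \<noteq> {}"
    and m: "m \<le> M" "b \<noteq> 0 \<Longrightarrow> m < M" "m = 0 \<Longrightarrow> b = 1" and \<delta>: "\<delta> \<noteq> 0"
    and nodes: "\<And>i z. i \<in> grid M \<Longrightarrow> z \<in> ball 0 \<omega> \<Longrightarrow> node q \<delta> i + z \<in> Q"
  shows "\<exists>K\<ge>0. \<forall>j (u :: real^'d^'n \<Rightarrow> real). smooth_on (power_set \<Omega>) u \<longrightarrow>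
    (\<integral>\<^sup>+z. \<integral>\<^sup>+X. indicator (ball 0 \<omega>) z * (indicator (power_set Q) X *
       ennreal ((u X - (\<Sum>i\<in>grid M. glag M q \<delta> i (X $ j - z) * u (upd_pt X j (node q \<delta> i + z))))\<^sup>2)) \<partial>lborel \<partial>lborel)
    \<le> ennreal K * (\<integral>\<^sup>+w. indicator Q w * (\<integral>\<^sup>+X. indicator (power_set Q) X * ennreal (top_difference j m b u w X) \<partial>lborel) \<partial>lborel)"
proof -
  let ?N = "power_set Q :: (real^'d^'n) set" and ?G = "grid M :: ('d \<Rightarrow> nat) set" and ?B = "ball (0 :: real^'d) \<omega>"
  have oN: "open ?N" by (rule open_power_set[OF Q(1)])
  define vQ where "vQ = measure lborel Q"
  have vQ: "emeasure lborel Q = ennreal vQ"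
    using emeasure_bounded_finite[OF Q(3)] by (simp add: vQ_def emeasure_eq_ennreal_measure less_top)
  have vQ0: "vQ > 0"
  proof -
    obtain a e where "e > 0" "ball a e \<subseteq> Q" using Q(1,5) openE by blast
    then have "emeasure lborel (ball a e) \<le> ennreal vQ"
      unfolding vQ[symmetric] using Q(1) by (intro emeasure_mono) auto
    moreover have "emeasure lborel (ball a e) = ennreal (measure lborel (ball a e))"
      using emeasure_lborel_ball_finite[of a e] by (simp add: emeasure_eq_ennreal_measure less_top)
    moreover have "measure lborel (ball a e) > 0" using \<open>e > 0\<close> by (rule content_ball_pos)
    ultimately show ?thesis by (smt (verit) ennreal_le_iff2)
  qed
  have cQ: "(\<integral>\<^sup>+y. c * indicator Q y \<partial>lborel) = ennreal vQ * c" for c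
    using Q(1) by (subst nn_integral_cmult_indicator) (auto simp: vQ mult.commute)
  define vZ where "vZ = measure lborel ?B"
  have vZ: "emeasure lborel ?B = ennreal vZ"
    using emeasure_lborel_ball_finite[of "0 :: real^'d" \<omega>] by (simp add: vZ_def emeasure_eq_ennreal_measure less_top)
  have vZ0: "vZ \<ge> 0" by (simp add: vZ_def)
  \<comment> \<open>A constant of Lebesgue type for the interpolation: the weights are continuous,
    hence bounded on the bounded set of differences x - z.\<close>
  obtain \<Lambda> where \<Lambda>: "\<And>x z. x \<in> Q \<Longrightarrow> z \<in> ?B \<Longrightarrow> (\<Sum>i\<in>?G. (glag M q \<delta> i (x - z))\<^sup>2) \<le> \<Lambda>" and \<Lambda>0: "\<Lambda> \<ge> 0"
  proof -
    obtain R where R: "\<And>x. x \<in> Q \<Longrightarrow> norm x \<le> R" using Q(3) by (auto simp: bounded_iff)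
    have "compact ((\<lambda>x. \<Sum>i\<in>?G. (glag M q \<delta> i x)\<^sup>2) ` cball 0 (R + \<omega>))"
      by (intro compact_continuous_image continuous_intros continuous_on_compose2[OF continuous_on_glag]) auto
    then have "bounded ((\<lambda>x. \<Sum>i\<in>?G. (glag M q \<delta> i x)\<^sup>2) ` cball 0 (R + \<omega>))" by (rule compact_imp_bounded)
    then obtain A where A: "\<And>x. x \<in> cball 0 (R + \<omega>) \<Longrightarrow> norm (\<Sum>i\<in>?G. (glag M q \<delta> i x)\<^sup>2) \<le> A"
      unfolding bounded_iff by blast
    have "(\<Sum>i\<in>?G. (glag M q \<delta> i (x - z))\<^sup>2) \<le> max A 0" if "x \<in> Q" "z \<in> ?B" for x z
    proof -
      have "norm (x - z) \<le> R + \<omega>" using norm_triangle_ineq4[of x z] R[OF that(1)] that(2) by simp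
      then show ?thesis using A[of "x - z"] by auto
    qed
    then show ?thesis by (intro that[of "max A 0"]) auto
  qed
  define D where "D = 2 * vZ + 2 * \<Lambda> * real (card ?G) * vQ + 1"
  have D0: "D > 0" using vZ0 \<Lambda>0 vQ0 by (auto simp: D_def intro!: add_nonneg_pos add_nonneg_nonneg)
  obtain K where K: "K > 0" and k: "\<And>j (u :: real^'d^'n \<Rightarrow> real) w. smooth_on (power_set \<Omega>) u \<Longrightarrow> w \<in> Q \<Longrightarrow>
    (\<integral>\<^sup>+y. indicator Q y * (\<integral>\<^sup>+X. indicator ?N X * ennreal ((u X - taylor_part j m b u y w X)\<^sup>2) \<partial>lborel) \<partial>lborel)
    \<le> ennreal K * (\<integral>\<^sup>+X. indicator ?N X * ennreal (top_difference j m b u w X) \<partial>lborel)"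
    using remainder_average_le[OF \<Omega> Q(1-4) m(3), where 'n = 'n] by blast
  define C where "C = (1 / vQ) * (K * (1 / vQ)) * D"
  have C0: "C \<ge> 0" using vQ0 K D0 by (simp add: C_def)
  have "(\<integral>\<^sup>+z. \<integral>\<^sup>+X. indicator ?B z * (indicator ?N X *
       ennreal ((u X - (\<Sum>i\<in>?G. glag M q \<delta> i (X $ j - z) * u (upd_pt X j (node q \<delta> i + z))))\<^sup>2)) \<partial>lborel \<partial>lborel)
    \<le> ennreal C * (\<integral>\<^sup>+w. indicator Q w * (\<integral>\<^sup>+X. indicator ?N X * ennreal (top_difference j m b u w X) \<partial>lborel) \<partial>lborel)"
    (is "?A \<le> _ * ?T")
    if u: "smooth_on (power_set \<Omega>) u" for j and u :: "real^'d^'n \<Rightarrow> real"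
  proof -
    have fixed: "?A \<le> ennreal D * (\<integral>\<^sup>+X. indicator ?N X * ennreal ((u X - taylor_part j m b u y w X)\<^sup>2) \<partial>lborel)"
      if y: "y \<in> Q" and w: "w \<in> Q" for y w
    proof -
      define r where "r X = u X - taylor_part j m b u y w X" for X
      define \<Phi> where "\<Phi> X = indicator ?N X * ennreal ((r X)\<^sup>2)" for X
      have m\<Phi>: "\<Phi> \<in> borel_measurable borel"
      proof -
        have upd: "upd_pt X j v \<in> power_set \<Omega>" if "X \<in> ?N" "v \<in> Q" for X v
          using upd_pt_in_power_set[OF that] power_set_mono[OF Q(4)] by blast
        have cw: "continuous_on ?N (\<lambda>X. word_deriv j v u (upd_pt X j x))" if "x \<in> Q" for v x
          unfolding word_deriv_def
          by (rule continuous_on_compose2[OF smooth_on_foldr_continuous[OF u]])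
             (use upd that in \<open>auto intro!: continuous_intros\<close>)
        have cu: "continuous_on ?N u"
          using continuous_on_subset[OF smooth_on_foldr_continuous[OF u, of "[]"] power_set_mono[OF Q(4)]] by simp
        have cp: "continuous_on ?N (\<lambda>X. prod_list (map (($) (X $ j - y)) v))" for v
          unfolding prod_list_coords by (intro continuous_intros)
        have "continuous_on ?N r"
          unfolding r_def[abs_def] taylor_part_def by (intro continuous_intros cw cu cp y w)
        then show ?thesis unfolding \<Phi>_def[abs_def] by (rule measurable_sq_indicator[OF oN])
      qed
      let ?P = "\<integral>\<^sup>+X. \<Phi> X \<partial>lborel"
      \<comment> \<open>Slot j of X is left only in an indicator, and the shifted node takes its
        place in the remainder; exchanging the two costs the volume of Q.\<close>
      define F where "F i z X = indicator Q (X $ j) * (indicator Q (node q \<delta> i + z) * \<Phi> (upd_pt X j (node q \<delta> i + z)))" for i z and X :: "real^'d^'n"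
      have mF: "(\<lambda>p. F i (f p) (g p)) \<in> borel_measurable borel" if "continuous_on UNIV f" "continuous_on UNIV g" for f g i
        unfolding F_def
        by (intro borel_measurable_times_ennreal borel_measurable_indicator_compose Q(1) borel_measurable_compose_continuous[OF m\<Phi>] continuous_intros that)
      have mB: "(\<lambda>p. indicator ?B (f p) * \<Phi> (g p)) \<in> borel_measurable borel" if "continuous_on UNIV f" "continuous_on UNIV g" for f g
        by (intro borel_measurable_times_ennreal borel_measurable_indicator_compose open_ball borel_measurable_compose_continuous[OF m\<Phi>] continuous_intros that)
      have pt: "indicator ?B z * (indicator ?N X *
          ennreal ((u X - (\<Sum>i\<in>?G. glag M q \<delta> i (X $ j - z) * u (upd_pt X j (node q \<delta> i + z))))\<^sup>2))
         \<le> ennreal 2 * (indicator ?B z * \<Phi> X) + ennreal (2 * \<Lambda>) * (\<Sum>i\<in>?G. F i z X)" for z X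
      proof (cases "z \<in> ?B \<and> X \<in> ?N")
        case True
        let ?g = "\<lambda>i. glag M q \<delta> i (X $ j - z)" and ?X = "\<lambda>i. upd_pt X j (node q \<delta> i + z)"
        have XjQ: "X $ j \<in> Q" using True power_set_nth by blast
        have "u X - (\<Sum>i\<in>?G. ?g i * u (?X i)) = r X - (\<Sum>i\<in>?G. ?g i * r (?X i))"
          using taylor_part_exact[OF \<delta> m(1,2), where q = q and X = X and j = j and z = z and u = u and y = y and w = w]
          by (simp add: r_def right_diff_distrib sum_subtractf)
        also have "(r X - (\<Sum>i\<in>?G. ?g i * r (?X i)))\<^sup>2 \<le> 2 * (r X)\<^sup>2 + 2 * (\<Sum>i\<in>?G. ?g i * r (?X i))\<^sup>2"
          using zero_le_power2[of "r X + (\<Sum>i\<in>?G. ?g i * r (?X i))"] by (simp add: power2_sum power2_diff)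
        also have "(\<Sum>i\<in>?G. ?g i * r (?X i))\<^sup>2 \<le> (\<Sum>i\<in>?G. (?g i)\<^sup>2) * (\<Sum>i\<in>?G. (r (?X i))\<^sup>2)"
          by (rule Cauchy_Schwarz_ineq_sum)
        also have "\<dots> \<le> \<Lambda> * (\<Sum>i\<in>?G. (r (?X i))\<^sup>2)"
          using \<Lambda>[OF XjQ, of z] True by (intro mult_right_mono sum_nonneg) auto
        finally have le: "(u X - (\<Sum>i\<in>?G. ?g i * u (?X i)))\<^sup>2 \<le> 2 * (r X)\<^sup>2 + (2 * \<Lambda>) * (\<Sum>i\<in>?G. (r (?X i))\<^sup>2)" by simp
        have "ennreal ((u X - (\<Sum>i\<in>?G. ?g i * u (?X i)))\<^sup>2) \<le> ennreal (2 * (r X)\<^sup>2 + (2 * \<Lambda>) * (\<Sum>i\<in>?G. (r (?X i))\<^sup>2))"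
          by (rule ennreal_leI[OF le])
        also have "\<dots> = ennreal (2 * (r X)\<^sup>2) + ennreal ((2 * \<Lambda>) * (\<Sum>i\<in>?G. (r (?X i))\<^sup>2))"
          using \<Lambda>0 by (intro ennreal_plus mult_nonneg_nonneg sum_nonneg) auto
        also have "ennreal (2 * (r X)\<^sup>2) = ennreal 2 * ennreal ((r X)\<^sup>2)" by (rule ennreal_mult) auto
        also have "ennreal ((2 * \<Lambda>) * (\<Sum>i\<in>?G. (r (?X i))\<^sup>2)) = ennreal (2 * \<Lambda>) * (\<Sum>i\<in>?G. ennreal ((r (?X i))\<^sup>2))"
          using \<Lambda>0 by (subst ennreal_mult) (auto simp: sum_nonneg sum_ennreal)
        also have "(\<Sum>i\<in>?G. ennreal ((r (?X i))\<^sup>2)) = (\<Sum>i\<in>?G. F i z X)"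
          using nodes True XjQ upd_pt_in_power_set[of X Q _ j] by (intro sum.cong) (auto simp: F_def \<Phi>_def)
        finally show ?thesis using True by (simp add: \<Phi>_def)
      qed (auto simp: indicator_def)
      have intF: "(\<integral>\<^sup>+z. \<integral>\<^sup>+X. F i z X \<partial>lborel \<partial>lborel) = ennreal vQ * ?P" for i
      proof -
        define H where "H Y v = indicator Q v * (indicator Q (Y $ j) * \<Phi> Y)" for v and Y :: "real^'d^'n"
        have mH: "case_prod H \<in> borel_measurable borel"
          unfolding H_def[abs_def] case_prod_unfold
          by (intro borel_measurable_times_ennreal borel_measurable_indicator_compose Q(1) borel_measurable_compose_continuous[OF m\<Phi>] continuous_intros)
        have "(\<integral>\<^sup>+z. \<integral>\<^sup>+X. F i z X \<partial>lborel \<partial>lborel) = (\<integral>\<^sup>+X. \<integral>\<^sup>+z. F i z X \<partial>lborel \<partial>lborel)"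
          by (rule nn_integral_lborel_swap) (auto simp: case_prod_unfold intro!: mF continuous_intros)
        also have "\<dots> = (\<integral>\<^sup>+X. \<integral>\<^sup>+z. H (upd_pt X j (node q \<delta> i + z)) (X $ j) \<partial>lborel \<partial>lborel)"
          by (simp add: F_def H_def)
        also have "\<dots> = (\<integral>\<^sup>+X. \<integral>\<^sup>+z. H (upd_pt X j z) (X $ j) \<partial>lborel \<partial>lborel)"
        proof (rule nn_integral_cong)
          fix X
          have "(\<lambda>z. H (upd_pt X j z) (X $ j)) \<in> borel_measurable borel"
            using borel_measurable_compose_continuous[OF mH, of "\<lambda>z. (upd_pt X j z, X $ j)"] by (simp add: continuous_intros)
          from nn_integral_lborel_translate[OF this, of "node q \<delta> i"]
          show "(\<integral>\<^sup>+z. H (upd_pt X j (node q \<delta> i + z)) (X $ j) \<partial>lborel) = (\<integral>\<^sup>+z. H (upd_pt X j z) (X $ j) \<partial>lborel)" .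
        qed
        also have "\<dots> = (\<integral>\<^sup>+X. \<integral>\<^sup>+z. H X z \<partial>lborel \<partial>lborel)"
          by (rule nn_integral_swap_slot[OF mH])
        also have "\<dots> = (\<integral>\<^sup>+X. \<Phi> X * ennreal vQ \<partial>lborel)"
        proof (intro nn_integral_cong)
          fix X
          have "(\<integral>\<^sup>+z. H X z \<partial>lborel) = (\<integral>\<^sup>+z. \<Phi> X * indicator Q z \<partial>lborel)"
            by (intro nn_integral_cong) (auto simp: H_def \<Phi>_def indicator_def dest: power_set_nth)
          also have "\<dots> = \<Phi> X * ennreal vQ" using Q(1) by (simp add: nn_integral_cmult_indicator vQ)
          finally show "(\<integral>\<^sup>+z. H X z \<partial>lborel) = \<Phi> X * ennreal vQ" .
        qed
        also have "\<dots> = ennreal vQ * ?P" using m\<Phi> by (subst nn_integral_multc) (auto simp: mult.commute)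
        finally show ?thesis .
      qed
      have "?A \<le> (\<integral>\<^sup>+z. \<integral>\<^sup>+X. ennreal 2 * (indicator ?B z * \<Phi> X) + ennreal (2 * \<Lambda>) * (\<Sum>i\<in>?G. F i z X) \<partial>lborel \<partial>lborel)"
        by (intro nn_integral_mono pt)
      also have "\<dots> = (\<integral>\<^sup>+z. ennreal 2 * (?P * indicator ?B z) + ennreal (2 * \<Lambda>) * (\<Sum>i\<in>?G. \<integral>\<^sup>+X. F i z X \<partial>lborel) \<partial>lborel)"
      proof (intro nn_integral_cong)
        fix z
        have mFz: "(\<lambda>X. F i z X) \<in> borel_measurable borel" for i by (intro mF continuous_intros)
        have "(\<integral>\<^sup>+X. ennreal 2 * (indicator ?B z * \<Phi> X) + ennreal (2 * \<Lambda>) * (\<Sum>i\<in>?G. F i z X) \<partial>lborel)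
           = (\<integral>\<^sup>+X. ennreal 2 * (indicator ?B z * \<Phi> X) \<partial>lborel) + (\<integral>\<^sup>+X. ennreal (2 * \<Lambda>) * (\<Sum>i\<in>?G. F i z X) \<partial>lborel)"
          using m\<Phi> mFz by (intro nn_integral_add) auto
        also have "(\<integral>\<^sup>+X. ennreal 2 * (indicator ?B z * \<Phi> X) \<partial>lborel) = ennreal 2 * (?P * indicator ?B z)"
          using m\<Phi> by (cases "z \<in> ?B") (auto simp: nn_integral_cmult)
        also have "(\<integral>\<^sup>+X. ennreal (2 * \<Lambda>) * (\<Sum>i\<in>?G. F i z X) \<partial>lborel) = ennreal (2 * \<Lambda>) * (\<Sum>i\<in>?G. \<integral>\<^sup>+X. F i z X \<partial>lborel)"
          using mFz by (subst nn_integral_cmult) (auto simp: nn_integral_sum)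
        finally show "(\<integral>\<^sup>+X. ennreal 2 * (indicator ?B z * \<Phi> X) + ennreal (2 * \<Lambda>) * (\<Sum>i\<in>?G. F i z X) \<partial>lborel)
           = ennreal 2 * (?P * indicator ?B z) + ennreal (2 * \<Lambda>) * (\<Sum>i\<in>?G. \<integral>\<^sup>+X. F i z X \<partial>lborel)" .
      qed
      also have "\<dots> = ennreal 2 * (?P * ennreal vZ) + ennreal (2 * \<Lambda>) * (\<Sum>i\<in>?G. \<integral>\<^sup>+z. \<integral>\<^sup>+X. F i z X \<partial>lborel \<partial>lborel)"
      proof -
        have m1: "(\<lambda>z. \<integral>\<^sup>+X. F i z X \<partial>lborel) \<in> borel_measurable borel" for i
          by (rule nn_integral_lborel_snd_measurable) (auto simp: case_prod_unfold intro!: mF continuous_intros)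
        have m2: "(\<lambda>z. ?P * indicator ?B z) \<in> borel_measurable borel"
          by (intro borel_measurable_times_ennreal borel_measurable_indicator) auto
        have "(\<integral>\<^sup>+z. ennreal 2 * (?P * indicator ?B z) + ennreal (2 * \<Lambda>) * (\<Sum>i\<in>?G. \<integral>\<^sup>+X. F i z X \<partial>lborel) \<partial>lborel)
          = (\<integral>\<^sup>+z. ennreal 2 * (?P * indicator ?B z) \<partial>lborel) + (\<integral>\<^sup>+z. ennreal (2 * \<Lambda>) * (\<Sum>i\<in>?G. \<integral>\<^sup>+X. F i z X \<partial>lborel) \<partial>lborel)"
          using m1 m2 by (intro nn_integral_add) auto
        also have "(\<integral>\<^sup>+z. ennreal 2 * (?P * indicator ?B z) \<partial>lborel) = ennreal 2 * (?P * ennreal vZ)"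
          using m2 by (subst nn_integral_cmult) (auto simp: nn_integral_cmult_indicator vZ)
        also have "(\<integral>\<^sup>+z. ennreal (2 * \<Lambda>) * (\<Sum>i\<in>?G. \<integral>\<^sup>+X. F i z X \<partial>lborel) \<partial>lborel) = ennreal (2 * \<Lambda>) * (\<Sum>i\<in>?G. \<integral>\<^sup>+z. \<integral>\<^sup>+X. F i z X \<partial>lborel \<partial>lborel)"
          using m1 by (subst nn_integral_cmult) (auto simp: nn_integral_sum)
        finally show ?thesis .
      qed
      also have "(\<Sum>i\<in>?G. \<integral>\<^sup>+z. \<integral>\<^sup>+X. F i z X \<partial>lborel \<partial>lborel) = (\<Sum>i\<in>?G. ennreal vQ * ?P)"
        by (simp only: intF)
      also have "ennreal 2 * (?P * ennreal vZ) + ennreal (2 * \<Lambda>) * (\<Sum>i\<in>?G. ennreal vQ * ?P) \<le> ennreal D * ?P"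
      proof -
        have "(\<Sum>i\<in>?G. ennreal vQ * ?P) = ennreal (real (card ?G)) * (ennreal vQ * ?P)"
          by (simp add: ennreal_of_nat_eq_real_of_nat)
        then have "ennreal 2 * (?P * ennreal vZ) + ennreal (2 * \<Lambda>) * (\<Sum>i\<in>?G. ennreal vQ * ?P)
          = (ennreal 2 * ennreal vZ) * ?P + (ennreal (2 * \<Lambda>) * (ennreal (real (card ?G)) * ennreal vQ)) * ?P"
          by (simp only: mult_ac)
        also have "\<dots> = ennreal (2 * vZ) * ?P + ennreal (2 * \<Lambda> * (real (card ?G) * vQ)) * ?P"
          using \<Lambda>0 vQ0 vZ0 by (simp only: ennreal_mult[symmetric] mult_nonneg_nonneg of_nat_0_le_iff less_imp_le zero_le_numeral)
        also have "\<dots> = ennreal (2 * vZ + 2 * \<Lambda> * (real (card ?G) * vQ)) * ?P"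
          using \<Lambda>0 vQ0 vZ0 by (subst distrib_right[symmetric], subst ennreal_plus[symmetric]) auto
        also have "\<dots> \<le> ennreal D * ?P" by (intro mult_right_mono ennreal_leI) (auto simp: D_def)
        finally show ?thesis .
      qed
      finally show ?thesis by (simp add: \<Phi>_def r_def)
    qed
    \<comment> \<open>\<open>?A\<close> involves neither y nor w. Integrating it over each of them
      brings out a factor \<open>vQ\<close>, which is divided off at the end.\<close>
    have step1: "ennreal vQ * (ennreal (1 / D) * ?A) \<le> ennreal K * (\<integral>\<^sup>+X. indicator ?N X * ennreal (top_difference j m b u w X) \<partial>lborel)"
      if w: "w \<in> Q" for w
    proof -
      have "ennreal vQ * (ennreal (1 / D) * ?A) = (\<integral>\<^sup>+y. (ennreal (1 / D) * ?A) * indicator Q y \<partial>lborel)"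
        by (simp only: cQ)
      also have "\<dots> \<le> (\<integral>\<^sup>+y. indicator Q y * (\<integral>\<^sup>+X. indicator ?N X * ennreal ((u X - taylor_part j m b u y w X)\<^sup>2) \<partial>lborel) \<partial>lborel)"
        using ennreal_divide_right[OF D0 fixed[OF _ w]] by (intro nn_integral_mono) (auto simp: indicator_def)
      also have "\<dots> \<le> ennreal K * (\<integral>\<^sup>+X. indicator ?N X * ennreal (top_difference j m b u w X) \<partial>lborel)"
        by (rule k[OF u w])
      finally show ?thesis .
    qed
    have "ennreal vQ * (ennreal (1 / K) * (ennreal vQ * (ennreal (1 / D) * ?A))) = (\<integral>\<^sup>+w. (ennreal (1 / K) * (ennreal vQ * (ennreal (1 / D) * ?A))) * indicator Q w \<partial>lborel)"
      by (simp only: cQ)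
    also have "\<dots> \<le> ?T"
      using ennreal_divide_right[OF K step1] by (intro nn_integral_mono) (auto simp: indicator_def)
    finally have "ennreal (1 / K) * (ennreal vQ * (ennreal (1 / D) * ?A)) \<le> ennreal (1 / vQ) * ?T"
      by (rule ennreal_divide_left[OF vQ0])
    then have "ennreal vQ * (ennreal (1 / D) * ?A) \<le> ennreal K * (ennreal (1 / vQ) * ?T)"
      using ennreal_divide_left[of "1 / K"] K by simp
    then have "ennreal (1 / D) * ?A \<le> ennreal (1 / vQ) * (ennreal K * (ennreal (1 / vQ) * ?T))"
      by (rule ennreal_divide_left[OF vQ0])
    then have "?A \<le> ennreal D * (ennreal (1 / vQ) * (ennreal K * (ennreal (1 / vQ) * ?T)))"
      using ennreal_divide_left[of "1 / D"] D0 by simp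
    also have "\<dots> = ennreal C * ?T"
    proof -
      have "ennreal C = ennreal (1 / vQ) * (ennreal K * ennreal (1 / vQ)) * ennreal D"
        unfolding C_def using K D0 vQ0 by (simp only: ennreal_mult mult_nonneg_nonneg less_imp_le zero_le_divide_1_iff)
      then show ?thesis by (simp only: mult_ac)
    qed
    finally show ?thesis .
  qed
  with C0 show ?thesis by blast
qed

section \<open>Replacing the slots one by one\<close>

definition interp_err :: "nat \<Rightarrow> real^'d \<Rightarrow> real \<Rightarrow> 'n \<Rightarrow> (real^'d^'n \<Rightarrow> real) \<Rightarrow> real^'d \<Rightarrow> real^'d^'n \<Rightarrow> real" where
  "interp_err M q \<delta> j u z X = u X - (\<Sum>i\<in>grid M. glag M q \<delta> i (X $ j - z) * u (upd_pt X j (node q \<delta> i + z)))"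

text \<open>The hybrid between u and the trace: slots in R are extrapolated to shifted nodes, the
  others range freely near q. With R empty this is u near the centre; with all slots in R it is the
  quantity of the trace estimate at scale 1.\<close>

definition mixed_tens :: "nat \<Rightarrow> real^'d \<Rightarrow> real \<Rightarrow> 'n set \<Rightarrow> ('n \<Rightarrow> 'd \<Rightarrow> nat) \<Rightarrow> (real^'d^'n \<Rightarrow> real) \<Rightarrow> (real^'d) \<times> (real^'d^'n) \<Rightarrow> real" where
  "mixed_tens M q \<delta> R i u p = tens M R (\<lambda>l a. node q \<delta> (i l) + fst p + real a *\<^sub>R snd p $ l) u (\<chi> l. q + snd p $ l)"

text \<open>Interpolate in slot j, then write the value at each shifted node as extrapolated value
  minus difference. The increment \<open>W $ j\<close>, until then the position of slot j relative
  to q, becomes the step of its extrapolation.\<close>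

lemma mixed_tens_step:
  fixes R :: "'n::finite set" and u :: "real^'d^'n \<Rightarrow> real"
  assumes j: "j \<notin> R"
  shows "mixed_tens M q \<delta> R i u (z, W) =
     tens M R (\<lambda>l a. node q \<delta> (i l) + z + real a *\<^sub>R W $ l) (interp_err M q \<delta> j u z) (\<chi> l. q + W $ l)
   + (\<Sum>\<iota>\<in>grid M. glag M q \<delta> \<iota> (q + W $ j - z) * (mixed_tens M q \<delta> (insert j R) (i(j := \<iota>)) u (z, W)
       - tens M R (\<lambda>l a. node q \<delta> (i l) + z + real a *\<^sub>R W $ l) (fdiff M j (W $ j) u) (upd_pt (\<chi> l. q + W $ l) j (node q \<delta> \<iota> + z))))"
proof -
  let ?e = "\<lambda>l a. node q \<delta> (i l) + z + real a *\<^sub>R W $ l" and ?Y = "\<chi> l. q + W $ l"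
  let ?g = "\<lambda>\<iota>. glag M q \<delta> \<iota> (q + W $ j - z)"
  define v where "v x = tens M R ?e u (upd_pt ?Y j x)" for x
  have split: "(\<Sum>k\<le>M. fd_coeff M k * f k) = - f 0 + (\<Sum>k\<in>{1..M}. fd_coeff M k * f k)" for f
    by (simp add: atMost_atLeast0 sum.atLeast_Suc_atMost fd_coeff_def)
  have v: "v n = mixed_tens M q \<delta> (insert j R) (i(j := \<iota>)) u (z, W) - tens M R ?e (fdiff M j (W $ j) u) (upd_pt ?Y j n)"
    if n: "n = node q \<delta> \<iota> + z" for n \<iota>
  proof -
    have "mixed_tens M q \<delta> (insert j R) (i(j := \<iota>)) u (z, W) = (\<Sum>a\<in>{1..M}. fd_coeff M a * v (n + real a *\<^sub>R W $ j))"
      unfolding mixed_tens_def tens_insert[OF j] v_def fst_conv snd_conv n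
      by (intro sum.cong refl arg_cong2[where f = "(*)"]) (use j in \<open>simp, intro tens_cong, auto\<close>)
    moreover have "tens M R ?e (fdiff M j (W $ j) u) (upd_pt ?Y j n) = (\<Sum>k\<le>M. fd_coeff M k * v (n + real k *\<^sub>R W $ j))"
      unfolding v_def by (rule fdiff_tens[OF j, symmetric])
    ultimately show ?thesis unfolding split by simp
  qed
  have "tens M R ?e (interp_err M q \<delta> j u z) ?Y = tens M R ?e u ?Y - (\<Sum>\<iota>\<in>grid M. ?g \<iota> * v (node q \<delta> \<iota> + z))"
  proof -
    let ?Z = "\<lambda>a. (\<chi> l. if l \<in> R then ?e l (a l) else ?Y $ l)" and ?c = "\<lambda>a. \<Prod>l\<in>R. fd_coeff M (a l)"
    have Zj: "?Z a $ j = q + W $ j" for a using j by simp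
    have Zu: "upd_pt (?Z a) j x = (\<chi> l. if l \<in> R then ?e l (a l) else upd_pt ?Y j x $ l)" for a x
      using j by (auto simp: vec_eq_iff)
    have "tens M R ?e (interp_err M q \<delta> j u z) ?Y
        = (\<Sum>a\<in>Pi\<^sub>E R (\<lambda>_. {1..M}). ?c a * u (?Z a)) - (\<Sum>a\<in>Pi\<^sub>E R (\<lambda>_. {1..M}). ?c a * (\<Sum>\<iota>\<in>grid M. ?g \<iota> * u (upd_pt (?Z a) j (node q \<delta> \<iota> + z))))"
      unfolding tens_def interp_err_def Zj by (simp add: right_diff_distrib sum_subtractf)
    also have "(\<Sum>a\<in>Pi\<^sub>E R (\<lambda>_. {1..M}). ?c a * (\<Sum>\<iota>\<in>grid M. ?g \<iota> * u (upd_pt (?Z a) j (node q \<delta> \<iota> + z))))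
        = (\<Sum>\<iota>\<in>grid M. ?g \<iota> * v (node q \<delta> \<iota> + z))"
      unfolding v_def tens_def Zu sum_distrib_left by (subst sum.swap) (simp add: mult_ac)
    finally show ?thesis by (simp add: tens_def)
  qed
  moreover have "mixed_tens M q \<delta> R i u (z, W) = tens M R ?e u ?Y" by (simp add: mixed_tens_def)
  ultimately have "mixed_tens M q \<delta> R i u (z, W) = tens M R ?e (interp_err M q \<delta> j u z) ?Y + (\<Sum>\<iota>\<in>grid M. ?g \<iota> * v (node q \<delta> \<iota> + z))"
    by simp
  then show ?thesis by (simp only: v[OF refl])
qed

lemma borel_measurable_tens:
  fixes u :: "real^'d^'n \<Rightarrow> real"
  assumes "u \<in> borel_measurable borel" "\<And>l a. continuous_on UNIV (\<lambda>p. e p l a)" "continuous_on UNIV Y"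
  shows "(\<lambda>p. tens M R (e p) u (Y p)) \<in> borel_measurable borel"
  unfolding tens_def
proof (intro borel_measurable_sum borel_measurable_times borel_measurable_const borel_measurable_compose_continuous[OF assms(1)] continuous_on_slotwise)
  show "continuous_on UNIV (\<lambda>p. if l \<in> R then e p l (a l) else Y p $ l)" for a l
    using assms(2,3) by (cases "l \<in> R") (auto intro: continuous_intros)
qed

lemma borel_measurable_mixed_tens:
  fixes u :: "real^'d^'n \<Rightarrow> real"
  assumes "u \<in> borel_measurable borel"
  shows "mixed_tens M q \<delta> R i u \<in> borel_measurable borel"
proof -
  have "(\<lambda>p. tens M R (\<lambda>l a. node q \<delta> (i l) + fst p + real a *\<^sub>R snd p $ l) u (\<chi> l. q + snd p $ l)) \<in> borel_measurable borel"
    by (intro borel_measurable_tens assms continuous_intros)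
  then show ?thesis by (simp add: mixed_tens_def[abs_def])
qed

text \<open>The two consequences of the seminorm on which the local estimate rests, averaged
  differences and one-slot interpolation errors, measured by one and the same E.\<close>

definition local_data :: "(real^'d) set \<Rightarrow> nat \<Rightarrow> real \<Rightarrow> (real^'d) set \<Rightarrow> real^'d \<Rightarrow> real \<Rightarrow> real \<Rightarrow> (real^'d^'n \<Rightarrow> real) \<Rightarrow> ennreal \<Rightarrow> bool" where
  "local_data \<Omega> M r Q q \<delta> \<omega> u E \<longleftrightarrow> u \<in> borel_measurable borel \<and> difference_bound \<Omega> M r u E \<and>
    (\<forall>j. (\<integral>\<^sup>+z. \<integral>\<^sup>+X. indicator (ball 0 \<omega>) z * (indicator (power_set Q) X * ennreal ((interp_err M q \<delta> j u z X)\<^sup>2)) \<partial>lborel \<partial>lborel) \<le> E)"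

text \<open>Three terms arise: interpolation errors, hybrids with one more slot replaced, and
  differences with step \<open>W $ j\<close>. Errors and differences are bounded by E, because the
  slots are integrated at scale at least 1, except that slot j of the differences is freed by the
  translation z.\<close>

lemma mixed_tens_norm_step:
  fixes \<Omega> Q :: "(real^'d) set" and R :: "'n::finite set"
  assumes Q: "open Q" "convex Q" "Q \<subseteq> \<Omega>" and \<omega>: "\<omega> > 0"
    and nodes: "\<And>\<iota>. \<iota> \<in> grid M \<Longrightarrow> ball (node q \<delta> \<iota>) ((2 * real M + 1) * \<omega>) \<subseteq> Q"
    and center: "ball q ((2 * real M + 1) * \<omega>) \<subseteq> Q" and M: "M \<ge> 1" and j: "j \<notin> R"
  shows "\<exists>C\<ge>0. \<forall>(u :: real^'d^'n \<Rightarrow> real) E i. local_data \<Omega> M r Q q \<delta> \<omega> u E \<longrightarrow> (\<forall>l. i l \<in> grid M) \<longrightarrow>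
    dint \<omega> (\<lambda>p. ennreal ((mixed_tens M q \<delta> R i u p)\<^sup>2))
     \<le> ennreal C * ((\<Sum>\<iota>\<in>grid M. dint \<omega> (\<lambda>p. ennreal ((mixed_tens M q \<delta> (insert j R) (i(j := \<iota>)) u p)\<^sup>2))) + E)"
proof -
  let ?G = "grid M :: ('d \<Rightarrow> nat) set" and ?A = "Pi\<^sub>E R (\<lambda>_. {1..M})"
  have finA: "finite ?A" by (intro finite_PiE) auto
  obtain D where D0: "D \<ge> 0" and D: "\<And>(e :: 'n \<Rightarrow> nat \<Rightarrow> real^'d) (u :: real^'d^'n \<Rightarrow> real) Y. (tens M R e u Y)\<^sup>2
    \<le> D * (\<Sum>a\<in>?A. (u (\<chi> l. if l \<in> R then e l (a l) else Y $ l))\<^sup>2)"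
    using tens_sq_le[where M = M and R = R and 'd = 'd] by blast
  \<comment> \<open>The weights are evaluated at \<open>q + W $ j - z\<close>, which lies within
    \<open>2 * \<omega>\<close> of q.\<close>
  obtain \<Lambda> where \<Lambda>: "\<And>x. x \<in> cball q (2 * \<omega>) \<Longrightarrow> (\<Sum>i\<in>?G. (glag M q \<delta> i x)\<^sup>2) \<le> \<Lambda>" and \<Lambda>0: "\<Lambda> \<ge> 0"
  proof -
    have "compact ((\<lambda>x. \<Sum>i\<in>?G. (glag M q \<delta> i x)\<^sup>2) ` cball q (2 * \<omega>))"
      by (intro compact_continuous_image continuous_intros continuous_on_compose2[OF continuous_on_glag]) auto
    then have "bounded ((\<lambda>x. \<Sum>i\<in>?G. (glag M q \<delta> i x)\<^sup>2) ` cball q (2 * \<omega>))" by (rule compact_imp_bounded)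
    then obtain A where A: "\<And>x. x \<in> cball q (2 * \<omega>) \<Longrightarrow> norm (\<Sum>i\<in>?G. (glag M q \<delta> i x)\<^sup>2) \<le> A"
      unfolding bounded_iff by blast
    show ?thesis by (rule that[of "max A 0"]) (use A in \<open>auto simp: le_max_iff_disj dest!: abs_le_D1\<close>)
  qed
  define N where "N = real (card ?A)"
  \<comment> \<open>The factor 2 splits off the interpolation error, the factor 4 also separates
    hybrids from differences. \<open>N\<close> and the size of the grid count summands, and the
    power of \<omega> is the difference bound for steps of length below \<omega>.\<close>
  define C where "C = 2 * D * N + 4 * \<Lambda> + 4 * \<Lambda> * D * real (card ?G) * N * \<omega> powr r"
  have N0: "N \<ge> 0" by (simp add: N_def)
  have C0: "C \<ge> 0" unfolding C_def using D0 \<Lambda>0 N0 by (intro add_nonneg_nonneg mult_nonneg_nonneg) auto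
  have "dint \<omega> (\<lambda>p. ennreal ((mixed_tens M q \<delta> R i u p)\<^sup>2))
     \<le> ennreal C * ((\<Sum>\<iota>\<in>?G. dint \<omega> (\<lambda>p. ennreal ((mixed_tens M q \<delta> (insert j R) (i(j := \<iota>)) u p)\<^sup>2))) + E)"
    if ld: "local_data \<Omega> M r Q q \<delta> \<omega> u E" and i: "\<forall>l. i l \<in> ?G" for u :: "real^'d^'n \<Rightarrow> real" and E i
  proof -
    have u: "u \<in> borel_measurable borel" and db: "difference_bound \<Omega> M r u E"
      and bh: "(\<integral>\<^sup>+z. \<integral>\<^sup>+X. indicator (ball 0 \<omega>) z * (indicator (power_set Q) X * ennreal ((interp_err M q \<delta> j u z X)\<^sup>2)) \<partial>lborel \<partial>lborel) \<le> E"
      using ld by (auto simp: local_data_def)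
    define Z where "Z a p = (\<chi> l. (if l \<in> R then node q \<delta> (i l) else q) + (if l \<in> R then 1 else 0) *\<^sub>R fst p + (if l \<in> R then real (a l) else 1) *\<^sub>R snd p $ l)"
      for a :: "'n \<Rightarrow> nat" and p :: "(real^'d) \<times> (real^'d^'n)"
    \<comment> \<open>The coefficient of the increment in slot j is 0: the base point of the
      difference moves with the translation only, while \<open>W $ j\<close> is its step.\<close>
    define Z' where "Z' \<iota> a p = (\<chi> l. (if l = j then node q \<delta> \<iota> else if l \<in> R then node q \<delta> (i l) else q) + (if l = j \<or> l \<in> R then 1 else 0) *\<^sub>R fst p
        + (if l = j then 0 else if l \<in> R then real (a l) else 1) *\<^sub>R snd p $ l)"
      for \<iota> and a :: "'n \<Rightarrow> nat" and p :: "(real^'d) \<times> (real^'d^'n)"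
    define f where "f a p = ennreal ((interp_err M q \<delta> j u (fst p) (Z a p))\<^sup>2)" for a p
    define h where "h \<iota> a p = ennreal ((fdiff M j (1 *\<^sub>R snd p $ j) u (Z' \<iota> a p))\<^sup>2)" for \<iota> a p
    define g where "g \<iota> p = ennreal ((mixed_tens M q \<delta> (insert j R) (i(j := \<iota>)) u p)\<^sup>2)" for \<iota> p
    have merr: "(\<lambda>p. interp_err M q \<delta> j u (z p) (X p)) \<in> borel_measurable borel"
      if "continuous_on UNIV z" "continuous_on UNIV X" for z X
      unfolding interp_err_def
      by (intro borel_measurable_diff borel_measurable_sum borel_measurable_times
          borel_measurable_compose_continuous[OF u] borel_measurable_continuous_onI
          continuous_on_compose2[OF continuous_on_glag[of UNIV]] continuous_intros that) auto
    have mf: "f a \<in> borel_measurable borel" for a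
    proof -
      have "(\<lambda>p. interp_err M q \<delta> j u (fst p) (Z a p)) \<in> borel_measurable borel"
        unfolding Z_def by (intro merr continuous_intros)
      then show ?thesis unfolding f_def[abs_def] by simp
    qed
    have mh: "h \<iota> a \<in> borel_measurable borel" for \<iota> a
    proof -
      have "(\<lambda>p. fdiff M j (1 *\<^sub>R snd p $ j) u (Z' \<iota> a p)) \<in> borel_measurable borel"
        unfolding Z'_def by (intro borel_measurable_fdiff[OF u] continuous_intros)
      then show ?thesis unfolding h_def[abs_def] by simp
    qed
    have mg: "g \<iota> \<in> borel_measurable borel" for \<iota>
      using borel_measurable_mixed_tens[OF u, of M q \<delta> "insert j R" "i(j := \<iota>)"] unfolding g_def[abs_def] by simp
    have slotQ: "node q \<delta> \<iota> + z + t *\<^sub>R w \<in> Q" if "\<iota> \<in> ?G" "z \<in> ball 0 \<omega>" "w \<in> ball 0 \<omega>" "\<bar>t\<bar> \<le> 2 * real M" for \<iota> z t w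
      by (rule in_fat_ball[OF nodes[OF that(1)] that(2-4)])
    have cenQ: "q + w \<in> Q" if "w \<in> ball 0 \<omega>" for w
      using in_fat_ball[OF center, of 0 w 1] that \<omega> M by simp
    have fE: "dint \<omega> (f a) \<le> E" if a: "a \<in> ?A" for a
    proof -
      define b where "b l = (if l \<in> R then real (a l) else 1)" for l
      have b1: "b l \<ge> 1" and bM: "b l \<le> real M" for l using a M by (auto simp: b_def PiE_iff)
      have "dint \<omega> (f a) = (\<integral>\<^sup>+z. \<integral>\<^sup>+W. indicator (ball 0 \<omega>) z * (indicator (power_set (ball 0 \<omega>)) W * f a (z, W)) \<partial>lborel \<partial>lborel)"
        by (rule dint_iterated[OF mf])
      also have "\<dots> \<le> (\<integral>\<^sup>+z. \<integral>\<^sup>+X. indicator (ball 0 \<omega>) z * (indicator (power_set Q) X * ennreal ((interp_err M q \<delta> j u z X)\<^sup>2)) \<partial>lborel \<partial>lborel)"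
      proof (rule nn_integral_mono)
        fix z :: "real^'d"
        define P :: "real^'d^'n" where "P = (\<chi> l. (if l \<in> R then node q \<delta> (i l) else q) + (if l \<in> R then 1 else 0) *\<^sub>R z)"
        let ?F = "\<lambda>X. indicator (ball 0 \<omega>) z * (indicator (power_set Q) X * ennreal ((interp_err M q \<delta> j u z X)\<^sup>2))"
        have ZP: "Z a (z, W) = (\<chi> l. P $ l + b l *\<^sub>R W $ l)" for W by (simp add: Z_def P_def b_def)
        have mF: "?F \<in> borel_measurable borel"
          using merr[of "\<lambda>_. z" "\<lambda>X. X"]
          by (intro borel_measurable_times_ennreal borel_measurable_const borel_measurable_indicator borel_open open_power_set Q(1)) (auto intro: continuous_intros)
        have "(\<integral>\<^sup>+W. indicator (ball 0 \<omega>) z * (indicator (power_set (ball 0 \<omega>)) W * f a (z, W)) \<partial>lborel)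
            \<le> (\<integral>\<^sup>+W. ?F (\<chi> l. P $ l + b l *\<^sub>R W $ l) \<partial>lborel)"
        proof (rule nn_integral_mono)
          fix W :: "real^'d^'n"
          show "indicator (ball 0 \<omega>) z * (indicator (power_set (ball 0 \<omega>)) W * f a (z, W)) \<le> ?F (\<chi> l. P $ l + b l *\<^sub>R W $ l)"
          proof (cases "z \<in> ball 0 \<omega> \<and> W \<in> power_set (ball 0 \<omega>)")
            case True
            have "P $ l + b l *\<^sub>R W $ l \<in> Q" for l
            proof (cases "l \<in> R")
              case l: True
              then show ?thesis using slotQ[of "i l" z "W $ l" "b l"] i True power_set_nth[of W "ball 0 \<omega>" l] b1[of l] bM[of l] by (simp add: P_def)
            next
              case False
              then show ?thesis using cenQ[of "W $ l"] True power_set_nth[of W "ball 0 \<omega>" l] by (simp add: P_def b_def)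
            qed
            then have "(\<chi> l. P $ l + b l *\<^sub>R W $ l) \<in> power_set Q" by (simp add: power_set_def)
            then show ?thesis using True by (simp add: f_def ZP)
          qed (auto simp: indicator_def)
        qed
        also have "\<dots> \<le> (\<integral>\<^sup>+X. ?F X \<partial>lborel)"
        proof -
          have "(\<integral>\<^sup>+X. ?F X \<partial>lborel) = ennreal (\<Prod>l\<in>UNIV. b l ^ DIM(real^'d)) * (\<integral>\<^sup>+W. ?F (\<chi> l. P $ l + b l *\<^sub>R W $ l) \<partial>lborel)"
            by (rule nn_integral_lborel_slotwise_affine[OF mF]) (use b1 in \<open>auto intro: less_le_trans[OF zero_less_one]\<close>)
          \<comment> \<open>All factors \<open>b l\<close> are at least 1, so the Jacobian can only
            help and is estimated from below by 1.\<close>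
          moreover have "1 * (\<integral>\<^sup>+W. ?F (\<chi> l. P $ l + b l *\<^sub>R W $ l) \<partial>lborel) \<le> ennreal (\<Prod>l\<in>UNIV. b l ^ DIM(real^'d)) * (\<integral>\<^sup>+W. ?F (\<chi> l. P $ l + b l *\<^sub>R W $ l) \<partial>lborel)"
          proof (rule mult_right_mono)
            have "(\<Prod>l\<in>UNIV. b l ^ DIM(real^'d)) \<ge> 1" by (intro prod_ge_1 one_le_power b1)
            then show "1 \<le> ennreal (\<Prod>l\<in>UNIV. b l ^ DIM(real^'d))" by (simp del: DIM_cart)
          qed simp
          ultimately show ?thesis by simp
        qed
        finally show "(\<integral>\<^sup>+W. indicator (ball 0 \<omega>) z * (indicator (power_set (ball 0 \<omega>)) W * f a (z, W)) \<partial>lborel) \<le> (\<integral>\<^sup>+X. ?F X \<partial>lborel)" .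
      qed
      also have "\<dots> \<le> E" by (rule bh)
      finally show ?thesis .
    qed
    have hE: "dint \<omega> (h \<iota> a) \<le> ennreal (\<omega> powr r) * E" if a: "a \<in> ?A" and \<iota>: "\<iota> \<in> ?G" for \<iota> a
    proof -
      define b where "b l = (if l = j then 0 else if l \<in> R then real (a l) else 1)" for l
      have b1: "l \<noteq> j \<Longrightarrow> b l \<ge> 1" and b0: "b l \<ge> 0" and bM: "b l \<le> real M" for l using a M by (auto simp: b_def PiE_iff)
      define P :: "real^'d^'n" where "P = (\<chi> l. if l = j then node q \<delta> \<iota> else if l \<in> R then node q \<delta> (i l) else q)"
      define \<epsilon> :: "'n \<Rightarrow> real" where "\<epsilon> l = (if l = j \<or> l \<in> R then 1 else 0)" for l
      have "dint \<omega> (h \<iota> a) = (\<integral>\<^sup>+z. \<integral>\<^sup>+W. indicator (ball 0 \<omega>) z * (indicator (power_set (ball 0 \<omega>)) W *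
          ennreal ((fdiff M j (1 *\<^sub>R W $ j) u (\<chi> l. P $ l + \<epsilon> l *\<^sub>R z + b l *\<^sub>R W $ l))\<^sup>2)) \<partial>lborel \<partial>lborel)"
        unfolding dint_iterated[OF mh] by (simp add: h_def Z'_def P_def \<epsilon>_def b_def)
      also have "\<dots> \<le> ennreal ((1 / (\<Prod>l\<in>UNIV-{j}. b l ^ CARD('d))) * (1 / 1 ^ CARD('d)) * (1 * \<omega>) powr r) * E"
      proof (rule fdiff_slots_bound[OF u db Q _ \<omega>])
        show "b l > 0" if "l \<noteq> j" for l using b1[OF that] by simp
        fix z :: "real^'d" and W :: "real^'d^'n" assume z: "z \<in> ball 0 \<omega>" and W: "W \<in> power_set (ball 0 \<omega>)"
        have Wl: "W $ l \<in> ball 0 \<omega>" for l using W power_set_nth by blast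
        show "P $ l + \<epsilon> l *\<^sub>R z + b l *\<^sub>R W $ l \<in> Q" for l
        proof (cases "l = j \<or> l \<in> R")
          case True
          then show ?thesis using slotQ[of "if l = j then \<iota> else i l" z "W $ l" "b l"] i \<iota> z Wl b0[of l] bM[of l] by (auto simp: P_def \<epsilon>_def)
        next
          case False
          then show ?thesis using cenQ[OF Wl[of l]] by (simp add: P_def \<epsilon>_def b_def)
        qed
        show "P $ j + z + b j *\<^sub>R W $ j + (real M * 1) *\<^sub>R W $ j \<in> Q"
          using slotQ[OF \<iota> z Wl, of "real M" j] by (simp add: P_def b_def)
      qed (auto simp: \<epsilon>_def)
      also have "\<dots> \<le> ennreal (\<omega> powr r) * E"
      proof (intro mult_right_mono ennreal_leI)
        have "(\<Prod>l\<in>UNIV-{j}. b l ^ CARD('d)) \<ge> 1" by (intro prod_ge_1 one_le_power b1) auto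
        then have "1 / (\<Prod>l\<in>UNIV-{j}. b l ^ CARD('d)) \<le> 1" by simp
        then have "1 / (\<Prod>l\<in>UNIV-{j}. b l ^ CARD('d)) * \<omega> powr r \<le> 1 * \<omega> powr r" by (rule mult_right_mono) simp
        then show "(1 / (\<Prod>l\<in>UNIV-{j}. b l ^ CARD('d))) * (1 / 1 ^ CARD('d)) * (1 * \<omega>) powr r \<le> \<omega> powr r" by simp
      qed simp
      finally show ?thesis .
    qed
    have pt: "ennreal ((mixed_tens M q \<delta> R i u p)\<^sup>2) \<le>
        ennreal (2 * D) * (\<Sum>a\<in>?A. f a p) + (ennreal (4 * \<Lambda>) * (\<Sum>\<iota>\<in>?G. g \<iota> p) + ennreal (4 * \<Lambda> * D) * (\<Sum>\<iota>\<in>?G. \<Sum>a\<in>?A. h \<iota> a p))"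
      if p: "p = (z, W)" and z: "z \<in> ball 0 \<omega>" and W: "W \<in> power_set (ball 0 \<omega>)" for p z W
    proof -
      let ?e = "\<lambda>l a. node q \<delta> (i l) + z + real a *\<^sub>R W $ l" and ?Y = "\<chi> l. q + W $ l"
      let ?c = "\<lambda>\<iota>. glag M q \<delta> \<iota> (q + W $ j - z)"
      let ?x = "tens M R ?e (interp_err M q \<delta> j u z) ?Y"
      let ?y = "\<lambda>\<iota>. mixed_tens M q \<delta> (insert j R) (i(j := \<iota>)) u (z, W)"
      let ?w = "\<lambda>\<iota>. tens M R ?e (fdiff M j (W $ j) u) (upd_pt ?Y j (node q \<delta> \<iota> + z))"
      have Wj: "norm (W $ j) < \<omega>" using power_set_nth[OF W, of j] by simp
      have "dist q (q + W $ j - z) \<le> norm (W $ j) + norm z"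
        using norm_triangle_ineq4[of z "W $ j"] by (simp add: dist_norm algebra_simps)
      then have "q + W $ j - z \<in> cball q (2 * \<omega>)" using Wj z by simp
      then have c\<Lambda>: "(\<Sum>\<iota>\<in>?G. (?c \<iota>)\<^sup>2) \<le> \<Lambda>" by (rule \<Lambda>)
      have x: "?x\<^sup>2 \<le> D * (\<Sum>a\<in>?A. (interp_err M q \<delta> j u z (Z a p))\<^sup>2)"
      proof -
        have "(\<chi> l. if l \<in> R then ?e l (a l) else ?Y $ l) = Z a p" for a by (simp add: Z_def p vec_eq_iff)
        then show ?thesis using D[of ?e "interp_err M q \<delta> j u z" ?Y] by simp
      qed
      have w: "(?w \<iota>)\<^sup>2 \<le> D * (\<Sum>a\<in>?A. (fdiff M j (1 *\<^sub>R W $ j) u (Z' \<iota> a p))\<^sup>2)" for \<iota>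
      proof -
        have "(\<chi> l. if l \<in> R then ?e l (a l) else upd_pt ?Y j (node q \<delta> \<iota> + z) $ l) = Z' \<iota> a p" for a
          using j by (auto simp: Z'_def p vec_eq_iff)
        then show ?thesis using D[of ?e "fdiff M j (W $ j) u" "upd_pt ?Y j (node q \<delta> \<iota> + z)"] by simp
      qed
      have "(mixed_tens M q \<delta> R i u p)\<^sup>2 = (?x + (\<Sum>\<iota>\<in>?G. ?c \<iota> * (?y \<iota> - ?w \<iota>)))\<^sup>2"
        unfolding p mixed_tens_step[OF j] ..
      also have "\<dots> \<le> 2 * ?x\<^sup>2 + 2 * (\<Sum>\<iota>\<in>?G. ?c \<iota> * (?y \<iota> - ?w \<iota>))\<^sup>2"
        using zero_le_power2[of "?x - (\<Sum>\<iota>\<in>?G. ?c \<iota> * (?y \<iota> - ?w \<iota>))"] by (simp add: power2_sum power2_diff)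
      also have "(\<Sum>\<iota>\<in>?G. ?c \<iota> * (?y \<iota> - ?w \<iota>))\<^sup>2 \<le> (\<Sum>\<iota>\<in>?G. (?c \<iota>)\<^sup>2) * (\<Sum>\<iota>\<in>?G. (?y \<iota> - ?w \<iota>)\<^sup>2)"
        by (rule Cauchy_Schwarz_ineq_sum)
      also have "\<dots> \<le> \<Lambda> * (\<Sum>\<iota>\<in>?G. 2 * (?y \<iota>)\<^sup>2 + 2 * (D * (\<Sum>a\<in>?A. (fdiff M j (1 *\<^sub>R W $ j) u (Z' \<iota> a p))\<^sup>2)))"
      proof (rule mult_mono[OF c\<Lambda>])
        show "(\<Sum>\<iota>\<in>?G. (?y \<iota> - ?w \<iota>)\<^sup>2) \<le> (\<Sum>\<iota>\<in>?G. 2 * (?y \<iota>)\<^sup>2 + 2 * (D * (\<Sum>a\<in>?A. (fdiff M j (1 *\<^sub>R W $ j) u (Z' \<iota> a p))\<^sup>2)))"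
        proof (rule sum_mono)
          fix \<iota>
          have "(?y \<iota> - ?w \<iota>)\<^sup>2 \<le> 2 * (?y \<iota>)\<^sup>2 + 2 * (?w \<iota>)\<^sup>2"
            using zero_le_power2[of "?y \<iota> + ?w \<iota>"] by (simp add: power2_sum power2_diff)
          then show "(?y \<iota> - ?w \<iota>)\<^sup>2 \<le> 2 * (?y \<iota>)\<^sup>2 + 2 * (D * (\<Sum>a\<in>?A. (fdiff M j (1 *\<^sub>R W $ j) u (Z' \<iota> a p))\<^sup>2))"
            using w[of \<iota>] by linarith
        qed
      qed (use \<Lambda>0 in \<open>auto intro: sum_nonneg\<close>)
      finally have "(mixed_tens M q \<delta> R i u p)\<^sup>2 \<le> 2 * ?x\<^sup>2 + 2 * (\<Lambda> * (\<Sum>\<iota>\<in>?G. 2 * (?y \<iota>)\<^sup>2 + 2 * (D * (\<Sum>a\<in>?A. (fdiff M j (1 *\<^sub>R W $ j) u (Z' \<iota> a p))\<^sup>2))))"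
        by simp
      also have "\<dots> \<le> 2 * (D * (\<Sum>a\<in>?A. (interp_err M q \<delta> j u z (Z a p))\<^sup>2)) + 2 * (\<Lambda> * (\<Sum>\<iota>\<in>?G. 2 * (?y \<iota>)\<^sup>2 + 2 * (D * (\<Sum>a\<in>?A. (fdiff M j (1 *\<^sub>R W $ j) u (Z' \<iota> a p))\<^sup>2))))"
        using x by simp
      also have "\<dots> = (2 * D) * (\<Sum>a\<in>?A. (interp_err M q \<delta> j u z (Z a p))\<^sup>2) + ((4 * \<Lambda>) * (\<Sum>\<iota>\<in>?G. (?y \<iota>)\<^sup>2)
          + (4 * \<Lambda> * D) * (\<Sum>\<iota>\<in>?G. \<Sum>a\<in>?A. (fdiff M j (1 *\<^sub>R W $ j) u (Z' \<iota> a p))\<^sup>2))"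
        by (simp add: sum.distrib sum_distrib_left[symmetric] algebra_simps)
      finally have "ennreal ((mixed_tens M q \<delta> R i u p)\<^sup>2) \<le> ennreal ((2 * D) * (\<Sum>a\<in>?A. (interp_err M q \<delta> j u z (Z a p))\<^sup>2) + ((4 * \<Lambda>) * (\<Sum>\<iota>\<in>?G. (?y \<iota>)\<^sup>2)
          + (4 * \<Lambda> * D) * (\<Sum>\<iota>\<in>?G. \<Sum>a\<in>?A. (fdiff M j (1 *\<^sub>R W $ j) u (Z' \<iota> a p))\<^sup>2)))" (is "_ \<le> ennreal (?a * ?sa + (?b * ?sb + ?d * ?sd))")
        by (rule ennreal_leI)
      also have "\<dots> = ennreal ?a * ennreal ?sa + (ennreal ?b * ennreal ?sb + ennreal ?d * ennreal ?sd)"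
      proof -
        have "?a \<ge> 0" "?sa \<ge> 0" "?b \<ge> 0" "?sb \<ge> 0" "?d \<ge> 0" "?sd \<ge> 0"
          using D0 \<Lambda>0 by (auto intro!: sum_nonneg)
        moreover have "ennreal (a * x + (b * y + d * w)) = ennreal a * ennreal x + (ennreal b * ennreal y + ennreal d * ennreal w)"
          if "a \<ge> 0" "x \<ge> 0" "b \<ge> 0" "y \<ge> 0" "d \<ge> 0" "w \<ge> 0" for a x b y d w :: real
          using that by (simp add: ennreal_mult)
        ultimately show ?thesis by blast
      qed
      also have "ennreal ?sa = (\<Sum>a\<in>?A. f a p)" by (simp add: f_def p sum_ennreal)
      also have "ennreal ?sb = (\<Sum>\<iota>\<in>?G. g \<iota> p)" by (simp add: g_def p sum_ennreal)
      also have "ennreal ?sd = (\<Sum>\<iota>\<in>?G. \<Sum>a\<in>?A. h \<iota> a p)" by (simp add: h_def p sum_ennreal sum_nonneg)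
      finally show ?thesis .
    qed
    let ?S = "\<Sum>\<iota>\<in>?G. dint \<omega> (g \<iota>)"
    have ms: "(\<lambda>p. \<Sum>a\<in>?A. f a p) \<in> borel_measurable borel" "(\<lambda>p. \<Sum>\<iota>\<in>?G. g \<iota> p) \<in> borel_measurable borel"
      "(\<lambda>p. \<Sum>\<iota>\<in>?G. \<Sum>a\<in>?A. h \<iota> a p) \<in> borel_measurable borel" "(\<lambda>p. \<Sum>a\<in>?A. h \<iota> a p) \<in> borel_measurable borel" for \<iota>
      by (intro borel_measurable_sum mf mg mh)+
    have mc: "(\<lambda>p. c * F p) \<in> borel_measurable borel" if "F \<in> borel_measurable borel" for c :: ennreal and F :: "(real^'d) \<times> (real^'d^'n) \<Rightarrow> ennreal"
      using that by simp
    have "dint \<omega> (\<lambda>p. ennreal ((mixed_tens M q \<delta> R i u p)\<^sup>2)) \<le> dint \<omega> (\<lambda>p. ennreal (2 * D) * (\<Sum>a\<in>?A. f a p) + (ennreal (4 * \<Lambda>) * (\<Sum>\<iota>\<in>?G. g \<iota> p) + ennreal (4 * \<Lambda> * D) * (\<Sum>\<iota>\<in>?G. \<Sum>a\<in>?A. h \<iota> a p)))"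
      by (rule dint_mono) (rule pt[OF refl])
    also have "\<dots> = ennreal (2 * D) * (\<Sum>a\<in>?A. dint \<omega> (f a)) + (ennreal (4 * \<Lambda>) * ?S + ennreal (4 * \<Lambda> * D) * (\<Sum>\<iota>\<in>?G. \<Sum>a\<in>?A. dint \<omega> (h \<iota> a)))"
      by (simp only: dint_add dint_cmult dint_sum ms mc mf mg mh borel_measurable_add)
    also have "\<dots> \<le> ennreal (2 * D) * (\<Sum>a\<in>?A. E) + (ennreal (4 * \<Lambda>) * ?S + ennreal (4 * \<Lambda> * D) * (\<Sum>\<iota>\<in>?G. \<Sum>a\<in>?A. ennreal (\<omega> powr r) * E))"
      by (intro add_mono mult_left_mono sum_mono fE hE order_refl) auto
    also have "\<dots> = ennreal (2 * D * N) * E + (ennreal (4 * \<Lambda>) * ?S + ennreal (4 * \<Lambda> * D * real (card ?G) * N * \<omega> powr r) * E)"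
    proof -
      have 1: "(\<Sum>a\<in>?A. E) = ennreal N * E" by (simp add: N_def ennreal_of_nat_eq_real_of_nat)
      have 2: "(\<Sum>\<iota>\<in>?G. \<Sum>a\<in>?A. ennreal (\<omega> powr r) * E) = ennreal (real (card ?G)) * (ennreal N * (ennreal (\<omega> powr r) * E))"
        by (simp add: N_def ennreal_of_nat_eq_real_of_nat)
      have "ennreal (2 * D) * (ennreal N * E) = ennreal (2 * D * N) * E"
        using D0 N0 by (simp add: ennreal_mult mult.assoc)
      moreover have "ennreal (4 * \<Lambda> * D) * (ennreal (real (card ?G)) * (ennreal N * (ennreal (\<omega> powr r) * E)))
          = ennreal (4 * \<Lambda> * D * real (card ?G) * N * \<omega> powr r) * E"
      proof -
        have "ennreal (a * b * c * d) = ennreal a * (ennreal b * (ennreal c * ennreal d))" if "a \<ge> 0" "b \<ge> 0" "c \<ge> 0" "d \<ge> 0" for a b c d :: real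
          using that by (simp add: ennreal_mult mult.assoc)
        from this[of "4 * \<Lambda> * D" "real (card ?G)" N "\<omega> powr r"] show ?thesis
          using D0 \<Lambda>0 N0 by (simp add: mult.assoc)
      qed
      ultimately show ?thesis unfolding 1 2 by simp
    qed
    also have "\<dots> \<le> ennreal C * ?S + ennreal C * E"
    proof -
      have "ennreal (2 * D * N) * E + (ennreal (4 * \<Lambda>) * ?S + ennreal (4 * \<Lambda> * D * real (card ?G) * N * \<omega> powr r) * E)
         = ennreal (4 * \<Lambda>) * ?S + (ennreal (2 * D * N) + ennreal (4 * \<Lambda> * D * real (card ?G) * N * \<omega> powr r)) * E"
        by (simp add: distrib_right add_ac)
      also have "ennreal (2 * D * N) + ennreal (4 * \<Lambda> * D * real (card ?G) * N * \<omega> powr r) = ennreal (2 * D * N + 4 * \<Lambda> * D * real (card ?G) * N * \<omega> powr r)"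
        using D0 \<Lambda>0 N0 by (intro ennreal_plus[symmetric] mult_nonneg_nonneg) auto
      also have "ennreal (4 * \<Lambda>) * ?S + ennreal (2 * D * N + 4 * \<Lambda> * D * real (card ?G) * N * \<omega> powr r) * E \<le> ennreal C * ?S + ennreal C * E"
      proof (intro add_mono mult_right_mono ennreal_leI)
        have "0 \<le> 2 * D * N" "0 \<le> 4 * \<Lambda> * D * real (card ?G) * N * \<omega> powr r"
          using D0 \<Lambda>0 N0 by (auto intro!: mult_nonneg_nonneg)
        then show "4 * \<Lambda> \<le> C" "2 * D * N + 4 * \<Lambda> * D * real (card ?G) * N * \<omega> powr r \<le> C" using \<Lambda>0 by (auto simp: C_def)
      qed auto
      finally show ?thesis .
    qed
    also have "\<dots> = ennreal C * (?S + E)" by (simp add: distrib_left)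
    finally show ?thesis by (simp only: g_def[abs_def])
  qed
  with C0 show ?thesis by blast
qed

section \<open>Conclusion\<close>

text \<open>If every fibre of i had at most k - 1 elements, the fibres could not cover all
  slots.\<close>

lemma pigeonhole_subset:
  fixes i :: "'n::finite \<Rightarrow> 'b"
  assumes "finite G" "\<And>l. i l \<in> G" "CARD('n) > card G * (k - 1)"
  shows "\<exists>S. card S = k \<and> (\<forall>a\<in>S. \<forall>b\<in>S. i a = i b)"
proof -
  have "\<exists>\<iota>\<in>G. card {l. i l = \<iota>} \<ge> k"
  proof (rule ccontr)
    assume "\<not> ?thesis"
    then have small: "card {l. i l = \<iota>} \<le> k - 1" if "\<iota> \<in> G" for \<iota> using that by force
    have "(UNIV :: 'n set) = (\<Union>\<iota>\<in>G. {l. i l = \<iota>})" using assms(2) by auto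
    then have "CARD('n) \<le> (\<Sum>\<iota>\<in>G. card {l. i l = \<iota>})" using card_UN_le[OF assms(1), of "\<lambda>\<iota>. {l. i l = \<iota>}"] by simp
    also have "\<dots> \<le> card G * (k - 1)" using sum_bounded_above[of G "\<lambda>\<iota>. card {l. i l = \<iota>}" "k - 1"] small by simp
    finally show False using assms(3) by simp
  qed
  then obtain \<iota> where "k \<le> card {l. i l = \<iota>}" by blast
  then obtain S where "S \<subseteq> {l. i l = \<iota>}" "card S = k" by (rule obtain_subset_with_card_n)
  then show ?thesis by (intro exI[of _ S]) auto
qed

text \<open>The induction runs backwards: it starts with every slot replaced, where the trace
  estimate applies, and frees one slot after another until u itself is reached. T is the set of
  slots that are free.\<close>

lemma local_bound:
  fixes \<Omega> Q :: "(real^'d) set"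
  assumes op: "open \<Omega>" and Q: "open Q" "convex Q" "Q \<subseteq> \<Omega>" and \<omega>: "\<omega> > 0"
    and nodes: "\<And>\<iota>. \<iota> \<in> grid M \<Longrightarrow> ball (node q \<delta> \<iota>) ((2 * real M + 1) * \<omega>) \<subseteq> Q"
    and center: "ball q ((2 * real M + 1) * \<omega>) \<subseteq> Q" and M: "M \<ge> 1"
    and s: "s > 0" "2 * s > real CARD('d) * (real k - 1)" and k: "k \<ge> 1" "CARD('n) > M ^ CARD('d) * (k - 1)"
  shows "\<exists>C\<ge>0. \<forall>(u :: real^'d^'n \<Rightarrow> real) E. local_data \<Omega> M (2 * s + real CARD('d)) Q q \<delta> \<omega> u E \<longrightarrow>
    continuous_on (power_set \<Omega>) u \<longrightarrow> (\<forall>X\<in>coinc k \<inter> power_set \<Omega>. u X = 0) \<longrightarrow>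
    (\<integral>\<^sup>+X. indicator (power_set (ball q \<omega>)) X * ennreal ((u X)\<^sup>2) \<partial>lborel) \<le> ennreal C * E"
proof -
  let ?r = "2 * s + real CARD('d)" and ?G = "grid M :: ('d \<Rightarrow> nat) set"
  define adm where "adm u E \<longleftrightarrow> local_data \<Omega> M ?r Q q \<delta> \<omega> u E \<and> continuous_on (power_set \<Omega>) u \<and> (\<forall>X\<in>coinc k \<inter> power_set \<Omega>. u X = 0)"
    for u :: "real^'d^'n \<Rightarrow> real" and E
  have "\<exists>C\<ge>0. \<forall>u E i. adm u E \<longrightarrow> (\<forall>l. i l \<in> ?G) \<longrightarrow> dint \<omega> (\<lambda>p. ennreal ((mixed_tens M q \<delta> (UNIV - T) i u p)\<^sup>2)) \<le> ennreal C * E"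
    for T :: "'n set"
    using finite[of T]
  proof (induction T)
    case empty
    have ex: "\<forall>S. \<exists>K. card S = k \<longrightarrow> K \<ge> 0 \<and> (\<forall>(P :: real^'d^'n) u E. trace_data \<Omega> M ?r Q \<omega> P u E \<longrightarrow>
      continuous_on (power_set \<Omega>) u \<longrightarrow> (\<forall>X\<in>coinc k \<inter> power_set \<Omega>. u X = 0) \<longrightarrow> (\<forall>a\<in>S. \<forall>b\<in>S. P $ a = P $ b) \<longrightarrow>
      dint \<omega> (\<lambda>p. ennreal ((scaled_tens M P (\<lambda>_. 1) u p)\<^sup>2)) \<le> ennreal K * E)"
    proof
      fix S :: "'n set"
      show "\<exists>K. card S = k \<longrightarrow> K \<ge> 0 \<and> (\<forall>(P :: real^'d^'n) u E. trace_data \<Omega> M ?r Q \<omega> P u E \<longrightarrow>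
        continuous_on (power_set \<Omega>) u \<longrightarrow> (\<forall>X\<in>coinc k \<inter> power_set \<Omega>. u X = 0) \<longrightarrow> (\<forall>a\<in>S. \<forall>b\<in>S. P $ a = P $ b) \<longrightarrow>
        dint \<omega> (\<lambda>p. ennreal ((scaled_tens M P (\<lambda>_. 1) u p)\<^sup>2)) \<le> ennreal K * E)"
      proof (cases "card S = k")
        case True
        from trace_bound[OF Q \<omega> s True k(1) op, where M = M] show ?thesis by (elim exE conjE) (intro exI conjI impI, assumption+)
      qed simp
    qed
    from choice[OF ex] obtain K where KK: "\<forall>S. card S = k \<longrightarrow> K S \<ge> 0 \<and> (\<forall>(P :: real^'d^'n) u E. trace_data \<Omega> M ?r Q \<omega> P u E \<longrightarrow>
      continuous_on (power_set \<Omega>) u \<longrightarrow> (\<forall>X\<in>coinc k \<inter> power_set \<Omega>. u X = 0) \<longrightarrow> (\<forall>a\<in>S. \<forall>b\<in>S. P $ a = P $ b) \<longrightarrow>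
      dint \<omega> (\<lambda>p. ennreal ((scaled_tens M P (\<lambda>_. 1) u p)\<^sup>2)) \<le> ennreal (K S) * E)"
      ..
    have K0: "\<And>S. card S = k \<Longrightarrow> K S \<ge> 0" using KK by blast
    have K: "\<And>S (P :: real^'d^'n) u E. card S = k \<Longrightarrow> trace_data \<Omega> M ?r Q \<omega> P u E \<Longrightarrow>
      continuous_on (power_set \<Omega>) u \<Longrightarrow> (\<forall>X\<in>coinc k \<inter> power_set \<Omega>. u X = 0) \<Longrightarrow> (\<forall>a\<in>S. \<forall>b\<in>S. P $ a = P $ b) \<Longrightarrow>
      dint \<omega> (\<lambda>p. ennreal ((scaled_tens M P (\<lambda>_. 1) u p)\<^sup>2)) \<le> ennreal (K S) * E"
      by (rule KK[THEN spec, THEN mp, THEN conjunct2, THEN spec, THEN spec, THEN spec, THEN mp, THEN mp, THEN mp, THEN mp])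
    \<comment> \<open>Which k slots share a node depends on i, so the constants of all candidate
      sets are added up.\<close>
    define C where "C = (\<Sum>S | card S = k. K S)"
    have C: "K S \<le> C" if "card S = k" for S
      unfolding C_def using that K0 by (intro member_le_sum) auto
    have "dint \<omega> (\<lambda>p. ennreal ((mixed_tens M q \<delta> (UNIV - {}) i u p)\<^sup>2)) \<le> ennreal C * E"
      if u: "adm u E" and i: "\<forall>l. i l \<in> ?G" for u E i
    proof -
      obtain S where S: "card S = k" "\<forall>a\<in>S. \<forall>b\<in>S. i a = i b"
        using pigeonhole_subset[of ?G i k] i k(2) by (auto simp: card_grid)
      define P :: "real^'d^'n" where "P = (\<chi> l. node q \<delta> (i l))"
      have td: "trace_data \<Omega> M ?r Q \<omega> P u E"
        unfolding trace_data_def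
      proof (intro conjI allI)
        show "u \<in> borel_measurable borel" "difference_bound \<Omega> M ?r u E"
          using u by (simp_all add: adm_def local_data_def)
        show "ball (P $ l) ((2 * real M + 1) * \<omega>) \<subseteq> Q" for l
          using nodes[of "i l"] i by (simp add: P_def)
      qed
      have PS: "\<forall>a\<in>S. \<forall>b\<in>S. P $ a = P $ b"
      proof (intro ballI)
        fix a b assume "a \<in> S" "b \<in> S"
        then have "i a = i b" using S(2) by blast
        then show "P $ a = P $ b" by (simp add: P_def)
      qed
      have cont: "continuous_on (power_set \<Omega>) u" and zero: "\<forall>X\<in>coinc k \<inter> power_set \<Omega>. u X = 0"
        using u unfolding adm_def by blast+
      have mt: "mixed_tens M q \<delta> (UNIV - {}) i u p = scaled_tens M P (\<lambda>_. 1) u p" for p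
        unfolding mixed_tens_def scaled_tens_def Diff_empty by (rule tens_cong) (auto simp: P_def)
      have "dint \<omega> (\<lambda>p. ennreal ((mixed_tens M q \<delta> (UNIV - {}) i u p)\<^sup>2)) \<le> ennreal (K S) * E"
        using K[OF S(1) td cont zero PS] by (simp only: mt)
      also have "\<dots> \<le> ennreal C * E" by (intro mult_right_mono ennreal_leI C S(1)) auto
      finally show ?thesis .
    qed
    moreover have "C \<ge> 0" unfolding C_def using K0 by (intro sum_nonneg) auto
    ultimately show ?case by blast
  next
    case (insert j T)
    obtain C where C: "C \<ge> 0" and c: "\<And>u E i. adm u E \<Longrightarrow> (\<forall>l. i l \<in> ?G) \<Longrightarrow>
      dint \<omega> (\<lambda>p. ennreal ((mixed_tens M q \<delta> (UNIV - T) i u p)\<^sup>2)) \<le> ennreal C * E"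
      using insert.IH by blast
    define R where "R = UNIV - insert j T"
    have jR: "j \<notin> R" and ins: "insert j R = UNIV - T" using insert.hyps by (auto simp: R_def)
    obtain C' where C': "C' \<ge> 0" and c': "\<And>u E i. local_data \<Omega> M ?r Q q \<delta> \<omega> u E \<Longrightarrow> (\<forall>l. i l \<in> ?G) \<Longrightarrow>
      dint \<omega> (\<lambda>p. ennreal ((mixed_tens M q \<delta> R i u p)\<^sup>2))
     \<le> ennreal C' * ((\<Sum>\<iota>\<in>?G. dint \<omega> (\<lambda>p. ennreal ((mixed_tens M q \<delta> (insert j R) (i(j := \<iota>)) u p)\<^sup>2))) + E)"
      using mixed_tens_norm_step[OF Q \<omega> nodes center M jR, of ?r] by blast
    have "dint \<omega> (\<lambda>p. ennreal ((mixed_tens M q \<delta> R i u p)\<^sup>2)) \<le> ennreal (C' * (real (card ?G) * C + 1)) * E"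
      if u: "adm u E" and i: "\<forall>l. i l \<in> ?G" for u E i
    proof -
      have "dint \<omega> (\<lambda>p. ennreal ((mixed_tens M q \<delta> R i u p)\<^sup>2))
         \<le> ennreal C' * ((\<Sum>\<iota>\<in>?G. dint \<omega> (\<lambda>p. ennreal ((mixed_tens M q \<delta> (insert j R) (i(j := \<iota>)) u p)\<^sup>2))) + E)"
        using u by (intro c' i) (simp add: adm_def)
      also have "\<dots> \<le> ennreal C' * ((\<Sum>\<iota>\<in>?G. ennreal C * E) + E)"
        unfolding ins by (intro mult_left_mono add_right_mono sum_mono c[OF u]) (use i in auto)
      also have "(\<Sum>\<iota>\<in>?G. ennreal C * E) = ennreal (real (card ?G)) * (ennreal C * E)"
        by (simp add: ennreal_of_nat_eq_real_of_nat)
      also have "ennreal C' * (ennreal (real (card ?G)) * (ennreal C * E) + E) = ennreal (C' * (real (card ?G) * C + 1)) * E"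
        using C C' by (simp add: ennreal_mult distrib_right mult.assoc)
      finally show ?thesis .
    qed
    then show ?case using C C' unfolding R_def by (intro exI[of _ "C' * (real (card ?G) * C + 1)"]) auto
  qed
  from this[of UNIV] obtain C where C: "C \<ge> 0" and c: "\<And>u E i. adm u E \<Longrightarrow> (\<forall>l. i l \<in> ?G) \<Longrightarrow>
      dint \<omega> (\<lambda>p. ennreal ((mixed_tens M q \<delta> {} i u p)\<^sup>2)) \<le> ennreal C * E"
    by auto
  define v where "v = measure lborel (ball (0::real^'d) \<omega>)"
  have v: "emeasure lborel (ball (0::real^'d) \<omega>) = ennreal v"
    using emeasure_lborel_ball_finite[of "0 :: real^'d" \<omega>] by (simp add: v_def emeasure_eq_ennreal_measure less_top)
  have v0: "v > 0" unfolding v_def by (rule content_ball_pos[OF \<omega>])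
  have "(\<integral>\<^sup>+X. indicator (power_set (ball q \<omega>)) X * ennreal ((u X)\<^sup>2) \<partial>lborel) \<le> ennreal (C / v) * E"
    if u: "adm u E" for u E
  proof -
    have mu: "u \<in> borel_measurable borel" using u by (simp add: adm_def local_data_def)
    let ?I = "\<integral>\<^sup>+X. indicator (power_set (ball q \<omega>)) X * ennreal ((u X)\<^sup>2) \<partial>lborel"
    \<comment> \<open>No slot is replaced any more, so any choice of nodes will do; the index 0
      belongs to the grid as \<open>M \<ge> 1\<close>.\<close>
    define i :: "'n \<Rightarrow> 'd \<Rightarrow> nat" where "i = (\<lambda>_ _. 0)"
    have i: "\<forall>l. i l \<in> ?G" using M by (simp add: i_def grid_def PiE_iff)
    have mt: "mixed_tens M q \<delta> {} i u p = u (\<chi> l. q + snd p $ l)" for p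
      by (simp add: mixed_tens_def tens_def)
    have mm: "(\<lambda>p. ennreal ((mixed_tens M q \<delta> {} i u p)\<^sup>2)) \<in> borel_measurable borel"
      using borel_measurable_mixed_tens[OF mu, of M q \<delta> "{}" i] by measurable
    \<comment> \<open>With no slot replaced the integrand does not involve z, and the translation
      contributes only the volume of its ball.\<close>
    have "dint \<omega> (\<lambda>p. ennreal ((mixed_tens M q \<delta> {} i u p)\<^sup>2)) = (\<integral>\<^sup>+z. ?I * indicator (ball (0::real^'d) \<omega>) z \<partial>lborel)"
      unfolding dint_iterated[OF mm]
    proof (rule nn_integral_cong)
      fix z :: "real^'d"
      define c :: "real^'d^'n" where "c = (\<chi> l. q)"
      have mI: "(\<lambda>X. indicator (power_set (ball q \<omega>)) X * ennreal ((u X)\<^sup>2)) \<in> borel_measurable borel"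
        using mu by (intro borel_measurable_times_ennreal borel_measurable_indicator borel_open open_power_set open_ball) simp
      have "?I = (\<integral>\<^sup>+W. indicator (power_set (ball q \<omega>)) (c + W) * ennreal ((u (c + W))\<^sup>2) \<partial>lborel)"
        by (rule nn_integral_lborel_translate[OF mI, symmetric])
      also have "\<dots> = (\<integral>\<^sup>+W. indicator (power_set (ball 0 \<omega>)) W * ennreal ((mixed_tens M q \<delta> {} i u (z, W))\<^sup>2) \<partial>lborel)"
      proof (rule nn_integral_cong)
        fix W :: "real^'d^'n"
        have "c + W = (\<chi> l. q + W $ l)" by (simp add: c_def vec_eq_iff)
        moreover have "c + W \<in> power_set (ball q \<omega>) \<longleftrightarrow> W \<in> power_set (ball 0 \<omega>)"
          by (simp add: power_set_def c_def dist_norm)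
        ultimately show "indicator (power_set (ball q \<omega>)) (c + W) * ennreal ((u (c + W))\<^sup>2) = indicator (power_set (ball 0 \<omega>)) W * ennreal ((mixed_tens M q \<delta> {} i u (z, W))\<^sup>2)"
          unfolding mt snd_conv by (simp add: indicator_def)
      qed
      finally show "(\<integral>\<^sup>+W. indicator (ball 0 \<omega>) z * (indicator (power_set (ball 0 \<omega>)) W * ennreal ((mixed_tens M q \<delta> {} i u (z, W))\<^sup>2)) \<partial>lborel) = ?I * indicator (ball 0 \<omega>) z"
        by (cases "z \<in> ball 0 \<omega>") auto
    qed
    also have "\<dots> = ennreal v * ?I" by (subst nn_integral_cmult_indicator) (auto simp: v mult.commute)
    finally have "ennreal v * ?I \<le> ennreal C * E" using c[OF u i] by simp
    then have "?I \<le> ennreal (1 / v) * (ennreal C * E)" by (rule ennreal_divide_left[OF v0])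
    also have "\<dots> = ennreal (C / v) * E"
      using C v0 by (simp add: mult.assoc[symmetric] ennreal_mult[symmetric])
    finally show ?thesis .
  qed
  then show ?thesis using C v0 unfolding adm_def by (intro exI[of _ "C / v"]) auto
qed

section \<open>From the seminorm to the hypotheses of the local estimate\<close>

lemma difference_bound_cong_mono:
  assumes "difference_bound \<Omega> M r u E" "\<And>X. X \<in> power_set \<Omega> \<Longrightarrow> u' X = u X" "E \<le> E'"
  shows "difference_bound \<Omega> M r u' E'"
  unfolding difference_bound_def
proof (intro allI impI)
  fix j and \<rho> :: real assume \<rho>: "\<rho> > 0"
  have fd: "fdiff M j \<eta> u' X = fdiff M j \<eta> u X" if "X \<in> segment_core (power_set \<Omega>) (axis j \<eta>) (real M)" for \<eta> X
    unfolding fdiff_def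
  proof (intro sum.cong refl arg_cong2[where f = "(*)"] assms(2))
    fix i assume "i \<in> {..M}"
    then show "X + real i *\<^sub>R axis j \<eta> \<in> power_set \<Omega>" using that unfolding segment_core_def by auto
  qed
  have "(\<integral>\<^sup>+\<eta>. indicator (ball 0 \<rho>) \<eta> *
      (\<integral>\<^sup>+X. indicator (segment_core (power_set \<Omega>) (axis j \<eta>) (real M)) X * ennreal ((fdiff M j \<eta> u' X)\<^sup>2) \<partial>lborel) \<partial>lborel)
    = (\<integral>\<^sup>+\<eta>. indicator (ball 0 \<rho>) \<eta> *
      (\<integral>\<^sup>+X. indicator (segment_core (power_set \<Omega>) (axis j \<eta>) (real M)) X * ennreal ((fdiff M j \<eta> u X)\<^sup>2) \<partial>lborel) \<partial>lborel)"
  proof -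
    have "indicator (segment_core (power_set \<Omega>) (axis j \<eta>) (real M)) X * ennreal ((fdiff M j \<eta> u' X)\<^sup>2)
        = indicator (segment_core (power_set \<Omega>) (axis j \<eta>) (real M)) X * ennreal ((fdiff M j \<eta> u X)\<^sup>2)" for \<eta> X
      by (cases "X \<in> segment_core (power_set \<Omega>) (axis j \<eta>) (real M)") (simp_all add: fd)
    then show ?thesis by (simp only:)
  qed
  also have "\<dots> \<le> ennreal (\<rho> powr r) * E" using assms(1) \<rho> by (simp add: difference_bound_def)
  also have "\<dots> \<le> ennreal (\<rho> powr r) * E'" using assms(3) by (rule mult_left_mono) simp
  finally show "(\<integral>\<^sup>+\<eta>. indicator (ball 0 \<rho>) \<eta> *
      (\<integral>\<^sup>+X. indicator (segment_core (power_set \<Omega>) (axis j \<eta>) (real M)) X * ennreal ((fdiff M j \<eta> u' X)\<^sup>2) \<partial>lborel) \<partial>lborel)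
    \<le> ennreal (\<rho> powr r) * E'" .
qed

text \<open>Outside of \<Omega>^N the function u is arbitrary and possibly not measurable, while the
  estimates are made for Borel functions on the whole space. They only see values inside, so the
  extension by 0 changes nothing.\<close>

definition restrict0 :: "'a set \<Rightarrow> ('a \<Rightarrow> real) \<Rightarrow> 'a \<Rightarrow> real" where
  "restrict0 U u X = (if X \<in> U then u X else 0)"

lemma borel_measurable_restrict0:
  fixes u :: "'a::euclidean_space \<Rightarrow> real"
  assumes "open U" "continuous_on U u"
  shows "restrict0 U u \<in> borel_measurable borel"
proof -
  have "(\<lambda>X. indicator U X *\<^sub>R u X) \<in> borel_measurable borel"
    using assms by (intro borel_measurable_continuous_on_indicator) auto
  moreover have "(\<lambda>X. indicator U X *\<^sub>R u X) = restrict0 U u" by (auto simp: restrict0_def indicator_def)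
  ultimately show ?thesis by simp
qed

lemma local_data_of_bounds:
  fixes \<Omega> Q :: "(real^'d) set"
  assumes op: "open \<Omega>" and Q: "Q \<subseteq> \<Omega>" and u: "smooth_on (power_set \<Omega>) (u :: real^'d^'n \<Rightarrow> real)"
    and db: "difference_bound \<Omega> M r u E"
    and nodes: "\<And>i z. i \<in> grid M \<Longrightarrow> z \<in> ball 0 \<omega> \<Longrightarrow> node q \<delta> i + z \<in> Q"
    and bh: "\<And>j. (\<integral>\<^sup>+z. \<integral>\<^sup>+X. indicator (ball 0 \<omega>) z * (indicator (power_set Q) X * ennreal ((interp_err M q \<delta> j u z X)\<^sup>2)) \<partial>lborel \<partial>lborel) \<le> E"
  shows "local_data \<Omega> M r Q q \<delta> \<omega> (restrict0 (power_set \<Omega>) u) E"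
  unfolding local_data_def
proof (intro conjI allI)
  let ?u = "restrict0 (power_set \<Omega>) u"
  have cu: "continuous_on (power_set \<Omega>) u"
    using smooth_on_foldr_continuous[OF u, of "[]"] by simp
  show "?u \<in> borel_measurable borel" by (rule borel_measurable_restrict0[OF open_power_set[OF op] cu])
  show "difference_bound \<Omega> M r ?u E" by (rule difference_bound_cong_mono[OF db]) (auto simp: restrict0_def)
  fix j
  have err: "interp_err M q \<delta> j ?u z X = interp_err M q \<delta> j u z X" if z: "z \<in> ball 0 \<omega>" and X: "X \<in> power_set Q" for z X
  proof -
    have in\<Omega>: "Y \<in> power_set \<Omega>" if "Y \<in> power_set Q" for Y :: "real^'d^'n" using that power_set_mono[OF Q] by blast
    have "?u (upd_pt X j (node q \<delta> i + z)) = u (upd_pt X j (node q \<delta> i + z))" if "i \<in> grid M" for i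
      using in\<Omega>[OF upd_pt_in_power_set[OF X nodes[OF that z]]] by (simp add: restrict0_def)
    moreover have "?u X = u X" using in\<Omega>[OF X] by (simp add: restrict0_def)
    ultimately show ?thesis by (simp add: interp_err_def)
  qed
  have "(\<integral>\<^sup>+z. \<integral>\<^sup>+X. indicator (ball 0 \<omega>) z * (indicator (power_set Q) X * ennreal ((interp_err M q \<delta> j ?u z X)\<^sup>2)) \<partial>lborel \<partial>lborel)
    = (\<integral>\<^sup>+z. \<integral>\<^sup>+X. indicator (ball 0 \<omega>) z * (indicator (power_set Q) X * ennreal ((interp_err M q \<delta> j u z X)\<^sup>2)) \<partial>lborel \<partial>lborel)"
    by (intro nn_integral_cong) (auto simp: indicator_def err)
  then show "(\<integral>\<^sup>+z. \<integral>\<^sup>+X. indicator (ball 0 \<omega>) z * (indicator (power_set Q) X * ennreal ((interp_err M q \<delta> j ?u z X)\<^sup>2)) \<partial>lborel \<partial>lborel) \<le> E"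
    using bh[of j] by simp
qed

text \<open>For integer s, M = m and b = 0: Taylor polynomials of degree below m are interpolated
  exactly. Otherwise M = m + 1 and b = 1, so the terms of degree m are still reproduced and only
  increments of the top derivatives remain. In both cases M is s rounded up.\<close>

lemma seminorm_local_data:
  fixes \<Omega> Q :: "(real^'d) set"
  assumes op: "open \<Omega>" and Q: "open Q" "convex Q" "bounded Q" "Q \<subseteq> \<Omega>" "Q \<noteq> {}" and s: "s > 0" and c: "c > 0"
    and nodes: "\<And>i z. i \<in> grid (nat \<lceil>s\<rceil>) \<Longrightarrow> z \<in> ball 0 \<omega> \<Longrightarrow> node q \<delta> i + z \<in> Q" and \<delta>: "\<delta> \<noteq> 0"
  shows "\<exists>K\<ge>0. \<forall>u :: real^'d^'n \<Rightarrow> real. smooth_on (power_set \<Omega>) u \<longrightarrow>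
    local_data \<Omega> (nat \<lceil>s\<rceil>) (2 * s + real CARD('d)) Q q \<delta> \<omega> (restrict0 (power_set \<Omega>) u) (ennreal K * HsNsq c s \<Omega> u)"
proof -
  define M where "M = nat \<lceil>s\<rceil>"
  define m where "m = nat \<lfloor>s\<rfloor>"
  let ?N = "power_set Q :: (real^'d^'n) set"
  have QN: "?N \<subseteq> power_set \<Omega>" by (rule power_set_mono[OF Q(4)])
  \<comment> \<open>Both cases end with one constant for the differences and one for the
    interpolation error; the larger of the two serves for both.\<close>
  have finish: ?thesis
    if "K1 \<ge> 0" "K2 \<ge> 0"
      and db: "\<And>u :: real^'d^'n \<Rightarrow> real. smooth_on (power_set \<Omega>) u \<Longrightarrow> difference_bound \<Omega> M (2 * s + real CARD('d)) u (ennreal K1 * HsNsq c s \<Omega> u)"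
      and bh: "\<And>(u :: real^'d^'n \<Rightarrow> real) j. smooth_on (power_set \<Omega>) u \<Longrightarrow> (\<integral>\<^sup>+z. \<integral>\<^sup>+X. indicator (ball 0 \<omega>) z * (indicator ?N X * ennreal ((interp_err M q \<delta> j u z X)\<^sup>2)) \<partial>lborel \<partial>lborel)
        \<le> ennreal K2 * HsNsq c s \<Omega> u" for K1 K2
  proof (intro exI[of _ "max K1 K2"] conjI allI impI)
    fix u :: "real^'d^'n \<Rightarrow> real" assume u: "smooth_on (power_set \<Omega>) u"
    show "local_data \<Omega> (nat \<lceil>s\<rceil>) (2 * s + real CARD('d)) Q q \<delta> \<omega> (restrict0 (power_set \<Omega>) u) (ennreal (max K1 K2) * HsNsq c s \<Omega> u)"
      unfolding M_def[symmetric]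
    proof (rule local_data_of_bounds[OF op Q(4) u])
      show "difference_bound \<Omega> M (2 * s + real CARD('d)) u (ennreal (max K1 K2) * HsNsq c s \<Omega> u)"
        by (rule difference_bound_cong_mono[OF db[OF u]]) (auto intro!: mult_right_mono ennreal_leI)
      show "(\<integral>\<^sup>+z. \<integral>\<^sup>+X. indicator (ball 0 \<omega>) z * (indicator ?N X * ennreal ((interp_err M q \<delta> j u z X)\<^sup>2)) \<partial>lborel \<partial>lborel)
        \<le> ennreal (max K1 K2) * HsNsq c s \<Omega> u" for j
        by (rule order_trans[OF bh[OF u]]) (auto intro!: mult_right_mono ennreal_leI)
    qed (use nodes in \<open>simp_all add: M_def\<close>)
  qed (use that in auto)
  define vQ where "vQ = measure lborel Q"
  have vQ: "emeasure lborel Q = ennreal vQ"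
    using emeasure_bounded_finite[OF Q(3)] by (simp add: vQ_def emeasure_eq_ennreal_measure less_top)
  show ?thesis
  proof (cases "s = of_int \<lfloor>s\<rfloor>")
    case True
    have mM: "m = M" using True by (metis M_def m_def ceiling_of_int)
    have sm: "s = real m" using True s by (simp add: m_def)
    have m0: "m \<noteq> 0" using sm s by simp
    obtain K1 where K1: "K1 \<ge> 0" and k1: "\<And>(u :: real^'d^'n \<Rightarrow> real) E. smooth_on (power_set \<Omega>) u \<Longrightarrow> (\<forall>j. top_seminorm m \<Omega> j u \<le> E) \<Longrightarrow>
      difference_bound \<Omega> m (2 * real m + real CARD('d)) u (ennreal K1 * E)"
      using difference_bound_integer[OF op, of m] by blast
    obtain K2 where K2: "K2 \<ge> 0" and k2: "\<And>j (u :: real^'d^'n \<Rightarrow> real). smooth_on (power_set \<Omega>) u \<Longrightarrow>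
      (\<integral>\<^sup>+z. \<integral>\<^sup>+X. indicator (ball 0 \<omega>) z * (indicator ?N X * ennreal ((interp_err M q \<delta> j u z X)\<^sup>2)) \<partial>lborel \<partial>lborel)
      \<le> ennreal K2 * (\<integral>\<^sup>+w. indicator Q w * (\<integral>\<^sup>+X. indicator ?N X * ennreal (top_difference j m 0 u w X) \<partial>lborel) \<partial>lborel)"
      using interpolation_error_le[OF op Q, where m = m and M = M and b = 0 and \<delta> = \<delta> and q = q and \<omega> = \<omega> and 'n = 'n] nodes \<delta> mM m0
      unfolding interp_err_def M_def[symmetric] by auto
    have sem: "top_seminorm m \<Omega> j u \<le> HsNsq c s \<Omega> u" for j and u :: "real^'d^'n \<Rightarrow> real"
      unfolding m_def by (rule top_seminorm_le_HsNsq[OF True])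
    show ?thesis
    proof (rule finish[OF K1, of "K2 * vQ"])
      show "K2 * vQ \<ge> 0" using K2 by (simp add: vQ_def)
      show "difference_bound \<Omega> M (2 * s + real CARD('d)) u (ennreal K1 * HsNsq c s \<Omega> u)" if "smooth_on (power_set \<Omega>) u" for u :: "real^'d^'n \<Rightarrow> real"
        using k1[OF that, of "HsNsq c s \<Omega> u"] sem unfolding mM[symmetric] sm[symmetric] by blast
      fix u :: "real^'d^'n \<Rightarrow> real" and j assume u: "smooth_on (power_set \<Omega>) u"
      \<comment> \<open>With b = 0 the inner integral does not involve w, so the outer one
        contributes the volume of Q.\<close>
      have "(\<integral>\<^sup>+w. indicator Q w * (\<integral>\<^sup>+X. indicator ?N X * ennreal (top_difference j m 0 u w X) \<partial>lborel) \<partial>lborel)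
          \<le> (\<integral>\<^sup>+w. HsNsq c s \<Omega> u * indicator Q w \<partial>lborel)"
      proof (intro nn_integral_mono)
        fix w
        have "(\<integral>\<^sup>+X. indicator ?N X * ennreal (top_difference j m 0 u w X) \<partial>lborel) \<le> top_seminorm m \<Omega> j u"
          unfolding top_seminorm_def top_difference_def using QN by (intro nn_integral_mono) (auto simp: indicator_def)
        also have "\<dots> \<le> HsNsq c s \<Omega> u" by (rule sem)
        finally show "indicator Q w * (\<integral>\<^sup>+X. indicator ?N X * ennreal (top_difference j m 0 u w X) \<partial>lborel) \<le> HsNsq c s \<Omega> u * indicator Q w"
          by (cases "w \<in> Q") auto
      qed
      also have "\<dots> = ennreal vQ * HsNsq c s \<Omega> u"
        using Q(1) by (subst nn_integral_cmult_indicator) (auto simp: vQ mult.commute)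
      finally have "ennreal K2 * (\<integral>\<^sup>+w. indicator Q w * (\<integral>\<^sup>+X. indicator ?N X * ennreal (top_difference j m 0 u w X) \<partial>lborel) \<partial>lborel) \<le> ennreal K2 * (ennreal vQ * HsNsq c s \<Omega> u)"
        by (rule mult_left_mono) simp
      also have "\<dots> = ennreal (K2 * vQ) * HsNsq c s \<Omega> u" using K2 by (simp add: ennreal_mult vQ_def mult.assoc)
      finally show "(\<integral>\<^sup>+z. \<integral>\<^sup>+X. indicator (ball 0 \<omega>) z * (indicator ?N X * ennreal ((interp_err M q \<delta> j u z X)\<^sup>2)) \<partial>lborel \<partial>lborel)
        \<le> ennreal (K2 * vQ) * HsNsq c s \<Omega> u"
        using k2[OF u, of j] by (rule order_trans[rotated])
    qed
  next
    case False
    define \<sigma> where "\<sigma> = s - of_int \<lfloor>s\<rfloor>"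
    have \<sigma>: "\<sigma> > 0" using False by (simp add: \<sigma>_def) (metis of_int_floor_le order_le_less)
    have mM: "M = Suc m"
    proof -
      have "\<lceil>s\<rceil> = \<lfloor>s\<rfloor> + 1" using False by (simp add: ceiling_altdef)
      moreover have "\<lfloor>s\<rfloor> \<ge> 0" using s by simp
      ultimately show ?thesis by (simp add: M_def m_def nat_add_distrib)
    qed
    have sm: "real m + \<sigma> = s" using s by (simp add: m_def \<sigma>_def)
    let ?p = "real CARD('d) + 2 * \<sigma>"
    let ?E = "\<lambda>u. ennreal (1 / c) * HsNsq c s \<Omega> u"
    obtain K1 where K1: "K1 \<ge> 0" and k1: "\<And>(u :: real^'d^'n \<Rightarrow> real) E. smooth_on (power_set \<Omega>) u \<Longrightarrow> (\<forall>j. frac_seminorm m ?p \<Omega> j u \<le> E) \<Longrightarrow>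
      difference_bound \<Omega> (Suc m) (2 * (real m + \<sigma>) + real CARD('d)) u (ennreal K1 * E)"
      using difference_bound_fractional[OF op \<sigma>, of m] by blast
    obtain K2 where K2: "K2 \<ge> 0" and k2: "\<And>j (u :: real^'d^'n \<Rightarrow> real). smooth_on (power_set \<Omega>) u \<Longrightarrow>
      (\<integral>\<^sup>+z. \<integral>\<^sup>+X. indicator (ball 0 \<omega>) z * (indicator ?N X * ennreal ((interp_err M q \<delta> j u z X)\<^sup>2)) \<partial>lborel \<partial>lborel)
      \<le> ennreal K2 * (\<integral>\<^sup>+w. indicator Q w * (\<integral>\<^sup>+X. indicator ?N X * ennreal (top_difference j m 1 u w X) \<partial>lborel) \<partial>lborel)"
      using interpolation_error_le[OF op Q, where m = m and M = M and b = 1 and \<delta> = \<delta> and q = q and \<omega> = \<omega> and 'n = 'n] nodes \<delta> mM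
      unfolding interp_err_def M_def[symmetric] by auto
    have sem: "frac_seminorm m ?p \<Omega> j u \<le> ?E u" for j and u :: "real^'d^'n \<Rightarrow> real"
      unfolding m_def \<sigma>_def by (rule frac_seminorm_le_HsNsq[OF False c])
    obtain L where L: "\<And>x y. x \<in> Q \<Longrightarrow> y \<in> Q \<Longrightarrow> norm (x - y) \<le> L"
      using diameter_bounded_bound[OF Q(3)] by (metis dist_norm)
    show ?thesis
    proof (rule finish[of "K1 * (1 / c)" "K2 * (L powr ?p * (1 / c))"])
      show "K1 * (1 / c) \<ge> 0" "K2 * (L powr ?p * (1 / c)) \<ge> 0" using K1 K2 c by auto
      show "difference_bound \<Omega> M (2 * s + real CARD('d)) u (ennreal (K1 * (1 / c)) * HsNsq c s \<Omega> u)" if "smooth_on (power_set \<Omega>) u" for u :: "real^'d^'n \<Rightarrow> real"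
      proof -
        have "ennreal (K1 * (1 / c)) = ennreal K1 * ennreal (1 / c)" using K1 c by (intro ennreal_mult) auto
        then have "ennreal (K1 * (1 / c)) * HsNsq c s \<Omega> u = ennreal K1 * ?E u" by (simp only: mult.assoc)
        moreover have "difference_bound \<Omega> M (2 * s + real CARD('d)) u (ennreal K1 * ?E u)"
          using k1[OF that, of "?E u"] sem unfolding mM sm by blast
        ultimately show ?thesis by simp
      qed
      fix u :: "real^'d^'n \<Rightarrow> real" and j assume u: "smooth_on (power_set \<Omega>) u"
      define G where "G X w = indicator (power_set \<Omega>) X * (indicator \<Omega> w *
        ennreal (\<Sum>\<alpha>\<in>(multi_indices m :: ('d \<Rightarrow> nat) set).
         (fact m / mfact \<alpha>) * (Dalpha j \<alpha> u X - Dalpha j \<alpha> u (upd_pt X j w))\<^sup>2 / norm (X $ j - w) powr ?p))" for X w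
      have mG: "case_prod G \<in> borel_measurable borel"
        unfolding G_def[abs_def] by (rule frac_seminorm_integrand_measurable[OF u op])
      have mG': "(\<lambda>p. G (snd p) (fst p)) \<in> borel_measurable borel"
        using borel_measurable_compose_continuous[OF mG, of "\<lambda>p. (snd p, fst p)"] by (simp add: case_prod_unfold continuous_intros)
      \<comment> \<open>Distances inside Q are at most L, so the kernel of the seminorm can be
        inserted at the cost of \<open>L powr ?p\<close>.\<close>
      have pt: "indicator Q w * (indicator ?N X * ennreal (top_difference j m 1 u w X)) \<le> ennreal (L powr ?p) * G X w" for X w
      proof (cases "w \<in> Q \<and> X \<in> ?N")
        case True
        have le: "top_difference j m 1 u w X \<le> L powr ?p * (top_difference j m 1 u w X / norm (X $ j - w) powr ?p)"
        proof (cases "X $ j = w")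
          \<comment> \<open>The quotient is 0 by convention here, and the difference in the
            numerator vanishes as well.\<close>
          case True
          then have "upd_pt X j w = X" using upd_pt_same[of X j] by simp
          then show ?thesis by (simp add: top_difference_def)
        next
          case False
          have "norm (X $ j - w) powr ?p \<le> L powr ?p"
            using L[of "X $ j" w] True power_set_nth \<sigma> by (intro powr_mono2) auto
          then have "top_difference j m 1 u w X * norm (X $ j - w) powr ?p \<le> top_difference j m 1 u w X * L powr ?p"
            by (intro mult_left_mono top_difference_nonneg)
          then show ?thesis using False by (simp add: field_simps)
        qed
        have "ennreal (top_difference j m 1 u w X) \<le> ennreal (L powr ?p) * ennreal (top_difference j m 1 u w X / norm (X $ j - w) powr ?p)"
          using ennreal_leI[OF le] by (subst ennreal_mult[symmetric]) (auto simp: top_difference_nonneg)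
        also have "top_difference j m 1 u w X / norm (X $ j - w) powr ?p = (\<Sum>\<alpha>\<in>(multi_indices m :: ('d \<Rightarrow> nat) set).
         (fact m / mfact \<alpha>) * (Dalpha j \<alpha> u X - Dalpha j \<alpha> u (upd_pt X j w))\<^sup>2 / norm (X $ j - w) powr ?p)"
          by (simp add: top_difference_def sum_divide_distrib)
        finally have "ennreal (top_difference j m 1 u w X) \<le> ennreal (L powr ?p) * ennreal (\<Sum>\<alpha>\<in>(multi_indices m :: ('d \<Rightarrow> nat) set).
         (fact m / mfact \<alpha>) * (Dalpha j \<alpha> u X - Dalpha j \<alpha> u (upd_pt X j w))\<^sup>2 / norm (X $ j - w) powr ?p)" .
        moreover have "X \<in> power_set \<Omega>" "w \<in> \<Omega>" using True QN Q(4) by blast+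
        ultimately show ?thesis using True by (simp add: G_def)
      qed (auto simp: indicator_def)
      have "(\<integral>\<^sup>+w. indicator Q w * (\<integral>\<^sup>+X. indicator ?N X * ennreal (top_difference j m 1 u w X) \<partial>lborel) \<partial>lborel)
          \<le> (\<integral>\<^sup>+w. ennreal (L powr ?p) * (\<integral>\<^sup>+X. G X w \<partial>lborel) \<partial>lborel)"
      proof (rule nn_integral_mono)
        fix w
        have "indicator Q w * (\<integral>\<^sup>+X. indicator ?N X * ennreal (top_difference j m 1 u w X) \<partial>lborel) = (\<integral>\<^sup>+X. indicator Q w * (indicator ?N X * ennreal (top_difference j m 1 u w X)) \<partial>lborel)"
          by (cases "w \<in> Q") auto
        also have "\<dots> \<le> (\<integral>\<^sup>+X. ennreal (L powr ?p) * G X w \<partial>lborel)" by (intro nn_integral_mono pt)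
        also have "\<dots> = ennreal (L powr ?p) * (\<integral>\<^sup>+X. G X w \<partial>lborel)"
          using borel_measurable_compose_continuous[OF mG, of "\<lambda>X. (X, w)"] by (intro nn_integral_cmult) (simp add: continuous_intros)
        finally show "indicator Q w * (\<integral>\<^sup>+X. indicator ?N X * ennreal (top_difference j m 1 u w X) \<partial>lborel) \<le> ennreal (L powr ?p) * (\<integral>\<^sup>+X. G X w \<partial>lborel)" .
      qed
      also have "\<dots> = ennreal (L powr ?p) * (\<integral>\<^sup>+w. \<integral>\<^sup>+X. G X w \<partial>lborel \<partial>lborel)"
        using nn_integral_lborel_snd_measurable[of "\<lambda>w X. G X w"] mG' by (intro nn_integral_cmult) (simp add: case_prod_unfold)
      also have "(\<integral>\<^sup>+w. \<integral>\<^sup>+X. G X w \<partial>lborel \<partial>lborel) = (\<integral>\<^sup>+X. \<integral>\<^sup>+w. G X w \<partial>lborel \<partial>lborel)"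
        by (rule nn_integral_lborel_swap[OF mG, symmetric])
      also have "\<dots> = frac_seminorm m ?p \<Omega> j u"
        unfolding frac_seminorm_def G_def by (intro nn_integral_cong) (auto simp: indicator_def)
      also have "ennreal (L powr ?p) * frac_seminorm m ?p \<Omega> j u \<le> ennreal (L powr ?p) * ?E u"
        by (intro mult_left_mono sem) simp
      finally have "ennreal K2 * (\<integral>\<^sup>+w. indicator Q w * (\<integral>\<^sup>+X. indicator ?N X * ennreal (top_difference j m 1 u w X) \<partial>lborel) \<partial>lborel) \<le> ennreal K2 * (ennreal (L powr ?p) * ?E u)"
        by (rule mult_left_mono) simp
      also have "\<dots> = ennreal (K2 * (L powr ?p * (1 / c))) * HsNsq c s \<Omega> u"
      proof -
        have "ennreal (K2 * (L powr ?p * (1 / c))) = ennreal K2 * (ennreal (L powr ?p) * ennreal (1 / c))"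
          using K2 c by (subst ennreal_mult, simp, simp, subst ennreal_mult) auto
        then show ?thesis by (simp only: mult.assoc)
      qed
      finally show "(\<integral>\<^sup>+z. \<integral>\<^sup>+X. indicator (ball 0 \<omega>) z * (indicator ?N X * ennreal ((interp_err M q \<delta> j u z X)\<^sup>2)) \<partial>lborel \<partial>lborel)
        \<le> ennreal (K2 * (L powr ?p * (1 / c))) * HsNsq c s \<Omega> u"
        using k2[OF u, of j] by (rule order_trans[rotated])
    qed
  qed
qed

text \<open>An infinite y is trivial, as \<open>ennsqrt\<close> preserves infinity; otherwise both
  values are finite and the claim is one about real square roots.\<close>

lemma ennsqrt_mono_scaled:
  assumes K: "K > 0" and le: "x \<le> ennreal K * y"
  shows "ennreal (1 / sqrt K) * ennsqrt x \<le> ennsqrt y"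
proof (cases "y = \<infinity>")
  case False
  then obtain b where b: "y = ennreal b" "b \<ge> 0" by (cases y) auto
  have "ennreal K * y \<noteq> \<infinity>" using b K by (simp add: ennreal_mult[symmetric])
  then have "x \<noteq> \<infinity>" using le by (auto simp: top_unique)
  then obtain a where a: "x = ennreal a" "a \<ge> 0" by (cases x) auto
  have "a \<le> K * b" using le a b K by (simp add: ennreal_mult[symmetric])
  then have "sqrt a \<le> sqrt K * sqrt b" by (simp add: real_sqrt_mult[symmetric])
  then have "1 / sqrt K * sqrt a \<le> sqrt b" using K by (simp add: field_simps)
  then show ?thesis using a b K by (simp add: ennsqrt_def ennreal_mult[symmetric] ennreal_leI)
qed (simp add: ennsqrt_def)

theorem mainTheorem6:
  fixes \<Omega> :: "(real^'d) set" and s :: real and k :: nat and c :: "nat \<Rightarrow> real \<Rightarrow> real"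
  assumes "\<And>dd \<sigma>. c dd \<sigma> > 0"
    and "k \<ge> 2" and "s > 0" and "2 * s > real CARD('d) * (real k - 1)"
    and "bounded \<Omega>" and "connected \<Omega>" and "\<Omega> \<noteq> {}" and "lipschitz_domain \<Omega>"
    and "CARD('n) \<ge> nat \<lceil>s\<rceil> ^ CARD('d) * k"
  shows "\<exists>C>0. \<forall>u :: real^'d^'n \<Rightarrow> real.
           smooth_on (power_set \<Omega>) u \<and> L2sq \<Omega> u < \<infinity> \<and>
           (\<forall>X \<in> coinc k \<inter> power_set \<Omega>. u X = 0) \<longrightarrow>
           ennreal C * ennsqrt (L2sq \<Omega> u)
             \<le> ennsqrt (HsNsq (c CARD('d) (s - of_int \<lfloor>s\<rfloor>)) s \<Omega> u)"
proof -
  define M where "M = nat \<lceil>s\<rceil>"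
  define c0 where "c0 = c CARD('d) (s - of_int \<lfloor>s\<rfloor>)"
  have c0: "c0 > 0" using assms(1) by (simp add: c0_def)
  have M: "M \<ge> 1" using assms(3) by (simp add: M_def Suc_le_eq)
  have op: "open \<Omega>" using assms(8) by (simp add: lipschitz_domain_def)
  \<comment> \<open>Any ball inside \<Omega> will do: interpolation and trace take place there, and
    the rest of \<Omega> is reached by propagation.\<close>
  obtain q e where e: "e > 0" and qe: "ball q e \<subseteq> \<Omega>" using op assms(7) openE by blast
  define Q where "Q = ball q e"
  have Q: "open Q" "convex Q" "bounded Q" "Q \<subseteq> \<Omega>" "Q \<noteq> {}" using e qe by (auto simp: Q_def)
  define d where "d = real CARD('d)"
  \<comment> \<open>The d coordinates of a node each differ from those of q by at most M \<delta>,
    which adds up to a distance of at most e / 4. The choice of \<omega> gives the balls around the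
    nodes the radius e / 4, so they stay within e / 2 of q.\<close>
  define \<delta> where "\<delta> = e / (4 * real M * d)"
  define \<omega> where "\<omega> = e / (4 * (2 * real M + 1))"
  have d0: "d > 0" by (simp add: d_def)
  have \<delta>0: "\<delta> > 0" using e M d0 by (simp add: \<delta>_def)
  have \<omega>0: "\<omega> > 0" using e by (simp add: \<omega>_def add_nonneg_pos)
  have \<omega>e: "(2 * real M + 1) * \<omega> = e / 4" by (simp add: \<omega>_def field_simps add_nonneg_pos)
  have nodes: "ball (node q \<delta> \<iota>) ((2 * real M + 1) * \<omega>) \<subseteq> Q" if "\<iota> \<in> grid M" for \<iota>
  proof
    fix x assume "x \<in> ball (node q \<delta> \<iota>) ((2 * real M + 1) * \<omega>)"
    then have 1: "dist (node q \<delta> \<iota>) x < e / 4" by (simp add: \<omega>e)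
    have "dist q (node q \<delta> \<iota>) \<le> (\<Sum>c\<in>UNIV. \<bar>(node q \<delta> \<iota> - q) $ c\<bar>)"
      by (subst dist_commute) (simp only: dist_norm norm_le_l1_cart)
    also have "\<dots> \<le> (\<Sum>c\<in>(UNIV :: 'd set). \<delta> * real M)"
      using that \<delta>0 by (intro sum_mono) (auto simp: node_def grid_def PiE_iff abs_mult less_imp_le)
    also have "\<dots> = e / 4" using M d0 by (simp add: \<delta>_def d_def)
    finally show "x \<in> Q" using 1 dist_triangle[of q x "node q \<delta> \<iota>"] e by (simp add: Q_def)
  qed
  have center: "ball q ((2 * real M + 1) * \<omega>) \<subseteq> Q" unfolding \<omega>e Q_def using e by (intro subset_ball) simp
  have nodes': "node q \<delta> i + z \<in> Q" if "i \<in> grid M" "z \<in> ball 0 \<omega>" for i z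
    using in_fat_ball[OF nodes[OF that(1)] that(2), of 0 0] \<omega>0 by simp
  define B where "B = ball q \<omega>"
  have "\<omega> \<le> (2 * real M + 1) * \<omega>" using \<omega>0 by simp
  then have B: "open B" "B \<subseteq> \<Omega>" "B \<noteq> {}"
    using \<omega>0 subset_ball[of \<omega> "(2 * real M + 1) * \<omega>" q] center Q(4) unfolding B_def by auto
  let ?r = "2 * s + real CARD('d)"
  obtain K where K: "K \<ge> 0" and ld: "\<And>u :: real^'d^'n \<Rightarrow> real. smooth_on (power_set \<Omega>) u \<Longrightarrow>
    local_data \<Omega> M ?r Q q \<delta> \<omega> (restrict0 (power_set \<Omega>) u) (ennreal K * HsNsq c0 s \<Omega> u)"
    using seminorm_local_data[OF op Q assms(3) c0, where q = q and \<delta> = \<delta> and \<omega> = \<omega> and 'n = 'n] nodes' \<delta>0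
    unfolding M_def[symmetric] by auto
  obtain C1 where C1: "C1 \<ge> 0" and c1: "\<And>(u :: real^'d^'n \<Rightarrow> real) E. u \<in> borel_measurable borel \<Longrightarrow> difference_bound \<Omega> M ?r u E \<Longrightarrow>
    (\<integral>\<^sup>+X. indicator (power_set \<Omega>) X * ennreal ((u X)\<^sup>2) \<partial>lborel)
     \<le> ennreal C1 * ((\<integral>\<^sup>+X. indicator (power_set B) X * ennreal ((u X)\<^sup>2) \<partial>lborel) + E)"
    using L2_norm_le_box[OF assms(8,6,5) M B, of ?r] by blast
  have card: "CARD('n) > M ^ CARD('d) * (k - 1)"
  proof -
    have "M ^ CARD('d) * (k - 1) < M ^ CARD('d) * k" using M assms(2) by (intro mult_strict_left_mono) auto
    then show ?thesis using assms(9) unfolding M_def by linarith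
  qed
  obtain C2 where C2: "C2 \<ge> 0" and c2: "\<And>(u :: real^'d^'n \<Rightarrow> real) E. local_data \<Omega> M ?r Q q \<delta> \<omega> u E \<Longrightarrow>
    continuous_on (power_set \<Omega>) u \<Longrightarrow> (\<forall>X\<in>coinc k \<inter> power_set \<Omega>. u X = 0) \<Longrightarrow>
    (\<integral>\<^sup>+X. indicator (power_set B) X * ennreal ((u X)\<^sup>2) \<partial>lborel) \<le> ennreal C2 * E"
    using local_bound[OF op Q(1,2,4) \<omega>0 nodes center M assms(3,4) _ card] assms(2) unfolding B_def by auto
  \<comment> \<open>The summand 1 keeps C positive even if one of the constants is 0, so that
    \<open>1 / sqrt C\<close> is a positive constant.\<close>
  define C where "C = C1 * (C2 + 1) * K + 1"
  have C: "C > 0" using C1 C2 K by (auto simp: C_def intro!: add_nonneg_pos)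
  have "ennreal (1 / sqrt C) * ennsqrt (L2sq \<Omega> u) \<le> ennsqrt (HsNsq c0 s \<Omega> u)"
    if u: "smooth_on (power_set \<Omega>) u" and zero: "\<forall>X \<in> coinc k \<inter> power_set \<Omega>. u X = 0" for u :: "real^'d^'n \<Rightarrow> real"
  proof (rule ennsqrt_mono_scaled[OF C])
    let ?u = "restrict0 (power_set \<Omega>) u" and ?E = "ennreal K * HsNsq c0 s \<Omega> u"
    have ld': "local_data \<Omega> M ?r Q q \<delta> \<omega> ?u ?E" by (rule ld[OF u])
    have "continuous_on (power_set \<Omega>) u" using smooth_on_foldr_continuous[OF u, of "[]"] by simp
    then have cont: "continuous_on (power_set \<Omega>) ?u"
      by (rule continuous_on_eq) (simp add: restrict0_def)
    have "L2sq \<Omega> u = (\<integral>\<^sup>+X. indicator (power_set \<Omega>) X * ennreal ((?u X)\<^sup>2) \<partial>lborel)"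
      unfolding L2sq_def by (intro nn_integral_cong) (auto simp: restrict0_def indicator_def)
    also have "\<dots> \<le> ennreal C1 * ((\<integral>\<^sup>+X. indicator (power_set B) X * ennreal ((?u X)\<^sup>2) \<partial>lborel) + ?E)"
      using ld' by (intro c1) (auto simp: local_data_def)
    also have "\<dots> \<le> ennreal C1 * (ennreal C2 * ?E + ?E)"
      using zero by (intro mult_left_mono add_right_mono c2[OF ld' cont]) (auto simp: restrict0_def)
    also have "\<dots> = ennreal (C1 * (C2 + 1) * K) * HsNsq c0 s \<Omega> u"
      using C1 C2 K by (simp add: ennreal_mult distrib_right mult.assoc)
    also have "\<dots> \<le> ennreal C * HsNsq c0 s \<Omega> u" by (intro mult_right_mono ennreal_leI) (auto simp: C_def)
    finally show "L2sq \<Omega> u \<le> ennreal C * HsNsq c0 s \<Omega> u" .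
  qed
  then show ?thesis using C unfolding c0_def by (intro exI[of _ "1 / sqrt C"]) auto
qed

end
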